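(* Let $d \in \mathbb{N}$, $s>0$, and suppose $2<p<p_*(d,s)$ is an even integer. Then any optimizer $Q \in H^s(\mathbb{R}^d)$ for the Gagliardo--Nirenberg inequality $$\| f \|_{L^p} \le \mathcal{C}_{d,s,p}\, \| (-\Delta)^{s/2} f \|_{L^2}^{\theta} \| f \|_{L^2}^{1-\theta}, \qquad f \in H^s(\mathbb{R}^d), \qquad \theta = \frac{d(p-2)}{2sp},$$ satisfies $$Q(x) = e^{i\alpha} Q^\sharp(x-x_0) \quad \text{for a.e. } x \in \mathbb{R}^d,$$ with some constants $\alpha \in \mathbb{R}$ and $x_0 \in \mathbb{R}^d$. As a consequence, $Q$ is radially symmetric on $\mathbb{R}^d$ (up to translation) and real-valued (up to a constant phase).
   Context: Functions are complex-valued. $p_*(d,s) = \frac{2d}{d-2s}$ if $0<s<d/2$ and $p_*(d,s)=\infty$ if $s\ge d/2$. Here $\mathcal{C}_{d,s,p}\in(0,\infty)$ denotes the optimal (smallest possible) constant in the inequality, and an optimizer is a function $Q \in H^s(\mathbb{R}^d)$, $Q\not\equiv 0$, for which equality holds with this optimal constant. The Fourier transform is $\widehat{f}(\xi) = (\mathcal{F} f)(\xi) = \int_{\mathbb{R}^d} e^{-2\pi i x\cdot \xi} f(x)\,dx$, and $(-\Delta)^{s/2}$ has Fourier multiplier $|2\pi\xi|^s$. For a measurable $g : \mathbb{R}^d \to \mathbb{C}$ vanishing at infinity (i.e. $\{|g|>t\}$ has finite Lebesgue measure for every $t>0$), its symmetric-decreasing rearrangement is $g^*(x) = \int_0^\infty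 \mathbf{1}_{\{|g|>t\}^*}(x)\,dt$, where for a measurable set $A$ of finite measure $A^*=B_R(0)$ is the open ball centered at the origin with $|B_R(0)| = |A|$ ($A^*=\emptyset$ if $|A|=0$). The Fourier rearrangement of $f \in L^2(\mathbb{R}^d)$ is $f^\sharp = \mathcal{F}^{-1}\{(\mathcal{F} f)^*\}$. *)

theory Defs
  imports "HOL-Analysis.Analysis"
begin

text \<open>
  Elements of function spaces are represented by functions, and identities between them are
  understood almost everywhere.
\<close>

definition Lp_space :: "real \<Rightarrow> ('a::euclidean_space \<Rightarrow> complex) set" where
  "Lp_space p =
     {f \<in> borel_measurable lebesgue. integrable lebesgue (\<lambda>x. norm (f x) powr p)}"

text \<open>Only meaningful on \<open>Lp_space p\<close>: the Bochner integral is \<open>0\<close> for non-integrable functions.\<close>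

definition Lp_norm :: "real \<Rightarrow> ('a::euclidean_space \<Rightarrow> complex) \<Rightarrow> real" where
  "Lp_norm p f = (LINT x|lebesgue. norm (f x) powr p) powr (1 / p)"

definition fourier_integral :: "('a::euclidean_space \<Rightarrow> complex) \<Rightarrow> 'a \<Rightarrow> complex" where
  "fourier_integral f \<xi> =
     (LINT x|lebesgue. exp (- 2 * complex_of_real pi * \<i> * complex_of_real (x \<bullet> \<xi>)) * f x)"

text \<open>
  The Fourier transform on \<open>L\<^sup>2\<close> in the sense of Plancherel: the \<open>L\<^sup>2\<close>-limit of the Fourier
  integrals of the truncations of \<open>f\<close> to balls (which are integrable). The limit is
  determined up to null sets, so the functions chosen by \<open>SOME\<close> below are arbitrary
  representatives.
\<close>

definition is_fourier ::
  "('a::euclidean_space \<Rightarrow> complex) \<Rightarrow> ('a \<Rightarrow> complex) \<Rightarrow> bool" where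
  "is_fourier f g \<longleftrightarrow> f \<in> Lp_space 2 \<and> g \<in> Lp_space 2 \<and>
     (\<lambda>n::nat. \<integral>\<^sup>+ \<xi>. ennreal
        ((norm (fourier_integral (\<lambda>x. indicator (cball 0 (real n)) x * f x) \<xi> - g \<xi>))\<^sup>2)
        \<partial>lebesgue) \<longlonglongrightarrow> 0"

definition fourier :: "('a::euclidean_space \<Rightarrow> complex) \<Rightarrow> 'a \<Rightarrow> complex" where
  "fourier f = (SOME g. is_fourier f g)"

definition inv_fourier :: "('a::euclidean_space \<Rightarrow> complex) \<Rightarrow> 'a \<Rightarrow> complex" where
  "inv_fourier g = (SOME f. is_fourier f g)"

definition sobolev_space :: "real \<Rightarrow> ('a::euclidean_space \<Rightarrow> complex) set" where
  "sobolev_space s = {f \<in> Lp_space 2.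
     (\<lambda>\<xi>. complex_of_real ((1 + (norm \<xi>)\<^sup>2) powr (s / 2)) * fourier f \<xi>) \<in> Lp_space 2}"

text \<open>\<open>frac_laplacian t\<close> is \<open>(- \<Delta>)\<close> to the power \<open>t\<close>.\<close>

definition frac_laplacian ::
  "real \<Rightarrow> ('a::euclidean_space \<Rightarrow> complex) \<Rightarrow> 'a \<Rightarrow> complex" where
  "frac_laplacian t f =
     inv_fourier (\<lambda>\<xi>. complex_of_real (norm ((2 * pi) *\<^sub>R \<xi>) powr (2 * t)) * fourier f \<xi>)"

text \<open>
  For sets of finite measure. The radius \<open>0\<close> gives the empty set, as it should for null sets.
\<close>

definition rearr_set :: "'a::euclidean_space set \<Rightarrow> 'a set" where
  "rearr_set A =
     ball 0 (THE R. 0 \<le> R \<and> emeasure lebesgue (ball (0::'a) R) = emeasure lebesgue A)"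

text \<open>
  For functions vanishing at infinity. The integral is finite except possibly at the origin
  (when \<open>g\<close> is essentially unbounded), where it then takes the default value \<open>0\<close>.
\<close>

definition sym_decr_rearr :: "('a::euclidean_space \<Rightarrow> complex) \<Rightarrow> 'a \<Rightarrow> real" where
  "sym_decr_rearr g x =
     (LINT t:{0<..}|lborel. indicator (rearr_set {y. norm (g y) > t}) x)"

definition fourier_rearr :: "('a::euclidean_space \<Rightarrow> complex) \<Rightarrow> 'a \<Rightarrow> complex" where
  "fourier_rearr f = inv_fourier (\<lambda>\<xi>. complex_of_real (sym_decr_rearr (fourier f) \<xi>))"

definition p_star :: "nat \<Rightarrow> real \<Rightarrow> ereal" where
  "p_star d s =
     (if s < real d / 2 then ereal (2 * real d / (real d - 2 * s)) else \<infinity>)"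

definition gn_theta :: "nat \<Rightarrow> real \<Rightarrow> real \<Rightarrow> real" where
  "gn_theta d s p = real d * (p - 2) / (2 * s * p)"

definition gn_product :: "real \<Rightarrow> real \<Rightarrow> ('a::euclidean_space \<Rightarrow> complex) \<Rightarrow> real" where
  "gn_product s p f =
     Lp_norm 2 (frac_laplacian (s / 2) f) powr gn_theta DIM('a) s p *
     Lp_norm 2 f powr (1 - gn_theta DIM('a) s p)"

text \<open>The membership in \<open>Lp_space p\<close> says that the left-hand side of the inequality is finite.\<close>

definition gn_inequality :: "'a::euclidean_space itself \<Rightarrow> real \<Rightarrow> real \<Rightarrow> real \<Rightarrow> bool" where
  "gn_inequality _ s p C \<longleftrightarrow>
     (\<forall>f \<in> sobolev_space s :: ('a \<Rightarrow> complex) set.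
        f \<in> Lp_space p \<and> Lp_norm p f \<le> C * gn_product s p f)"

text \<open>
  The optimal constant. It is defined in \<open>[0, \<infinity>]\<close>, where the infimum is always
  meaningful; that it lies in \<open>(0, \<infinity>)\<close> is the content of the Gagliardo--Nirenberg inequality.
\<close>

definition gn_constant :: "'a::euclidean_space itself \<Rightarrow> real \<Rightarrow> real \<Rightarrow> ennreal" where
  "gn_constant T s p = (INF C \<in> {C. 0 < C \<and> gn_inequality T s p C}. ennreal C)"

definition gn_optimizer :: "real \<Rightarrow> real \<Rightarrow> ('a::euclidean_space \<Rightarrow> complex) \<Rightarrow> bool" where
  "gn_optimizer s p Q \<longleftrightarrow>
     Q \<in> sobolev_space s \<and> \<not> (AE x in lebesgue. Q x = 0) \<and>
     ennreal (Lp_norm p Q) = gn_constant TYPE('a) s p * ennreal (gn_product s p Q)"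

definition radial_about :: "'a::euclidean_space \<Rightarrow> ('a \<Rightarrow> complex) \<Rightarrow> bool" where
  "radial_about x0 f \<longleftrightarrow>
     (\<exists>\<phi> :: real \<Rightarrow> complex. AE x in lebesgue. f x = \<phi> (norm (x - x0)))"

end

theory Submission
  imports Defs "HOL-Probability.Probability"
begin

text \<open>
  For \<open>p = 2 k\<close> the norm \<open>\<parallel>f\<parallel>\<^sub>p\<close> is the \<open>L\<^sup>2\<close>-norm of \<open>f\<^sup>k\<close>, hence of the \<open>k\<close>-fold convolution power of the
  Fourier transform \<open>g\<close> of \<open>f\<close>. Passing from \<open>g\<close> to \<open>\<bar>g\<bar>\<close> and then to the Steiner symmetrization of \<open>\<bar>g\<bar>\<close>
  in a direction \<open>e\<close> does not decrease this norm (Riesz's inequality, applied on lines parallel to \<open>e\<close>), does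
  not change \<open>\<parallel>g\<parallel>\<^sub>2\<close> and does not increase \<open>\<parallel>\<bar>2\<pi>\<xi>\<bar>\<^sup>s g\<parallel>\<^sub>2\<close>, the last one strictly unless \<open>\<bar>g\<bar>\<close> is
  already symmetric. For an optimizer all these steps are equalities. So \<open>\<bar>g\<bar>\<close> is Steiner symmetric in every
  direction, i.e. radially decreasing, and thus equal to its rearrangement and positive exactly on a ball.
  Moreover \<open>\<bar>g * \<dots> * g\<bar> = \<bar>g\<bar> * \<dots> * \<bar>g\<bar>\<close>, which turns the phase of \<open>g\<close> into a solution of Cauchy's functional
  equation on that ball: it is \<open>\<alpha> + \<xi> \<bullet> w\<close>, and the linear part is a translation of \<open>f\<close>.
\<close>

subsection \<open>Convolution of symmetric decreasing functions on the line\<close>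

text \<open>A convolution power of a rearranged function is not the rearrangement of the convolution
  power, so Riesz's inequality cannot simply be iterated. What is iterated is a majorization,
  \<open>maj\<close>, comparing integrals over arbitrary sets with integrals over centred intervals.
  It survives convolution and integration over parallel lines, and it still compares L2 norms.
  Steiner symmetrization keeps this one-dimensional. The convolution term only ever supplies an
  inequality; all strictness comes from the weight, which on each line increases strictly away from
  the point nearest the origin. The phase comes last, because the logarithm used there lives on a
  ball, and only symmetry makes the set where \<open>g\<close> is nonzero a ball. Symmetrized
  functions are \<open>ennreal\<close>-valued and controlled by integrals alone; the
  Gagliardo-Nirenberg bound reaches them through bounded truncations. That the sharp constant is
  finite is read off from the optimizer: an infinite constant would contradict its defining
  equation. Transforms are fixed only almost everywhere, so uncountable families of directions or
  levels are treated by Fubini or by countable dense subfamilies.\<close>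

lemma nn_integral_lborel_translate:
  fixes f :: "'a::euclidean_space \<Rightarrow> ennreal"
  assumes [measurable]: "f \<in> borel_measurable borel"
  shows "(\<integral>\<^sup>+x. f (a + x) \<partial>lborel) = (\<integral>\<^sup>+x. f x \<partial>lborel)"
proof -
  have "lborel = distr lborel borel (\<lambda>x. a + x)"
    using lborel_affine[of 1 a] by (simp add: density_1)
  then have "(\<integral>\<^sup>+x. f x \<partial>lborel) = (\<integral>\<^sup>+x. f x \<partial>distr lborel borel (\<lambda>x. a + x))" by simp
  also have "\<dots> = (\<integral>\<^sup>+x. f (a + x) \<partial>lborel)" by (subst nn_integral_distr) auto
  finally show ?thesis by simp
qed

lemma nn_integral_lborel_reflect:
  fixes f :: "'a::euclidean_space \<Rightarrow> ennreal"
  assumes [measurable]: "f \<in> borel_measurable borel"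
  shows "(\<integral>\<^sup>+x. f (a - x) \<partial>lborel) = (\<integral>\<^sup>+x. f x \<partial>lborel)"
proof -
  have "lborel = distr lborel borel (\<lambda>x. a - x)"
    using lborel_affine[of "-1" a] by (simp add: density_1)
  then have "(\<integral>\<^sup>+x. f x \<partial>lborel) = (\<integral>\<^sup>+x. f x \<partial>distr lborel borel (\<lambda>x. a - x))" by simp
  also have "\<dots> = (\<integral>\<^sup>+x. f (a - x) \<partial>lborel)" by (subst nn_integral_distr) auto
  finally show ?thesis by simp
qed

lemma nn_integral_commute:
  assumes "sigma_finite_measure M" "sigma_finite_measure N"
    and "(\<lambda>(x, y). f x y) \<in> borel_measurable (M \<Otimes>\<^sub>M N)"
  shows "(\<integral>\<^sup>+x. \<integral>\<^sup>+y. f x y \<partial>N \<partial>M) = (\<integral>\<^sup>+y. \<integral>\<^sup>+x. f x y \<partial>M \<partial>N)"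
proof -
  interpret M: sigma_finite_measure M by fact
  interpret N: sigma_finite_measure N by fact
  interpret pair_sigma_finite M N ..
  show ?thesis using Fubini'[OF assms(3)] by simp
qed

text \<open>The space of levels in layer-cake formulas. \<open>ennreal\<close> sends every negative
  real to 0, so on the whole line the negative levels would all be counted; a density on
  \<open>lborel\<close> removes them and keeps a sigma-finite measure on \<open>real\<close> for
  Fubini.\<close>

definition halfline :: "real measure" where
  "halfline = density lborel (indicator {0..})"

lemma sets_halfline [measurable_cong]: "sets halfline = sets borel"
  by (simp add: halfline_def)

lemma space_halfline [simp]: "space halfline = UNIV"
  by (simp add: halfline_def)

lemma sigma_finite_halfline: "sigma_finite_measure halfline"
  unfolding halfline_def
  by (subst sigma_finite_measure.sigma_finite_iff_density_finite'[OF sigma_finite_lborel])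
     (auto split: split_indicator)

interpretation halfline: sigma_finite_measure halfline
  by (rule sigma_finite_halfline)

lemma emeasure_halfline:
  "A \<in> sets borel \<Longrightarrow> emeasure halfline A = emeasure lborel ({0..} \<inter> A)"
  unfolding halfline_def
  by (subst emeasure_density) (auto simp: nn_integral_indicator[symmetric] simp del: nn_integral_indicator
      intro!: nn_integral_cong split: split_indicator)

lemma emeasure_lborel_atLeast: "emeasure lborel {0::real..} = \<infinity>"
proof (cases "emeasure lborel {0::real..}")
  case (real r)
  obtain n :: nat where n: "r < real n" using reals_Archimedean2 by blast
  have "emeasure lborel {0..real n} \<le> emeasure lborel {0::real..}"
    by (intro emeasure_mono) auto
  with real n show ?thesis by (simp add: ennreal_le_iff2)
qed auto

lemma emeasure_halfline_lessThan: "emeasure halfline {t. ennreal t < w} = w"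
proof (cases w)
  case (real r)
  have "{0..} \<inter> {t. ennreal t < w} = {0..<r}"
    using real by (auto simp: ennreal_less_iff)
  then show ?thesis using real by (subst emeasure_halfline) (auto)
next
  case top
  have "{0..} \<inter> {t. ennreal t < w} = {0..}"
    using top by auto
  then show ?thesis using top
    by (subst emeasure_halfline) (auto simp: emeasure_lborel_atLeast)
qed

abbreviation ind :: "bool \<Rightarrow> ennreal" where "ind P \<equiv> (if P then 1 else 0)"

lemma layer_cake: "(\<integral>\<^sup>+t. ind (ennreal t < w) \<partial>halfline) = w"
proof -
  have "(\<integral>\<^sup>+t. ind (ennreal t < w) \<partial>halfline) = (\<integral>\<^sup>+t. indicator {t. ennreal t < w} t \<partial>halfline)"
    by (intro nn_integral_cong) (auto split: split_indicator)
  then show ?thesis by (simp add: emeasure_halfline_lessThan)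
qed

lemma layer_cake_mult:
  fixes w F :: "'a \<Rightarrow> ennreal"
  assumes [measurable]: "w \<in> borel_measurable M" "F \<in> borel_measurable M" and M: "sigma_finite_measure M"
  shows "(\<integral>\<^sup>+x. w x * F x \<partial>M) = (\<integral>\<^sup>+t. \<integral>\<^sup>+x. ind (ennreal t < w x) * F x \<partial>M \<partial>halfline)"
proof -
  have "(\<integral>\<^sup>+x. w x * F x \<partial>M) = (\<integral>\<^sup>+x. (\<integral>\<^sup>+t. ind (ennreal t < w x) * F x \<partial>halfline) \<partial>M)"
    by (subst nn_integral_multc) (auto simp: layer_cake)
  also have "\<dots> = (\<integral>\<^sup>+t. \<integral>\<^sup>+x. ind (ennreal t < w x) * F x \<partial>M \<partial>halfline)"
    by (rule nn_integral_commute[OF M sigma_finite_halfline]) measurable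
  finally show ?thesis .
qed

definition nconv :: "('a::euclidean_space \<Rightarrow> ennreal) \<Rightarrow> ('a \<Rightarrow> ennreal) \<Rightarrow> 'a \<Rightarrow> ennreal" where
  "nconv f g x = (\<integral>\<^sup>+y. f y * g (x - y) \<partial>lborel)"

lemma borel_measurable_nconv [measurable (raw)]:
  assumes [measurable]: "f \<in> borel_measurable borel" "g \<in> borel_measurable borel"
  shows "nconv f g \<in> borel_measurable borel"
  unfolding nconv_def by measurable

text \<open>The open interval of length \<open>m\<close> centred at 0. Letting \<open>m\<close>
  range over \<open>ennreal\<close> covers the extremes as well: the empty set for
  \<open>m = 0\<close> and the whole line for infinite \<open>m\<close>.\<close>

definition cint :: "ennreal \<Rightarrow> real set" where
  "cint m = {t. ennreal (2 * \<bar>t\<bar>) < m}"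

lemma borel_cint [measurable]: "cint m \<in> sets borel"
  unfolding cint_def by measurable

lemma cint_top [simp]: "cint \<top> = UNIV"
  by (auto simp: cint_def)

lemma cint_real: "cint (ennreal r) = {- (r / 2) <..< r / 2}"
  by (cases "r \<ge> 0") (auto simp: cint_def ennreal_less_iff ennreal_neg)

lemma emeasure_cint [simp]: "emeasure lborel (cint m) = m"
proof (cases m)
  case (real r)
  then show ?thesis by (simp add: cint_real)
next
  case top
  then show ?thesis by simp
qed

lemma cint_mono: "m \<le> n \<Longrightarrow> cint m \<subseteq> cint n"
  by (auto simp: cint_def)

definition symm_decr :: "(real \<Rightarrow> ennreal) \<Rightarrow> bool" where
  "symm_decr G \<longleftrightarrow> (\<forall>x y. \<bar>x\<bar> \<le> \<bar>y\<bar> \<longrightarrow> G y \<le> G x)"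

lemma symm_decrD: "symm_decr G \<Longrightarrow> \<bar>x\<bar> \<le> \<bar>y\<bar> \<Longrightarrow> G y \<le> G x"
  by (auto simp: symm_decr_def)

lemma symm_decr_uminus: "symm_decr G \<Longrightarrow> G (- x) = G x"
  by (intro antisym) (auto intro: symm_decrD)

lemma symm_decr_cint: "symm_decr (\<lambda>x. ind (x \<in> cint m))"
proof (unfold symm_decr_def, intro allI impI)
  fix x y :: real assume "\<bar>x\<bar> \<le> \<bar>y\<bar>"
  then have "ennreal (2 * \<bar>x\<bar>) \<le> ennreal (2 * \<bar>y\<bar>)" by (intro ennreal_leI) auto
  then have "y \<in> cint m \<Longrightarrow> x \<in> cint m"
    unfolding cint_def mem_Collect_eq by (rule order.strict_trans1)
  then show "ind (y \<in> cint m) \<le> ind (x \<in> cint m)" by auto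
qed

text \<open>Formally this is \<open>(a - c) * (b - d) \<ge> 0\<close>. Writing \<open>a\<close> as
  \<open>c + a'\<close> avoids subtraction, which misbehaves at infinity.\<close>

lemma rearr_two:
  fixes a b c d :: ennreal
  assumes "c \<le> a" "d \<le> b" 
  shows "a * d + c * b \<le> a * b + c * d"
proof -
  obtain a' where a: "a = c + a'" using assms(1) le_iff_add by blast
  have "a' * d \<le> a' * b" using assms(2) by (rule mult_left_mono) simp
  then show ?thesis unfolding a
    by (simp add: algebra_simps add_left_mono)
qed

text \<open>The half line to the right of \<open>m\<close> is reflected onto the left one; the point
  \<open>m\<close> itself is a null set.\<close>

lemma nn_integral_fold:
  fixes f :: "real \<Rightarrow> ennreal"
  assumes [measurable]: "f \<in> borel_measurable borel"
  shows "(\<integral>\<^sup>+y. f y \<partial>lborel) = (\<integral>\<^sup>+y. ind (y < m) * (f y + f (2 * m - y)) \<partial>lborel)"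
proof -
  have "(\<integral>\<^sup>+y. f y \<partial>lborel) = (\<integral>\<^sup>+y. ind (y < m) * f y + ind (y > m) * f y \<partial>lborel)"
    by (intro nn_integral_cong_AE) (use AE_lborel_singleton[of m] in \<open>auto elim!: eventually_mono\<close>)
  also have "\<dots> = (\<integral>\<^sup>+y. ind (y < m) * f y \<partial>lborel) + (\<integral>\<^sup>+y. ind (y > m) * f y \<partial>lborel)"
    by (intro nn_integral_add) auto
  also have "(\<integral>\<^sup>+y. ind (y > m) * f y \<partial>lborel) = (\<integral>\<^sup>+y. ind (2 * m - y > m) * f (2 * m - y) \<partial>lborel)"
    by (rule nn_integral_lborel_reflect[symmetric]) auto
  also have "\<dots> = (\<integral>\<^sup>+y. ind (y < m) * f (2 * m - y) \<partial>lborel)"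
    by (intro nn_integral_cong) auto
  also have "(\<integral>\<^sup>+y. ind (y < m) * f y \<partial>lborel) + \<dots> = (\<integral>\<^sup>+y. ind (y < m) * f y + ind (y < m) * f (2 * m - y) \<partial>lborel)"
    by (intro nn_integral_add[symmetric]) auto
  finally show ?thesis by (simp add: distrib_left)
qed

lemma nconv_uminus:
  fixes f g :: "real \<Rightarrow> ennreal"
  assumes "symm_decr f" "symm_decr g"
    and [measurable]: "f \<in> borel_measurable borel" "g \<in> borel_measurable borel"
  shows "nconv f g (- x) = nconv f g x"
proof -
  have "nconv f g (- x) = (\<integral>\<^sup>+y. f (0 - y) * g (- x - (0 - y)) \<partial>lborel)"
    unfolding nconv_def by (rule nn_integral_lborel_reflect[symmetric]) auto
  also have "\<dots> = nconv f g x" unfolding nconv_def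
    using symm_decr_uminus[OF assms(1)] symm_decr_uminus[OF assms(2), of "x - _"]
    by (intro nn_integral_cong) (auto simp: algebra_simps)
  finally show ?thesis .
qed

text \<open>To compare the values at \<open>x \<le> x'\<close>, fold both integrals at the midpoint
  of \<open>x\<close> and \<open>x'\<close>. Reflection in it exchanges \<open>g (x - y)\<close> and
  \<open>g (x' - y)\<close>, and for \<open>y\<close> on the left the two pairs of values are
  ordered alike, so \<open>rearr_two\<close> applies pointwise.\<close>

lemma symm_decr_nconv:
  assumes "symm_decr f" "symm_decr g"
    and [measurable]: "f \<in> borel_measurable borel" "g \<in> borel_measurable borel"
  shows "symm_decr (nconv f g)"
proof -
  have *: "nconv f g x' \<le> nconv f g x" if x: "0 \<le> x" "x \<le> x'" for x x'
  proof -
    define m where "m = (x + x') / 2"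
    have m2: "2 * m = x + x'" by (simp add: m_def)
    have e: "g (x' - (2 * m - y)) = g (x - y)" "g (x - (2 * m - y)) = g (x' - y)" for y
      using symm_decr_uminus[OF assms(2), of "x - y"] symm_decr_uminus[OF assms(2), of "x' - y"]
      unfolding m2 by auto
    have "nconv f g x' = (\<integral>\<^sup>+y. ind (y < m) * (f y * g (x' - y) + f (2 * m - y) * g (x - y)) \<partial>lborel)"
      unfolding nconv_def by (subst nn_integral_fold[where m=m]) (auto simp: e)
    also have "\<dots> \<le> (\<integral>\<^sup>+y. ind (y < m) * (f y * g (x - y) + f (2 * m - y) * g (x' - y)) \<partial>lborel)"
    proof (intro nn_integral_mono, clarsimp)
      fix y assume "y < m"
      then have ym: "2 * y < x + x'" using m2 by simp
      have "f (2 * m - y) \<le> f y" using ym x unfolding m2 by (intro symm_decrD[OF assms(1)]) (auto simp: abs_if)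
      moreover have "g (x' - y) \<le> g (x - y)" using ym x by (intro symm_decrD[OF assms(2)]) (auto simp: abs_if)
      ultimately show "f y * g (x' - y) + f (2 * m - y) * g (x - y) \<le> f y * g (x - y) + f (2 * m - y) * g (x' - y)"
        by (rule rearr_two)
    qed
    also have "\<dots> = nconv f g x"
      unfolding nconv_def by (subst (2) nn_integral_fold[where m=m]) (auto simp: e)
    finally show ?thesis .
  qed
  have a: "nconv f g x = nconv f g \<bar>x\<bar>" for x
    using nconv_uminus[OF assms, of x] by (auto simp: abs_real_def)
  show ?thesis unfolding symm_decr_def
    using * by (metis a abs_ge_zero)
qed

text \<open>The Riesz functional, with the third argument chosen so that the three arguments sum to
  0. In this form it is invariant under all permutations of the functions.\<close>

definition tri :: "(real \<Rightarrow> ennreal) \<Rightarrow> (real \<Rightarrow> ennreal) \<Rightarrow> (real \<Rightarrow> ennreal) \<Rightarrow> ennreal" where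
  "tri f g h = (\<integral>\<^sup>+x. \<integral>\<^sup>+y. f x * g y * h (- x - y) \<partial>lborel \<partial>lborel)"

lemma tri_swap12:
  assumes [measurable]: "f \<in> borel_measurable borel" "g \<in> borel_measurable borel" "h \<in> borel_measurable borel"
  shows "tri f g h = tri g f h"
proof -
  have "tri f g h = (\<integral>\<^sup>+y. \<integral>\<^sup>+x. f x * g y * h (- x - y) \<partial>lborel \<partial>lborel)"
    unfolding tri_def by (rule nn_integral_commute) (auto intro: sigma_finite_lborel)
  also have "\<dots> = tri g f h" unfolding tri_def
  proof (intro nn_integral_cong)
    fix x y :: real
    have "- x - y = - y - x" by (rule minus_diff_commute)
    then show "f y * g x * h (- y - x) = g x * f y * h (- x - y)" by (simp only: mult.commute)
  qed
  finally show ?thesis .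
qed

lemma tri_swap23:
  assumes [measurable]: "f \<in> borel_measurable borel" "g \<in> borel_measurable borel" "h \<in> borel_measurable borel"
  shows "tri f g h = tri f h g"
proof -
  have "(\<integral>\<^sup>+y. f x * g y * h (- x - y) \<partial>lborel) = (\<integral>\<^sup>+y. f x * h y * g (- x - y) \<partial>lborel)" for x
  proof -
    have "(\<integral>\<^sup>+y. f x * g y * h (- x - y) \<partial>lborel) = (\<integral>\<^sup>+y. f x * g (- x - y) * h (- x - (- x - y)) \<partial>lborel)"
      by (rule nn_integral_lborel_reflect[symmetric]) auto
    then show ?thesis by (simp add: mult_ac)
  qed
  then show ?thesis unfolding tri_def by simp
qed

lemma tri_mono:
  assumes "\<And>x. f x \<le> f' x" "\<And>x. g x \<le> g' x" "\<And>x. h x \<le> h' x"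
  shows "tri f g h \<le> tri f' g' h'"
  unfolding tri_def by (intro nn_integral_mono mult_mono assms) auto

lemma tri_cong_AE:
  assumes [measurable]: "f \<in> borel_measurable borel" "g \<in> borel_measurable borel" "h \<in> borel_measurable borel"
    "f' \<in> borel_measurable borel"
  assumes "AE x in lborel. f x = f' x"
  shows "tri f g h = tri f' g h"
  unfolding tri_def
  using assms(5) by (intro nn_integral_cong_AE) (auto elim!: eventually_mono)

lemma tri_add:
  assumes [measurable]: "f \<in> borel_measurable borel" "g \<in> borel_measurable borel" "h \<in> borel_measurable borel"
    "f' \<in> borel_measurable borel"
  shows "tri (\<lambda>x. f x + f' x) g h = tri f g h + tri f' g h"
  unfolding tri_def by (simp add: distrib_right nn_integral_add)

lemma tri_sum:
  assumes "finite S"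
  assumes [measurable]: "\<And>p. p \<in> S \<Longrightarrow> f p \<in> borel_measurable borel" "g \<in> borel_measurable borel" "h \<in> borel_measurable borel"
  shows "tri (\<lambda>x. \<Sum>p\<in>S. f p x) g h = (\<Sum>p\<in>S. tri (f p) g h)"
  using assms(1,2)
proof (induction S)
  case empty
  then show ?case by (simp add: tri_def)
next
  case (insert p S)
  then show ?case by (simp add: tri_add)
qed

lemma SUP_mult_incseq:
  fixes f g :: "nat \<Rightarrow> ennreal"
  assumes "incseq f" "incseq g"
  shows "(SUP n. f n * g n) = (SUP n. f n) * (SUP n. g n)"
proof (rule antisym)
  show "(SUP n. f n * g n) \<le> (SUP n. f n) * (SUP n. g n)"
    by (intro SUP_least mult_mono SUP_upper) auto
  have "(SUP n. f n) * (SUP n. g n) = (SUP i. SUP j. f i * g j)"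
    by (subst SUP_mult_right_ennreal) (simp add: SUP_mult_left_ennreal)
  also have "\<dots> \<le> (SUP n. f n * g n)"
  proof (intro SUP_least)
    fix i j
    have "f i * g j \<le> f (max i j) * g (max i j)"
      using assms by (intro mult_mono) (auto simp: incseq_def)
    also have "\<dots> \<le> (SUP n. f n * g n)" by (intro SUP_upper) auto
    finally show "f i * g j \<le> (SUP n. f n * g n)" .
  qed
  finally show "(SUP n. f n) * (SUP n. g n) \<le> (SUP n. f n * g n)" .
qed

lemma tri_SUP:
  fixes f g h :: "nat \<Rightarrow> real \<Rightarrow> ennreal"
  assumes m: "incseq f" "incseq g" "incseq h"
  assumes [measurable]: "\<And>n. f n \<in> borel_measurable borel" "\<And>n. g n \<in> borel_measurable borel" "\<And>n. h n \<in> borel_measurable borel"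
  assumes F: "\<And>x. (SUP n. f n x) = F x" and G: "\<And>x. (SUP n. g n x) = G x" and H: "\<And>x. (SUP n. h n x) = H x"
  shows "(SUP n. tri (f n) (g n) (h n)) = tri F G H"
proof -
  have mm: "incseq (\<lambda>n. f n x)" "incseq (\<lambda>n. g n x)" "incseq (\<lambda>n. h n x)" for x
    using m by (auto simp: incseq_def le_fun_def)

  have inc: "incseq (\<lambda>n. f n x * g n y * h n z)" for x y z
    using mm by (auto simp: incseq_def intro!: mult_mono)
  have p: "(SUP n. f n x * g n y * h n z) = F x * G y * H z" for x y z
  proof -
    have "(SUP n. f n x * g n y * h n z) = (SUP n. f n x * g n y) * (SUP n. h n z)"
      using mm by (intro SUP_mult_incseq) (auto simp: incseq_def intro!: mult_mono)
    also have "(SUP n. f n x * g n y) = F x * G y"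
      using mm by (subst SUP_mult_incseq) (auto simp: F G)
    finally show ?thesis by (simp add: H)
  qed
  have "tri F G H = (\<integral>\<^sup>+x. \<integral>\<^sup>+y. (SUP n. f n x * g n y * h n (- x - y)) \<partial>lborel \<partial>lborel)"
    unfolding tri_def by (simp add: p)
  also have "\<dots> = (\<integral>\<^sup>+x. (SUP n. \<integral>\<^sup>+y. f n x * g n y * h n (- x - y) \<partial>lborel) \<partial>lborel)"
  proof (intro nn_integral_cong nn_integral_monotone_convergence_SUP)
    fix x show "incseq (\<lambda>n y. f n x * g n y * h n (- x - y))"
      using inc unfolding incseq_def le_fun_def by blast
  qed measurable
  also have "\<dots> = (SUP n. tri (f n) (g n) (h n))" unfolding tri_def
  proof (intro nn_integral_monotone_convergence_SUP)
    show "incseq (\<lambda>n x. \<integral>\<^sup>+y. f n x * g n y * h n (- x - y) \<partial>lborel)"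
      using inc unfolding incseq_def le_fun_def by (blast intro: nn_integral_mono)
  qed measurable
  finally show ?thesis by simp
qed

subsection \<open>Riesz's inequality for finite unions of intervals\<close>

text \<open>A pair stores centre and half-length, so moving an interval changes the first component
  only.\<close>

definition iv :: "real \<times> real \<Rightarrow> real set" where
  "iv p = {fst p - snd p <..< fst p + snd p}"

lemma borel_iv [measurable]: "iv p \<in> sets borel"
  by (simp add: iv_def)

definition stepf :: "(real \<times> real) set \<Rightarrow> real \<Rightarrow> ennreal" where
  "stepf S x = (\<Sum>p\<in>S. ind (x \<in> iv p))"

lemma borel_stepf [measurable]: "stepf S \<in> borel_measurable borel"
  unfolding stepf_def by measurable

definition separated :: "(real \<times> real) set \<Rightarrow> bool" where
  "separated S \<longleftrightarrow> finite S \<and> (\<forall>p\<in>S. 0 < snd p) \<and>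
     (\<forall>p\<in>S. \<forall>q\<in>S. p \<noteq> q \<longrightarrow> snd p + snd q \<le> \<bar>fst p - fst q\<bar>)"

definition len :: "(real \<times> real) set \<Rightarrow> real" where
  "len S = (\<Sum>p\<in>S. 2 * snd p)"

abbreviation ic :: "ennreal \<Rightarrow> real \<Rightarrow> ennreal" where
  "ic m \<equiv> \<lambda>x. ind (x \<in> cint m)"

definition tri_iv :: "real \<times> real \<Rightarrow> real \<times> real \<Rightarrow> real \<times> real \<Rightarrow> ennreal" where
  "tri_iv p q r = tri (\<lambda>x. ind (x \<in> iv p)) (\<lambda>x. ind (x \<in> iv q)) (\<lambda>x. ind (x \<in> iv r))"

text \<open>For three intervals the functional depends on the centres only through their sum, and as
  a function of that sum it is an iterated convolution of symmetric decreasing functions.\<close>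

lemma tri_iv_eq:
  "tri_iv (a, l) (b, m) (c, n) =
     nconv (ic (ennreal (2 * l))) (nconv (ic (ennreal (2 * m))) (ic (ennreal (2 * n)))) (- (a + b + c))"
proof -
  have s: "a + x \<in> iv (a, l) \<longleftrightarrow> x \<in> cint (ennreal (2 * l))" for a x l
    by (auto simp: iv_def cint_real)
  have s3: "- (a + x) - (b + y) \<in> iv (c, n) \<longleftrightarrow> - (a + b + c) - x - y \<in> cint (ennreal (2 * n))" for x y
    by (auto simp: iv_def cint_real)
  have "tri_iv (a, l) (b, m) (c, n) =
     (\<integral>\<^sup>+x. \<integral>\<^sup>+y. ind (a + x \<in> iv (a, l)) * ind (y \<in> iv (b, m)) * ind (- (a + x) - y \<in> iv (c, n)) \<partial>lborel \<partial>lborel)"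
    unfolding tri_iv_def tri_def by (rule nn_integral_lborel_translate[symmetric]) measurable
  also have "\<dots> = (\<integral>\<^sup>+x. \<integral>\<^sup>+y. ind (a + x \<in> iv (a, l)) * ind (b + y \<in> iv (b, m)) * ind (- (a + x) - (b + y) \<in> iv (c, n)) \<partial>lborel \<partial>lborel)"
    by (intro nn_integral_cong nn_integral_lborel_translate[symmetric]) measurable
  also have "\<dots> = (\<integral>\<^sup>+x. \<integral>\<^sup>+y. ic (ennreal (2 * l)) x * (ic (ennreal (2 * m)) y * ic (ennreal (2 * n)) (- (a + b + c) - x - y)) \<partial>lborel \<partial>lborel)"
    unfolding s s3 by (simp only: mult.assoc)
  also have "\<dots> = nconv (ic (ennreal (2 * l))) (nconv (ic (ennreal (2 * m))) (ic (ennreal (2 * n)))) (- (a + b + c))"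
    unfolding nconv_def by (intro nn_integral_cong nn_integral_cmult) measurable
  finally show ?thesis .
qed

lemma tri_iv_mono:
  assumes "\<bar>a' + b' + c'\<bar> \<le> \<bar>a + b + c\<bar>"
  shows "tri_iv (a, l) (b, m) (c, n) \<le> tri_iv (a', l) (b', m) (c', n)"
  unfolding tri_iv_eq
  by (intro symm_decrD[of "nconv _ _"] symm_decr_nconv symm_decr_cint) (use assms in auto)

lemma tri_stepf:
  assumes "finite S1" "finite S2" "finite S3"
  shows "tri (stepf S1) (stepf S2) (stepf S3) = (\<Sum>p\<in>S1. \<Sum>q\<in>S2. \<Sum>r\<in>S3. tri_iv p q r)"
proof -
  have "tri (stepf S1) (stepf S2) (stepf S3) = (\<Sum>p\<in>S1. tri (\<lambda>x. ind (x \<in> iv p)) (stepf S2) (stepf S3))"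
    unfolding stepf_def[of S1, abs_def] by (rule tri_sum) (use assms in auto)
  also have "\<dots> = (\<Sum>p\<in>S1. \<Sum>q\<in>S2. tri (\<lambda>x. ind (x \<in> iv p)) (\<lambda>x. ind (x \<in> iv q)) (stepf S3))"
    apply (rule sum.cong[OF refl])
    apply (subst tri_swap12, measurable)
    apply (unfold stepf_def[of S2, abs_def])
    apply (subst tri_sum, use assms in auto)
    apply (intro sum.cong refl tri_swap12, measurable)
    done
  also have "\<dots> = (\<Sum>p\<in>S1. \<Sum>q\<in>S2. \<Sum>r\<in>S3. tri_iv p q r)"
    apply (rule sum.cong[OF refl])
    apply (rule sum.cong[OF refl])
    apply (subst tri_swap23, measurable)
    apply (subst tri_swap12, measurable)
    apply (unfold stepf_def[of S3, abs_def])
    apply (subst tri_sum, use assms in auto)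
    apply (intro sum.cong refl)
    apply (unfold tri_iv_def)
    apply (subst tri_swap12, measurable)
    apply (rule tri_swap23, measurable)
    done
  finally show ?thesis .
qed

definition contract :: "real \<Rightarrow> real \<times> real \<Rightarrow> real \<times> real" where
  "contract t p = (t * fst p, snd p)"

lemma inj_contract: "t > 0 \<Longrightarrow> inj_on (contract t) S"
  by (auto simp: inj_on_def contract_def prod_eq_iff)

lemma card_contract: "t > 0 \<Longrightarrow> card (contract t ` S) = card S"
  by (intro card_image inj_contract)

lemma len_contract: "t > 0 \<Longrightarrow> len (contract t ` S) = len S"
  unfolding len_def by (subst sum.reindex) (auto simp: inj_contract contract_def)

lemma separated_contract:
  assumes "separated S" "t > 0"
    and "\<And>p q. p \<in> S \<Longrightarrow> q \<in> S \<Longrightarrow> p \<noteq> q \<Longrightarrow> snd p + snd q \<le> t * \<bar>fst p - fst q\<bar>"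
  shows "separated (contract t ` S)"
proof -
  have "snd p + snd q \<le> \<bar>t * fst p - t * fst q\<bar>" if "p \<in> S" "q \<in> S" "p \<noteq> q" for p q
    using assms(3)[OF that] \<open>t > 0\<close> by (simp flip: right_diff_distrib add: abs_mult)
  then show ?thesis using assms(1) unfolding separated_def by (auto simp: contract_def)
qed

text \<open>Scaling all centres by \<open>t\<close> scales the sum of centres of every triple by
  \<open>t\<close>, so by \<open>tri_iv_mono\<close> each summand in \<open>tri_stepf\<close> can
  only grow.\<close>

lemma tri_contract:
  assumes "finite S1" "finite S2" "finite S3" "0 < t" "t \<le> 1"
  shows "tri (stepf S1) (stepf S2) (stepf S3) \<le>
         tri (stepf (contract t ` S1)) (stepf (contract t ` S2)) (stepf (contract t ` S3))"
proof -
  have *: "tri_iv p q r \<le> tri_iv (contract t p) (contract t q) (contract t r)" for p q r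
  proof -
    have "t * fst p + t * fst q + t * fst r = t * (fst p + fst q + fst r)" by (simp add: algebra_simps)
    then have "\<bar>t * fst p + t * fst q + t * fst r\<bar> \<le> \<bar>fst p + fst q + fst r\<bar>"
      using assms by (simp add: abs_mult mult_left_le_one_le)
    then show ?thesis
      using tri_iv_mono[of "t * fst p" "t * fst q" "t * fst r" "fst p" "fst q" "fst r" "snd p" "snd q" "snd r"]
      by (simp add: contract_def)
  qed
  show ?thesis
    using assms by (simp add: tri_stepf sum.reindex inj_contract sum_mono *)
qed

text \<open>The merged interval \<open>n\<close> runs from the left end of \<open>p\<close> to the
  right end of \<open>q\<close>. It contains their common endpoint, which the two open intervals
  omit, so the step functions agree only almost everywhere.\<close>

lemma separated_merge_ordered:
  assumes S: "separated S" and p: "p \<in> S" and q: "q \<in> S"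
    and touch: "snd p + snd q = fst q - fst p"
  shows "\<exists>S'. separated S' \<and> card S' < card S \<and> len S' = len S \<and>
    (AE x in lborel. stepf S x = stepf S' x)"
proof -
  have fin: "finite S" and pos: "\<And>r. r \<in> S \<Longrightarrow> 0 < snd r"
    and sep: "\<And>r s. r \<in> S \<Longrightarrow> s \<in> S \<Longrightarrow> r \<noteq> s \<Longrightarrow> snd r + snd s \<le> \<bar>fst r - fst s\<bar>"
    using S by (auto simp: separated_def)
  have pq: "p \<noteq> q" using touch pos[OF p] pos[OF q] by auto
  define n where "n = ((fst p - snd p + fst q + snd q) / 2, snd p + snd q)"
  define R where "R = S - {p, q}"
  have sepn: "snd n + snd r \<le> \<bar>fst n - fst r\<bar>" if "r \<in> R" for r
  proof -
    have r: "r \<in> S" "r \<noteq> p" "r \<noteq> q" using that by (auto simp: R_def)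
    have "snd r + snd p \<le> \<bar>fst r - fst p\<bar>" "snd r + snd q \<le> \<bar>fst r - fst q\<bar>" "0 < snd r"
      "0 < snd p" "0 < snd q"
      using sep[of r p] sep[of r q] r p q pos by auto
    moreover have n: "fst n = fst q - snd p" "snd n = snd p + snd q" using touch by (auto simp: n_def field_simps)
    ultimately show ?thesis using touch unfolding n by linarith
  qed
  have nR: "n \<notin> R"
  proof
    assume "n \<in> R"
    from sepn[OF this] have "snd n \<le> 0" by simp
    then show False using pos[OF p] pos[OF q] by (simp add: n_def)
  qed
  have S_eq: "S = insert p (insert q R)" and nin: "p \<notin> insert q R" "q \<notin> R"
    using p q pq by (auto simp: R_def)
  have finR: "finite R" using fin by (simp add: R_def)
  have "separated (insert n R)"
    unfolding separated_def
  proof (intro conjI ballI impI)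
    show "finite (insert n R)" using finR by simp
    show "0 < snd r" if "r \<in> insert n R" for r
      using that pos[of r] pos[OF p] pos[OF q] unfolding R_def by (cases "r = n") (simp_all add: n_def)
    show "snd r + snd s \<le> \<bar>fst r - fst s\<bar>" if "r \<in> insert n R" "s \<in> insert n R" "r \<noteq> s" for r s
    proof (cases "r = n \<or> s = n")
      case True
      then show ?thesis using that sepn[of r] sepn[of s] by (metis insertE abs_minus_commute add.commute)
    next
      case False
      then show ?thesis using that sep[of r s] unfolding R_def by blast
    qed
  qed
  moreover have "card (insert n R) < card S"
    using nR nin finR by (subst S_eq) simp
  moreover have "len (insert n R) = len S"
    using nR nin finR by (subst S_eq) (simp add: len_def n_def)
  moreover have "AE x in lborel. stepf S x = stepf (insert n R) x"
  proof -
    have "ind (x \<in> iv p) + ind (x \<in> iv q) = ind (x \<in> iv n)" if "x \<noteq> fst p + snd p" for x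
    proof -
      have "x \<in> iv n \<longleftrightarrow> fst p - snd p < x \<and> x < fst q + snd q"
        using touch by (auto simp: iv_def n_def field_simps)
      moreover have "fst q - snd q = fst p + snd p" using touch by simp
      ultimately show ?thesis using that pos[OF p] pos[OF q] 
        by (auto simp: iv_def)
    qed
    then have "stepf S x = stepf (insert n R) x" if "x \<noteq> fst p + snd p" for x
      using that nR nin finR by (subst S_eq) (simp add: stepf_def add.assoc[symmetric])
    then show ?thesis using AE_lborel_singleton[of "fst p + snd p"] by (auto elim!: eventually_mono)
  qed
  ultimately show ?thesis by blast
qed

lemma separated_merge:
  assumes S: "separated S" and p: "p \<in> S" and q: "q \<in> S" "p \<noteq> q"
    and touch: "snd p + snd q = \<bar>fst p - fst q\<bar>"
  obtains S' where "separated S'" "card S' < card S" "len S' = len S"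
    "AE x in lborel. stepf S x = stepf S' x"
proof (cases "fst p \<le> fst q")
  case True
  then show ?thesis using separated_merge_ordered[OF S p q(1)] touch that by auto
next
  case False
  then show ?thesis using separated_merge_ordered[OF S q(1) p] touch that by (auto simp: add.commute)
qed

definition riesz_step :: "(real \<times> real) set \<Rightarrow> (real \<times> real) set \<Rightarrow> (real \<times> real) set \<Rightarrow> bool" where
  "riesz_step S1 S2 S3 \<longleftrightarrow> tri (stepf S1) (stepf S2) (stepf S3) \<le> tri (ic (len S1)) (ic (len S2)) (ic (len S3))"

lemma riesz_step_swap:
  "riesz_step S1 S2 S3 \<longleftrightarrow> riesz_step S2 S1 S3" "riesz_step S1 S2 S3 \<longleftrightarrow> riesz_step S1 S3 S2"
  unfolding riesz_step_def by (subst (1 2) tri_swap12; simp) (subst (1 2) tri_swap23; simp)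

lemma riesz_step_touching:
  assumes "separated S1" "p \<in> S1" "q \<in> S1" "p \<noteq> q" "snd p + snd q = \<bar>fst p - fst q\<bar>"
    and IH: "\<And>S'. separated S' \<Longrightarrow> card S' < card S1 \<Longrightarrow> riesz_step S' S2 S3"
  shows "riesz_step S1 S2 S3"
proof -
  from separated_merge[OF assms(1-5)] obtain S' where
    S': "separated S'" "card S' < card S1" "len S' = len S1" "AE x in lborel. stepf S1 x = stepf S' x" .
  have "tri (stepf S1) (stepf S2) (stepf S3) = tri (stepf S') (stepf S2) (stepf S3)"
    using S'(4) by (intro tri_cong_AE) auto
  then show ?thesis using IH[OF S'(1,2)] S'(3) by (simp add: riesz_step_def)
qed

lemma riesz_step_small:
  assumes "separated S1" "separated S2" "separated S3" "card S1 \<le> 1" "card S2 \<le> 1" "card S3 \<le> 1"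
  shows "riesz_step S1 S2 S3"
proof (cases "S1 = {} \<or> S2 = {} \<or> S3 = {}")
  case True
  then have "tri (stepf S1) (stepf S2) (stepf S3) = 0"
    by (subst tri_stepf) (use assms in \<open>auto simp: separated_def\<close>)
  then show ?thesis by (simp add: riesz_step_def)
next
  case False
  moreover have "finite S1" "finite S2" "finite S3" using assms by (auto simp: separated_def)
  ultimately have "card S1 = 1" "card S2 = 1" "card S3 = 1"
    using assms(4-6) by (auto simp: le_Suc_eq)
  then obtain p q r where S: "S1 = {p}" "S2 = {q}" "S3 = {r}" by (metis card_1_singletonE)
  have e: "(x \<in> iv (0, l)) = (x \<in> cint (ennreal (2 * l)))" for x l by (auto simp: iv_def cint_real)
  have "tri_iv p q r \<le> tri_iv (0, snd p) (0, snd q) (0, snd r)"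
    using tri_iv_mono[of 0 0 0 "fst p" "fst q" "fst r" "snd p" "snd q" "snd r"] by simp
  then show ?thesis unfolding riesz_step_def S
    by (subst tri_stepf) (auto simp: len_def tri_iv_def e)
qed

text \<open>Move all intervals towards the origin, which increases the integral, until two intervals of the same
  set touch and can be merged; then induct on the number of intervals.\<close>

lemma riesz_step_separated:
  assumes "separated S1" "separated S2" "separated S3"
  shows "riesz_step S1 S2 S3"
  using assms
proof (induction "card S1 + card S2 + card S3" arbitrary: S1 S2 S3 rule: less_induct)
  case less
  define W where "W S = {(p, q). p \<in> S \<and> q \<in> S \<and> p \<noteq> q}" for S :: "(real \<times> real) set"
  \<comment> \<open>The contraction factors at which the pairs of intervals from \<open>S\<close>
    would come into contact.\<close>
  define X where "X S = (\<lambda>(p, q). (snd p + snd q) / \<bar>fst p - fst q\<bar>) ` W S" for S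
  have finW: "finite (W S)" if "separated S" for S
    by (rule finite_subset[of _ "S \<times> S"]) (use that in \<open>auto simp: W_def separated_def\<close>)
  have X: "x > 0" "x \<le> 1" if "x \<in> X S" "separated S" for x S
  proof -
    from that(1) obtain p q where pq: "p \<in> S" "q \<in> S" "p \<noteq> q" and x: "x = (snd p + snd q) / \<bar>fst p - fst q\<bar>"
      by (auto simp: X_def W_def)
    have "0 < snd p + snd q" "snd p + snd q \<le> \<bar>fst p - fst q\<bar>"
      using that(2) pq by (auto simp: separated_def add_pos_pos)
    then show "x > 0" "x \<le> 1" unfolding x by (auto simp: divide_simps)
  qed
  define Y where "Y = X S1 \<union> X S2 \<union> X S3"
  have finY: "finite Y" using less.prems finW by (auto simp: Y_def X_def)
  show ?case
  proof (cases "Y = {}")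
    case True
    have "card S \<le> 1" if "X S = {}" "separated S" for S
    proof -
      have "finite S" using that by (simp add: separated_def)
      then have "card S \<le> Suc 0"
        by (subst card_le_Suc0_iff_eq) (use that in \<open>auto simp: X_def W_def\<close>)
      then show ?thesis by simp
    qed
    then show ?thesis using True less.prems by (intro riesz_step_small) (auto simp: Y_def)
  next
    case False
    \<comment> \<open>As the factor decreases from 1, the first contact in any of the three sets
      happens at the largest of the ratios; up to there all three sets stay separated.\<close>
    define t where "t = Max Y"
    have tY: "t \<in> Y" unfolding t_def by (rule Max_in) fact+
    then have t: "0 < t" "t \<le> 1" using X less.prems by (auto simp: Y_def)
    have key: "snd p + snd q \<le> t * \<bar>fst p - fst q\<bar>" if "X S \<subseteq> Y" "separated S" "p \<in> S" "q \<in> S" "p \<noteq> q" for S p q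
    proof -
      have "(snd p + snd q) / \<bar>fst p - fst q\<bar> \<in> Y" using that by (auto simp: X_def W_def)
      then have "(snd p + snd q) / \<bar>fst p - fst q\<bar> \<le> t" using finY by (auto simp: t_def)
      moreover have "0 < snd p + snd q" "snd p + snd q \<le> \<bar>fst p - fst q\<bar>"
        using that by (auto simp: separated_def add_pos_pos)
      ultimately show ?thesis by (simp add: divide_simps split: if_splits)
    qed
    have sub: "X S1 \<subseteq> Y" "X S2 \<subseteq> Y" "X S3 \<subseteq> Y" by (auto simp: Y_def)
    let ?c = "\<lambda>S. contract t ` S"
    have sep: "separated (?c S1)" "separated (?c S2)" "separated (?c S3)"
      using separated_contract[OF less.prems(1) t(1) key[OF sub(1) less.prems(1)]]
        separated_contract[OF less.prems(2) t(1) key[OF sub(2) less.prems(2)]]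
        separated_contract[OF less.prems(3) t(1) key[OF sub(3) less.prems(3)]] by blast+
    have touching: "\<exists>p q. p \<in> ?c S \<and> q \<in> ?c S \<and> p \<noteq> q \<and> snd p + snd q = \<bar>fst p - fst q\<bar>"
      if "t \<in> X S" "separated S" for S
    proof -
      from that(1) obtain p q where pq: "p \<in> S" "q \<in> S" "p \<noteq> q" and x: "t = (snd p + snd q) / \<bar>fst p - fst q\<bar>"
        by (auto simp: X_def W_def)
      have "\<bar>fst p - fst q\<bar> > 0" using t x by (metis abs_ge_zero divide_eq_0_iff less_eq_real_def less_irrefl)
      then have "snd p + snd q = t * \<bar>fst p - fst q\<bar>" using x by simp
      then have "snd p + snd q = \<bar>t * fst p - t * fst q\<bar>"
        using \<open>t > 0\<close> by (simp flip: right_diff_distrib add: abs_mult)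
      moreover have "contract t p \<noteq> contract t q" using inj_contract[OF t(1), of UNIV] pq(3) by (auto dest: injD)
      ultimately show ?thesis using pq
        by (intro exI[of _ "contract t p"] exI[of _ "contract t q"]) (auto simp: contract_def)
    qed
    have "riesz_step (?c S1) (?c S2) (?c S3)"
    proof -
      consider "t \<in> X S1" | "t \<in> X S2" | "t \<in> X S3" using tY by (auto simp: Y_def)
      then show ?thesis
      proof cases
        case 1
        from touching[OF this less.prems(1)] obtain p q where
          pq: "p \<in> ?c S1" "q \<in> ?c S1" "p \<noteq> q" "snd p + snd q = \<bar>fst p - fst q\<bar>" by blast
        show ?thesis
          by (rule riesz_step_touching[OF sep(1) pq], rule less.hyps)
             (use sep t in \<open>auto simp: card_contract\<close>)
      next
        case 2
        from touching[OF this less.prems(2)] obtain p q where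
          pq: "p \<in> ?c S2" "q \<in> ?c S2" "p \<noteq> q" "snd p + snd q = \<bar>fst p - fst q\<bar>" by blast
        show ?thesis
          by (subst riesz_step_swap(1), rule riesz_step_touching[OF sep(2) pq], rule less.hyps)
             (use sep t in \<open>auto simp: card_contract\<close>)
      next
        case 3
        from touching[OF this less.prems(3)] obtain p q where
          pq: "p \<in> ?c S3" "q \<in> ?c S3" "p \<noteq> q" "snd p + snd q = \<bar>fst p - fst q\<bar>" by blast
        show ?thesis
          by (subst riesz_step_swap(2), subst riesz_step_swap(1), rule riesz_step_touching[OF sep(3) pq], rule less.hyps)
             (use sep t in \<open>auto simp: card_contract\<close>)
      qed
    qed
    then have "tri (stepf (?c S1)) (stepf (?c S2)) (stepf (?c S3)) \<le> tri (ic (len S1)) (ic (len S2)) (ic (len S3))"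
      using t by (simp add: riesz_step_def len_contract)
    moreover have "tri (stepf S1) (stepf S2) (stepf S3) \<le> tri (stepf (?c S1)) (stepf (?c S2)) (stepf (?c S3))"
      using less.prems t by (intro tri_contract) (auto simp: separated_def)
    ultimately show ?thesis unfolding riesz_step_def by (rule order_trans[rotated])
  qed
qed

subsection \<open>Riesz's inequality for measurable functions\<close>

abbreviation chi :: "real set \<Rightarrow> real \<Rightarrow> ennreal" where
  "chi A \<equiv> \<lambda>x. ind (x \<in> A)"

lemma nn_integral_ind: "A \<in> sets M \<Longrightarrow> (\<integral>\<^sup>+x. ind (x \<in> A) \<partial>M) = emeasure M A"
proof -
  have "(\<integral>\<^sup>+x. ind (x \<in> A) \<partial>M) = (\<integral>\<^sup>+x. indicator A x \<partial>M)"
    by (intro nn_integral_cong) (auto split: split_indicator)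
  then show "A \<in> sets M \<Longrightarrow> ?thesis" by simp
qed

definition riesz :: "real set \<Rightarrow> real set \<Rightarrow> real set \<Rightarrow> bool" where
  "riesz A B C \<longleftrightarrow> tri (chi A) (chi B) (chi C) \<le>
     tri (ic (emeasure lborel A)) (ic (emeasure lborel B)) (ic (emeasure lborel C))"

lemma riesz_swap:
  assumes [measurable]: "A \<in> sets borel" "B \<in> sets borel" "C \<in> sets borel"
  shows "riesz A B C \<longleftrightarrow> riesz B A C" "riesz A B C \<longleftrightarrow> riesz A C B"
proof -
  have m: "chi S \<in> borel_measurable borel" if "S \<in> sets borel" for S
    using that by measurable
  show "riesz A B C \<longleftrightarrow> riesz B A C"
    unfolding riesz_def
    using tri_swap12[of "chi A" "chi B" "chi C"] 
      tri_swap12[of "ic (emeasure lborel A)" "ic (emeasure lborel B)" "ic (emeasure lborel C)"] by simp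
  show "riesz A B C \<longleftrightarrow> riesz A C B"
    unfolding riesz_def
    using tri_swap23[of "chi A" "chi B" "chi C"] 
      tri_swap23[of "ic (emeasure lborel A)" "ic (emeasure lborel B)" "ic (emeasure lborel C)"] by simp
qed

text \<open>The pieces of a division have disjoint interiors, so their centres and half-lengths form
  a separated family. The finitely many endpoints collected in \<open>N\<close> are where the two
  functions may differ.\<close>

lemma separated_of_division:
  assumes "D division_of U"
  shows "\<exists>S. separated S \<and> (AE x in lborel. chi U x = stepf S x)"
proof -
  have fin: "finite D" and U: "U = \<Union>D" and box: "\<And>k. k \<in> D \<Longrightarrow> \<exists>a b. k = {a..b}"
    and disj: "\<And>k l. k \<in> D \<Longrightarrow> l \<in> D \<Longrightarrow> k \<noteq> l \<Longrightarrow> interior k \<inter> interior l = {}"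
    using assms by (auto simp: division_of_def)
  \<comment> \<open>Degenerate pieces would have half-length 0, which \<open>separated\<close>
    forbids; their points lie in \<open>N\<close>.\<close>
  define D' where "D' = {k \<in> D. interior k \<noteq> {}}"
  define \<phi> where "\<phi> k = ((Inf k + Sup k) / 2, (Sup k - Inf k) / 2)" for k :: "real set"
  have int: "\<exists>a b. a < b \<and> k = {a..b} \<and> interior k = {a<..<b} \<and> \<phi> k = ((a + b) / 2, (b - a) / 2)
      \<and> iv (\<phi> k) = interior k" if kD: "k \<in> D'" for k
  proof -
    have "k \<in> D" using kD by (simp add: D'_def)
    then obtain a b where k: "k = {a..b}" using box by metis
    moreover have i: "interior k = {a<..<b}" using k by (simp add: interior_atLeastAtMost_real)
    moreover have "a < b" using kD i by (auto simp: D'_def)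
    moreover from this have "\<phi> k = ((a + b) / 2, (b - a) / 2)" by (simp add: k \<phi>_def)
    moreover from this have "iv (\<phi> k) = {a<..<b}" by (auto simp: iv_def field_simps)
    ultimately show ?thesis by metis
  qed
  have inj: "inj_on \<phi> D'"
  proof (rule inj_onI)
    fix k l assume kl: "k \<in> D'" "l \<in> D'" "\<phi> k = \<phi> l"
    then have "interior k = interior l" using int by metis
    moreover have "interior k \<noteq> {}" using kl by (simp add: D'_def)
    ultimately show "k = l" using disj[of k l] kl by (auto simp: D'_def)
  qed
  have sep: "separated (\<phi> ` D')"
    unfolding separated_def
  proof (intro conjI ballI impI)
    show "finite (\<phi> ` D')" using fin by (simp add: D'_def)
    show "0 < snd p" if "p \<in> \<phi> ` D'" for p
    proof -
      from that obtain k where "k \<in> D'" "p = \<phi> k" by blast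
      with int[of k] show ?thesis by force
    qed
    fix p q assume "p \<in> \<phi> ` D'" "q \<in> \<phi> ` D'" "p \<noteq> q"
    then obtain k l where kl: "k \<in> D'" "l \<in> D'" "p = \<phi> k" "q = \<phi> l" "k \<noteq> l" by blast
    obtain a b where k: "a < b" "interior k = {a<..<b}" "p = ((a + b) / 2, (b - a) / 2)"
      using int[OF kl(1)] kl(3) by blast
    obtain c d where l: "c < d" "interior l = {c<..<d}" "q = ((c + d) / 2, (d - c) / 2)"
      using int[OF kl(2)] kl(4) by blast
    have "{a<..<b} \<inter> {c<..<d} = {}" using disj[of k l] kl k l by (auto simp: D'_def)
    then have "{max a c<..<min b d} = {}" by auto
    then have "min b d \<le> max a c" by simp
    then have "b \<le> c \<or> d \<le> a" using k(1) l(1) by (auto simp: min_def max_def split: if_splits)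
    then show "snd p + snd q \<le> \<bar>fst p - fst q\<bar>" unfolding k(3) l(3) using k(1) l(1)
      by (auto simp: abs_if field_simps)
  qed
  define N where "N = Inf ` D \<union> Sup ` D"
  have N: "AE x in lborel. x \<notin> N"
  proof (rule AE_not_in)
    show "N \<in> null_sets lborel"
      using fin by (intro finite_imp_null_set_lborel) (simp add: N_def)
  qed
  have "chi U x = stepf (\<phi> ` D') x" if x: "x \<notin> N" for x
  proof -
    have st: "stepf (\<phi> ` D') x = (\<Sum>k\<in>D'. ind (x \<in> interior k))"
      unfolding stepf_def by (subst sum.reindex[OF inj]) (auto intro!: sum.cong dest!: int)
    show ?thesis
    proof (cases "x \<in> U")
      case True
      then obtain k where k: "k \<in> D" "x \<in> k" using U by blast
      obtain a b where ab: "k = {a..b}" using box k by blast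
      have "a \<noteq> x" "x \<noteq> b" using x k ab by (auto simp: N_def image_iff dest!: bspec)
      then have xk: "x \<in> interior k" using k(2) ab by (auto simp: interior_atLeastAtMost_real)
      then have kD: "k \<in> D'" using k by (auto simp: D'_def)
      have "x \<notin> interior l" if "l \<in> D'" "l \<noteq> k" for l
        using disj[of k l] that kD xk by (auto simp: D'_def)
      then have "(\<Sum>k\<in>D'. ind (x \<in> interior k)) = (\<Sum>l\<in>D'. if l = k then 1 else 0)"
        using xk by (intro sum.cong) auto
      also have "\<dots> = 1" using kD fin by (simp add: D'_def)
      finally show ?thesis using st True by simp
    next
      case False
      have "x \<notin> interior k" if "k \<in> D'" for k
        using False that interior_subset[of k] U by (auto simp: D'_def)
      then show ?thesis using st False by (simp add: sum.neutral)
    qed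
  qed
  then have "AE x in lborel. chi U x = stepf (\<phi> ` D') x" by (rule eventually_mono[OF N])
  with sep show ?thesis by blast
qed

lemma len_eq_emeasure:
  assumes S: "separated S" and ae: "AE x in lborel. chi U x = stepf S x" and [measurable]: "U \<in> sets borel"
  shows "emeasure lborel U = ennreal (len S)"
proof -
  have "emeasure lborel U = (\<integral>\<^sup>+x. chi U x \<partial>lborel)" by (simp add: nn_integral_ind)
  also have "\<dots> = (\<integral>\<^sup>+x. stepf S x \<partial>lborel)" using ae by (rule nn_integral_cong_AE)
  also have "\<dots> = (\<Sum>p\<in>S. emeasure lborel (iv p))"
    unfolding stepf_def by (subst nn_integral_sum) (auto simp: nn_integral_ind)
  also have "\<dots> = (\<Sum>p\<in>S. ennreal (2 * snd p))"
    using S by (intro sum.cong) (auto simp: iv_def separated_def emeasure_lborel_Ioo dest!: bspec)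
  also have "\<dots> = ennreal (len S)"
    unfolding len_def using S by (intro sum_ennreal) (auto simp: separated_def less_imp_le)
  finally show ?thesis .
qed

definition boxes :: "real set \<Rightarrow> bool" where
  "boxes U \<longleftrightarrow> (\<exists>F. finite F \<and> (\<forall>k\<in>F. \<exists>a b. k = cbox a b) \<and> U = \<Union>F)"

lemma borel_boxes: "boxes U \<Longrightarrow> U \<in> sets borel"
  unfolding boxes_def by (auto intro!: sets.finite_Union)

lemma boxes_separated:
  assumes "boxes U"
  obtains S where "separated S" "AE x in lborel. chi U x = stepf S x" "emeasure lborel U = ennreal (len S)"
proof -
  obtain F where F: "finite F" "\<And>k. k \<in> F \<Longrightarrow> \<exists>a b. k = cbox a b" "U = \<Union>F"
    using assms by (auto simp: boxes_def)
  obtain D where "D division_of U" using elementary_unions_intervals[OF F(1,2)] F(3) by metis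
  from separated_of_division[OF this] that len_eq_emeasure borel_boxes[OF assms] show thesis by blast
qed

lemma riesz_boxes:
  assumes "boxes A" "boxes B" "boxes C"
  shows "riesz A B C"
proof -
  note [measurable] = assms[THEN borel_boxes]
  obtain S1 where S1: "separated S1" "AE x in lborel. chi A x = stepf S1 x" "emeasure lborel A = ennreal (len S1)"
    using boxes_separated[OF assms(1)] .
  obtain S2 where S2: "separated S2" "AE x in lborel. chi B x = stepf S2 x" "emeasure lborel B = ennreal (len S2)"
    using boxes_separated[OF assms(2)] .
  obtain S3 where S3: "separated S3" "AE x in lborel. chi C x = stepf S3 x" "emeasure lborel C = ennreal (len S3)"
    using boxes_separated[OF assms(3)] .
  have "tri (chi A) (chi B) (chi C) = tri (stepf S1) (chi B) (chi C)"
    by (rule tri_cong_AE) (use S1 in auto)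
  also have "\<dots> = tri (chi B) (stepf S1) (chi C)" by (rule tri_swap12) measurable
  also have "\<dots> = tri (stepf S2) (stepf S1) (chi C)"
    by (rule tri_cong_AE) (use S2 in auto)
  also have "\<dots> = tri (stepf S1) (stepf S2) (chi C)" by (rule tri_swap12) measurable
  also have "\<dots> = tri (stepf S1) (chi C) (stepf S2)" by (rule tri_swap23) measurable
  also have "\<dots> = tri (chi C) (stepf S1) (stepf S2)" by (rule tri_swap12) measurable
  also have "\<dots> = tri (stepf S3) (stepf S1) (stepf S2)"
    by (rule tri_cong_AE) (use S3 in auto)
  also have "\<dots> \<le> tri (ic (len S3)) (ic (len S1)) (ic (len S2))"
    using riesz_step_separated[OF S3(1) S1(1) S2(1)] by (simp add: riesz_step_def)
  also have "\<dots> = tri (ic (len S1)) (ic (len S3)) (ic (len S2))" by (rule tri_swap12) measurable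
  also have "\<dots> = tri (ic (len S1)) (ic (len S2)) (ic (len S3))" by (rule tri_swap23) measurable
  finally show ?thesis by (simp add: riesz_def S1 S2 S3)
qed

lemma SUP_chi:
  assumes "incseq A"
  shows "(SUP n. chi (A n) x) = chi (\<Union>n. A n) x"
proof (cases "\<exists>n. x \<in> A n")
  case True
  then obtain n where n: "x \<in> A n" by blast
  have "(SUP n. chi (A n) x) = 1"
    by (intro antisym SUP_least SUP_upper2[of n]) (use n in auto)
  then show ?thesis using n by auto
qed auto

lemma incseq_chi: "incseq A \<Longrightarrow> incseq (\<lambda>n. chi (A n))"
  by (auto simp: incseq_def le_fun_def)

lemma ic_mono: "m \<le> n \<Longrightarrow> ic m x \<le> ic n x"
  using cint_mono[of m n] by auto

lemma riesz_incseq: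
  assumes inc: "incseq A" "incseq B" "incseq C"
    and m: "\<And>n. A n \<in> sets borel" "\<And>n. B n \<in> sets borel" "\<And>n. C n \<in> sets borel"
    and r: "\<And>n::nat. riesz (A n) (B n) (C n)"
  shows "riesz (\<Union>n. A n) (\<Union>n. B n) (\<Union>n. C n)"
proof -
  note [measurable] = m
  have "tri (chi (\<Union>n. A n)) (chi (\<Union>n. B n)) (chi (\<Union>n. C n)) = (SUP n. tri (chi (A n)) (chi (B n)) (chi (C n)))"
    by (rule tri_SUP[symmetric]) (use inc in \<open>auto simp only: SUP_chi incseq_chi, measurable\<close>)
  also have "\<dots> \<le> tri (ic (emeasure lborel (\<Union>n. A n))) (ic (emeasure lborel (\<Union>n. B n))) (ic (emeasure lborel (\<Union>n. C n)))"
  proof (rule SUP_least)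
    fix n
    have "tri (chi (A n)) (chi (B n)) (chi (C n)) \<le> tri (ic (emeasure lborel (A n))) (ic (emeasure lborel (B n))) (ic (emeasure lborel (C n)))"
      using r by (simp add: riesz_def)
    also have "\<dots> \<le> tri (ic (emeasure lborel (\<Union>n. A n))) (ic (emeasure lborel (\<Union>n. B n))) (ic (emeasure lborel (\<Union>n. C n)))"
      by (intro tri_mono ic_mono emeasure_mono) (use m in auto)
    finally show "tri (chi (A n)) (chi (B n)) (chi (C n)) \<le> \<dots>" .
  qed
  finally show ?thesis by (simp add: riesz_def)
qed

lemma open_boxes:
  assumes "open (U :: real set)"
  obtains A where "incseq A" "\<And>n::nat. boxes (A n)" "(\<Union>n. A n) = U"
proof -
  obtain D where D: "countable D" "\<And>X. X \<in> D \<Longrightarrow> \<exists>a b. X = cbox a (b::real)" "\<Union>D = U"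
    using open_countable_Union_open_cbox[OF assms] by metis
  define E where "E = insert {} D"
  have E: "countable E" "E \<noteq> {}" "\<And>X. X \<in> E \<Longrightarrow> \<exists>a b. X = cbox a (b::real)" "\<Union>E = U"
  proof -
    have "{} = cbox 1 (0::real)" by simp
    then show "\<And>X. X \<in> E \<Longrightarrow> \<exists>a b. X = cbox a (b::real)" using D(2) unfolding E_def by blast
  qed (use D in \<open>auto simp: E_def\<close>)
  define A where "A n = \<Union>(from_nat_into E ` {..n})" for n
  have "boxes (A n)" for n
    unfolding boxes_def A_def
    by (intro exI[of _ "from_nat_into E ` {..n}"]) (use E from_nat_into[OF E(2)] in auto)
  moreover have "(\<Union>n. A n) = \<Union>E"
    using range_from_nat_into[OF E(2,1)] by (auto simp: A_def) (metis atMost_iff order_refl rangeE)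
  moreover have "incseq A" by (auto simp: incseq_def A_def) (meson atMost_iff order_trans)
  ultimately show thesis using that E(4) by metis
qed

lemma riesz_open:
  assumes "open A" "open B" "open C"
  shows "riesz A B C"
proof -
  obtain A' where A: "incseq A'" "\<And>n::nat. boxes (A' n)" "(\<Union>n. A' n) = A" using open_boxes[OF assms(1)] by metis
  obtain B' where B: "incseq B'" "\<And>n::nat. boxes (B' n)" "(\<Union>n. B' n) = B" using open_boxes[OF assms(2)] by metis
  obtain C' where C: "incseq C'" "\<And>n::nat. boxes (C' n)" "(\<Union>n. C' n) = C" using open_boxes[OF assms(3)] by metis
  show ?thesis
    using riesz_incseq[OF A(1) B(1) C(1)] A B C riesz_boxes borel_boxes by metis
qed

text \<open>Passing from an open superset \<open>U\<close> back to \<open>A\<close> replaces a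
  centred interval by a slightly shorter one. The loss on the right-hand side is at most the excess
  measure of \<open>U\<close> times the measure of \<open>B\<close>, which is why \<open>B\<close>
  has to have finite measure.\<close>

lemma riesz_outer:
  assumes [measurable]: "A \<in> sets borel" "B \<in> sets borel" "C \<in> sets borel"
    and fin: "emeasure lborel A < \<infinity>" "emeasure lborel B < \<infinity>"
    and r: "\<And>U. open U \<Longrightarrow> emeasure lborel U < \<infinity> \<Longrightarrow> riesz U B C"
  shows "riesz A B C"
  unfolding riesz_def
proof (rule ennreal_le_epsilon)
  fix e :: real assume e: "0 < e"
  define b where "b = measure lborel B"
  have b: "emeasure lborel B = ennreal b" "0 \<le> b"
    using fin by (auto simp: b_def emeasure_eq_ennreal_measure)
  define a where "a = measure lborel A"
  have a: "emeasure lborel A = ennreal a" "0 \<le> a"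
    using fin by (auto simp: a_def emeasure_eq_ennreal_measure)
  \<comment> \<open>Chosen so that \<open>e' * b \<le> e\<close>; adding 1 covers
    \<open>b = 0\<close>.\<close>
  define e' where "e' = e / (b + 1)"
  have e': "0 < e'" "e' * b \<le> e" using e b by (auto simp: e'_def field_simps)
  obtain U where U: "open U" "A \<subseteq> U" "emeasure lborel (U - A) < e'"
    using outer_regular_lborel[OF assms(1) e'(1)] .
  have [measurable]: "U \<in> sets borel" using U by simp
  have mU: "emeasure lborel U = emeasure lborel A + emeasure lborel (U - A)"
    using U by (subst plus_emeasure) (auto simp: Un_absorb1)
  have Ufin: "emeasure lborel U < \<infinity>"
    unfolding mU using U fin by (auto simp: less_top[symmetric])
  define u where "u = measure lborel U"
  have u: "emeasure lborel U = ennreal u" "0 \<le> u"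
    using Ufin by (auto simp: u_def emeasure_eq_ennreal_measure)
  have "ennreal u \<le> ennreal a + ennreal e'" using mU U u a by (simp add: less_imp_le add_left_mono)
  then have ua: "u \<le> a + e'" using a e' by (simp flip: ennreal_plus)
  have "ennreal a \<le> ennreal u" using mU a u by simp
  then have au: "a \<le> u" using u by simp
  let ?B = "ic (ennreal b)" and ?C = "ic (emeasure lborel C)"
  let ?D = "cint (ennreal u) - cint (ennreal a)"
  have D: "emeasure lborel ?D \<le> ennreal e'"
  proof -
    have "emeasure lborel ?D = ennreal u - ennreal a"
      by (subst emeasure_Diff) (use au cint_mono in \<open>auto simp: ennreal_leI\<close>)
    also have "\<dots> \<le> ennreal e'" using ua a e' by (simp add: ennreal_minus)
    finally show ?thesis .
  qed
  have "tri (chi A) (chi B) (chi C) \<le> tri (chi U) (chi B) (chi C)"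
    by (intro tri_mono) (use U in auto)
  also have "\<dots> \<le> tri (ic (ennreal u)) ?B ?C"
    using r[OF U(1) Ufin] by (simp add: riesz_def b u)
  also have "\<dots> \<le> tri (\<lambda>x. ic (ennreal a) x + chi ?D x) ?B ?C"
    by (intro tri_mono) auto
  also have "\<dots> = tri (ic (ennreal a)) ?B ?C + tri (chi ?D) ?B ?C"
    by (rule tri_add) measurable
  also have "tri (chi ?D) ?B ?C \<le> tri (chi ?D) ?B (\<lambda>_. 1)" by (intro tri_mono) auto
  also have "\<dots> = emeasure lborel ?D * ennreal b"
    unfolding tri_def by (simp add: nn_integral_cmult nn_integral_multc nn_integral_ind del: Diff_iff)
  also have "\<dots> \<le> ennreal e' * ennreal b" using D by (intro mult_right_mono) auto
  also have "\<dots> \<le> ennreal e" using e' b by (simp flip: ennreal_mult add: ennreal_leI)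
  finally show "tri (chi A) (chi B) (chi C) \<le> tri (ic (emeasure lborel A)) (ic (emeasure lborel B)) ?C + ennreal e"
    by (simp add: a b)
qed

text \<open>Openness is dropped for one set at a time. The permutation lemmas move the set to be
  treated into the first place, where \<open>riesz_outer\<close> acts.\<close>

lemma riesz_finite:
  assumes [measurable]: "A \<in> sets borel" "B \<in> sets borel" "C \<in> sets borel"
    and fin: "emeasure lborel A < \<infinity>" "emeasure lborel B < \<infinity>" "emeasure lborel C < \<infinity>"
  shows "riesz A B C"
proof -
  have 1: "riesz A' U V" if "A' \<in> sets borel" "open U" "open V" 
    "emeasure lborel A' < \<infinity>" "emeasure lborel U < \<infinity>" for A' U V
    by (rule riesz_outer) (use that riesz_open in auto)
  have 2: "riesz A B' V" if "B' \<in> sets borel" "open V" "emeasure lborel B' < \<infinity>" for B' V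
  proof -
    have [measurable]: "B' \<in> sets borel" "V \<in> sets borel" using that by auto
    have "riesz U A V" if "open U" "emeasure lborel U < \<infinity>" for U
      by (subst riesz_swap(1)) (use 1[of A U V] that \<open>open V\<close> fin in auto)
    then have "riesz B' A V" apply - apply (rule riesz_outer) by (use fin that in auto)
    then show ?thesis by (subst riesz_swap) (use that in auto)
  qed
  have "riesz U A B" if "open U" "emeasure lborel U < \<infinity>" for U
    by (subst riesz_swap(1), use that in simp_all, subst riesz_swap(2)) (use 2[of B U] that fin in auto)
  then have "riesz C A B" apply - apply (rule riesz_outer) by (use fin in auto)
  then show ?thesis by (subst riesz_swap(2), simp_all) (subst riesz_swap(1), simp_all)
qed

lemma riesz_borel:
  assumes [measurable]: "A \<in> sets borel" "B \<in> sets borel" "C \<in> sets borel"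
  shows "riesz A B C"
proof -
  define c where "c n S = S \<inter> {- real n .. real n}" for n :: nat and S :: "real set"
  have inc: "incseq (\<lambda>n. c n S)" for S by (auto simp: incseq_def c_def)
  have [measurable]: "c n S \<in> sets borel" if "S \<in> sets borel" for n S using that by (simp add: c_def)
  have un: "(\<Union>n. c n S) = S" for S
  proof
    show "S \<subseteq> (\<Union>n. c n S)"
    proof
      fix x assume "x \<in> S"
      obtain n :: nat where "\<bar>x\<bar> \<le> real n" using real_arch_simple by blast
      with \<open>x \<in> S\<close> show "x \<in> (\<Union>n. c n S)" by (auto simp: c_def abs_le_iff intro!: exI[of _ n])
    qed
  qed (auto simp: c_def)
  have fin: "emeasure lborel (c n S) < \<infinity>" for n S
  proof -
    have "emeasure lborel (c n S) \<le> emeasure lborel {- real n .. real n}"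
      by (intro emeasure_mono) (auto simp: c_def)
    also have "\<dots> < \<infinity>" by simp
    finally show ?thesis .
  qed
  have "riesz (\<Union>n. c n A) (\<Union>n. c n B) (\<Union>n. c n C)"
    by (intro riesz_incseq inc riesz_finite fin) measurable
  then show ?thesis by (simp add: un)
qed

text \<open>A majorization order in which \<open>F\<close> and \<open>G\<close> need not be
  equimeasurable. It is the invariant of the whole induction: \<open>maj_srearr\<close> starts it,
  \<open>maj_nconv\<close> propagates it through a convolution, and \<open>maj_mult\<close> converts
  it into a comparison of L2 norms.\<close>

definition maj :: "(real \<Rightarrow> ennreal) \<Rightarrow> (real \<Rightarrow> ennreal) \<Rightarrow> bool" where
  "maj F G \<longleftrightarrow> (\<forall>A\<in>sets borel. (\<integral>\<^sup>+x. chi A x * F x \<partial>lborel) \<le> (\<integral>\<^sup>+x. ic (emeasure lborel A) x * G x \<partial>lborel))"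

text \<open>The distribution function of \<open>w\<close>. As an integral rather than a measure of a
  set it is jointly measurable in the level and in further parameters.\<close>

definition lev :: "(real \<Rightarrow> ennreal) \<Rightarrow> real \<Rightarrow> ennreal" where
  "lev w t = (\<integral>\<^sup>+y. ind (ennreal t < w y) \<partial>lborel)"

definition srearr :: "(real \<Rightarrow> ennreal) \<Rightarrow> real \<Rightarrow> ennreal" where
  "srearr w x = (\<integral>\<^sup>+t. ind (x \<in> cint (lev w t)) \<partial>halfline)"

lemma borel_lev [measurable]:
  assumes [measurable]: "w \<in> borel_measurable borel"
  shows "lev w \<in> borel_measurable borel"
  unfolding lev_def by measurable

lemma borel_srearr [measurable]:
  assumes [measurable]: "w \<in> borel_measurable borel"
  shows "srearr w \<in> borel_measurable borel"
  unfolding srearr_def cint_def by measurable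

lemma lev_eq: "w \<in> borel_measurable borel \<Longrightarrow> lev w t = emeasure lborel {y. ennreal t < w y}"
  unfolding lev_def using nn_integral_ind[of "{y. ennreal t < w y}" lborel] by simp

text \<open>Layer cake in \<open>w\<close>: the hypothesis is applied to each superlevel set, and
  the centred intervals that result integrate up to \<open>srearr w\<close>.\<close>

lemma majD_fun:
  assumes "maj F G" and [measurable]: "w \<in> borel_measurable borel" "F \<in> borel_measurable borel" "G \<in> borel_measurable borel"
  shows "(\<integral>\<^sup>+x. w x * F x \<partial>lborel) \<le> (\<integral>\<^sup>+x. srearr w x * G x \<partial>lborel)"
proof -
  have "(\<integral>\<^sup>+x. w x * F x \<partial>lborel) = (\<integral>\<^sup>+t. \<integral>\<^sup>+x. chi {x. ennreal t < w x} x * F x \<partial>lborel \<partial>halfline)"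
    by (subst layer_cake_mult) (auto simp: sigma_finite_lborel)
  also have "\<dots> \<le> (\<integral>\<^sup>+t. \<integral>\<^sup>+x. ic (lev w t) x * G x \<partial>lborel \<partial>halfline)"
  proof (rule nn_integral_mono)
    fix t
    have "{x. ennreal t < w x} \<in> sets borel" by measurable
    with assms(1) show "(\<integral>\<^sup>+x. chi {x. ennreal t < w x} x * F x \<partial>lborel) \<le> (\<integral>\<^sup>+x. ic (lev w t) x * G x \<partial>lborel)"
      unfolding maj_def lev_eq[OF assms(2)] by blast
  qed
  also have "\<dots> = (\<integral>\<^sup>+x. \<integral>\<^sup>+t. ic (lev w t) x * G x \<partial>halfline \<partial>lborel)"
    unfolding cint_def by (intro nn_integral_commute sigma_finite_halfline sigma_finite_lborel) measurable
  also have "\<dots> = (\<integral>\<^sup>+x. srearr w x * G x \<partial>lborel)"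
    unfolding srearr_def cint_def by (intro nn_integral_cong nn_integral_multc) measurable
  finally show ?thesis .
qed

lemma symm_decr_srearr: "symm_decr (srearr w)"
  unfolding symm_decr_def srearr_def
  using symm_decr_cint by (auto simp: symm_decr_def intro!: nn_integral_mono)

lemma ennreal_le_diff_add: "(a::ennreal) \<le> t + (a - t)"
proof (cases "t \<le> a")
  case True
  then show ?thesis using diff_add_self_ennreal[of a t] by (simp only: add.commute if_True order_refl)
next
  case False
  then show ?thesis by (intro add_increasing2) auto
qed

lemma le_ennreal_diff: "w \<le> ennreal t \<Longrightarrow> w - ennreal t = 0"
  by (metis diff_eq_0_iff_ennreal ennreal_less_top le_less_trans)

lemma layer_cake_diff: "(\<integral>\<^sup>+s. ind (ennreal t \<le> ennreal s \<and> ennreal s < w) \<partial>halfline) = w - ennreal t"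
proof -
  have fin: "min w (ennreal t) \<noteq> \<top>"
    by (metis ennreal_less_top min_less_iff_disj order_less_irrefl)
  have "(\<integral>\<^sup>+s. ind (ennreal t \<le> ennreal s \<and> ennreal s < w) \<partial>halfline)
      = emeasure halfline ({s. ennreal s < w} - {s. ennreal s < min w (ennreal t)})"
    by (subst nn_integral_ind[symmetric]) (auto intro!: nn_integral_cong simp: not_less)
  also have "\<dots> = w - min w (ennreal t)"
    by (subst emeasure_Diff)
       (use fin in \<open>auto simp: emeasure_halfline_lessThan sets_halfline simp del: min_less_iff_conj
          dest: order.strict_trans2[OF _ min.cobounded1]\<close>)
  also have "\<dots> = w - ennreal t"
  proof (cases "w \<le> ennreal t")
    case True
    then have "w < \<top>" by (rule le_less_trans) simp
    with True show ?thesis by (simp add: min_def le_ennreal_diff diff_eq_0_iff_ennreal)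
  qed (simp add: min_def)
  finally show ?thesis .
qed

text \<open>Differences in \<open>ennreal\<close> are truncated, so these are integrals of positive
  parts. Testing \<open>maj\<close> with the superlevel set of \<open>w\<close> at \<open>t\<close>
  produces \<open>t\<close> times the measure of that set on both sides. Cutting the set down to
  \<open>[-n, n]\<close> makes this term finite, hence cancellable.\<close>

lemma majD_excess:
  assumes "maj w W" and [measurable]: "w \<in> borel_measurable borel" "W \<in> borel_measurable borel"
  shows "(\<integral>\<^sup>+x. w x - ennreal t \<partial>lborel) \<le> (\<integral>\<^sup>+x. W x - ennreal t \<partial>lborel)"
proof -
  define A where "A n = {x. ennreal t < w x} \<inter> {- real n .. real n}" for n :: nat
  have [measurable]: "A n \<in> sets borel" for n unfolding A_def by measurable
  have fin: "emeasure lborel (A n) < \<infinity>" for n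
    by (rule order.strict_trans1[OF emeasure_mono[of _ "{- real n .. real n}"]]) (auto simp: A_def)
  have *: "(\<integral>\<^sup>+x. chi (A n) x * (w x - ennreal t) \<partial>lborel) \<le> (\<integral>\<^sup>+x. W x - ennreal t \<partial>lborel)" for n
  proof -
    have "ennreal t * emeasure lborel (A n) + (\<integral>\<^sup>+x. chi (A n) x * (w x - ennreal t) \<partial>lborel)
        = (\<integral>\<^sup>+x. ennreal t * chi (A n) x + chi (A n) x * (w x - ennreal t) \<partial>lborel)"
      by (subst nn_integral_add) (auto simp: nn_integral_cmult nn_integral_ind)
    also have "\<dots> = (\<integral>\<^sup>+x. chi (A n) x * w x \<partial>lborel)"
      by (intro nn_integral_cong) (auto simp: A_def less_imp_le diff_add_self_ennreal add.commute)
    also have "\<dots> \<le> (\<integral>\<^sup>+x. ic (emeasure lborel (A n)) x * W x \<partial>lborel)"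
      using assms(1) by (auto simp: maj_def)
    also have "\<dots> \<le> (\<integral>\<^sup>+x. ennreal t * ic (emeasure lborel (A n)) x + (W x - ennreal t) \<partial>lborel)"
      by (intro nn_integral_mono) (auto simp: ennreal_le_diff_add)
    also have "\<dots> = ennreal t * emeasure lborel (A n) + (\<integral>\<^sup>+x. W x - ennreal t \<partial>lborel)"
      by (subst nn_integral_add) (auto simp: nn_integral_cmult nn_integral_ind)
    finally show ?thesis
      using fin[of n] by (subst (asm) ennreal_add_left_cancel_le) (auto simp: ennreal_mult_eq_top_iff)
  qed
  have "(\<integral>\<^sup>+x. w x - ennreal t \<partial>lborel) = (\<integral>\<^sup>+x. (SUP n. chi (A n) x * (w x - ennreal t)) \<partial>lborel)"
  proof (intro nn_integral_cong)
    fix x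
    obtain n :: nat where n: "\<bar>x\<bar> \<le> real n" using real_arch_simple by blast
    show "w x - ennreal t = (SUP n. chi (A n) x * (w x - ennreal t))"
    proof (cases "ennreal t < w x")
      case True
      then have "x \<in> A n" using n by (auto simp: A_def abs_le_iff)
      then show ?thesis by (intro antisym SUP_least SUP_upper2[of n]) auto
    next
      case False
      then have "w x - ennreal t = 0" by (simp add: not_less le_ennreal_diff)
      then show ?thesis by simp
    qed
  qed
  also have "\<dots> = (SUP n. (\<integral>\<^sup>+x. chi (A n) x * (w x - ennreal t) \<partial>lborel))"
    by (intro nn_integral_monotone_convergence_SUP)
       (auto simp: incseq_def le_fun_def A_def)
  also have "\<dots> \<le> (\<integral>\<^sup>+x. W x - ennreal t \<partial>lborel)"
    by (intro SUP_least *)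
  finally show ?thesis .
qed

text \<open>Let \<open>t\<close> be the infimum of \<open>W\<close> over the centred set
  \<open>C\<close>, so that \<open>W\<close> is at least \<open>t\<close> on \<open>C\<close> and at
  most \<open>t\<close> off it. Then the left side is at most \<open>t\<close> times the measure of
  \<open>C\<close> plus the integral of the excess of \<open>srearr w\<close> over \<open>t\<close>.
  That excess has the same integral as the excess of \<open>w\<close>, which is bounded by that of
  \<open>W\<close>, and by the choice of \<open>t\<close> the sum is exactly the right side.\<close>

lemma nn_integral_srearr_centered:
  assumes "maj w W" "symm_decr W" and [measurable]: "w \<in> borel_measurable borel" "W \<in> borel_measurable borel" "C \<in> sets borel"
    and C: "\<And>x y. x \<in> C \<Longrightarrow> \<bar>y\<bar> \<le> \<bar>x\<bar> \<Longrightarrow> y \<in> C"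
  shows "(\<integral>\<^sup>+x. chi C x * srearr w x \<partial>lborel) \<le> (\<integral>\<^sup>+x. chi C x * W x \<partial>lborel)"
proof (cases "(INF x\<in>C. W x)")
  \<comment> \<open>This includes the empty \<open>C\<close>, whose infimum is infinite.\<close>
  case top
  show ?thesis
  proof (intro nn_integral_mono)
    fix x show "chi C x * srearr w x \<le> chi C x * W x"
      using top INF_lower[of x C W] by (auto simp: top_unique)
  qed
next
  case (real t)
  have t1: "ennreal t \<le> W x" if "x \<in> C" for x
    using real INF_lower[OF that, of W] by simp
  have t2: "W x \<le> ennreal t" if "x \<notin> C" for x
    unfolding real(2)[symmetric]
  proof (rule INF_greatest)
    fix y assume "y \<in> C"
    then have "\<bar>y\<bar> \<le> \<bar>x\<bar>" using C[of y x] that by force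
    then show "W x \<le> W y" by (rule symm_decrD[OF assms(2)])
  qed
  \<comment> \<open>The part of the layer-cake integral of \<open>srearr w\<close> above level
    \<open>t\<close>, i.e. its excess over \<open>t\<close>.\<close>
  let ?J = "\<lambda>x. \<integral>\<^sup>+s. ind (ennreal t \<le> ennreal s) * ind (x \<in> cint (lev w s)) \<partial>halfline"
  have Jm: "(\<lambda>(x, s). ind (ennreal t \<le> ennreal s) * ind (x \<in> cint (lev w s))) \<in> borel_measurable (lborel \<Otimes>\<^sub>M halfline)"
    unfolding cint_def by measurable
  have [measurable]: "?J \<in> borel_measurable borel"
    unfolding cint_def by measurable
  have "srearr w x \<le> ennreal t + ?J x" for x
  proof -
    have "srearr w x = (\<integral>\<^sup>+s. ind (ennreal s < ennreal t) * ind (x \<in> cint (lev w s)) + ind (ennreal t \<le> ennreal s) * ind (x \<in> cint (lev w s)) \<partial>halfline)"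
      unfolding srearr_def by (intro nn_integral_cong) (auto simp: not_less)
    also have "\<dots> = (\<integral>\<^sup>+s. ind (ennreal s < ennreal t) * ind (x \<in> cint (lev w s)) \<partial>halfline) + ?J x"
      unfolding cint_def by (rule nn_integral_add) measurable
    also have "(\<integral>\<^sup>+s. ind (ennreal s < ennreal t) * ind (x \<in> cint (lev w s)) \<partial>halfline) \<le> (\<integral>\<^sup>+s. ind (ennreal s < ennreal t) \<partial>halfline)"
      by (intro nn_integral_mono) auto
    also have "\<dots> = ennreal t" by (rule layer_cake)
    finally show ?thesis by (simp add: add_right_mono)
  qed
  then have "(\<integral>\<^sup>+x. chi C x * srearr w x \<partial>lborel) \<le> (\<integral>\<^sup>+x. ennreal t * chi C x + ?J x \<partial>lborel)"
    by (intro nn_integral_mono) auto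
  also have "\<dots> = ennreal t * emeasure lborel C + (\<integral>\<^sup>+x. ?J x \<partial>lborel)"
    by (subst nn_integral_add) (auto simp: nn_integral_cmult nn_integral_ind)
  also have "(\<integral>\<^sup>+x. ?J x \<partial>lborel) = (\<integral>\<^sup>+s. \<integral>\<^sup>+x. ind (ennreal t \<le> ennreal s) * ind (x \<in> cint (lev w s)) \<partial>lborel \<partial>halfline)"
    by (rule nn_integral_commute[OF sigma_finite_lborel sigma_finite_halfline Jm])
  also have "\<dots> = (\<integral>\<^sup>+s. \<integral>\<^sup>+x. ind (ennreal t \<le> ennreal s) * ind (ennreal s < w x) \<partial>lborel \<partial>halfline)"
    by (rule nn_integral_cong) (simp add: nn_integral_cmult nn_integral_ind, simp add: lev_def)
  also have "\<dots> = (\<integral>\<^sup>+x. \<integral>\<^sup>+s. ind (ennreal t \<le> ennreal s) * ind (ennreal s < w x) \<partial>halfline \<partial>lborel)"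
    by (rule nn_integral_commute[OF sigma_finite_halfline sigma_finite_lborel]) measurable
  also have "\<dots> = (\<integral>\<^sup>+x. \<integral>\<^sup>+s. ind (ennreal t \<le> ennreal s \<and> ennreal s < w x) \<partial>halfline \<partial>lborel)"
    by (intro nn_integral_cong) auto
  also have "\<dots> = (\<integral>\<^sup>+x. w x - ennreal t \<partial>lborel)" by (simp add: layer_cake_diff)
  also have "\<dots> \<le> (\<integral>\<^sup>+x. W x - ennreal t \<partial>lborel)" by (intro majD_excess assms)
  also have "ennreal t * emeasure lborel C + (\<integral>\<^sup>+x. W x - ennreal t \<partial>lborel) = (\<integral>\<^sup>+x. ennreal t * chi C x + (W x - ennreal t) \<partial>lborel)"
    by (subst nn_integral_add) (auto simp: nn_integral_cmult nn_integral_ind)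
  also have "\<dots> = (\<integral>\<^sup>+x. chi C x * W x \<partial>lborel)"
    by (intro nn_integral_cong) (use t1 t2 in \<open>auto simp: diff_add_self_ennreal add.commute le_ennreal_diff\<close>)
  finally show ?thesis by (simp add: add_left_mono)
qed

text \<open>Layer cake in \<open>G\<close>, whose superlevel sets are centred.\<close>

lemma nn_integral_srearr_mult_le:
  assumes "maj w W" "symm_decr W" "symm_decr G"
    and [measurable]: "w \<in> borel_measurable borel" "W \<in> borel_measurable borel" "G \<in> borel_measurable borel"
  shows "(\<integral>\<^sup>+x. srearr w x * G x \<partial>lborel) \<le> (\<integral>\<^sup>+x. W x * G x \<partial>lborel)"
proof -
  have "(\<integral>\<^sup>+x. srearr w x * G x \<partial>lborel) = (\<integral>\<^sup>+t. \<integral>\<^sup>+x. chi {x. ennreal t < G x} x * srearr w x \<partial>lborel \<partial>halfline)"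
    by (subst mult.commute, subst layer_cake_mult) (auto simp: sigma_finite_lborel)
  also have "\<dots> \<le> (\<integral>\<^sup>+t. \<integral>\<^sup>+x. chi {x. ennreal t < G x} x * W x \<partial>lborel \<partial>halfline)"
    by (intro nn_integral_mono nn_integral_srearr_centered assms)
       (use symm_decrD[OF assms(3)] in \<open>auto elim: order.strict_trans2\<close>)
  also have "\<dots> = (\<integral>\<^sup>+x. G x * W x \<partial>lborel)"
    by (subst layer_cake_mult) (auto simp: sigma_finite_lborel)
  finally show ?thesis by (simp add: mult.commute)
qed

text \<open>The comparison goes through the integral of \<open>srearr w * G\<close>: the first step
  tests \<open>maj F G\<close> with the superlevel sets of \<open>w\<close>, the second uses
  \<open>maj w W\<close> together with the symmetry of \<open>W\<close> and
  \<open>G\<close>.\<close>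

lemma maj_mult:
  assumes "maj F G" "maj w W" "symm_decr W" "symm_decr G"
    and [measurable]: "w \<in> borel_measurable borel" "W \<in> borel_measurable borel" "F \<in> borel_measurable borel" "G \<in> borel_measurable borel"
  shows "(\<integral>\<^sup>+x. F x * w x \<partial>lborel) \<le> (\<integral>\<^sup>+x. G x * W x \<partial>lborel)"
  using order_trans[OF majD_fun[OF assms(1,5,7,8)] nn_integral_srearr_mult_le[OF assms(2-6,8)]]
  by (simp add: mult.commute)

text \<open>The measure of the intersection of \<open>A\<close> with a superlevel set is at most the
  smaller of the two measures, and for centred intervals, which are nested, the intersection attains
  it.\<close>

lemma maj_srearr:
  assumes [measurable]: "f \<in> borel_measurable borel"
  shows "maj f (srearr f)"
  unfolding maj_def
proof (intro ballI)
  fix A :: "real set" assume [measurable]: "A \<in> sets borel"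
  have "(\<integral>\<^sup>+x. chi A x * f x \<partial>lborel) = (\<integral>\<^sup>+t. \<integral>\<^sup>+x. ind (ennreal t < f x) * chi A x \<partial>lborel \<partial>halfline)"
    by (subst mult.commute, subst layer_cake_mult) (auto simp: sigma_finite_lborel)
  also have "\<dots> \<le> (\<integral>\<^sup>+t. \<integral>\<^sup>+x. ic (emeasure lborel A) x * ic (lev f t) x \<partial>lborel \<partial>halfline)"
  proof (rule nn_integral_mono)
    fix t
    have "(\<integral>\<^sup>+x. ind (ennreal t < f x) * chi A x \<partial>lborel) = (\<integral>\<^sup>+x. chi ({x. ennreal t < f x} \<inter> A) x \<partial>lborel)"
      by (intro nn_integral_cong) auto
    also have "\<dots> \<le> min (lev f t) (emeasure lborel A)"
      by (subst nn_integral_ind) (auto simp: lev_eq intro!: emeasure_mono)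
    also have "\<dots> = (\<integral>\<^sup>+x. chi (cint (min (lev f t) (emeasure lborel A))) x \<partial>lborel)"
      by (simp add: nn_integral_ind)
    also have "\<dots> = (\<integral>\<^sup>+x. ic (emeasure lborel A) x * ic (lev f t) x \<partial>lborel)"
      by (intro nn_integral_cong) (auto simp: cint_def)
    finally show "(\<integral>\<^sup>+x. ind (ennreal t < f x) * chi A x \<partial>lborel) \<le> \<dots>" .
  qed
  also have "\<dots> = (\<integral>\<^sup>+x. \<integral>\<^sup>+t. ic (emeasure lborel A) x * ic (lev f t) x \<partial>halfline \<partial>lborel)"
    unfolding cint_def by (rule nn_integral_commute[OF sigma_finite_halfline sigma_finite_lborel]) measurable
  also have "\<dots> = (\<integral>\<^sup>+x. ic (emeasure lborel A) x * srearr f x \<partial>lborel)"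
    unfolding srearr_def cint_def by (intro nn_integral_cong nn_integral_cmult) measurable
  finally show "(\<integral>\<^sup>+x. chi A x * f x \<partial>lborel) \<le> (\<integral>\<^sup>+x. ic (emeasure lborel A) x * srearr f x \<partial>lborel)" .
qed

lemma tri_fst:
  assumes [measurable]: "f \<in> borel_measurable borel" "g \<in> borel_measurable borel" "h \<in> borel_measurable borel"
  shows "tri f g h = (\<integral>\<^sup>+x. f x * (\<integral>\<^sup>+y. g y * h (- x - y) \<partial>lborel) \<partial>lborel)"
  unfolding tri_def by (intro nn_integral_cong) (simp add: nn_integral_cmult mult.assoc)

lemma tri_layer:
  assumes [measurable]: "f \<in> borel_measurable borel" "g \<in> borel_measurable borel" "h \<in> borel_measurable borel"
  shows "tri f g h = (\<integral>\<^sup>+t. tri (chi {x. ennreal t < f x}) g h \<partial>halfline)"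
proof -
  have "tri f g h = (\<integral>\<^sup>+t. \<integral>\<^sup>+x. ind (ennreal t < f x) * (\<integral>\<^sup>+y. g y * h (- x - y) \<partial>lborel) \<partial>lborel \<partial>halfline)"
    unfolding tri_fst[OF assms] by (rule layer_cake_mult[OF _ _ sigma_finite_lborel]) measurable
  also have "\<dots> = (\<integral>\<^sup>+t. tri (chi {x. ennreal t < f x}) g h \<partial>halfline)"
    by (rule nn_integral_cong) (subst tri_fst, auto)
  finally show ?thesis .
qed

lemma tri_layer_srearr:
  assumes [measurable]: "f \<in> borel_measurable borel" "g \<in> borel_measurable borel" "h \<in> borel_measurable borel"
  shows "tri (srearr f) g h = (\<integral>\<^sup>+t. tri (ic (lev f t)) g h \<partial>halfline)"
proof -
  have "tri (srearr f) g h = (\<integral>\<^sup>+x. \<integral>\<^sup>+t. ic (lev f t) x * (\<integral>\<^sup>+y. g y * h (- x - y) \<partial>lborel) \<partial>halfline \<partial>lborel)"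
    unfolding tri_fst[OF borel_srearr[OF assms(1)] assms(2,3)] unfolding srearr_def cint_def
    by (intro nn_integral_cong nn_integral_multc[symmetric]) measurable
  also have "\<dots> = (\<integral>\<^sup>+t. \<integral>\<^sup>+x. ic (lev f t) x * (\<integral>\<^sup>+y. g y * h (- x - y) \<partial>lborel) \<partial>lborel \<partial>halfline)"
    unfolding cint_def by (rule nn_integral_commute[OF sigma_finite_lborel sigma_finite_halfline]) measurable
  finally show ?thesis by (simp add: tri_fst)
qed

text \<open>With two of the functions indicators, Riesz's inequality for all choices of the third
  set says precisely that the convolution \<open>w\<close> of the indicators is majorized by the
  convolution \<open>W\<close> of centred intervals. Then \<open>maj_mult\<close> admits a general
  third function.\<close>

lemma maj_tri_sets:
  assumes "maj F G" "symm_decr G"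
    and [measurable]: "A \<in> sets borel" "B \<in> sets borel" "F \<in> borel_measurable borel" "G \<in> borel_measurable borel"
  shows "tri (chi B) (chi A) F \<le> tri (ic (emeasure lborel B)) (ic (emeasure lborel A)) G"
proof -
  define w where "w x = (\<integral>\<^sup>+y. chi A y * chi B (- x - y) \<partial>lborel)" for x
  define W where "W x = (\<integral>\<^sup>+y. ic (emeasure lborel A) y * ic (emeasure lborel B) (- x - y) \<partial>lborel)" for x
  have [measurable]: "w \<in> borel_measurable borel" "W \<in> borel_measurable borel"
    unfolding w_def W_def by measurable
  have "maj w W" unfolding maj_def
  proof (intro ballI)
    fix C :: "real set" assume [measurable]: "C \<in> sets borel"
    show "(\<integral>\<^sup>+x. chi C x * w x \<partial>lborel) \<le> (\<integral>\<^sup>+x. ic (emeasure lborel C) x * W x \<partial>lborel)"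
      using riesz_borel[of C A B] unfolding riesz_def w_def W_def by (simp add: tri_fst)
  qed
  moreover have "symm_decr W"
  proof -
    have "W x = nconv (ic (emeasure lborel A)) (ic (emeasure lborel B)) x" for x
      using nconv_uminus[OF symm_decr_cint symm_decr_cint] by (simp add: W_def nconv_def)
    then show ?thesis
      using symm_decr_nconv[OF symm_decr_cint symm_decr_cint] by (simp add: symm_decr_def)
  qed
  ultimately have "(\<integral>\<^sup>+x. F x * w x \<partial>lborel) \<le> (\<integral>\<^sup>+x. G x * W x \<partial>lborel)"
    by (intro maj_mult assms) measurable
  then have "tri F (chi A) (chi B) \<le> tri G (ic (emeasure lborel A)) (ic (emeasure lborel B))"
    by (simp add: tri_fst w_def W_def)
  moreover have "tri F (chi A) (chi B) = tri (chi B) (chi A) F"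
    by (subst tri_swap12, measurable, subst tri_swap23, measurable, subst tri_swap12, measurable)
  moreover have "tri G (ic (emeasure lborel A)) (ic (emeasure lborel B)) = tri (ic (emeasure lborel B)) (ic (emeasure lborel A)) G"
    by (subst tri_swap12, measurable, subst tri_swap23, measurable, subst tri_swap12, measurable)
  ultimately show ?thesis by simp
qed

text \<open>A layer cake in \<open>f\<close> reduces the claim to superlevel sets. The test set is
  reflected because the arguments in \<open>tri\<close> sum to 0.\<close>

proposition maj_nconv:
  assumes "maj F G" "symm_decr G"
    and [measurable]: "f \<in> borel_measurable borel" "F \<in> borel_measurable borel" "G \<in> borel_measurable borel"
  shows "maj (nconv f F) (nconv (srearr f) G)"
  unfolding maj_def
proof (intro ballI)
  fix A :: "real set" assume [measurable]: "A \<in> sets borel"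
  let ?A = "{x. - x \<in> A}"
  have eA: "emeasure lborel ?A = emeasure lborel A"
  proof -
    have "(\<integral>\<^sup>+x. chi A (0 - x) \<partial>lborel) = (\<integral>\<^sup>+x. chi A x \<partial>lborel)"
      by (rule nn_integral_lborel_reflect) measurable
    then show ?thesis using nn_integral_ind[of A lborel] nn_integral_ind[of ?A lborel] by simp
  qed
  have e: "(\<integral>\<^sup>+x. a x * nconv g H x \<partial>lborel) = tri g (\<lambda>x. a (- x)) H"
    if [measurable]: "a \<in> borel_measurable borel" "g \<in> borel_measurable borel" "H \<in> borel_measurable borel" for a g H
  proof -
    have "(\<integral>\<^sup>+x. a x * nconv g H x \<partial>lborel) = (\<integral>\<^sup>+x. a (0 - x) * nconv g H (0 - x) \<partial>lborel)"
      by (rule nn_integral_lborel_reflect[symmetric]) measurable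
    also have "\<dots> = tri (\<lambda>x. a (- x)) g H" by (simp add: tri_fst nconv_def)
    finally show ?thesis by (subst tri_swap12) auto
  qed
  have "(\<integral>\<^sup>+x. chi A x * nconv f F x \<partial>lborel) = tri f (\<lambda>x. chi A (- x)) F"
    by (rule e) measurable
  also have "\<dots> = (\<integral>\<^sup>+t. tri (chi {x. ennreal t < f x}) (\<lambda>x. chi A (- x)) F \<partial>halfline)"
    by (rule tri_layer) measurable
  also have "\<dots> = (\<integral>\<^sup>+t. tri (chi {x. ennreal t < f x}) (chi ?A) F \<partial>halfline)"
    by simp
  also have "\<dots> \<le> (\<integral>\<^sup>+t. tri (ic (lev f t)) (ic (emeasure lborel A)) G \<partial>halfline)"
    unfolding lev_eq[OF assms(3)] eA[symmetric]
    by (intro nn_integral_mono maj_tri_sets assms) measurable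
  also have "\<dots> = tri (srearr f) (ic (emeasure lborel A)) G"
    by (rule tri_layer_srearr[symmetric]) measurable
  also have "\<dots> = (\<integral>\<^sup>+x. ic (emeasure lborel A) x * nconv (srearr f) G x \<partial>lborel)"
    by (subst e) (auto simp: cint_def)
  finally show "(\<integral>\<^sup>+x. chi A x * nconv f F x \<partial>lborel) \<le> (\<integral>\<^sup>+x. ic (emeasure lborel A) x * nconv (srearr f) G x \<partial>lborel)" .
qed

subsection \<open>Steiner symmetrization\<close>

text \<open>The weights for which moving mass towards 0 strictly pays. The weak clause adds evenness
  to the strict one. Squares of \<open>wt s\<close> restricted to lines are the instances, see
  \<open>heavy_slice_wt\<close>.\<close>

definition heavy :: "(real \<Rightarrow> ennreal) \<Rightarrow> bool" where
  "heavy w \<longleftrightarrow> (\<forall>x. w x < \<infinity>) \<and> (\<forall>x y. \<bar>x\<bar> \<le> \<bar>y\<bar> \<longrightarrow> w x \<le> w y) \<and> (\<forall>x y. \<bar>x\<bar> < \<bar>y\<bar> \<longrightarrow> w x < w y)"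

lemma heavy_infinite:
  assumes "heavy w" and [measurable]: "w \<in> borel_measurable borel" "A \<in> sets borel" and inf: "emeasure lborel A = \<infinity>"
  shows "(\<integral>\<^sup>+x. w x * chi A x \<partial>lborel) = \<infinity>"
proof -
  have "w 0 < w 1" using assms(1) unfolding heavy_def by (metis abs_0 abs_one zero_less_one)
  then have w1: "w 1 > 0" by (rule le_less_trans[OF zero_le])
  have "emeasure lborel A \<le> emeasure lborel {-1..1::real} + emeasure lborel (A - {-1..1})"
    by (rule order_trans[OF _ emeasure_subadditive]) (auto intro!: emeasure_mono)
  then have "emeasure lborel (A - {-1..1}) = \<infinity>"
    using inf by (auto simp: top_unique)
  then have "\<infinity> = w 1 * emeasure lborel (A - {-1..1})"
    using w1 by (simp add: ennreal_mult_top)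
  also have "\<dots> = (\<integral>\<^sup>+x. w 1 * chi (A - {-1..1}) x \<partial>lborel)"
    by (subst nn_integral_cmult) (auto simp: nn_integral_ind simp del: Diff_iff)
  also have "\<dots> \<le> (\<integral>\<^sup>+x. w x * chi A x \<partial>lborel)"
    using assms(1) by (intro nn_integral_mono) (auto simp: heavy_def)
  finally show ?thesis by (simp add: top_unique)
qed

text \<open>A bathtub argument. The parts of \<open>A\<close> and of the centred interval outside
  each other have equal measure. With \<open>r\<close> the right end of the interval, the weight is
  at least \<open>w r\<close> on the former part and at most \<open>w r\<close> on the latter. In
  the case of equality the weight equals \<open>w r\<close> almost everywhere on the former, which
  by strictness confines it to the two points of modulus \<open>r\<close>.\<close>

lemma heavy_cint:
  assumes "heavy w" and [measurable]: "w \<in> borel_measurable borel" "A \<in> sets borel"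
  shows heavy_cint_le: "(\<integral>\<^sup>+x. w x * ic (emeasure lborel A) x \<partial>lborel) \<le> (\<integral>\<^sup>+x. w x * chi A x \<partial>lborel)"
    and heavy_cint_eq: "(\<integral>\<^sup>+x. w x * ic (emeasure lborel A) x \<partial>lborel) = (\<integral>\<^sup>+x. w x * chi A x \<partial>lborel) \<Longrightarrow>
       (\<integral>\<^sup>+x. w x * chi A x \<partial>lborel) < \<infinity> \<Longrightarrow> AE x in lborel. x \<in> A \<longleftrightarrow> x \<in> cint (emeasure lborel A)"
proof -
  let ?C = "cint (emeasure lborel A)"
  have "(\<integral>\<^sup>+x. w x * chi ?C x \<partial>lborel) \<le> (\<integral>\<^sup>+x. w x * chi A x \<partial>lborel) \<and>
    ((\<integral>\<^sup>+x. w x * chi ?C x \<partial>lborel) = (\<integral>\<^sup>+x. w x * chi A x \<partial>lborel) \<longrightarrow>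
       (\<integral>\<^sup>+x. w x * chi A x \<partial>lborel) < \<infinity> \<longrightarrow> (AE x in lborel. x \<in> A \<longleftrightarrow> x \<in> ?C))"
  proof (cases "emeasure lborel A = \<infinity>")
    case True
    then show ?thesis using heavy_infinite[OF assms True] by simp
  next
    case False
    then obtain m where m: "emeasure lborel A = ennreal m" "0 \<le> m" by (cases "emeasure lborel A") auto
    define r where "r = m / 2"
    have C: "?C = {-r<..<r}" by (simp add: m cint_real r_def)
    have r0: "0 \<le> r" using m by (simp add: r_def)
    have split: "(\<integral>\<^sup>+x. w x * chi S x \<partial>lborel) = (\<integral>\<^sup>+x. w x * chi (S \<inter> T) x \<partial>lborel) + (\<integral>\<^sup>+x. w x * chi (S - T) x \<partial>lborel)"
      if [measurable]: "S \<in> sets borel" "T \<in> sets borel" for S T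
      by (subst nn_integral_add[symmetric]) (auto intro!: nn_integral_cong)
    have dm: "emeasure lborel (A - ?C) = emeasure lborel (?C - A)"
    proof -
      have "emeasure lborel A = emeasure lborel (A \<inter> ?C) + emeasure lborel (A - ?C)"
        by (subst plus_emeasure) (auto simp: Int_Diff_Un)
      moreover have "emeasure lborel ?C = emeasure lborel (A \<inter> ?C) + emeasure lborel (?C - A)"
        by (subst plus_emeasure) (auto simp: Int_Diff_Un Int_commute[of A])
      moreover have "emeasure lborel (A \<inter> ?C) \<noteq> \<top>"
        using emeasure_mono[of "A \<inter> ?C" A lborel] m by (auto simp: top_unique)
      ultimately have "emeasure lborel (A \<inter> ?C) + emeasure lborel (A - ?C) = emeasure lborel (A \<inter> ?C) + emeasure lborel (?C - A)"
        "emeasure lborel (A \<inter> ?C) \<noteq> \<top>" by simp_all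
      then show ?thesis unfolding ennreal_add_left_cancel by simp
    qed
    have AC: "w r \<le> w x" if "x \<in> A - ?C" for x
      using assms(1) that r0 unfolding C heavy_def by (auto simp: abs_if)
    have CA: "w x \<le> w r" if "x \<in> ?C - A" for x
      using assms(1) that r0 unfolding C heavy_def by (auto simp: abs_if)
    have 1: "(\<integral>\<^sup>+x. w x * chi (?C - A) x \<partial>lborel) \<le> w r * emeasure lborel (?C - A)"
    proof -
      have "(\<integral>\<^sup>+x. w x * chi (?C - A) x \<partial>lborel) \<le> (\<integral>\<^sup>+x. w r * chi (?C - A) x \<partial>lborel)"
        using CA by (intro nn_integral_mono) auto
      also have "\<dots> = w r * emeasure lborel (?C - A)"
        by (subst nn_integral_cmult) (auto simp: nn_integral_ind simp del: Diff_iff)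
      finally show ?thesis .
    qed
    have 2: "(\<integral>\<^sup>+x. w x * chi (A - ?C) x \<partial>lborel) = w r * emeasure lborel (A - ?C) + (\<integral>\<^sup>+x. (w x - w r) * chi (A - ?C) x \<partial>lborel)"
    proof -
      have "w r * emeasure lborel (A - ?C) = (\<integral>\<^sup>+x. w r * chi (A - ?C) x \<partial>lborel)"
        by (subst nn_integral_cmult) (auto simp: nn_integral_ind simp del: Diff_iff)
      moreover have "(\<integral>\<^sup>+x. w x * chi (A - ?C) x \<partial>lborel) = (\<integral>\<^sup>+x. w r * chi (A - ?C) x + (w x - w r) * chi (A - ?C) x \<partial>lborel)"
      proof (rule nn_integral_cong)
        fix x
        show "w x * chi (A - ?C) x = w r * chi (A - ?C) x + (w x - w r) * chi (A - ?C) x"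
          using AC[of x] diff_add_self_ennreal[of "w x" "w r"] by (cases "x \<in> A - ?C") (auto simp: add.commute[of "w r"])
      qed
      moreover have "\<dots> = (\<integral>\<^sup>+x. w r * chi (A - ?C) x \<partial>lborel) + (\<integral>\<^sup>+x. (w x - w r) * chi (A - ?C) x \<partial>lborel)"
        by (rule nn_integral_add) measurable
      ultimately show ?thesis by simp
    qed
    have sA: "(\<integral>\<^sup>+x. w x * chi A x \<partial>lborel) = (\<integral>\<^sup>+x. w x * chi (A \<inter> ?C) x \<partial>lborel) + (\<integral>\<^sup>+x. w x * chi (A - ?C) x \<partial>lborel)"
      by (rule split) measurable
    have sC: "(\<integral>\<^sup>+x. w x * chi ?C x \<partial>lborel) = (\<integral>\<^sup>+x. w x * chi (A \<inter> ?C) x \<partial>lborel) + (\<integral>\<^sup>+x. w x * chi (?C - A) x \<partial>lborel)"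
      by (subst split[of ?C A]) (auto simp: Int_commute)
    have le: "(\<integral>\<^sup>+x. w x * chi ?C x \<partial>lborel) \<le> (\<integral>\<^sup>+x. w x * chi A x \<partial>lborel)"
    proof -
      have "w r * emeasure lborel (A - ?C) \<le> (\<integral>\<^sup>+x. w x * chi (A - ?C) x \<partial>lborel)"
        unfolding 2 by simp
      with 1 have "(\<integral>\<^sup>+x. w x * chi (?C - A) x \<partial>lborel) \<le> (\<integral>\<^sup>+x. w x * chi (A - ?C) x \<partial>lborel)"
        unfolding dm by (rule order_trans)
      then show ?thesis unfolding sA sC by (rule add_left_mono)
    qed
    have ae: "AE x in lborel. x \<in> A \<longleftrightarrow> x \<in> ?C"
      if eq: "(\<integral>\<^sup>+x. w x * chi ?C x \<partial>lborel) = (\<integral>\<^sup>+x. w x * chi A x \<partial>lborel)" 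
        and fin: "(\<integral>\<^sup>+x. w x * chi A x \<partial>lborel) < \<infinity>"
    proof -
      have f1: "(\<integral>\<^sup>+x. w x * chi (A \<inter> ?C) x \<partial>lborel) \<noteq> \<top>" "(\<integral>\<^sup>+x. w x * chi (A - ?C) x \<partial>lborel) \<noteq> \<top>"
        using fin unfolding sA by (auto simp: less_top[symmetric])
      have "(\<integral>\<^sup>+x. w x * chi (?C - A) x \<partial>lborel) = (\<integral>\<^sup>+x. w x * chi (A - ?C) x \<partial>lborel)"
        using eq f1 unfolding sA sC ennreal_add_left_cancel by simp
      then have "w r * emeasure lborel (A - ?C) + (\<integral>\<^sup>+x. (w x - w r) * chi (A - ?C) x \<partial>lborel) \<le> w r * emeasure lborel (A - ?C) + 0"
        using 1 2 dm by simp
      moreover have "w r * emeasure lborel (A - ?C) \<noteq> \<top>" using f1(2) 2 by auto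
      ultimately have "(\<integral>\<^sup>+x. (w x - w r) * chi (A - ?C) x \<partial>lborel) \<le> 0"
        by (subst (asm) ennreal_add_left_cancel_le) auto
      then have "AE x in lborel. (w x - w r) * chi (A - ?C) x = 0"
        by (subst nn_integral_0_iff_AE[symmetric]) auto
      moreover have "AE x in lborel. x \<noteq> r" "AE x in lborel. x \<noteq> - r" by (rule AE_lborel_singleton)+
      ultimately have nA: "AE x in lborel. x \<notin> A - ?C"
      proof eventually_elim
        case (elim x)
        show ?case
        proof
          assume x: "x \<in> A - ?C"
          then have "\<bar>x\<bar> > \<bar>r\<bar>" using elim r0 unfolding C by (auto simp: abs_if)
          then have "w r < w x" "w x < \<infinity>" using assms(1) by (auto simp: heavy_def)
          then have "w x - w r \<noteq> 0" by (auto simp: diff_eq_0_iff_ennreal)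
          with elim x show False by auto
        qed
      qed
      then have "emeasure lborel (A - ?C) = 0"
        by (subst (asm) AE_iff_measurable[of "A - ?C"]) auto
      then have "emeasure lborel (?C - A) = 0" using dm by simp
      then have "AE x in lborel. x \<notin> ?C - A"
        by (subst AE_iff_measurable[of "?C - A"]) auto
      with nA show ?thesis by eventually_elim auto
    qed
    show ?thesis using le ae by blast
  qed
  then show "(\<integral>\<^sup>+x. w x * chi ?C x \<partial>lborel) \<le> (\<integral>\<^sup>+x. w x * chi A x \<partial>lborel)"
    "(\<integral>\<^sup>+x. w x * chi ?C x \<partial>lborel) = (\<integral>\<^sup>+x. w x * chi A x \<partial>lborel) \<Longrightarrow>
       (\<integral>\<^sup>+x. w x * chi A x \<partial>lborel) < \<infinity> \<Longrightarrow> AE x in lborel. x \<in> A \<longleftrightarrow> x \<in> ?C" by blast+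
qed

lemma lev_antimono: "s \<le> t \<Longrightarrow> lev f t \<le> lev f s"
  unfolding lev_def by (intro nn_integral_mono) (auto intro: le_less_trans[OF ennreal_leI])

lemma lev_max: "lev f (max s t) = min (lev f s) (lev f t)"
  using lev_antimono[of s t f] lev_antimono[of t s f] by (auto simp: max_def min_def)

text \<open>The square is expanded as a double layer-cake integral. Exceeding both \<open>s\<close>
  and \<open>t\<close> means exceeding their maximum, so only weighted measures of superlevel sets
  remain.\<close>

lemma square_layer:
  assumes [measurable]: "f \<in> borel_measurable borel" "w \<in> borel_measurable borel"
  shows "(\<integral>\<^sup>+x. w x * (f x)\<^sup>2 \<partial>lborel) = 
    (\<integral>\<^sup>+s. \<integral>\<^sup>+t. (\<integral>\<^sup>+x. w x * chi {x. ennreal (max s t) < f x} x \<partial>lborel) \<partial>halfline \<partial>halfline)"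
proof -
  have e: "ind (ennreal s < f x) * (ind (ennreal t < f x) * w x) = w x * chi {x. ennreal (max s t) < f x} x" for s t x
    by (auto simp: max_def intro: le_less_trans[OF ennreal_leI] split: if_splits)
       (meson ennreal_leI less_le_trans linorder_le_cases order.strict_trans1)+
  have "(\<integral>\<^sup>+x. w x * (f x)\<^sup>2 \<partial>lborel) = (\<integral>\<^sup>+x. f x * (f x * w x) \<partial>lborel)"
    by (intro nn_integral_cong) (simp add: power2_eq_square mult_ac)
  also have "\<dots> = (\<integral>\<^sup>+s. \<integral>\<^sup>+x. f x * (ind (ennreal s < f x) * w x) \<partial>lborel \<partial>halfline)"
    by (subst layer_cake_mult) (auto simp: sigma_finite_lborel mult_ac)
  also have "\<dots> = (\<integral>\<^sup>+s. \<integral>\<^sup>+t. (\<integral>\<^sup>+x. ind (ennreal t < f x) * (ind (ennreal s < f x) * w x) \<partial>lborel) \<partial>halfline \<partial>halfline)"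
    by (intro nn_integral_cong layer_cake_mult sigma_finite_lborel) measurable
  finally show ?thesis by (simp only: e max.commute)
qed

lemma square_layer_srearr:
  assumes [measurable]: "f \<in> borel_measurable borel" "w \<in> borel_measurable borel"
  shows "(\<integral>\<^sup>+x. w x * (srearr f x)\<^sup>2 \<partial>lborel) = 
    (\<integral>\<^sup>+s. \<integral>\<^sup>+t. (\<integral>\<^sup>+x. w x * ic (lev f (max s t)) x \<partial>lborel) \<partial>halfline \<partial>halfline)"
proof -
  have e: "ic (lev f s) x * (ic (lev f t) x * w x) = w x * ic (lev f (max s t)) x" for s t x
    by (auto simp: lev_max cint_def)
  have l: "(\<integral>\<^sup>+x. srearr f x * h x \<partial>lborel) = (\<integral>\<^sup>+s. \<integral>\<^sup>+x. ic (lev f s) x * h x \<partial>lborel \<partial>halfline)"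
    if [measurable]: "h \<in> borel_measurable borel" for h
  proof -
    have "(\<integral>\<^sup>+x. srearr f x * h x \<partial>lborel) = (\<integral>\<^sup>+x. \<integral>\<^sup>+s. ic (lev f s) x * h x \<partial>halfline \<partial>lborel)"
      unfolding srearr_def cint_def by (intro nn_integral_cong nn_integral_multc[symmetric]) measurable
    also have "\<dots> = (\<integral>\<^sup>+s. \<integral>\<^sup>+x. ic (lev f s) x * h x \<partial>lborel \<partial>halfline)"
      unfolding cint_def by (rule nn_integral_commute[OF sigma_finite_lborel sigma_finite_halfline]) measurable
    finally show ?thesis .
  qed
  have "(\<integral>\<^sup>+x. w x * (srearr f x)\<^sup>2 \<partial>lborel) = (\<integral>\<^sup>+x. srearr f x * (srearr f x * w x) \<partial>lborel)"
    by (intro nn_integral_cong) (simp add: power2_eq_square mult_ac)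
  also have "\<dots> = (\<integral>\<^sup>+s. \<integral>\<^sup>+x. srearr f x * (ic (lev f s) x * w x) \<partial>lborel \<partial>halfline)"
    by (subst l) (auto simp: mult_ac)
  also have "\<dots> = (\<integral>\<^sup>+s. \<integral>\<^sup>+t. (\<integral>\<^sup>+x. ic (lev f t) x * (ic (lev f s) x * w x) \<partial>lborel) \<partial>halfline \<partial>halfline)"
    by (rule nn_integral_cong, rule l) measurable
  finally show ?thesis by (simp only: e max.commute)
qed

lemma nn_integral_square_srearr_le:
  assumes [measurable]: "f \<in> borel_measurable borel" "w \<in> borel_measurable borel"
    and le: "\<And>A. A \<in> sets borel \<Longrightarrow> (\<integral>\<^sup>+x. w x * ic (emeasure lborel A) x \<partial>lborel) \<le> (\<integral>\<^sup>+x. w x * chi A x \<partial>lborel)"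
  shows "(\<integral>\<^sup>+x. w x * (srearr f x)\<^sup>2 \<partial>lborel) \<le> (\<integral>\<^sup>+x. w x * (f x)\<^sup>2 \<partial>lborel)"
  unfolding square_layer[OF assms(1,2)] square_layer_srearr[OF assms(1,2)] lev_eq[OF assms(1)]
  by (rule nn_integral_mono, rule nn_integral_mono, rule le) measurable

lemma eq_AE_of_nn_integral_eq:
  fixes f g :: "'a \<Rightarrow> ennreal"
  assumes [measurable]: "f \<in> borel_measurable M" "g \<in> borel_measurable M"
    and le: "\<And>x. x \<in> space M \<Longrightarrow> f x \<le> g x" and eq: "(\<integral>\<^sup>+x. f x \<partial>M) = (\<integral>\<^sup>+x. g x \<partial>M)" and fin: "(\<integral>\<^sup>+x. g x \<partial>M) < \<infinity>"
  shows "AE x in M. f x = g x \<and> g x < \<infinity>"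
proof -
  have fg: "AE x in M. g x \<noteq> \<infinity>" using fin by (intro nn_integral_PInf_AE) auto
  have "(\<integral>\<^sup>+x. g x - f x \<partial>M) = (\<integral>\<^sup>+x. g x \<partial>M) - (\<integral>\<^sup>+x. f x \<partial>M)"
    by (intro nn_integral_diff) (use le eq fin in auto)
  also have "\<dots> = 0" using eq fin by (simp add: diff_eq_0_iff_ennreal)
  finally have "AE x in M. g x - f x = 0" by (subst (asm) nn_integral_0_iff_AE) auto
  with fg show ?thesis using AE_space
    by eventually_elim (use le in \<open>auto simp: diff_eq_0_iff_ennreal less_top antisym\<close>)
qed

lemma AE_halflineD: "AE t in halfline. P t \<Longrightarrow> 0 \<le> a \<Longrightarrow> a < b \<Longrightarrow> \<exists>t. a < t \<and> t < b \<and> P t"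
proof (rule ccontr)
  assume P: "AE t in halfline. P t" and ab: "0 \<le> a" "a < b" and n: "\<not> (\<exists>t. a < t \<and> t < b \<and> P t)"
  have "AE t in halfline. t \<notin> {a<..<b}" using P by eventually_elim (use n in auto)
  then have "emeasure halfline {a<..<b} = 0"
    by (subst (asm) AE_iff_measurable[of "{a<..<b}"]) (auto simp: sets_halfline)
  moreover have "emeasure halfline {a<..<b} = emeasure lborel {a<..<b}"
  proof -
    have "{0..} \<inter> {a<..<b} = {a<..<b}" using ab by auto
    then show ?thesis by (subst emeasure_halfline) auto
  qed
  ultimately show False using ab by simp
qed

text \<open>Good levels are dense, so countably many of them suffice. Off one null set of points
  \<open>x\<close>, monotonicity in the level then decides whether \<open>f x\<close> exceeds
  \<open>t\<close> for every \<open>t\<close> other than \<open>f x\<close>, and layer cake recovers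
  the value.\<close>

lemma srearr_eq_of_levels:
  assumes [measurable]: "f \<in> borel_measurable borel"
    and ldense: "\<And>a b. 0 \<le> a \<Longrightarrow> a < b \<Longrightarrow> \<exists>u. a < u \<and> u < b \<and> (AE x in lborel. ennreal u < f x \<longleftrightarrow> x \<in> cint (lev f u))"
  shows "AE x in lborel. f x = srearr f x"
proof -
  have "\<exists>u. \<forall>a b. 0 \<le> a \<longrightarrow> a < b \<longrightarrow> a < u a b \<and> u a b < b \<and> (AE x in lborel. ennreal (u a b) < f x \<longleftrightarrow> x \<in> cint (lev f (u a b)))"
    using ldense by metis
  then obtain u where u: "\<And>a b. 0 \<le> a \<Longrightarrow> a < b \<Longrightarrow> a < u a b \<and> u a b < b \<and> (AE x in lborel. ennreal (u a b) < f x \<longleftrightarrow> x \<in> cint (lev f (u a b)))"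
    by blast
  \<comment> \<open>One good level between any two rationals: countable, yet dense in the half
    line.\<close>
  define D where "D = {u a b |a b. a \<in> \<rat> \<and> b \<in> \<rat> \<and> 0 \<le> a \<and> a < b}"
  have "D \<subseteq> (\<lambda>(a, b). u a b) ` (\<rat> \<times> \<rat>)" by (auto simp: D_def)
  then have cD: "countable D" by (rule countable_subset) (auto intro: countable_rat)
  have "AE x in lborel. \<forall>d\<in>D. ennreal d < f x \<longleftrightarrow> x \<in> cint (lev f d)"
    using cD u by (subst AE_ball_countable) (auto simp: D_def)
  then show ?thesis
  proof eventually_elim
    case (elim x)
    have dD: "\<exists>d\<in>D. a < d \<and> d < b" if ab: "0 \<le> a" "a < b" for a b
    proof -
      obtain p where p: "p \<in> \<rat>" "a < p" "p < b" using Rats_dense_in_real[OF ab(2)] by blast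
      obtain q where q: "q \<in> \<rat>" "p < q" "q < b" using Rats_dense_in_real[OF p(3)] by blast
      have "u p q \<in> D" unfolding D_def mem_Collect_eq
        by (rule exI[of _ p], rule exI[of _ q]) (use p q ab in auto)
      then show ?thesis using u[of p q] p q ab by (intro bexI[of _ "u p q"]) auto
    qed
    have d1: "ennreal s < f x" if s: "0 \<le> s" "x \<in> cint (lev f s')" "s < s'" for s s'
    proof -
      obtain d where d: "d \<in> D" "s < d" "d < s'" using dD[of s s'] s by auto
      have "x \<in> cint (lev f d)" using s(2) cint_mono[OF lev_antimono[of d s' f]] d by auto
      then have "ennreal d < f x" using elim d by auto
      then show ?thesis using d s by (intro le_less_trans[OF ennreal_leI[of s d]]) auto
    qed
    have d2: "x \<in> cint (lev f s)" if s: "0 \<le> s" "ennreal s' < f x" "s < s'" for s s'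
    proof -
      obtain d where d: "d \<in> D" "s < d" "d < s'" using dD[of s s'] s by auto
      have "ennreal d < f x" using d s by (intro le_less_trans[OF ennreal_leI[of d s']]) auto
      then have "x \<in> cint (lev f d)" using elim d by auto
      then show ?thesis using cint_mono[OF lev_antimono[of s d f]] d by auto
    qed
    \<comment> \<open>The level equal to the value itself cannot be squeezed between good levels; a
      single level does not affect the integral. If \<open>f x\<close> is infinite, the exempted
      level is 0.\<close>
    have key: "x \<in> cint (lev f t) \<longleftrightarrow> ennreal t < f x" if t: "0 \<le> t" "t \<noteq> enn2real (f x)" for t
    proof
      assume x: "x \<in> cint (lev f t)"
      show "ennreal t < f x"
      proof (rule ccontr)
        assume "\<not> ennreal t < f x"
        then have fx: "f x \<le> ennreal t" by simp
        then obtain r where r: "f x = ennreal r" "0 \<le> r" by (cases "f x") (auto simp: top_unique)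
        then have "r < t" using fx t by (auto simp: less_le)
        from d1[OF r(2) x this] r show False by simp
      qed
    next
      assume t': "ennreal t < f x"
      obtain c where c: "ennreal t < c" "c < f x" using dense[OF t'] by blast
      then obtain s where s: "c = ennreal s" "0 \<le> s" by (cases c) auto
      then have "t < s" using c t by (simp add: ennreal_less_iff)
      with d2[OF t(1)] c s show "x \<in> cint (lev f t)" by auto
    qed
    have "AE t in halfline. 0 \<le> t \<and> t \<noteq> enn2real (f x)"
      unfolding halfline_def using AE_lborel_singleton[of "enn2real (f x)"]
      by (subst AE_density) (auto elim!: eventually_mono split: split_indicator)
    then have "AE t in halfline. ind (x \<in> cint (lev f t)) = ind (ennreal t < f x)"
      by eventually_elim (use key in auto)
    then have "srearr f x = (\<integral>\<^sup>+t. ind (ennreal t < f x) \<partial>halfline)"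
      unfolding srearr_def by (rule nn_integral_cong_AE)
    then show "f x = srearr f x" by (simp add: layer_cake)
  qed
qed

text \<open>In the double layer-cake formula the integrands are ordered by
  \<open>heavy_cint_le\<close>, so equality of the finite integrals forces equality at almost all
  pairs of levels. This yields good levels in every interval, at which the equality case for sets
  applies.\<close>

lemma nn_integral_square_srearr_eq:
  assumes "heavy w" and [measurable]: "f \<in> borel_measurable borel" "w \<in> borel_measurable borel"
    and eq: "(\<integral>\<^sup>+x. w x * (srearr f x)\<^sup>2 \<partial>lborel) = (\<integral>\<^sup>+x. w x * (f x)\<^sup>2 \<partial>lborel)"
    and fin: "(\<integral>\<^sup>+x. w x * (f x)\<^sup>2 \<partial>lborel) < \<infinity>"
  shows "AE x in lborel. f x = srearr f x"
proof (rule srearr_eq_of_levels[OF assms(2)])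
  fix a b :: real assume ab: "0 \<le> a" "a < b"
  define K where "K u = (\<integral>\<^sup>+x. w x * chi {x. ennreal u < f x} x \<partial>lborel)" for u
  define K' where "K' u = (\<integral>\<^sup>+x. w x * ic (lev f u) x \<partial>lborel)" for u
  have [measurable]: "K \<in> borel_measurable borel" "K' \<in> borel_measurable borel"
    unfolding K_def K'_def cint_def by measurable
  have le: "K' u \<le> K u" for u
    unfolding K_def K'_def lev_eq[OF assms(2)] by (rule heavy_cint_le[OF assms(1)]) measurable
  have 1: "(\<integral>\<^sup>+s. \<integral>\<^sup>+t. K' (max s t) \<partial>halfline \<partial>halfline) = (\<integral>\<^sup>+s. \<integral>\<^sup>+t. K (max s t) \<partial>halfline \<partial>halfline)"
    using eq unfolding square_layer[OF assms(2,3)] square_layer_srearr[OF assms(2,3)] K_def K'_def .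
  have 2: "(\<integral>\<^sup>+s. \<integral>\<^sup>+t. K (max s t) \<partial>halfline \<partial>halfline) < \<infinity>"
    using fin unfolding square_layer[OF assms(2,3)] K_def .
  have "AE s in halfline. (\<integral>\<^sup>+t. K' (max s t) \<partial>halfline) = (\<integral>\<^sup>+t. K (max s t) \<partial>halfline) \<and> (\<integral>\<^sup>+t. K (max s t) \<partial>halfline) < \<infinity>"
    by (rule eq_AE_of_nn_integral_eq[OF _ _ _ 1 2]) (auto intro!: nn_integral_mono le)
  from AE_halflineD[OF this ab] obtain s where s: "a < s" "s < b"
    "(\<integral>\<^sup>+t. K' (max s t) \<partial>halfline) = (\<integral>\<^sup>+t. K (max s t) \<partial>halfline)" "(\<integral>\<^sup>+t. K (max s t) \<partial>halfline) < \<infinity>"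
    by blast
  have "AE t in halfline. K' (max s t) = K (max s t) \<and> K (max s t) < \<infinity>"
    by (rule eq_AE_of_nn_integral_eq[OF _ _ _ s(3,4)]) (auto intro!: le)
  \<comment> \<open>Taking \<open>t\<close> below \<open>s\<close> makes the maximum of the two
    equal to \<open>s\<close>, which is the good level.\<close>
  from AE_halflineD[OF this ab(1) s(1)] obtain t where t: "t < s" "K' (max s t) = K (max s t)" "K (max s t) < \<infinity>"
    by blast
  then have "K' s = K s" "K s < \<infinity>" by (auto simp: max_def split: if_splits)
  then have "AE x in lborel. x \<in> {x. ennreal s < f x} \<longleftrightarrow> x \<in> cint (lev f s)"
    unfolding K_def K'_def lev_eq[OF assms(2)] by (intro heavy_cint_eq[OF assms(1)]) measurable
  with s show "\<exists>u. a < u \<and> u < b \<and> (AE x in lborel. ennreal u < f x \<longleftrightarrow> x \<in> cint (lev f u))" by auto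
qed

text \<open>Off by one on purpose, as a convolution unit is not a function: \<open>cpow n f\<close>
  has \<open>n + 1\<close> factors.\<close>

primrec cpow :: "nat \<Rightarrow> ('a::euclidean_space \<Rightarrow> ennreal) \<Rightarrow> 'a \<Rightarrow> ennreal" where
  "cpow 0 f = f"
| "cpow (Suc n) f = nconv f (cpow n f)"

lemma borel_cpow [measurable]:
  assumes [measurable]: "f \<in> borel_measurable borel"
  shows "cpow n f \<in> borel_measurable borel"
  by (induction n) auto

section \<open>Rotation invariance of Lebesgue measure, and slicing along a direction\<close>

lemma borel_measurable_orthogonal:
  fixes T :: "'a::euclidean_space \<Rightarrow> 'a"
  shows "orthogonal_transformation T \<Longrightarrow> T \<in> borel_measurable borel"
  by (intro borel_measurable_continuous_onI linear_continuous_on)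
     (simp add: linear_conv_bounded_linear[symmetric] orthogonal_transformation_linear)

text \<open>The argument for uniqueness of Haar measure. The double integral of the indicator of
  \<open>A\<close> at \<open>T x\<close> times that of the unit ball \<open>B\<close> at
  \<open>T x + y\<close> is evaluated in two ways, using translation invariance and the fact that
  \<open>T\<close> preserves \<open>B\<close>. The measure of \<open>B\<close> is positive and
  finite, so it cancels.\<close>

lemma emeasure_orthogonal_vimage:
  fixes T :: "'a::euclidean_space \<Rightarrow> 'a"
  assumes T: "orthogonal_transformation T" and [measurable]: "A \<in> sets borel"
  shows "emeasure lborel {x. T x \<in> A} = emeasure lborel A"
proof -
  note [measurable] = borel_measurable_orthogonal[OF T]
  have lin: "linear T" using T by (simp add: orthogonal_transformation_linear)
  have surj: "surj T" using T by (rule orthogonal_transformation_surj)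
  define B where "B = ball (0::'a) 1"
  have [measurable]: "B \<in> sets borel" by (simp add: B_def)
  have TB: "T x \<in> B \<longleftrightarrow> x \<in> B" for x using T by (simp add: B_def orthogonal_transformation_norm)
  let ?a = "\<lambda>x. ind (x \<in> A)" and ?b = "\<lambda>x. ind (x \<in> B)"
  have "emeasure lborel {x. T x \<in> A} * emeasure lborel B = (\<integral>\<^sup>+x. ?a (T x) * (\<integral>\<^sup>+y. ?b y \<partial>lborel) \<partial>lborel)"
    by (subst nn_integral_multc) (auto simp: nn_integral_ind[symmetric])
  also have "\<dots> = (\<integral>\<^sup>+x. ?a (T x) * (\<integral>\<^sup>+y. ?b (T x + y) \<partial>lborel) \<partial>lborel)"
    by (subst nn_integral_lborel_translate) auto
  also have "\<dots> = (\<integral>\<^sup>+x. \<integral>\<^sup>+y. ?a (T x) * ?b (T x + y) \<partial>lborel \<partial>lborel)"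
    by (intro nn_integral_cong nn_integral_cmult[symmetric]) measurable
  also have "\<dots> = (\<integral>\<^sup>+y. \<integral>\<^sup>+x. ?a (T x) * ?b (T x + y) \<partial>lborel \<partial>lborel)"
    by (rule nn_integral_commute[OF sigma_finite_lborel sigma_finite_lborel]) measurable
  also have "\<dots> = (\<integral>\<^sup>+y. \<integral>\<^sup>+x. ?a (T x - y) * ?b x \<partial>lborel \<partial>lborel)"
  proof (rule nn_integral_cong)
    fix y
    obtain z where z: "T z = y" using surj by (metis surjD)
    have "(\<integral>\<^sup>+x. ?a (T x) * ?b (T x + y) \<partial>lborel) = (\<integral>\<^sup>+x. ?a (T (- z + x)) * ?b (T (- z + x) + y) \<partial>lborel)"
      by (rule nn_integral_lborel_translate[symmetric]) measurable
    also have "\<dots> = (\<integral>\<^sup>+x. ?a (T x - y) * ?b x \<partial>lborel)"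
      unfolding linear_add[OF lin] linear_neg[OF lin] z by (simp add: TB)
    finally show "(\<integral>\<^sup>+x. ?a (T x) * ?b (T x + y) \<partial>lborel) = (\<integral>\<^sup>+x. ?a (T x - y) * ?b x \<partial>lborel)" .
  qed
  also have "\<dots> = (\<integral>\<^sup>+x. \<integral>\<^sup>+y. ?a (T x - y) * ?b x \<partial>lborel \<partial>lborel)"
    by (rule nn_integral_commute[OF sigma_finite_lborel sigma_finite_lborel]) measurable
  also have "\<dots> = (\<integral>\<^sup>+x. (\<integral>\<^sup>+y. ?a (T x - y) \<partial>lborel) * ?b x \<partial>lborel)"
    by (intro nn_integral_cong nn_integral_multc) measurable
  also have "\<dots> = (\<integral>\<^sup>+x. (\<integral>\<^sup>+y. ?a y \<partial>lborel) * ?b x \<partial>lborel)"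
    by (subst nn_integral_lborel_reflect) auto
  also have "\<dots> = emeasure lborel A * emeasure lborel B"
    by (subst nn_integral_cmult) (auto simp: nn_integral_ind)
  finally have *: "emeasure lborel {x. T x \<in> A} * emeasure lborel B = emeasure lborel A * emeasure lborel B" .
  have "emeasure lborel B = ennreal (unit_ball_vol DIM('a))"
    unfolding B_def by (subst emeasure_ball) auto
  moreover have "unit_ball_vol (real DIM('a)) > 0" by simp
  ultimately have "emeasure lborel B \<noteq> 0" "emeasure lborel B \<noteq> \<top>" by (simp_all add: ennreal_eq_0_iff not_le)
  with * show ?thesis by (simp add: mult.commute[of _ "emeasure lborel B"] ennreal_mult_cancel_left)
qed

lemma nn_integral_orthogonal:
  fixes T :: "'a::euclidean_space \<Rightarrow> 'a"
  assumes T: "orthogonal_transformation T" and [measurable]: "f \<in> borel_measurable borel"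
  shows "(\<integral>\<^sup>+x. f (T x) \<partial>lborel) = (\<integral>\<^sup>+x. f x \<partial>lborel)"
proof -
  note [measurable] = borel_measurable_orthogonal[OF T]
  have "distr lborel borel T = lborel"
    by (rule measure_eqI) (auto simp: emeasure_distr emeasure_orthogonal_vimage[OF T] vimage_def)
  then have "(\<integral>\<^sup>+x. f x \<partial>lborel) = (\<integral>\<^sup>+x. f x \<partial>distr lborel borel T)" by simp
  also have "\<dots> = (\<integral>\<^sup>+x. f (T x) \<partial>lborel)" by (subst nn_integral_distr) auto
  finally show ?thesis by simp
qed

text \<open>An orthogonal \<open>T\<close> carries a basis vector \<open>b\<close> to
  \<open>e\<close>. In the coordinates before \<open>T\<close>, Lebesgue measure is a product, and
  splitting off the coordinate of \<open>b\<close> gives the lines. \<open>M\<close> is the product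
  over the other coordinates and \<open>\<pi>\<close> embeds it in the hyperplane orthogonal to
  \<open>e\<close>.\<close>

lemma lborel_slicing:
  fixes e :: "real ^ 'n"
  assumes e: "norm e = 1"
  shows "\<exists>(M :: (real ^ 'n \<Rightarrow> real) measure) \<pi>. sigma_finite_measure M \<and> \<pi> \<in> borel_measurable M \<and>
    (\<forall>y\<in>space M. \<pi> y \<bullet> e = 0) \<and>
    (\<forall>F\<in>borel_measurable borel. (\<integral>\<^sup>+x. F x \<partial>lborel) = (\<integral>\<^sup>+y. \<integral>\<^sup>+t. F (\<pi> y + t *\<^sub>R e) \<partial>lborel \<partial>M))"
proof -
  obtain b :: "real ^ 'n" where b: "b \<in> Basis" using nonempty_Basis by blast
  obtain T where T: "orthogonal_transformation T" "T b = e"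
    using orthogonal_transformation_exists[of b e] e b by auto
  have lin: "linear T" using T by (simp add: orthogonal_transformation_linear)
  note [measurable] = borel_measurable_orthogonal[OF T(1)]
  interpret product_sigma_finite "\<lambda>_::real ^ 'n. lborel :: real measure"
    by (simp add: product_sigma_finite_def sigma_finite_lborel)
  define M where "M = (\<Pi>\<^sub>M b'\<in>Basis - {b}. lborel :: real measure)"
  define \<pi> where "\<pi> f = T (\<Sum>c\<in>Basis - {b}. f c *\<^sub>R c)" for f
  have fin: "finite (Basis - {b})" by simp
  have [measurable]: "(\<lambda>f. f c) \<in> borel_measurable M" if "c \<in> Basis - {b}" for c
    using that measurable_component_singleton[of c "Basis - {b}" "\<lambda>_. lborel :: real measure"] by (simp add: M_def)
  have s: "sigma_finite_measure M" unfolding M_def by (rule sigma_finite[OF fin])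
  moreover have pm: "\<pi> \<in> borel_measurable M" unfolding \<pi>_def by measurable
  moreover have "\<pi> y \<bullet> e = 0" for y
  proof -
    have "\<pi> y \<bullet> e = (\<Sum>c\<in>Basis - {b}. y c *\<^sub>R c) \<bullet> b"
      using T(1) unfolding \<pi>_def T(2)[symmetric] orthogonal_transformation_def by blast
    also have "\<dots> = 0" unfolding inner_sum_left
      by (rule sum.neutral) (use b in \<open>auto simp: inner_Basis\<close>)
    finally show ?thesis .
  qed
  moreover have "(\<integral>\<^sup>+x. F x \<partial>lborel) = (\<integral>\<^sup>+y. \<integral>\<^sup>+t. F (\<pi> y + t *\<^sub>R e) \<partial>lborel \<partial>M)"
    if F[measurable]: "F \<in> borel_measurable borel" for F
  proof -
    have ins: "insert b (Basis - {b}) = Basis" using b by auto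
    have [measurable]: "(\<lambda>f. f c) \<in> borel_measurable (\<Pi>\<^sub>M b'\<in>Basis. lborel :: real measure)" if "c \<in> Basis" for c :: "real ^ 'n"
      using that measurable_component_singleton[of c Basis "\<lambda>_. lborel :: real measure"] by simp
    have sm [measurable]: "(\<lambda>f. \<Sum>c\<in>Basis. f c *\<^sub>R c) \<in> borel_measurable (\<Pi>\<^sub>M b'\<in>(Basis :: (real ^ 'n) set). lborel :: real measure)"
      by measurable
    have "(\<integral>\<^sup>+x. F x \<partial>lborel) = (\<integral>\<^sup>+x. F (T x) \<partial>lborel)" by (rule nn_integral_orthogonal[OF T(1) F, symmetric])
    also have "\<dots> = (\<integral>\<^sup>+f. F (T (\<Sum>c\<in>Basis. f c *\<^sub>R c)) \<partial>(\<Pi>\<^sub>M b'\<in>Basis. lborel))"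
      by (subst lborel_eq) (subst nn_integral_distr, auto)
    also have "\<dots> = (\<integral>\<^sup>+f. F (T (\<Sum>c\<in>Basis. f c *\<^sub>R c)) \<partial>(\<Pi>\<^sub>M b'\<in>insert b (Basis - {b}). lborel))"
      by (simp only: ins)
    also have "\<dots> = (\<integral>\<^sup>+y. \<integral>\<^sup>+t. F (T (\<Sum>c\<in>Basis. (y(b := t)) c *\<^sub>R c)) \<partial>lborel \<partial>M)"
      unfolding M_def
    proof (rule product_nn_integral_insert)
      show "(\<lambda>f. F (T (\<Sum>c\<in>Basis. f c *\<^sub>R c))) \<in> borel_measurable (\<Pi>\<^sub>M b'\<in>insert b (Basis - {b}). lborel)"
        unfolding ins by measurable
    qed (use fin in auto)
    also have "\<dots> = (\<integral>\<^sup>+y. \<integral>\<^sup>+t. F (\<pi> y + t *\<^sub>R e) \<partial>lborel \<partial>M)"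
    proof (intro nn_integral_cong arg_cong[where f=F])
      fix y t
      have "(\<Sum>c\<in>Basis. (y(b := t)) c *\<^sub>R c) = t *\<^sub>R b + (\<Sum>c\<in>Basis - {b}. (y(b := t)) c *\<^sub>R c)"
        using b by (subst sum.remove[of _ b]) auto
      also have "(\<Sum>c\<in>Basis - {b}. (y(b := t)) c *\<^sub>R c) = (\<Sum>c\<in>Basis - {b}. y c *\<^sub>R c)"
        by (rule sum.cong) auto
      finally show "T (\<Sum>c\<in>Basis. (y(b := t)) c *\<^sub>R c) = \<pi> y + t *\<^sub>R e"
        using T(2) by (simp add: \<pi>_def linear_add[OF lin] linear_scale[OF lin] add.commute)
    qed
    finally show ?thesis .
  qed
  ultimately show ?thesis by blast
qed

definition steiner :: "'a::euclidean_space \<Rightarrow> ('a \<Rightarrow> ennreal) \<Rightarrow> 'a \<Rightarrow> ennreal" where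
  "steiner e f x = srearr (\<lambda>t. f (x - (x \<bullet> e) *\<^sub>R e + t *\<^sub>R e)) (x \<bullet> e)"

lemma borel_steiner [measurable]:
  assumes [measurable]: "f \<in> borel_measurable borel"
  shows "steiner e f \<in> borel_measurable borel"
  unfolding steiner_def srearr_def lev_def cint_def mem_Collect_eq by measurable

definition slice :: "'a::euclidean_space \<Rightarrow> ('a \<Rightarrow> ennreal) \<Rightarrow> 'a \<Rightarrow> real \<Rightarrow> ennreal" where
  "slice e f z t = f (z + t *\<^sub>R e)"

lemma borel_slice [measurable]:
  assumes [measurable]: "f \<in> borel_measurable borel"
  shows "slice e f z \<in> borel_measurable borel"
  unfolding slice_def by measurable

lemma slice_steiner:
  assumes "norm e = 1" "z \<bullet> e = 0"
  shows "slice e (steiner e f) z = srearr (slice e f z)"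
proof
  fix t
  have "(z + t *\<^sub>R e) \<bullet> e = t" using assms by (simp add: inner_add_left norm_eq_1)
  then show "slice e (steiner e f) z t = srearr (slice e f z) t"
    by (simp add: slice_def steiner_def slice_def[abs_def])
qed

text \<open>Fubini along lines parallel to \<open>e\<close> without reference to coordinates: base
  points are only known to be orthogonal to \<open>e\<close>, which is all that
  \<open>slice_steiner\<close> asks for.\<close>

locale slicing =
  fixes e :: "'a::euclidean_space" and M :: "'b measure" and \<pi> :: "'b \<Rightarrow> 'a"
  assumes norm_e: "norm e = 1" and sf: "sigma_finite_measure M" and meas [measurable]: "\<pi> \<in> borel_measurable M"
    and perp: "y \<in> space M \<Longrightarrow> \<pi> y \<bullet> e = 0"
    and fub: "F \<in> borel_measurable borel \<Longrightarrow> (\<integral>\<^sup>+x. F x \<partial>lborel) = (\<integral>\<^sup>+y. \<integral>\<^sup>+t. slice e F (\<pi> y) t \<partial>lborel \<partial>M)"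
begin

lemma nn_integral_mono_slices:
  assumes "F \<in> borel_measurable borel" "G \<in> borel_measurable borel"
    and "\<And>z. z \<bullet> e = 0 \<Longrightarrow> (\<integral>\<^sup>+t. slice e F z t \<partial>lborel) \<le> (\<integral>\<^sup>+t. slice e G z t \<partial>lborel)"
  shows "(\<integral>\<^sup>+x. F x \<partial>lborel) \<le> (\<integral>\<^sup>+x. G x \<partial>lborel)"
  unfolding fub[OF assms(1)] fub[OF assms(2)] by (rule nn_integral_mono) (intro assms(3) perp)

text \<open>This is where the line enters: a slice of a convolution is a superposition of
  one-dimensional convolutions of slices, at the base points \<open>\<pi> y\<close> and
  \<open>z - \<pi> y\<close>, and both are again orthogonal to \<open>e\<close> when
  \<open>z\<close> is.\<close>

lemma slice_nconv:
  assumes [measurable]: "F \<in> borel_measurable borel" "G \<in> borel_measurable borel"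
  shows "slice e (nconv F G) z t = (\<integral>\<^sup>+y. nconv (slice e F (\<pi> y)) (slice e G (z - \<pi> y)) t \<partial>M)"
proof -
  have "slice e (nconv F G) z t = (\<integral>\<^sup>+y. \<integral>\<^sup>+s. slice e (\<lambda>x. F x * G (z + t *\<^sub>R e - x)) (\<pi> y) s \<partial>lborel \<partial>M)"
    unfolding slice_def[of e "nconv F G"] nconv_def by (rule fub) measurable
  also have "\<dots> = (\<integral>\<^sup>+y. nconv (slice e F (\<pi> y)) (slice e G (z - \<pi> y)) t \<partial>M)"
    unfolding nconv_def slice_def by (simp add: algebra_simps)
  finally show ?thesis .
qed

text \<open>Both sides of \<open>maj\<close> are linear in the functions, so the relation survives
  integration over \<open>y\<close> in \<open>slice_nconv\<close>; for each fixed \<open>y\<close>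
  the induction step is \<open>maj_nconv\<close>. Symmetry is carried along because
  \<open>maj_nconv\<close> requires it.\<close>

lemma maj_slice_cpow:
  assumes [measurable]: "f \<in> borel_measurable borel"
  shows "z \<bullet> e = 0 \<Longrightarrow> maj (slice e (cpow n f) z) (slice e (cpow n (steiner e f)) z) \<and>
     symm_decr (slice e (cpow n (steiner e f)) z)"
proof (induction n arbitrary: z)
  case 0
  then show ?case by (simp add: slice_steiner norm_e maj_srearr symm_decr_srearr)
next
  case (Suc n)
  let ?F = "cpow n f" and ?G = "cpow n (steiner e f)"
  have IH: "maj (slice e ?F (z - \<pi> y)) (slice e ?G (z - \<pi> y))" "symm_decr (slice e ?G (z - \<pi> y))" if "y \<in> space M" for y
    using Suc.IH[of "z - \<pi> y"] Suc.prems perp[OF that] by (auto simp: inner_diff_left)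
  have st: "slice e (steiner e f) (\<pi> y) = srearr (slice e f (\<pi> y))" if "y \<in> space M" for y
    using slice_steiner[OF norm_e perp[OF that]] .
  have "symm_decr (slice e (cpow (Suc n) (steiner e f)) z)"
    unfolding symm_decr_def
  proof (intro allI impI)
    fix s t :: real assume "\<bar>s\<bar> \<le> \<bar>t\<bar>"
    then show "slice e (cpow (Suc n) (steiner e f)) z t \<le> slice e (cpow (Suc n) (steiner e f)) z s"
      using IH st by (auto simp: slice_nconv symm_decr_srearr intro!: nn_integral_mono symm_decrD[OF symm_decr_nconv])
  qed
  moreover have "maj (slice e (cpow (Suc n) f) z) (slice e (cpow (Suc n) (steiner e f)) z)"
    unfolding maj_def
  proof (intro ballI)
    fix A :: "real set" assume [measurable]: "A \<in> sets borel"
    have sw: "(\<integral>\<^sup>+t. a t * slice e (nconv F G) z t \<partial>lborel) = (\<integral>\<^sup>+y. \<integral>\<^sup>+t. a t * nconv (slice e F (\<pi> y)) (slice e G (z - \<pi> y)) t \<partial>lborel \<partial>M)"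
      if [measurable]: "a \<in> borel_measurable borel" "F \<in> borel_measurable borel" "G \<in> borel_measurable borel" for a F G
    proof -
      have m: "(\<lambda>(y, t). nconv (slice e F (\<pi> y)) (slice e G (z - \<pi> y)) t) \<in> borel_measurable (M \<Otimes>\<^sub>M borel)"
        unfolding nconv_def slice_def by measurable
      have m': "nconv (slice e F (\<pi> y)) (slice e G (z - \<pi> y)) \<in> borel_measurable borel" for y by measurable
      have m'': "(\<lambda>y. nconv (slice e F (\<pi> y)) (slice e G (z - \<pi> y)) t) \<in> borel_measurable M" for t
        using measurable_compose[OF measurable_Pair2' m, of t] m
        unfolding nconv_def slice_def by measurable
      have "(\<integral>\<^sup>+t. a t * slice e (nconv F G) z t \<partial>lborel) = (\<integral>\<^sup>+t. \<integral>\<^sup>+y. a t * nconv (slice e F (\<pi> y)) (slice e G (z - \<pi> y)) t \<partial>M \<partial>lborel)"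
        unfolding slice_nconv[OF that(2,3)] by (rule nn_integral_cong) (subst nn_integral_cmult, rule m'', simp)
      also have "\<dots> = (\<integral>\<^sup>+y. \<integral>\<^sup>+t. a t * nconv (slice e F (\<pi> y)) (slice e G (z - \<pi> y)) t \<partial>lborel \<partial>M)"
        by (rule nn_integral_commute[OF sigma_finite_lborel sf]) (unfold nconv_def slice_def, measurable)
      finally show ?thesis .
    qed
    have "(\<integral>\<^sup>+t. chi A t * slice e (nconv f ?F) z t \<partial>lborel) \<le> (\<integral>\<^sup>+t. ic (emeasure lborel A) t * slice e (nconv (steiner e f) ?G) z t \<partial>lborel)"
      unfolding sw[OF _ assms borel_cpow[OF assms]]
    proof (subst (1 2) sw, measurable, rule nn_integral_mono)
      fix y assume y: "y \<in> space M"
      have "maj (nconv (slice e f (\<pi> y)) (slice e ?F (z - \<pi> y))) (nconv (slice e (steiner e f) (\<pi> y)) (slice e ?G (z - \<pi> y)))"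
        unfolding st[OF y] by (intro maj_nconv IH y) measurable
      then show "(\<integral>\<^sup>+t. chi A t * nconv (slice e f (\<pi> y)) (slice e ?F (z - \<pi> y)) t \<partial>lborel)
        \<le> (\<integral>\<^sup>+t. ic (emeasure lborel A) t * nconv (slice e (steiner e f) (\<pi> y)) (slice e ?G (z - \<pi> y)) t \<partial>lborel)"
        by (auto simp: maj_def)
    qed
    then show "(\<integral>\<^sup>+t. chi A t * slice e (cpow (Suc n) f) z t \<partial>lborel) \<le> (\<integral>\<^sup>+t. ic (emeasure lborel A) t * slice e (cpow (Suc n) (steiner e f)) z t \<partial>lborel)"
      by simp
  qed
  ultimately show ?case by blast
qed

text \<open>On each line, \<open>maj_mult\<close> is applied with the same majorized pair in both
  places.\<close>

lemma cpow_square_steiner: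
  assumes [measurable]: "f \<in> borel_measurable borel"
  shows "(\<integral>\<^sup>+x. (cpow n f x)\<^sup>2 \<partial>lborel) \<le> (\<integral>\<^sup>+x. (cpow n (steiner e f) x)\<^sup>2 \<partial>lborel)"
proof -
  have "(\<integral>\<^sup>+t. slice e (\<lambda>x. (cpow n f x)\<^sup>2) z t \<partial>lborel) \<le> (\<integral>\<^sup>+t. slice e (\<lambda>x. (cpow n (steiner e f) x)\<^sup>2) z t \<partial>lborel)"
    if z: "z \<bullet> e = 0" for z
  proof -
    have "(\<integral>\<^sup>+t. slice e (cpow n f) z t * slice e (cpow n f) z t \<partial>lborel) \<le>
        (\<integral>\<^sup>+t. slice e (cpow n (steiner e f)) z t * slice e (cpow n (steiner e f)) z t \<partial>lborel)"
      using maj_slice_cpow[OF assms z] by (intro maj_mult) auto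
    then show ?thesis by (simp add: slice_def power2_eq_square)
  qed
  then show ?thesis by (intro nn_integral_mono_slices) (auto simp: perp)
qed

text \<open>The one-dimensional comparison with weight 1, for which the condition on sets is an
  equality of measures.\<close>

lemma steiner_square_le:
  assumes [measurable]: "f \<in> borel_measurable borel"
  shows "(\<integral>\<^sup>+x. (steiner e f x)\<^sup>2 \<partial>lborel) \<le> (\<integral>\<^sup>+x. (f x)\<^sup>2 \<partial>lborel)"
proof -
  have "(\<integral>\<^sup>+t. slice e (\<lambda>x. (steiner e f x)\<^sup>2) z t \<partial>lborel) \<le> (\<integral>\<^sup>+t. slice e (\<lambda>x. (f x)\<^sup>2) z t \<partial>lborel)"
    if z: "z \<bullet> e = 0" for z
  proof -
    have "(\<integral>\<^sup>+t. 1 * (srearr (slice e f z) t)\<^sup>2 \<partial>lborel) \<le> (\<integral>\<^sup>+t. 1 * (slice e f z t)\<^sup>2 \<partial>lborel)"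
      by (rule nn_integral_square_srearr_le) (auto simp: nn_integral_ind)
    then show ?thesis unfolding slice_steiner[OF norm_e z, symmetric] by (simp add: slice_def)
  qed
  then show ?thesis by (intro nn_integral_mono_slices) (auto simp: perp)
qed

text \<open>The inequality holds on each line. If the finite total integrals agree, almost every
  line has equality and a finite integral, so the function equals its rearrangement there; Fubini
  collects the exceptional sets.\<close>

lemma
  assumes [measurable]: "f \<in> borel_measurable borel" "W \<in> borel_measurable borel"
    and heavy: "\<And>z. z \<bullet> e = 0 \<Longrightarrow> heavy (slice e W z)"
  shows steiner_weighted_le: "(\<integral>\<^sup>+x. W x * (steiner e f x)\<^sup>2 \<partial>lborel) \<le> (\<integral>\<^sup>+x. W x * (f x)\<^sup>2 \<partial>lborel)"
    and steiner_weighted_eq: "(\<integral>\<^sup>+x. W x * (steiner e f x)\<^sup>2 \<partial>lborel) = (\<integral>\<^sup>+x. W x * (f x)\<^sup>2 \<partial>lborel) \<Longrightarrow>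
      (\<integral>\<^sup>+x. W x * (f x)\<^sup>2 \<partial>lborel) < \<infinity> \<Longrightarrow> AE x in lborel. f x = steiner e f x"
proof -
  let ?L = "\<lambda>z. \<integral>\<^sup>+t. slice e (\<lambda>x. W x * (steiner e f x)\<^sup>2) z t \<partial>lborel"
  let ?R = "\<lambda>z. \<integral>\<^sup>+t. slice e (\<lambda>x. W x * (f x)\<^sup>2) z t \<partial>lborel"
  have L: "?L z = (\<integral>\<^sup>+t. slice e W z t * (srearr (slice e f z) t)\<^sup>2 \<partial>lborel)" if z: "z \<bullet> e = 0" for z
    unfolding slice_steiner[OF norm_e z, symmetric] by (simp add: slice_def)
  have R: "?R z = (\<integral>\<^sup>+t. slice e W z t * (slice e f z t)\<^sup>2 \<partial>lborel)" for z
    by (simp add: slice_def)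
  have LR: "?L z \<le> ?R z" if z: "z \<bullet> e = 0" for z
    unfolding L[OF z] R by (intro nn_integral_square_srearr_le heavy_cint_le heavy z) auto
  have mL: "(\<lambda>y. ?L (\<pi> y)) \<in> borel_measurable M" "(\<lambda>y. ?R (\<pi> y)) \<in> borel_measurable M"
    unfolding slice_def by measurable
  show "(\<integral>\<^sup>+x. W x * (steiner e f x)\<^sup>2 \<partial>lborel) \<le> (\<integral>\<^sup>+x. W x * (f x)\<^sup>2 \<partial>lborel)"
    by (intro nn_integral_mono_slices LR) (auto simp: perp)
  assume eq: "(\<integral>\<^sup>+x. W x * (steiner e f x)\<^sup>2 \<partial>lborel) = (\<integral>\<^sup>+x. W x * (f x)\<^sup>2 \<partial>lborel)"
    and fin: "(\<integral>\<^sup>+x. W x * (f x)\<^sup>2 \<partial>lborel) < \<infinity>"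
  have "AE y in M. ?L (\<pi> y) = ?R (\<pi> y) \<and> ?R (\<pi> y) < \<infinity>"
  proof (rule eq_AE_of_nn_integral_eq[OF mL])
    show "(\<integral>\<^sup>+y. ?L (\<pi> y) \<partial>M) = (\<integral>\<^sup>+y. ?R (\<pi> y) \<partial>M)" using eq by (subst (asm) (1 2) fub) auto
    show "(\<integral>\<^sup>+y. ?R (\<pi> y) \<partial>M) < \<infinity>" using fin by (subst (asm) fub) auto
  qed (use LR perp in auto)
  then have "AE y in M. (\<integral>\<^sup>+t. slice e (\<lambda>x. ind (f x \<noteq> steiner e f x)) (\<pi> y) t \<partial>lborel) = 0"
    using AE_space
  proof eventually_elim
    case (elim y)
    have p: "\<pi> y \<bullet> e = 0" using perp elim by auto
    have "AE t in lborel. slice e f (\<pi> y) t = srearr (slice e f (\<pi> y)) t"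
      by (rule nn_integral_square_srearr_eq[OF heavy[OF p]]) (use elim in \<open>auto simp: L[OF p] R\<close>)
    then have "AE t in lborel. f (\<pi> y + t *\<^sub>R e) = steiner e f (\<pi> y + t *\<^sub>R e)"
      unfolding slice_steiner[OF norm_e p, symmetric] by (simp add: slice_def)
    then show ?case unfolding slice_def
      by (subst nn_integral_0_iff_AE) auto
  qed
  then have "(\<integral>\<^sup>+y. (\<integral>\<^sup>+t. slice e (\<lambda>x. ind (f x \<noteq> steiner e f x)) (\<pi> y) t \<partial>lborel) \<partial>M) = 0"
    by (subst nn_integral_0_iff_AE) (unfold slice_def, auto)
  then have "(\<integral>\<^sup>+x. ind (f x \<noteq> steiner e f x) \<partial>lborel) = 0"
    by (subst fub) auto
  then show "AE x in lborel. f x = steiner e f x"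
    by (subst (asm) nn_integral_0_iff_AE) (auto elim!: eventually_mono split: if_splits)
qed

end

subsection \<open>Functions invariant under all Steiner symmetrizations\<close>

lemma AE_lborel_translate:
  fixes v :: "'a::euclidean_space"
  assumes "AE x in lborel. P x" and [measurable]: "Measurable.pred borel P"
  shows "AE x in lborel. P (v + x)"
proof -
  have "(\<integral>\<^sup>+x. ind (\<not> P (v + x)) \<partial>lborel) = (\<integral>\<^sup>+x. ind (\<not> P x) \<partial>lborel)"
    by (rule nn_integral_lborel_translate) measurable
  also have "\<dots> = 0" using assms(1) by (subst nn_integral_0_iff_AE) (auto elim!: eventually_mono)
  finally show ?thesis
    by (subst (asm) nn_integral_0_iff_AE) (auto elim!: eventually_mono split: if_splits)
qed

text \<open>Both points lie on one line parallel to \<open>e\<close>, where comparing norms amounts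
  to comparing the moduli of the components along \<open>e\<close>.\<close>

lemma steiner_symm_decr:
  assumes e: "norm e = 1" and n: "norm x \<le> norm (x + c *\<^sub>R e)"
  shows "steiner e F (x + c *\<^sub>R e) \<le> steiner e F x"
proof -
  have ee: "e \<bullet> e = 1" using e by (simp add: norm_eq_1)
  have i: "(x + c *\<^sub>R e) \<bullet> e = x \<bullet> e + c" using ee by (simp add: inner_add_left)
  have "x \<bullet> x \<le> (x + c *\<^sub>R e) \<bullet> (x + c *\<^sub>R e)" using n by (simp add: norm_le)
  also have "\<dots> = x \<bullet> x + 2 * c * (x \<bullet> e) + c\<^sup>2"
    using ee by (simp add: inner_add_left inner_add_right inner_commute power2_eq_square)
  finally have "(x \<bullet> e)\<^sup>2 \<le> (x \<bullet> e + c)\<^sup>2" by (simp add: power2_sum algebra_simps)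
  then have "\<bar>x \<bullet> e\<bar> \<le> \<bar>x \<bullet> e + c\<bar>" by (simp add: abs_le_square_iff)
  moreover have eq: "x + c *\<^sub>R e - (x \<bullet> e + c) *\<^sub>R e = x - (x \<bullet> e) *\<^sub>R e" by (simp add: algebra_simps)
  ultimately show ?thesis unfolding steiner_def i eq by (intro symm_decrD[OF symm_decr_srearr])
qed

text \<open>The invariance comes with a null set for each of uncountably many directions. For fixed
  \<open>v\<close>, only the direction of \<open>v\<close> is used, and the bad \<open>x\<close> in
  the comparison of \<open>x\<close> with \<open>x + v\<close> form a null set. Integrating over
  \<open>v\<close> and shearing back shows that almost all pairs are good.\<close>

lemma steiner_invariant_decreasing:
  fixes F :: "'a::euclidean_space \<Rightarrow> ennreal"
  assumes [measurable]: "F \<in> borel_measurable borel"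
    and inv: "\<And>e. norm e = 1 \<Longrightarrow> AE x in lborel. F x = steiner e F x"
  shows "AE z in lborel. AE x in lborel. norm x < norm z \<longrightarrow> F z \<le> F x"
proof -
  let ?bad = "\<lambda>x z. ind (norm x < norm z \<and> \<not> F z \<le> F x)"
  have m: "(\<lambda>(x, v). ?bad x (x + v)) \<in> borel_measurable (lborel \<Otimes>\<^sub>M lborel)"
    "(\<lambda>(x, z). ?bad x z) \<in> borel_measurable (lborel \<Otimes>\<^sub>M lborel)"
    by measurable
  have *: "(\<integral>\<^sup>+x. ?bad x (x + v) \<partial>lborel) = 0" for v :: 'a
  proof (cases "v = 0")
    case False
    define e where "e = v /\<^sub>R norm v"
    have e: "norm e = 1" "v = norm v *\<^sub>R e" using False by (auto simp: e_def)
    have "AE x in lborel. F (v + x) = steiner e F (v + x)"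
      by (rule AE_lborel_translate[OF inv[OF e(1)]]) measurable
    with inv[OF e(1)] have "AE x in lborel. ?bad x (x + v) = 0"
    proof eventually_elim
      case (elim x)
      have "F (x + v) \<le> F x" if "norm x < norm (x + v)"
        using steiner_symm_decr[of e x "norm v" F] e that elim by (simp add: add.commute)
      then show ?case by auto
    qed
    then show ?thesis by (subst nn_integral_0_iff_AE) auto
  qed simp
  have "(\<integral>\<^sup>+z. \<integral>\<^sup>+x. ?bad x z \<partial>lborel \<partial>lborel) = (\<integral>\<^sup>+x. \<integral>\<^sup>+z. ?bad x z \<partial>lborel \<partial>lborel)"
    by (rule nn_integral_commute[symmetric, OF sigma_finite_lborel sigma_finite_lborel]) (rule m)
  also have "\<dots> = (\<integral>\<^sup>+x. \<integral>\<^sup>+v. ?bad x (x + v) \<partial>lborel \<partial>lborel)"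
    by (rule nn_integral_cong, rule nn_integral_lborel_translate[symmetric]) measurable
  also have "\<dots> = (\<integral>\<^sup>+v. \<integral>\<^sup>+x. ?bad x (x + v) \<partial>lborel \<partial>lborel)"
    by (rule nn_integral_commute[OF sigma_finite_lborel sigma_finite_lborel]) (rule m)
  also have "\<dots> = 0" by (simp add: *)
  finally have "AE z in lborel. (\<integral>\<^sup>+x. ?bad x z \<partial>lborel) = 0"
    by (subst (asm) nn_integral_0_iff_AE) auto
  then show ?thesis
  proof eventually_elim
    case (elim z)
    then have "AE x in lborel. ?bad x z = 0" by (subst (asm) nn_integral_0_iff_AE) auto
    then show ?case by eventually_elim (auto split: if_splits)
  qed
qed

lemma AE_norm_neq: "AE x in lborel. norm (x::'a::euclidean_space) \<noteq> r"
proof -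
  have "negligible (sphere (0::'a) r)" by (rule negligible_sphere)
  then have "emeasure lborel (sphere (0::'a) r) = 0"
    using negligible_iff_emeasure0[of "sphere (0::'a) r"] by simp
  then have "AE x in lborel. x \<notin> sphere (0::'a) r"
    by (subst AE_iff_measurable[of "sphere (0::'a) r"]) auto
  then show ?thesis by eventually_elim auto
qed

text \<open>The radius is the supremum of the norms of good points in the level set. A sequence
  approaching it needs only countably many comparisons. Values in \<open>ereal\<close> let the empty
  level set and the whole space be balls too.\<close>

lemma decreasing_level_ball:
  fixes F :: "'a::euclidean_space \<Rightarrow> ennreal"
  assumes [measurable]: "F \<in> borel_measurable borel"
    and dec: "AE z in lborel. AE x in lborel. norm x < norm z \<longrightarrow> F z \<le> F x"
  shows "\<exists>\<rho>::ereal. AE x in lborel. t < F x \<longleftrightarrow> ereal (norm x) < \<rho>"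
proof -
  define G where "G = {z. AE x in lborel. norm x < norm z \<longrightarrow> F z \<le> F x}"
  define S where "S = {ereal (norm z) |z. z \<in> G \<and> t < F z}"
  show ?thesis
  proof (cases "S = {}")
    case True
    have "AE z in lborel. t < F z \<longleftrightarrow> ereal (norm z) < -\<infinity>"
      using dec by eventually_elim (use True in \<open>auto simp: S_def G_def\<close>)
    then show ?thesis by blast
  next
    case False
    then obtain f :: "nat \<Rightarrow> ereal" where f: "range f \<subseteq> S" "Sup S = (SUP i. f i)"
      using Sup_countable_SUP by blast
    have "\<exists>z. f i = ereal (norm z) \<and> z \<in> G \<and> t < F z" for i using f(1) by (auto simp: S_def)
    then obtain z where z: "\<And>i. f i = ereal (norm (z i))" "\<And>i. z i \<in> G" "\<And>i. t < F (z i)" by metis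
    have 1: "AE x in lborel. \<forall>i. norm x < norm (z i) \<longrightarrow> F (z i) \<le> F x"
      using z(2) by (subst AE_all_countable) (auto simp: G_def)
    have 2: "AE x in lborel. ereal (norm (x::'a)) \<noteq> Sup S"
    proof (cases "Sup S")
      case (real r)
      then show ?thesis using AE_norm_neq[of r] by (auto elim!: eventually_mono)
    qed auto
    have "AE x in lborel. t < F x \<longleftrightarrow> ereal (norm x) < Sup S"
      using dec 1 2
    proof eventually_elim
      case (elim x)
      show ?case
      proof
        assume "t < F x"
        then have "ereal (norm x) \<in> S" using elim(1) by (auto simp: S_def G_def)
        then have "ereal (norm x) \<le> Sup S" by (rule Sup_upper)
        with elim(3) show "ereal (norm x) < Sup S" by simp
      next
        assume "ereal (norm x) < Sup S"
        then obtain i where "norm x < norm (z i)" unfolding f(2) less_SUP_iff z(1) by auto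
        with elim(2) z(3)[of i] show "t < F x" by (blast intro: less_le_trans)
      qed
    qed
    then show ?thesis by blast
  qed
qed

lemma emeasure_ball_strict_mono:
  fixes r s :: real
  assumes "0 \<le> r" "r < s"
  shows "emeasure lebesgue (ball (0::'a::euclidean_space) r) < emeasure lebesgue (ball (0::'a) s)"
proof -
  have "emeasure lborel (ball (0::'a) r) < emeasure lborel (ball (0::'a) s)"
    using assms by (simp add: emeasure_ball ennreal_less_iff power_strict_mono)
  then show ?thesis by simp
qed

lemma rearr_set_eq_ball:
  fixes A :: "'a::euclidean_space set"
  assumes "0 \<le> r" "emeasure lebesgue A = emeasure lebesgue (ball (0::'a) r)"
  shows "rearr_set A = ball 0 r"
proof -
  have "(THE R. 0 \<le> R \<and> emeasure lebesgue (ball (0::'a) R) = emeasure lebesgue A) = r"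
  proof (rule the_equality)
    fix R assume "0 \<le> R \<and> emeasure lebesgue (ball (0::'a) R) = emeasure lebesgue A"
    then show "R = r"
      using emeasure_ball_strict_mono[of R r, where 'a='a] emeasure_ball_strict_mono[of r R, where 'a='a] assms
      by (cases R r rule: linorder_cases) auto
  qed (use assms in auto)
  then show ?thesis by (simp add: rearr_set_def)
qed

lemma sym_decr_rearr_radial: "norm x = norm y \<Longrightarrow> sym_decr_rearr g x = sym_decr_rearr g y"
  by (simp add: sym_decr_rearr_def rearr_set_def indicator_def)

text \<open>Each superlevel set agrees up to a null set with a ball of radius \<open>R t\<close>, so
  \<open>rearr_set\<close> returns exactly that ball. Rational levels, together with monotonicity of
  \<open>R\<close>, determine the layer-cake integral off a null set of points.\<close>

lemma sym_decr_rearr_eq: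
  fixes h :: "'a::euclidean_space \<Rightarrow> real" and g :: "'a \<Rightarrow> complex"
  assumes [measurable]: "h \<in> borel_measurable borel"
    and h0: "\<And>x. 0 \<le> h x" and fin: "(\<integral>\<^sup>+x. (ennreal (h x))\<^sup>2 \<partial>lborel) < \<infinity>"
    and g: "g \<in> borel_measurable lebesgue" "AE x in lebesgue. norm (g x) = h x"
    and dec: "AE z in lborel. AE x in lborel. norm x < norm z \<longrightarrow> ennreal (h z) \<le> ennreal (h x)"
  shows "AE x in lborel. sym_decr_rearr g x = h x"
proof -
  have lev: "\<exists>r. 0 \<le> r \<and> rearr_set {y. norm (g y) > t} = ball 0 r \<and> (AE x in lborel. t < h x \<longleftrightarrow> norm x < r) \<and>
      emeasure lebesgue (ball (0::'a) r) = emeasure lebesgue {y. norm (g y) > t}" if t: "t > 0" for t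
  proof -
    have "\<exists>\<rho>::ereal. AE x in lborel. ennreal t < ennreal (h x) \<longleftrightarrow> ereal (norm x) < \<rho>"
      by (rule decreasing_level_ball[OF _ dec]) measurable
    then obtain \<rho> :: ereal where \<rho>: "AE x in lborel. ennreal t < ennreal (h x) \<longleftrightarrow> ereal (norm x) < \<rho>" by blast
    \<comment> \<open>Chebyshev's inequality; this rules out an infinite radius.\<close>
    have fint: "emeasure lborel {x. t < h x} < \<infinity>"
    proof -
      have "ennreal (t\<^sup>2) * emeasure lborel {x. t < h x} = (\<integral>\<^sup>+x. ennreal (t\<^sup>2) * ind (x \<in> {x. t < h x}) \<partial>lborel)"
        by (subst nn_integral_cmult) (auto simp: nn_integral_ind simp del: mem_Collect_eq)
      also have "\<dots> \<le> (\<integral>\<^sup>+x. (ennreal (h x))\<^sup>2 \<partial>lborel)"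
        using t h0 by (intro nn_integral_mono) (auto simp: ennreal_power intro!: power_mono)
      finally have "ennreal (t\<^sup>2) * emeasure lborel {x. t < h x} < \<infinity>" using fin by (rule le_less_trans)
      then show ?thesis using t by (auto simp: ennreal_mult_less_top)
    qed
    obtain r where r: "0 \<le> r" "AE x in lborel. t < h x \<longleftrightarrow> norm (x::'a) < r"
    proof (cases \<rho>)
      case (real r)
      show ?thesis
        by (rule that[of "max 0 r"], simp, use \<rho> real in \<open>auto elim!: eventually_mono simp: ennreal_less_iff t less_imp_le less_max_iff_disj\<close>)
    next
      case PInf
      then have "AE x in lborel. x \<in> {x. t < h x}" using \<rho> t by (auto elim!: eventually_mono simp: ennreal_less_iff)
      then have "emeasure lborel {x. t < h x} = emeasure lborel (UNIV :: 'a set)"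
        by (intro emeasure_eq_AE) auto
      with fint show ?thesis by simp
    next
      case MInf
      then show ?thesis using \<rho> t by (intro that[of 0]) (auto elim!: eventually_mono simp: ennreal_less_iff)
    qed
    have "emeasure lebesgue {y. norm (g y) > t} = emeasure lebesgue (ball (0::'a) r)"
    proof (rule emeasure_eq_AE)
      show "AE x in lebesgue. x \<in> {y. norm (g y) > t} \<longleftrightarrow> x \<in> ball 0 r"
        using g(2) AE_completion[OF r(2)] by eventually_elim auto
      have [measurable]: "g \<in> borel_measurable lebesgue" by (rule g)
      have "{y \<in> space lebesgue. norm (g y) > t} \<in> sets lebesgue" by measurable
      then show "{y. norm (g y) > t} \<in> sets lebesgue" by simp
    qed auto
    with r show ?thesis using rearr_set_eq_ball[of r "{y. norm (g y) > t}"] by auto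
  qed
  then obtain R where R: "\<And>t. t > 0 \<Longrightarrow> 0 \<le> R t" "\<And>t. t > 0 \<Longrightarrow> rearr_set {y. norm (g y) > t} = ball 0 (R t)"
    "\<And>t. t > 0 \<Longrightarrow> AE x in lborel. t < h x \<longleftrightarrow> norm x < R t"
    "\<And>t. t > 0 \<Longrightarrow> emeasure lebesgue (ball (0::'a) (R t)) = emeasure lebesgue {y. norm (g y) > t}"
  proof -
    have "\<exists>R. \<forall>t. t > 0 \<longrightarrow> 0 \<le> R t \<and> rearr_set {y. norm (g y) > t} = ball 0 (R t) \<and> (AE x in lborel. t < h x \<longleftrightarrow> norm x < R t) \<and>
      emeasure lebesgue (ball (0::'a) (R t)) = emeasure lebesgue {y. norm (g y) > t}"
      by (intro choice allI) (use lev in blast)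
    then show thesis using that by blast
  qed
  have Rmono: "R t \<le> R s" if st: "0 < s" "s \<le> t" for s t
  proof (rule ccontr)
    assume "\<not> R t \<le> R s"
    then have "emeasure lebesgue (ball (0::'a) (R s)) < emeasure lebesgue (ball (0::'a) (R t))"
      using R(1)[of s] st by (intro emeasure_ball_strict_mono) auto
    moreover have "emeasure lebesgue {y. norm (g y) > t} \<le> emeasure lebesgue {y. norm (g y) > s}"
    proof (rule emeasure_mono)
      have [measurable]: "g \<in> borel_measurable lebesgue" by (rule g)
      have "{y \<in> space lebesgue. norm (g y) > s} \<in> sets lebesgue" by measurable
      then show "{y. norm (g y) > s} \<in> sets lebesgue" by simp
    qed (use st in auto)
    ultimately show False using R(4)[of s] R(4)[of t] st by auto
  qed
  have "AE x in lborel. \<forall>q\<in>\<rat> \<inter> {0<..}. q < h x \<longleftrightarrow> norm x < R q"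
    by (subst AE_ball_countable) (auto intro: R(3) countable_rat)
  then show ?thesis
  proof eventually_elim
    case (elim x)
    have key: "norm x < R t \<longleftrightarrow> t < h x" if t: "t > 0" "t \<noteq> h x" for t
    proof (cases "t < h x")
      case True
      then obtain q where q: "q \<in> \<rat>" "t < q" "q < h x" using Rats_dense_in_real by blast
      then have "norm x < R q" using elim t by auto
      then show ?thesis using Rmono[of t q] q t True by auto
    next
      case False
      then have "h x < t" using t by auto
      then obtain q where q: "q \<in> \<rat>" "h x < q" "q < t" using Rats_dense_in_real by blast
      then have "q \<in> \<rat> \<inter> {0<..}" using h0[of x] by auto
      then have "\<not> norm x < R q" using elim q by (metis less_asym)
      then show ?thesis using Rmono[of q t] q h0[of x] False by auto
    qed
    have "sym_decr_rearr g x = (LINT t|lborel. indicator {0<..} t * indicator (rearr_set {y. norm (g y) > t}) x)"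
      by (simp add: sym_decr_rearr_def set_lebesgue_integral_def)
    also have "\<dots> = (LINT t|lborel. indicator {0<..<h x} t)"
    proof (rule integral_cong_AE)
      have eq: "indicator {0<..} t * indicator (rearr_set {y. norm (g y) > t}) x = (indicator {0<..<h x} t :: real)" if "t \<noteq> h x" for t
        using key[of t] that R(2)[of t] by (auto split: split_indicator)
      show "AE t in lborel. indicator {0<..} t * indicator (rearr_set {y. norm (g y) > t}) x = (indicator {0<..<h x} t :: real)"
        using AE_lborel_singleton[of "h x"] by eventually_elim (rule eq)
      \<comment> \<open>Measurability in the level is not automatic, as \<open>R\<close> was merely
        chosen; but the integrand differs from an indicator of an interval at one level at
        most.\<close>
      have "(\<lambda>t. indicator {0<..} t * indicator (rearr_set {y. norm (g y) > t}) x :: real) =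
         (\<lambda>t. if t = h x then indicator {0<..} (h x) * indicator (rearr_set {y. norm (g y) > h x}) x else indicator {0<..<h x} t)"
        using eq by auto
      then show "(\<lambda>t. indicator {0<..} t * indicator (rearr_set {y. norm (g y) > t}) x :: real) \<in> borel_measurable lborel"
        by simp
    qed simp
    also have "\<dots> = h x" using h0[of x] by simp
    finally show ?case .
  qed
qed

subsection \<open>Additive functions modulo one\<close>

lemma ennreal_tendsto_0I:
  fixes X :: "'a \<Rightarrow> ennreal"
  assumes "\<And>e::real. e > 0 \<Longrightarrow> eventually (\<lambda>n. X n \<le> ennreal e) F"
  shows "(X \<longlongrightarrow> 0) F"
proof (rule order_tendstoI)
  fix a :: ennreal assume "0 < a"
  then obtain b where b: "0 < b" "b < a" using dense by blast
  then obtain e where e: "b = ennreal e" "0 \<le> e" by (cases b) auto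
  then have "e > 0" using b by auto
  from assms[OF this] show "eventually (\<lambda>n. X n < a) F"
    by eventually_elim (use b e in auto)
qed simp

lemma ennreal_tendsto_0D: "(X \<longlongrightarrow> (0::ennreal)) F \<Longrightarrow> e > 0 \<Longrightarrow> eventually (\<lambda>n. X n \<le> ennreal e) F"
  by (drule order_tendstoD(2)[of _ _ _ "ennreal e"]) (auto elim!: eventually_mono)

definition translation_continuous :: "('a::euclidean_space \<Rightarrow> 'b::real_normed_vector) \<Rightarrow> bool" where
  "translation_continuous \<psi> \<longleftrightarrow> (\<forall>v. v \<longlonglongrightarrow> 0 \<longrightarrow>
     (\<lambda>n. \<integral>\<^sup>+x. ennreal (norm (\<psi> (v n + x) - \<psi> x)) \<partial>lborel) \<longlonglongrightarrow> 0)"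

lemma translation_continuous_approx:
  fixes \<psi> :: "'a::euclidean_space \<Rightarrow> 'b::{real_normed_vector, second_countable_topology}"
  assumes [measurable]: "\<psi> \<in> borel_measurable borel"
    and ap: "\<And>e::real. e > 0 \<Longrightarrow> \<exists>\<phi>\<in>borel_measurable borel. translation_continuous \<phi> \<and> (\<integral>\<^sup>+x. ennreal (norm (\<phi> x - \<psi> x)) \<partial>lborel) \<le> ennreal e"
  shows "translation_continuous \<psi>"
  unfolding translation_continuous_def
proof (intro allI impI ennreal_tendsto_0I)
  fix v :: "nat \<Rightarrow> 'a" and e :: real assume v: "v \<longlonglongrightarrow> 0" and e: "e > 0"
  obtain \<phi> where [measurable]: "\<phi> \<in> borel_measurable borel" and \<phi>: "translation_continuous \<phi>" "(\<integral>\<^sup>+x. ennreal (norm (\<phi> x - \<psi> x)) \<partial>lborel) \<le> ennreal (e / 3)"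
    using ap[of "e / 3"] e by auto
  have "eventually (\<lambda>n. (\<integral>\<^sup>+x. ennreal (norm (\<phi> (v n + x) - \<phi> x)) \<partial>lborel) \<le> ennreal (e / 3)) sequentially"
    using \<phi>(1) v e by (intro ennreal_tendsto_0D) (auto simp: translation_continuous_def)
  then show "eventually (\<lambda>n. (\<integral>\<^sup>+x. ennreal (norm (\<psi> (v n + x) - \<psi> x)) \<partial>lborel) \<le> ennreal e) sequentially"
  proof eventually_elim
    case (elim n)
    have "(\<integral>\<^sup>+x. ennreal (norm (\<psi> (v n + x) - \<psi> x)) \<partial>lborel) \<le>
      (\<integral>\<^sup>+x. ennreal (norm (\<phi> (v n + x) - \<psi> (v n + x))) + (ennreal (norm (\<phi> (v n + x) - \<phi> x)) + ennreal (norm (\<phi> x - \<psi> x))) \<partial>lborel)"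
    proof (rule nn_integral_mono)
      fix x
      have "norm (\<psi> (v n + x) - \<psi> x) \<le> norm (\<phi> (v n + x) - \<psi> (v n + x)) + (norm (\<phi> (v n + x) - \<phi> x) + norm (\<phi> x - \<psi> x))"
        by norm
      then show "ennreal (norm (\<psi> (v n + x) - \<psi> x)) \<le> ennreal (norm (\<phi> (v n + x) - \<psi> (v n + x))) + (ennreal (norm (\<phi> (v n + x) - \<phi> x)) + ennreal (norm (\<phi> x - \<psi> x)))"
        by (simp flip: ennreal_plus add: ennreal_leI)
    qed
    also have "\<dots> = (\<integral>\<^sup>+x. ennreal (norm (\<phi> (v n + x) - \<psi> (v n + x))) \<partial>lborel) +
       ((\<integral>\<^sup>+x. ennreal (norm (\<phi> (v n + x) - \<phi> x)) \<partial>lborel) + (\<integral>\<^sup>+x. ennreal (norm (\<phi> x - \<psi> x)) \<partial>lborel))"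
      by (simp add: nn_integral_add)
    also have "(\<integral>\<^sup>+x. ennreal (norm (\<phi> (v n + x) - \<psi> (v n + x))) \<partial>lborel) = (\<integral>\<^sup>+x. ennreal (norm (\<phi> x - \<psi> x)) \<partial>lborel)"
      by (rule nn_integral_lborel_translate) measurable
    also have "\<dots> + ((\<integral>\<^sup>+x. ennreal (norm (\<phi> (v n + x) - \<phi> x)) \<partial>lborel) + \<dots>) \<le> ennreal (e / 3) + (ennreal (e / 3) + ennreal (e / 3))"
      by (intro add_mono \<phi>(2) elim)
    also have "\<dots> = ennreal e" using e by (simp flip: ennreal_plus)
    finally show ?case .
  qed
qed

text \<open>A point of an open set stays in it under small shifts, so dominated convergence handles
  the points that leave. The points that enter are those that leave under the opposite
  shift.\<close>

lemma translation_continuous_scaleR_indicator_open: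
  fixes c :: "'b::{real_normed_vector, second_countable_topology}"
  assumes U: "open (U :: 'a::euclidean_space set)" "emeasure lborel U < \<infinity>"
  shows "translation_continuous (\<lambda>x. indicator U x *\<^sub>R c)"
  unfolding translation_continuous_def
proof (intro allI impI)
  fix v :: "nat \<Rightarrow> 'a" assume v: "v \<longlonglongrightarrow> 0"
  have [measurable]: "U \<in> sets borel" using U by simp
  define a where "a w = (\<integral>\<^sup>+x. ennreal (norm c) * ind (x \<in> U \<and> w + x \<notin> U) \<partial>lborel)" for w
  have a0: "(\<lambda>n. a (w n)) \<longlonglongrightarrow> 0" if w: "w \<longlonglongrightarrow> 0" for w
  proof -
    have "(\<lambda>n. a (w n)) \<longlonglongrightarrow> (integral\<^sup>N lborel (\<lambda>x::'a. 0))"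
      unfolding a_def
    proof (rule nn_integral_dominated_convergence[where w = "\<lambda>x. ennreal (norm c) * ind (x \<in> U)"])
      show "(\<integral>\<^sup>+x. ennreal (norm c) * ind (x \<in> U) \<partial>lborel) < \<infinity>"
        using U by (subst nn_integral_cmult) (auto simp: nn_integral_ind ennreal_mult_less_top)
      show "AE x in lborel. (\<lambda>n. ennreal (norm c) * ind (x \<in> U \<and> w n + x \<notin> U)) \<longlonglongrightarrow> 0"
      proof (rule AE_I2)
        fix x
        have "(\<lambda>n. w n + x) \<longlonglongrightarrow> 0 + x" by (intro tendsto_intros w)
        then have "eventually (\<lambda>n. x \<in> U \<longrightarrow> w n + x \<in> U) sequentially"
          using topological_tendstoD[OF _ U(1)] by (cases "x \<in> U") auto
        then have "eventually (\<lambda>n. ennreal (norm c) * ind (x \<in> U \<and> w n + x \<notin> U) = 0) sequentially"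
          by eventually_elim auto
        then show "(\<lambda>n. ennreal (norm c) * ind (x \<in> U \<and> w n + x \<notin> U)) \<longlonglongrightarrow> 0"
          by (rule tendsto_eventually)
      qed
    qed auto
    then show ?thesis by simp
  qed
  have eq: "(\<integral>\<^sup>+x. ennreal (norm (indicator U (v n + x) *\<^sub>R c - indicator U x *\<^sub>R c)) \<partial>lborel) = a (v n) + a (- v n)" for n
  proof -
    have "a (- v n) = (\<integral>\<^sup>+x. ennreal (norm c) * ind (v n + x \<in> U \<and> - v n + (v n + x) \<notin> U) \<partial>lborel)"
      unfolding a_def by (rule nn_integral_lborel_translate[symmetric]) measurable
    then have "a (v n) + a (- v n) = (\<integral>\<^sup>+x. ennreal (norm c) * ind (x \<in> U \<and> v n + x \<notin> U) + ennreal (norm c) * ind (v n + x \<in> U \<and> x \<notin> U) \<partial>lborel)"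
      unfolding a_def by (subst nn_integral_add) auto
    also have "\<dots> = (\<integral>\<^sup>+x. ennreal (norm (indicator U (v n + x) *\<^sub>R c - indicator U x *\<^sub>R c)) \<partial>lborel)"
      by (intro nn_integral_cong) (auto split: split_indicator)
    finally show ?thesis by simp
  qed
  have "(\<lambda>n. a (v n) + a (- v n)) \<longlonglongrightarrow> 0 + 0"
    using v by (intro tendsto_add a0) (auto intro: tendsto_eq_intros)
  then show "(\<lambda>n. \<integral>\<^sup>+x. ennreal (norm (indicator U (v n + x) *\<^sub>R c - indicator U x *\<^sub>R c)) \<partial>lborel) \<longlonglongrightarrow> 0"
    unfolding eq by simp
qed

text \<open>Indicators of Borel sets are approximated by indicators of open sets through outer
  regularity; sums and dominated limits extend this to all integrable functions.\<close>

lemma translation_continuous_integrable: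
  fixes \<psi> :: "'a::euclidean_space \<Rightarrow> 'b::{banach, second_countable_topology}"
  assumes "integrable lborel \<psi>"
  shows "translation_continuous \<psi>"
  using assms
proof (induction rule: integrable_induct)
  case (base A c)
  then have A: "A \<in> sets borel" "emeasure lborel A < \<infinity>" by auto
  note [measurable] = A(1)
  show ?case
  proof (rule translation_continuous_approx)
    fix e :: real assume e: "e > 0"
    define d where "d = e / (norm c + 1)"
    have d: "d > 0" "d * norm c \<le> e"
    proof -
      have "norm c \<ge> 0" by simp
      then have "norm c + 1 > 0" by linarith
      with e show "d > 0" unfolding d_def by simp
      have "e * norm c \<le> e * (norm c + 1)" using e by simp
      then show "d * norm c \<le> e" unfolding d_def using \<open>norm c + 1 > 0\<close> by (simp add: pos_divide_le_eq)
    qed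
    obtain U where U: "open U" "A \<subseteq> U" "emeasure lborel (U - A) < d"
      using outer_regular_lborel[OF A(1) d(1)] .
    have [measurable]: "U \<in> sets borel" using U by simp
    have "emeasure lborel U = emeasure lborel A + emeasure lborel (U - A)"
      using U by (subst plus_emeasure) (auto simp: Un_absorb1)
    then have "emeasure lborel U < \<infinity>" using A U by (auto simp: less_top[symmetric])
    then have "translation_continuous (\<lambda>x. indicator U x *\<^sub>R c)"
      by (rule translation_continuous_scaleR_indicator_open[OF U(1)])
    moreover have "(\<integral>\<^sup>+x. ennreal (norm (indicator U x *\<^sub>R c - indicator A x *\<^sub>R c)) \<partial>lborel) \<le> ennreal e"
    proof -
      have "(\<integral>\<^sup>+x. ennreal (norm (indicator U x *\<^sub>R c - indicator A x *\<^sub>R c)) \<partial>lborel) = (\<integral>\<^sup>+x. ennreal (norm c) * ind (x \<in> U - A) \<partial>lborel)"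
        using U by (intro nn_integral_cong) (auto split: split_indicator)
      also have "\<dots> = ennreal (norm c) * emeasure lborel (U - A)"
        by (subst nn_integral_cmult) (auto simp: nn_integral_ind simp del: Diff_iff)
      also have "\<dots> \<le> ennreal (norm c) * ennreal d" using U by (intro mult_left_mono) auto
      also have "\<dots> \<le> ennreal e" using d by (simp flip: ennreal_mult add: ennreal_leI mult.commute)
      finally show ?thesis .
    qed
    ultimately show "\<exists>\<phi>\<in>borel_measurable borel. translation_continuous \<phi> \<and> (\<integral>\<^sup>+x. ennreal (norm (\<phi> x - indicator A x *\<^sub>R c)) \<partial>lborel) \<le> ennreal e"
      by (intro bexI[of _ "\<lambda>x. indicator U x *\<^sub>R c"]) auto
  qed auto
next
  case (add f g)
  have [measurable]: "f \<in> borel_measurable borel" "g \<in> borel_measurable borel" using add by (auto dest: borel_measurable_integrable)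
  show ?case
    unfolding translation_continuous_def
  proof (intro allI impI)
    fix v :: "nat \<Rightarrow> 'a" assume v: "v \<longlonglongrightarrow> 0"
    show "(\<lambda>n. \<integral>\<^sup>+x. ennreal (norm (f (v n + x) + g (v n + x) - (f x + g x))) \<partial>lborel) \<longlonglongrightarrow> 0"
    proof (rule tendsto_sandwich[OF _ _ tendsto_const])
      have "(\<lambda>n. (\<integral>\<^sup>+x. ennreal (norm (f (v n + x) - f x)) \<partial>lborel) + (\<integral>\<^sup>+x. ennreal (norm (g (v n + x) - g x)) \<partial>lborel)) \<longlonglongrightarrow> 0 + 0"
        using add v by (intro tendsto_add) (auto simp: translation_continuous_def)
      then show "(\<lambda>n. (\<integral>\<^sup>+x. ennreal (norm (f (v n + x) - f x)) \<partial>lborel) + (\<integral>\<^sup>+x. ennreal (norm (g (v n + x) - g x)) \<partial>lborel)) \<longlonglongrightarrow> 0" by simp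
      show "eventually (\<lambda>n. (\<integral>\<^sup>+x. ennreal (norm (f (v n + x) + g (v n + x) - (f x + g x))) \<partial>lborel) \<le>
          (\<integral>\<^sup>+x. ennreal (norm (f (v n + x) - f x)) \<partial>lborel) + (\<integral>\<^sup>+x. ennreal (norm (g (v n + x) - g x)) \<partial>lborel)) sequentially"
      proof (rule always_eventually, rule allI)
        fix n
        have "(\<integral>\<^sup>+x. ennreal (norm (f (v n + x) + g (v n + x) - (f x + g x))) \<partial>lborel) \<le>
          (\<integral>\<^sup>+x. ennreal (norm (f (v n + x) - f x)) + ennreal (norm (g (v n + x) - g x)) \<partial>lborel)"
        proof (rule nn_integral_mono)
          fix x
          have "norm (f (v n + x) + g (v n + x) - (f x + g x)) \<le> norm (f (v n + x) - f x) + norm (g (v n + x) - g x)"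
            by norm
          then show "ennreal (norm (f (v n + x) + g (v n + x) - (f x + g x))) \<le> ennreal (norm (f (v n + x) - f x)) + ennreal (norm (g (v n + x) - g x))"
            by (simp flip: ennreal_plus add: ennreal_leI)
        qed
        then show "(\<integral>\<^sup>+x. ennreal (norm (f (v n + x) + g (v n + x) - (f x + g x))) \<partial>lborel) \<le>
          (\<integral>\<^sup>+x. ennreal (norm (f (v n + x) - f x)) \<partial>lborel) + (\<integral>\<^sup>+x. ennreal (norm (g (v n + x) - g x)) \<partial>lborel)"
          by (simp add: nn_integral_add)
      qed
    qed auto
  qed
next
  case (lim f s)
  have [measurable]: "f \<in> borel_measurable borel" "\<And>i. s i \<in> borel_measurable borel" using lim by (auto dest: borel_measurable_integrable)
  have "(\<lambda>i. \<integral>\<^sup>+x. ennreal (norm (s i x - f x)) \<partial>lborel) \<longlonglongrightarrow> (integral\<^sup>N lborel (\<lambda>x::'a. 0))"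
  proof (rule nn_integral_dominated_convergence[where w = "\<lambda>x. 3 * ennreal (norm (f x))"])
    show "(\<integral>\<^sup>+x. 3 * ennreal (norm (f x)) \<partial>lborel) < \<infinity>"
      using lim(4) by (subst nn_integral_cmult) (auto simp: ennreal_mult_less_top integrable_iff_bounded)
    show "AE x in lborel. ennreal (norm (s i x - f x)) \<le> 3 * ennreal (norm (f x))" for i
    proof (rule AE_I2)
      fix x
      have "norm (s i x - f x) \<le> norm (s i x) + norm (f x)" by norm
      also have "\<dots> \<le> 3 * norm (f x)" using lim(3)[of x i] by simp
      finally have "ennreal (norm (s i x - f x)) \<le> ennreal (3 * norm (f x))" by (rule ennreal_leI)
      then show "ennreal (norm (s i x - f x)) \<le> 3 * ennreal (norm (f x))" by (simp add: ennreal_mult)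
    qed
    show "AE x in lborel. (\<lambda>i. ennreal (norm (s i x - f x))) \<longlonglongrightarrow> 0"
    proof (rule AE_I2)
      fix x
      have "(\<lambda>i. norm (s i x - f x)) \<longlonglongrightarrow> 0" using lim(2)[of x] by (simp add: LIM_zero_iff tendsto_norm_zero_iff)
      then have "(\<lambda>i. ennreal (norm (s i x - f x))) \<longlonglongrightarrow> ennreal 0" by (rule tendsto_ennrealI)
      then show "(\<lambda>i. ennreal (norm (s i x - f x))) \<longlonglongrightarrow> 0" by simp
    qed
  qed auto
  then have l: "(\<lambda>i. \<integral>\<^sup>+x. ennreal (norm (s i x - f x)) \<partial>lborel) \<longlonglongrightarrow> 0" by simp
  show ?case
  proof (rule translation_continuous_approx)
    fix e :: real assume "e > 0"
    from eventually_happens[OF ennreal_tendsto_0D[OF l this]] obtain i where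
      "(\<integral>\<^sup>+x. ennreal (norm (s i x - f x)) \<partial>lborel) \<le> ennreal e" by auto
    then show "\<exists>\<phi>\<in>borel_measurable borel. translation_continuous \<phi> \<and> (\<integral>\<^sup>+x. ennreal (norm (\<phi> x - f x)) \<partial>lborel) \<le> ennreal e"
      using lim(5) by (intro bexI[of _ "s i"]) auto
  qed measurable
qed

lemma nn_integral_cconv_swap:
  fixes p :: "'a::euclidean_space \<Rightarrow> 'a \<Rightarrow> bool"
  assumes [measurable]: "(\<lambda>(x, y). p x y) \<in> measurable (borel \<Otimes>\<^sub>M borel) (count_space UNIV)"
  shows AE_pair_swap: "(AE x in lborel. AE y in lborel. p x y) \<longleftrightarrow> (AE y in lborel. AE x in lborel. p x y)"
    and AE_pair_shear: "(AE x in lborel. AE y in lborel. p x y) \<longleftrightarrow> (AE x in lborel. AE y in lborel. p x (x - y))"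
    and AE_pair_shear_add: "(AE x in lborel. AE y in lborel. p x y) \<longleftrightarrow> (AE x in lborel. AE y in lborel. p x (x + y))"
proof -
  have 0: "(AE x in lborel. AE y in lborel. q x y) \<longleftrightarrow> (\<integral>\<^sup>+x. \<integral>\<^sup>+y. ind (\<not> q x y) \<partial>lborel \<partial>lborel) = 0"
    if [measurable]: "(\<lambda>(x, y). q x y) \<in> measurable (borel \<Otimes>\<^sub>M borel) (count_space UNIV)" for q :: "'a \<Rightarrow> 'a \<Rightarrow> bool"
  proof -
    have i: "(\<integral>\<^sup>+y. ind (\<not> q x y) \<partial>lborel) = 0 \<longleftrightarrow> (AE y in lborel. q x y)" for x
      by (subst nn_integral_0_iff_AE) (auto intro!: arg_cong[where f="\<lambda>P. almost_everywhere lborel P"])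
    show ?thesis
      by (subst nn_integral_0_iff_AE) (auto simp: i)
  qed
  show "(AE x in lborel. AE y in lborel. p x y) \<longleftrightarrow> (AE y in lborel. AE x in lborel. p x y)"
    by (subst 0, measurable, subst 0, measurable, subst nn_integral_commute[OF sigma_finite_lborel sigma_finite_lborel], measurable)
  show "(AE x in lborel. AE y in lborel. p x y) \<longleftrightarrow> (AE x in lborel. AE y in lborel. p x (x - y))"
  proof -
    have "(\<integral>\<^sup>+x. \<integral>\<^sup>+y. ind (\<not> p x (x - y)) \<partial>lborel \<partial>lborel) = (\<integral>\<^sup>+x. \<integral>\<^sup>+y. ind (\<not> p x y) \<partial>lborel \<partial>lborel)"
      by (rule nn_integral_cong, rule nn_integral_lborel_reflect) measurable
    moreover have "Measurable.pred (borel \<Otimes>\<^sub>M borel) (\<lambda>(x, y). p x (x - y))" by measurable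
    ultimately show ?thesis using 0[OF assms] 0[of "\<lambda>x y. p x (x - y)"] by simp
  qed
  show "(AE x in lborel. AE y in lborel. p x y) \<longleftrightarrow> (AE x in lborel. AE y in lborel. p x (x + y))"
  proof -
    have "(\<integral>\<^sup>+x. \<integral>\<^sup>+y. ind (\<not> p x (x + y)) \<partial>lborel \<partial>lborel) = (\<integral>\<^sup>+x. \<integral>\<^sup>+y. ind (\<not> p x y) \<partial>lborel \<partial>lborel)"
      by (rule nn_integral_cong, rule nn_integral_lborel_translate) measurable
    moreover have "Measurable.pred (borel \<Otimes>\<^sub>M borel) (\<lambda>(x, y). p x (x + y))" by measurable
    ultimately show ?thesis using 0[OF assms] 0[of "\<lambda>x y. p x (x + y)"] by simp
  qed
qed

subsection \<open>Equality in the convolution inequality\<close>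

lemma borel_measurable_cnj [measurable]: "cnj \<in> borel_measurable borel"
  by (intro borel_measurable_continuous_onI continuous_intros)

lemma AE_lborel_reflect:
  fixes v :: "'a::euclidean_space"
  assumes "AE x in lborel. P x" and [measurable]: "Measurable.pred borel P"
  shows "AE x in lborel. P (v - x)"
proof -
  have "(\<integral>\<^sup>+x. ind (\<not> P (v - x)) \<partial>lborel) = (\<integral>\<^sup>+x. ind (\<not> P x) \<partial>lborel)"
    by (rule nn_integral_lborel_reflect) measurable
  also have "\<dots> = 0" using assms(1) by (subst nn_integral_0_iff_AE) (auto elim!: eventually_mono)
  finally show ?thesis
    by (subst (asm) nn_integral_0_iff_AE) (auto elim!: eventually_mono split: if_splits)
qed

definition cconv :: "('a::euclidean_space \<Rightarrow> complex) \<Rightarrow> ('a \<Rightarrow> complex) \<Rightarrow> 'a \<Rightarrow> complex" where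
  "cconv f g x = (LINT y|lborel. f y * g (x - y))"

lemma borel_cconv [measurable]:
  assumes [measurable]: "f \<in> borel_measurable borel" "g \<in> borel_measurable borel"
  shows "cconv f g \<in> borel_measurable borel"
  unfolding cconv_def by measurable

primrec ccpow :: "nat \<Rightarrow> ('a::euclidean_space \<Rightarrow> complex) \<Rightarrow> 'a \<Rightarrow> complex" where
  "ccpow 0 f = f"
| "ccpow (Suc n) f = cconv f (ccpow n f)"

lemma borel_ccpow [measurable]:
  assumes [measurable]: "f \<in> borel_measurable borel"
  shows "ccpow n f \<in> borel_measurable borel"
  by (induction n) auto

text \<open>True without integrability, since the Bochner integral is 0 by default. Hence complex
  convolution powers are dominated by those of the modulus at every point.\<close>

lemma norm_integral_le_nn_integral:
  fixes f :: "'a \<Rightarrow> 'b::{banach, second_countable_topology}"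
  shows "ennreal (norm (LINT x|M. f x)) \<le> (\<integral>\<^sup>+x. ennreal (norm (f x)) \<partial>M)"
  by (cases "integrable M f") (auto intro: integral_norm_bound_ennreal simp: not_integrable_integral_eq)

lemma norm_ccpow_le:
  shows "ennreal (norm (ccpow n g x)) \<le> cpow n (\<lambda>x. ennreal (norm (g x))) x"
proof (induction n arbitrary: x)
  case (Suc n)
  have "ennreal (norm (ccpow (Suc n) g x)) \<le> (\<integral>\<^sup>+y. ennreal (norm (g y * ccpow n g (x - y))) \<partial>lborel)"
    by (simp add: cconv_def norm_integral_le_nn_integral)
  also have "\<dots> \<le> cpow (Suc n) (\<lambda>x. ennreal (norm (g x))) x"
    unfolding cpow.simps nconv_def using Suc.IH
    by (intro nn_integral_mono) (auto simp: norm_mult ennreal_mult intro!: mult_left_mono)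
  finally show ?case .
qed simp

text \<open>The equality case of the triangle inequality. After rotating by the conjugate phase of
  the integral, modulus minus real part is nonnegative with integral 0. For a vanishing integral
  \<open>sgn\<close> is 0, in agreement with the integrand being 0 almost everywhere.\<close>

lemma integral_norm_eq_phase:
  fixes \<phi> :: "'a \<Rightarrow> complex"
  assumes [measurable]: "\<phi> \<in> borel_measurable M"
    and eq: "ennreal (norm (LINT x|M. \<phi> x)) = (\<integral>\<^sup>+x. ennreal (norm (\<phi> x)) \<partial>M)"
  shows "AE x in M. \<phi> x = sgn (LINT x|M. \<phi> x) * complex_of_real (norm (\<phi> x))"
proof -
  let ?I = "LINT x|M. \<phi> x"
  have int: "integrable M \<phi>" using eq[symmetric] by (intro integrableI_bounded) auto
  have nI: "(LINT x|M. norm (\<phi> x)) = norm ?I"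
    using eq int by (subst (asm) nn_integral_eq_integral) auto
  show ?thesis
  proof (cases "?I = 0")
    case True
    then have "(LINT x|M. norm (\<phi> x)) = 0" using nI by simp
    then have "AE x in M. norm (\<phi> x) = 0"
      by (subst (asm) integral_nonneg_eq_0_iff_AE) (use int in auto)
    then show ?thesis by eventually_elim simp
  next
    case False
    define c where "c = sgn ?I"
    have c: "norm c = 1" using False by (simp add: c_def norm_sgn)
    have c2: "?I = c * norm ?I" by (simp add: c_def sgn_eq)
    have cc: "cnj c * c = 1" using c by (simp add: complex_norm_square[symmetric] mult.commute)
    have "(LINT x|M. norm (\<phi> x) - Re (cnj c * \<phi> x)) = (LINT x|M. norm (\<phi> x)) - (LINT x|M. Re (cnj c * \<phi> x))"
      by (intro Bochner_Integration.integral_diff integrable_norm int integrable_Re integrable_mult_right)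
    also have "(LINT x|M. Re (cnj c * \<phi> x)) = Re (cnj c * ?I)"
      using int by simp
    also have "cnj c * ?I = norm ?I" by (subst c2) (simp add: mult.assoc[symmetric] cc)
    finally have "(LINT x|M. norm (\<phi> x) - Re (cnj c * \<phi> x)) = 0" using nI by simp
    moreover have nn: "norm (\<phi> x) - Re (cnj c * \<phi> x) \<ge> 0" for x
      using complex_Re_le_cmod[of "cnj c * \<phi> x"] c(1) by (simp add: norm_mult)
    ultimately have "AE x in M. norm (\<phi> x) - Re (cnj c * \<phi> x) = 0"
      by (subst (asm) integral_nonneg_eq_0_iff_AE) (use int in \<open>auto intro!: Bochner_Integration.integrable_diff integrable_Re\<close>)
    then show ?thesis
    proof eventually_elim
      case (elim x)
      define w where "w = cnj c * \<phi> x"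
      have n: "norm w = norm (\<phi> x)" using c(1) by (simp add: norm_mult w_def)
      have re: "Re w = norm w" using elim n unfolding w_def by linarith
      then have "Im w = 0" using cmod_power2[of w] by simp
      with re n have "w = complex_of_real (norm (\<phi> x))" by (simp add: complex_eq_iff)
      then have "c * w = c * complex_of_real (norm (\<phi> x))" by simp
      moreover have "c * w = (cnj c * c) * \<phi> x" by (simp add: w_def mult_ac)
      ultimately show ?case unfolding cc c_def[symmetric] by simp
    qed
  qed
qed

text \<open>Absence of cancellation in the convolution power. As the left side is finite, this
  includes finiteness of the power of the modulus almost everywhere.\<close>

definition tight :: "nat \<Rightarrow> ('a::euclidean_space \<Rightarrow> complex) \<Rightarrow> bool" where
  "tight n g \<longleftrightarrow> (AE x in lborel. ennreal (norm (ccpow n g x)) = cpow n (\<lambda>x. ennreal (norm (g x))) x)"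

lemma tight_of_square:
  assumes [measurable]: "g \<in> borel_measurable borel"
    and eq: "(\<integral>\<^sup>+x. (ennreal (norm (ccpow n g x)))\<^sup>2 \<partial>lborel) = (\<integral>\<^sup>+x. (cpow n (\<lambda>x. ennreal (norm (g x))) x)\<^sup>2 \<partial>lborel)"
    and fin: "(\<integral>\<^sup>+x. (cpow n (\<lambda>x. ennreal (norm (g x))) x)\<^sup>2 \<partial>lborel) < \<infinity>"
  shows "tight n g"
proof -
  have "AE x in lborel. (ennreal (norm (ccpow n g x)))\<^sup>2 = (cpow n (\<lambda>x. ennreal (norm (g x))) x)\<^sup>2 \<and> (cpow n (\<lambda>x. ennreal (norm (g x))) x)\<^sup>2 < \<infinity>"
    by (rule eq_AE_of_nn_integral_eq[OF _ _ _ eq fin]) (auto intro!: power_mono norm_ccpow_le)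
  then show ?thesis unfolding tight_def
  proof eventually_elim
    case (elim x)
    then obtain r where r: "cpow n (\<lambda>x. ennreal (norm (g x))) x = ennreal r" "0 \<le> r"
      by (cases "cpow n (\<lambda>x. ennreal (norm (g x))) x") (auto simp: power2_eq_square)
    with elim have "ennreal ((norm (ccpow n g x))\<^sup>2) = ennreal (r\<^sup>2)" by (simp add: ennreal_power)
    then have "(norm (ccpow n g x))\<^sup>2 = r\<^sup>2" using r(2) by (subst (asm) ennreal_inj) auto
    then show ?case using r by (simp add: power2_eq_iff_nonneg)
  qed
qed

text \<open>Absence of cancellation at \<open>x\<close> for the longer power forces it for the
  shorter one at \<open>x - y\<close>, for almost every \<open>y\<close> with \<open>g y\<close>
  nonzero. After a shear the condition sits at a fixed point, and a bad point would make
  \<open>g\<close> vanish almost everywhere.\<close>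

lemma tight_descend:
  fixes g :: "'a::euclidean_space \<Rightarrow> complex"
  assumes [measurable]: "g \<in> borel_measurable borel" and nz: "\<not> (AE x in lborel. g x = 0)"
    and t: "tight (Suc n) g"
  shows "tight n g"
proof -
  let ?F = "\<lambda>x. ennreal (norm (g x))"
  define Q where "Q x \<longleftrightarrow> ennreal (norm (ccpow n g x)) = cpow n ?F x" for x
  have Qm: "Measurable.pred borel Q" unfolding Q_def by measurable
  note [measurable] = Qm
  have Zm [measurable]: "Measurable.pred (borel \<Otimes>\<^sub>M borel) (\<lambda>(x, y). norm (g y) > 0 \<longrightarrow> Q (x - y))"
    "Measurable.pred (borel \<Otimes>\<^sub>M borel) (\<lambda>(x, y). norm (g (x - y)) > 0 \<longrightarrow> Q y)" by measurable
  have "AE x in lborel. AE y in lborel. norm (g y) > 0 \<longrightarrow> Q (x - y)"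
    using t unfolding tight_def
  proof eventually_elim
    case (elim x)
    have "(\<integral>\<^sup>+y. ?F y * ennreal (norm (ccpow n g (x - y))) \<partial>lborel) \<ge> ennreal (norm (ccpow (Suc n) g x))"
      using norm_integral_le_nn_integral[of lborel "\<lambda>y. g y * ccpow n g (x - y)"] by (simp add: cconv_def norm_mult ennreal_mult)
    moreover have "(\<integral>\<^sup>+y. ?F y * ennreal (norm (ccpow n g (x - y))) \<partial>lborel) \<le> (\<integral>\<^sup>+y. ?F y * cpow n ?F (x - y) \<partial>lborel)"
      by (intro nn_integral_mono mult_left_mono norm_ccpow_le) auto
    ultimately have eq: "(\<integral>\<^sup>+y. ?F y * ennreal (norm (ccpow n g (x - y))) \<partial>lborel) = (\<integral>\<^sup>+y. ?F y * cpow n ?F (x - y) \<partial>lborel)"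
      using elim by (intro antisym) (auto simp: nconv_def)
    moreover have fin: "(\<integral>\<^sup>+y. ?F y * cpow n ?F (x - y) \<partial>lborel) < \<infinity>"
      using elim unfolding cpow.simps nconv_def by (metis ennreal_less_top infinity_ennreal_def)
    ultimately have "AE y in lborel. ?F y * ennreal (norm (ccpow n g (x - y))) = ?F y * cpow n ?F (x - y) \<and> ?F y * cpow n ?F (x - y) < \<infinity>"
      by (intro eq_AE_of_nn_integral_eq) (auto intro!: mult_left_mono norm_ccpow_le)
    then show ?case
      by eventually_elim (auto simp: Q_def ennreal_mult_cancel_left)
  qed
  then have "AE x in lborel. AE y in lborel. norm (g (x - y)) > 0 \<longrightarrow> Q y"
    using AE_pair_shear[OF Zm(1)] by simp
  then have "AE y in lborel. AE x in lborel. norm (g (x - y)) > 0 \<longrightarrow> Q y"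
    using AE_pair_swap[OF Zm(2)] by simp
  then show ?thesis unfolding tight_def Q_def[symmetric]
  proof eventually_elim
    case (elim y)
    show ?case
    proof (rule ccontr)
      assume "\<not> Q y"
      then have "AE x in lborel. g (x - y) = 0" using elim by auto
      from AE_lborel_translate[OF this, of y] have "AE x in lborel. g x = 0" by simp
      with nz show False ..
    qed
  qed
qed

lemma tight_one:
  assumes "g \<in> borel_measurable borel" "\<not> (AE x in lborel. g x = 0)" "tight n g" "n \<ge> 1"
  shows "tight 1 g"
  using assms(4,3)
proof (induction n rule: dec_induct)
  case (step n)
  then show ?case using tight_descend[OF assms(1,2)] by blast
qed

text \<open>The multiplicative Cauchy equation: the phase of the product depends on the sum
  \<open>x\<close> of the two arguments alone.\<close>

lemma tight_phase:
  assumes [measurable]: "g \<in> borel_measurable borel" and t: "tight 1 g"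
  shows "AE x in lborel. AE y in lborel. g y * g (x - y) = sgn (cconv g g x) * complex_of_real (norm (g y) * norm (g (x - y)))"
  using t unfolding tight_def
proof eventually_elim
  case (elim x)
  have "AE y in lborel. g y * g (x - y) = sgn (LINT y|lborel. g y * g (x - y)) * complex_of_real (norm (g y * g (x - y)))"
    by (rule integral_norm_eq_phase) (use elim in \<open>auto simp: cconv_def nconv_def norm_mult ennreal_mult\<close>)
  then show ?case by (simp add: cconv_def norm_mult)
qed

lemma continuous_translate_integral:
  fixes \<psi> C :: "'a::euclidean_space \<Rightarrow> complex"
  assumes \<psi>: "integrable lborel \<psi>" and [measurable]: "C \<in> borel_measurable borel" and C: "\<And>x. norm (C x) \<le> 1"
  shows "continuous_on UNIV (\<lambda>x. LINT z|lborel. C z * \<psi> (z - x))"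
proof (rule continuous_on_sequentiallyI)
  fix u :: "nat \<Rightarrow> 'a" and a :: 'a assume u: "u \<longlonglongrightarrow> a"
  have [measurable]: "\<psi> \<in> borel_measurable borel" using \<psi> by auto
  have i\<psi>: "integrable lborel (\<lambda>z. \<psi> (z - x))" for x
  proof (rule integrableI_bounded)
    have "(\<integral>\<^sup>+z. ennreal (norm (\<psi> (z - x))) \<partial>lborel) = (\<integral>\<^sup>+z. ennreal (norm (\<psi> z)) \<partial>lborel)"
      using nn_integral_lborel_translate[of "\<lambda>z. ennreal (norm (\<psi> z))" "-x"] by simp
    then show "(\<integral>\<^sup>+z. ennreal (norm (\<psi> (z - x))) \<partial>lborel) < \<infinity>" using \<psi> by (simp add: integrable_iff_bounded)
  qed measurable
  have int: "integrable lborel (\<lambda>z. C z * \<psi> (z - x))" for x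
    by (rule Bochner_Integration.integrable_bound[OF i\<psi>[of x]])
       (use C in \<open>auto simp: norm_mult intro!: mult_left_le_one_le\<close>)
  have "(\<lambda>n. a - u n) \<longlonglongrightarrow> 0" using tendsto_diff[OF tendsto_const u, of a] by simp
  then have l: "(\<lambda>n. \<integral>\<^sup>+z. ennreal (norm (\<psi> (a - u n + z) - \<psi> z)) \<partial>lborel) \<longlonglongrightarrow> 0"
    using translation_continuous_integrable[OF \<psi>] by (simp add: translation_continuous_def)
  have le: "ennreal (norm ((LINT z|lborel. C z * \<psi> (z - u n)) - (LINT z|lborel. C z * \<psi> (z - a))))
     \<le> (\<integral>\<^sup>+z. ennreal (norm (\<psi> (a - u n + z) - \<psi> z)) \<partial>lborel)" for n
  proof -
    have "(LINT z|lborel. C z * \<psi> (z - u n)) - (LINT z|lborel. C z * \<psi> (z - a)) = (LINT z|lborel. C z * \<psi> (z - u n) - C z * \<psi> (z - a))"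
      by (rule Bochner_Integration.integral_diff[symmetric]) (rule int)+
    then have "ennreal (norm ((LINT z|lborel. C z * \<psi> (z - u n)) - (LINT z|lborel. C z * \<psi> (z - a)))) \<le> (\<integral>\<^sup>+z. ennreal (norm (C z * \<psi> (z - u n) - C z * \<psi> (z - a))) \<partial>lborel)"
      by (simp only: norm_integral_le_nn_integral)
    also have "\<dots> \<le> (\<integral>\<^sup>+z. ennreal (norm (\<psi> (z - u n) - \<psi> (z - a))) \<partial>lborel)"
    proof (intro nn_integral_mono ennreal_leI)
      fix z
      have "norm (C z * \<psi> (z - u n) - C z * \<psi> (z - a)) = norm (C z) * norm (\<psi> (z - u n) - \<psi> (z - a))"
        by (simp flip: norm_mult right_diff_distrib)
      then show "norm (C z * \<psi> (z - u n) - C z * \<psi> (z - a)) \<le> norm (\<psi> (z - u n) - \<psi> (z - a))"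
        using C[of z] by (simp add: mult_left_le_one_le)
    qed
    also have "\<dots> = (\<integral>\<^sup>+z. ennreal (norm (\<psi> (a - u n + z) - \<psi> z)) \<partial>lborel)"
      using nn_integral_lborel_translate[of "\<lambda>z. ennreal (norm (\<psi> (a - u n + z) - \<psi> z))" "- a"]
      by simp
    finally show ?thesis .
  qed
  have "(\<lambda>n. norm ((LINT z|lborel. C z * \<psi> (z - u n)) - (LINT z|lborel. C z * \<psi> (z - a)))) \<longlonglongrightarrow> 0"
  proof (rule tendsto_ennrealD)
    show "(\<lambda>n. ennreal (norm ((LINT z|lborel. C z * \<psi> (z - u n)) - (LINT z|lborel. C z * \<psi> (z - a))))) \<longlonglongrightarrow> ennreal 0"
      using tendsto_sandwich[OF _ always_eventually[OF allI[OF le]] tendsto_const[of 0] l] by simp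
  qed auto
  then show "(\<lambda>n. LINT z|lborel. C z * \<psi> (z - u n)) \<longlonglongrightarrow> (LINT z|lborel. C z * \<psi> (z - a))"
    by (simp add: LIM_zero_iff tendsto_norm_zero_iff)
qed

section \<open>Characters on a ball\<close>

lemma AE_open_continuous_eq:
  fixes f g :: "'a::euclidean_space \<Rightarrow> 'b::real_normed_vector"
  assumes "open U" "continuous_on U f" "continuous_on U g" and ae: "AE x in lborel. x \<in> U \<longrightarrow> f x = g x" and x: "x \<in> U"
  shows "f x = g x"
proof (rule ccontr)
  assume ne: "f x \<noteq> g x"
  define V where "V = U \<inter> (\<lambda>x. f x - g x) -` (- {0})"
  have V: "open V" unfolding V_def
    by (intro continuous_open_preimage continuous_intros assms)
  have "x \<in> V" using ne x by (simp add: V_def)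
  have "AE x in lborel. x \<notin> V" using ae by eventually_elim (auto simp: V_def)
  then have "emeasure lborel V = 0" using V by (subst (asm) AE_iff_measurable[of V]) auto
  moreover obtain e where e: "e > 0" "ball x e \<subseteq> V" using V \<open>x \<in> V\<close> openE by blast
  ultimately have "emeasure lborel (ball x e) = 0"
    using emeasure_mono[OF e(2), of lborel] V by simp
  moreover have "unit_ball_vol (real DIM('a)) > 0" by simp
  ultimately show False using e by (simp add: emeasure_ball del: unit_ball_vol_pos)
qed

text \<open>Homogeneity comes first, because the midpoint equation keeps all points inside
  \<open>B\<close>; it turns midpoints into sums. Coordinates are then added one by one. The partial
  sums of the coordinate expansion have norm at most that of \<open>x\<close>, so they never leave
  \<open>B\<close>.\<close>

lemma additive_on_ball:
  fixes L :: "'a::euclidean_space \<Rightarrow> complex" and \<rho> :: ereal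
  defines "B \<equiv> {x. ereal (norm x) < \<rho>}"
  assumes \<rho>: "0 < \<rho>" and cont: "continuous_on B L" and L0: "L 0 = 0"
    and mid: "\<And>x y. x \<in> B \<Longrightarrow> y \<in> B \<Longrightarrow> L ((1/2) *\<^sub>R (x + y)) = (L x + L y) / 2"
  shows "\<exists>\<kappa>. \<forall>x\<in>B. L x = (\<Sum>b\<in>Basis. of_real (x \<bullet> b) * \<kappa> b)"
proof -
  have B_le: "y \<in> B" if "x \<in> B" "norm y \<le> norm x" for x y
    using that by (auto simp: B_def intro: le_less_trans[of _ "ereal (norm x)"])
  have B0: "0 \<in> B" using \<rho> by (simp add: B_def zero_ereal_def)
  have hom: "L (t *\<^sub>R x) = of_real t * L x" if x: "x \<in> B" and t: "0 \<le> t" "t \<le> 1" for x t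
  proof -
    \<comment> \<open>The deviation from homogeneity satisfies the midpoint equation and vanishes at
      both ends of the unit interval; a maximum argument shows that it is zero.\<close>
    define f where "f t = L (t *\<^sub>R x) - of_real t * L x" for t
    have tB: "t *\<^sub>R x \<in> B" if "0 \<le> t" "t \<le> 1" for t
      by (rule B_le[OF x]) (use that in \<open>simp add: mult_left_le_one_le\<close>)
    have cf: "continuous_on {0..1} (\<lambda>t. norm (f t))" unfolding f_def
      by (intro continuous_intros continuous_on_compose2[OF cont]) (use tB in auto)
    have fm: "f ((s + t) / 2) = (f s + f t) / 2" if "0 \<le> s" "s \<le> 1" "0 \<le> t" "t \<le> 1" for s t
    proof -
      have "(1/2) *\<^sub>R (s *\<^sub>R x + t *\<^sub>R x) = ((s + t) / 2) *\<^sub>R x"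
        by (simp add: scaleR_add_right scaleR_add_left[symmetric] add_divide_distrib)
      then have "L (((s + t) / 2) *\<^sub>R x) = (L (s *\<^sub>R x) + L (t *\<^sub>R x)) / 2"
        using mid[OF tB[OF that(1,2)] tB[OF that(3,4)]] by simp
      then show ?thesis unfolding f_def by (simp add: add_divide_distrib diff_divide_distrib algebra_simps)
    qed
    have f01: "f 0 = 0" "f 1 = 0" by (simp_all add: f_def L0)
    obtain m where m: "m \<in> {0..1}" "\<And>t. t \<in> {0..1} \<Longrightarrow> norm (f t) \<le> norm (f m)"
      using continuous_attains_sup[OF _ _ cf] by auto
    \<comment> \<open>The largest symmetric step around the maximum \<open>m\<close>: one of
      \<open>m - \<delta>\<close>, \<open>m + \<delta>\<close> is an endpoint, where
      \<open>f\<close> vanishes, so the maximum is at most half of itself.\<close>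
    define \<delta> where "\<delta> = min m (1 - m)"
    have b: "0 \<le> m - \<delta>" "m + \<delta> \<le> 1" "0 \<le> \<delta>" "m - \<delta> = 0 \<or> m + \<delta> = 1" using m(1) by (auto simp: \<delta>_def min_def)
    have "f m = (f (m - \<delta>) + f (m + \<delta>)) / 2" using fm[of "m - \<delta>" "m + \<delta>"] b by simp
    from arg_cong[OF this, of norm] have "norm (f m) = norm (f (m - \<delta>) + f (m + \<delta>)) / 2"
      by (simp only: norm_divide norm_numeral)
    then have "norm (f m) \<le> (norm (f (m - \<delta>)) + norm (f (m + \<delta>))) / 2"
      using norm_triangle_ineq[of "f (m - \<delta>)" "f (m + \<delta>)"] by simp
    also have "\<dots> \<le> norm (f m) / 2" using b f01 m(2)[of "m - \<delta>"] m(2)[of "m + \<delta>"] by auto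
    finally have "norm (f m) = 0" by simp
    then have "f t = 0" using m(2)[of t] t by simp
    then show ?thesis by (simp add: f_def)
  qed
  have neg: "L (- x) = - L x" if "x \<in> B" for x
  proof -
    have "- x \<in> B" using that by (simp add: B_def)
    from mid[OF that this] L0 show ?thesis by (simp add: add_eq_0_iff)
  qed
  have add: "L (x + y) = L x + L y" if "x \<in> B" "y \<in> B" "x + y \<in> B" for x y
  proof -
    have "L (x + y) = 2 * L ((1/2) *\<^sub>R (x + y))" using hom[OF that(3), of "1/2"] by (simp add: mult.commute)
    also have "\<dots> = L x + L y" unfolding mid[OF that(1,2)] by simp
    finally show ?thesis .
  qed
  obtain \<epsilon> :: real where \<epsilon>: "0 < \<epsilon>" "ereal \<epsilon> < \<rho>"
    using ereal_dense2[OF \<rho>] by (auto simp: zero_ereal_def)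
  have bB: "\<epsilon> *\<^sub>R b \<in> B" if "b \<in> Basis" for b using \<epsilon> that by (simp add: B_def)
  \<comment> \<open>Basis vectors may lie outside \<open>B\<close>; their multiples by
    \<open>\<epsilon>\<close> do not.\<close>
  define \<kappa> where "\<kappa> b = L (\<epsilon> *\<^sub>R b) / of_real \<epsilon>" for b
  have line: "L (c *\<^sub>R b) = of_real c * \<kappa> b" if b: "b \<in> Basis" and c: "c *\<^sub>R b \<in> B" for b c
  proof -
    have pos: "L (c *\<^sub>R b) = of_real c * \<kappa> b" if c0: "0 \<le> c" and c: "c *\<^sub>R b \<in> B" for c
    proof (cases "c \<le> \<epsilon>")
      case True
      have "L (c *\<^sub>R b) = L ((c / \<epsilon>) *\<^sub>R (\<epsilon> *\<^sub>R b))" using \<epsilon> by simp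
      also have "\<dots> = of_real (c / \<epsilon>) * L (\<epsilon> *\<^sub>R b)" by (rule hom[OF bB[OF b]]) (use True \<epsilon> c0 in auto)
      finally show ?thesis by (simp add: \<kappa>_def)
    next
      case False
      have "L (\<epsilon> *\<^sub>R b) = L ((\<epsilon> / c) *\<^sub>R (c *\<^sub>R b))" using False \<epsilon> by simp
      also have "\<dots> = of_real (\<epsilon> / c) * L (c *\<^sub>R b)" by (rule hom[OF c]) (use False \<epsilon> c0 in auto)
      finally show ?thesis using False \<epsilon> by (simp add: \<kappa>_def)
    qed
    show ?thesis
    proof (cases "0 \<le> c")
      case True
      then show ?thesis using pos c by simp
    next
      case False
      have c': "(- c) *\<^sub>R b \<in> B" using c by (simp add: B_def)
      have "L ((- c) *\<^sub>R b) = of_real (- c) * \<kappa> b" using False by (intro pos c') simp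
      moreover have "L ((- c) *\<^sub>R b) = - L (c *\<^sub>R b)" using neg[OF c] by simp
      ultimately show ?thesis by (simp add: minus_equation_iff)
    qed
  qed
  have "L x = (\<Sum>b\<in>Basis. of_real (x \<bullet> b) * \<kappa> b)" if x: "x \<in> B" for x
  proof -
    have part: "norm (\<Sum>b\<in>A. (x \<bullet> b) *\<^sub>R b) \<le> norm x" if "A \<subseteq> Basis" for A
    proof -
      have fA: "finite A" using that finite_Basis finite_subset by blast
      have "(\<Sum>b\<in>A. (x \<bullet> b) *\<^sub>R b) \<bullet> c = (if c \<in> A then x \<bullet> c else 0)" if "c \<in> Basis" for c
      proof -
        have "(\<Sum>b\<in>A. (x \<bullet> b) *\<^sub>R b) \<bullet> c = (\<Sum>b\<in>A. if b = c then x \<bullet> c else 0)"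
          unfolding inner_sum_left using \<open>A \<subseteq> Basis\<close> that by (intro sum.cong) (auto simp: inner_Basis)
        then show ?thesis using fA by simp
      qed
      then show ?thesis by (intro norm_le_componentwise) auto
    qed
    have "L (\<Sum>b\<in>A. (x \<bullet> b) *\<^sub>R b) = (\<Sum>b\<in>A. of_real (x \<bullet> b) * \<kappa> b)" if "A \<subseteq> Basis" for A
    proof -
      have "finite A" using that finite_Basis finite_subset by blast
      then show ?thesis using that
      proof (induction A)
        case empty
        then show ?case by (simp add: L0)
      next
        case (insert a A)
        have 1: "(x \<bullet> a) *\<^sub>R a \<in> B" using part[of "{a}"] insert.prems B_le[OF x] by simp
        have 2: "(\<Sum>b\<in>A. (x \<bullet> b) *\<^sub>R b) \<in> B" using part[of A] insert.prems B_le[OF x] by simp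
        have 3: "(x \<bullet> a) *\<^sub>R a + (\<Sum>b\<in>A. (x \<bullet> b) *\<^sub>R b) \<in> B" using part[of "insert a A"] insert B_le[OF x] by simp
        show ?case using add[OF 1 2 3] line[OF _ 1] insert by simp
      qed
    qed
    from this[of Basis] show ?thesis by (simp add: euclidean_representation)
  qed
  then show ?thesis by blast
qed

text \<open>\<open>B\<close> is convex, hence contractible, so \<open>v\<close> has a continuous
  logarithm \<open>G\<close> there. The multiplicative equation becomes a midpoint equation for
  \<open>G\<close> up to multiples of \<open>2 * pi * \<i>\<close>, and connectedness removes
  these.\<close>

lemma continuous_character_on_ball:
  fixes v :: "'a::euclidean_space \<Rightarrow> complex" and \<rho> :: ereal
  defines "B \<equiv> {x. ereal (norm x) < \<rho>}"
  assumes \<rho>: "0 < \<rho>" and cont: "continuous_on B v" and nv: "\<And>x. x \<in> B \<Longrightarrow> norm (v x) = 1"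
    and mid: "\<And>x y. x \<in> B \<Longrightarrow> y \<in> B \<Longrightarrow> v x * v y = (v ((1/2) *\<^sub>R (x + y)))\<^sup>2"
  shows "\<exists>(\<alpha>::real) w. \<forall>x\<in>B. v x = exp (\<i> * of_real (\<alpha> + x \<bullet> w))"
proof -
  have convB: "convex B"
  proof (cases \<rho>)
    case (real r)
    then have "B = ball 0 r" by (auto simp: B_def)
    then show ?thesis by simp
  qed (use \<rho> in \<open>auto simp: B_def\<close>)
  have B0: "0 \<in> B" using \<rho> by (simp add: B_def zero_ereal_def)
  have midB: "(1/2) *\<^sub>R (x + y) \<in> B" if "x \<in> B" "y \<in> B" for x y
    using convexD[OF convB that, of "1/2" "1/2"] by (simp add: scaleR_add_right)
  obtain G where G: "continuous_on B G" "\<And>x. x \<in> B \<Longrightarrow> v x = exp (G x)"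
    using continuous_logarithm_on_contractible[OF cont convex_imp_contractible[OF convB]] nv by (metis norm_zero zero_neq_one)
  \<comment> \<open>The defect in the midpoint equation: continuous, with values in a discrete set,
    and zero at the origin.\<close>
  define D where "D p = G (fst p) + G (snd p) - 2 * G ((1/2) *\<^sub>R (fst p + snd p))" for p
  have cD: "continuous_on (B \<times> B) D" unfolding D_def
    by (intro continuous_intros continuous_on_compose2[OF G(1)]) (auto intro: midB)
  have Dint: "\<exists>n::int. D p = 2 * of_int n * of_real pi * \<i>" if p: "p \<in> B \<times> B" for p
  proof -
    obtain x y where xy: "p = (x, y)" "x \<in> B" "y \<in> B" using p by auto
    have "exp (G x + G y) = exp (2 * G ((1/2) *\<^sub>R (x + y)))"
      using mid[OF xy(2,3)] G(2) xy midB by (simp add: exp_add exp_double)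
    then obtain n :: int where "G x + G y = 2 * G ((1/2) *\<^sub>R (x + y)) + of_int (2 * n) * of_real pi * \<i>"
      by (auto simp: exp_eq)
    then show ?thesis by (intro exI[of _ n]) (simp add: D_def xy)
  qed
  have "connected (B \<times> B)" by (intro convex_connected convex_Times convB)
  then have "D constant_on (B \<times> B)"
  proof (rule continuous_discrete_range_constant[OF _ cD])
    fix p assume p: "p \<in> B \<times> B"
    show "\<exists>e>0. \<forall>q. q \<in> B \<times> B \<and> D q \<noteq> D p \<longrightarrow> e \<le> norm (D q - D p)"
    proof (intro exI[of _ "2 * pi"] conjI allI impI)
      fix q assume q: "q \<in> B \<times> B \<and> D q \<noteq> D p"
      obtain n m :: int where nm: "D p = 2 * of_int n * of_real pi * \<i>" "D q = 2 * of_int m * of_real pi * \<i>"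
        using Dint p q by metis
      then have "m \<noteq> n" using q by auto
      then have "1 \<le> \<bar>real_of_int (m - n)\<bar>" by linarith
      moreover have "D q - D p = of_real (2 * pi * real_of_int (m - n)) * \<i>" unfolding nm by (simp add: algebra_simps)
      then have "norm (D q - D p) = 2 * pi * \<bar>real_of_int (m - n)\<bar>" by (simp only: norm_mult norm_of_real norm_ii) (simp add: abs_mult)
      ultimately show "2 * pi \<le> norm (D q - D p)" by simp
    qed simp
  qed
  moreover have "D (0, 0) = 0" by (simp add: D_def)
  ultimately have D0: "D p = 0" if "p \<in> B \<times> B" for p using that B0 unfolding constant_on_def by (metis SigmaI)
  have "\<exists>\<kappa>. \<forall>x\<in>B. G x - G 0 = (\<Sum>b\<in>Basis. of_real (x \<bullet> b) * \<kappa> b)"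
    unfolding B_def
  proof (rule additive_on_ball[OF \<rho>], fold B_def)
    show "continuous_on B (\<lambda>x. G x - G 0)" by (intro continuous_intros G)
    fix x y assume "x \<in> B" "y \<in> B"
    then show "G ((1/2) *\<^sub>R (x + y)) - G 0 = (G x - G 0 + (G y - G 0)) / 2"
      using D0[of "(x, y)"] by (simp add: D_def field_simps)
  qed simp
  then obtain \<kappa> where \<kappa>: "\<And>x. x \<in> B \<Longrightarrow> G x - G 0 = (\<Sum>b\<in>Basis. of_real (x \<bullet> b) * \<kappa> b)" by blast
  have ReG: "Re (G x) = 0" if "x \<in> B" for x
    using nv[OF that] G(2)[OF that] by (simp add: norm_exp_eq_Re)
  define w where "w = (\<Sum>b\<in>Basis. Im (\<kappa> b) *\<^sub>R b)"
  have "v x = exp (\<i> * of_real (Im (G 0) + x \<bullet> w))" if x: "x \<in> B" for x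
  proof -
    have "Im (G x - G 0) = x \<bullet> w"
      unfolding \<kappa>[OF x] w_def by (simp add: inner_sum_right mult.commute)
    then have "G x = \<i> * of_real (Im (G 0) + x \<bullet> w)"
      using ReG[OF x] by (simp add: complex_eq_iff)
    then show ?thesis using G(2)[OF x] by simp
  qed
  then show ?thesis by blast
qed

text \<open>Regularity first: multiplying the equation by the conjugate of one factor and averaging
  expresses \<open>u\<close> as an integral that is continuous in \<open>x\<close>. The continuous
  version satisfies the equation pointwise, since almost-everywhere identities between continuous
  functions on open sets hold everywhere.\<close>

theorem measurable_character_on_ball:
  fixes u C :: "'a::euclidean_space \<Rightarrow> complex" and \<rho> :: ereal
  defines "B \<equiv> {x. ereal (norm x) < \<rho>}"
  assumes \<rho>: "0 < \<rho>" and [measurable]: "u \<in> borel_measurable borel" "C \<in> borel_measurable borel"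
    and nu: "AE x in lborel. x \<in> B \<longrightarrow> norm (u x) = 1" and u1: "\<And>x. norm (u x) \<le> 1" and C1: "\<And>x. norm (C x) \<le> 1"
    and char: "AE x in lborel. AE y in lborel. y \<in> B \<longrightarrow> x - y \<in> B \<longrightarrow> u y * u (x - y) = C x"
  shows "\<exists>(\<alpha>::real) w. AE x in lborel. x \<in> B \<longrightarrow> u x = exp (\<i> * of_real (\<alpha> + x \<bullet> w))"
proof -
  have oB: "open B"
  proof (cases \<rho>)
    case (real r)
    then have "B = ball 0 r" by (auto simp: B_def)
    then show ?thesis by simp
  qed (auto simp: B_def)
  then have Bm [measurable]: "B \<in> sets borel" by simp
  have Bs: "- x \<in> B \<longleftrightarrow> x \<in> B" for x by (simp add: B_def)
  have pm: "Measurable.pred (borel \<Otimes>\<^sub>M borel) (\<lambda>(x, y). y \<in> B \<longrightarrow> x - y \<in> B \<longrightarrow> u y * u (x - y) = C x)"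
    "Measurable.pred (borel \<Otimes>\<^sub>M borel) (\<lambda>(y, x). y \<in> B \<longrightarrow> x - y \<in> B \<longrightarrow> u y * u (x - y) = C x)"
    "Measurable.pred (borel \<Otimes>\<^sub>M borel) (\<lambda>(y, x). y \<in> B \<longrightarrow> x \<in> B \<longrightarrow> u y * u x = C (y + x))"
    by measurable
  have char2: "AE y in lborel. AE x in lborel. y \<in> B \<longrightarrow> x \<in> B \<longrightarrow> u y * u x = C (y + x)"
    using char unfolding AE_pair_swap[OF pm(1)] AE_pair_shear_add[OF pm(2)] by (simp add: add.commute)
  \<comment> \<open>The average is taken over a ball of finite radius, as \<open>B\<close> may be
    the whole space.\<close>
  obtain \<epsilon> :: real where \<epsilon>: "0 < \<epsilon>" "ereal \<epsilon> < \<rho>"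
    using ereal_dense2[OF \<rho>] by (auto simp: zero_ereal_def)
  define W where "W = ball (0::'a) \<epsilon>"
  have WB: "W \<subseteq> B" using \<epsilon>(2) by (auto simp: W_def B_def intro: less_trans[of _ "ereal \<epsilon>"])
  have [measurable]: "W \<in> sets borel" by (simp add: W_def)
  define m where "m = measure lborel W"
  have m: "m > 0" "emeasure lborel W < \<infinity>"
  proof -
    have "unit_ball_vol (real DIM('a)) > 0" by simp
    then have e: "emeasure lborel W = ennreal (unit_ball_vol DIM('a) * \<epsilon> ^ DIM('a))" "unit_ball_vol DIM('a) * \<epsilon> ^ DIM('a) > 0"
      using \<epsilon>(1) by (auto simp: W_def emeasure_ball)
    then show "m > 0" "emeasure lborel W < \<infinity>" by (auto simp: m_def measure_def)
  qed
  define \<psi> where "\<psi> y = indicator W y * cnj (u y)" for y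
  have \<psi>m [measurable]: "\<psi> \<in> borel_measurable borel" unfolding \<psi>_def by measurable
  have \<psi>i: "integrable lborel \<psi>"
  proof (rule Bochner_Integration.integrable_bound[of lborel "indicator W :: 'a \<Rightarrow> real"])
    show "integrable lborel (indicator W :: 'a \<Rightarrow> real)" using m(2) by simp
  qed (use u1 in \<open>auto simp: \<psi>_def norm_mult split: split_indicator\<close>)
  \<comment> \<open>With \<open>z = x + y\<close> the integrand is
    \<open>C (x + y) * cnj (u y)\<close> for \<open>y\<close> in \<open>W\<close>, which equals
    \<open>u x\<close> because \<open>u y\<close> has modulus 1.\<close>
  define v where "v x = (LINT z|lborel. C z * \<psi> (z - x)) / of_real m" for x
  have cv: "continuous_on UNIV v" unfolding v_def
    by (intro continuous_on_divide continuous_translate_integral \<psi>i C1 continuous_on_const) (use m in auto)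
  have uv: "AE x in lborel. x \<in> B \<longrightarrow> u x = v x"
    using char2
  proof eventually_elim
    case (elim x)
    show ?case
    proof
      assume x: "x \<in> B"
      have "(LINT z|lborel. C z * \<psi> (z - x)) = (LINT y|lborel. C (x + y) * \<psi> (x + y - x))"
      proof -
        have "lborel = distr lborel borel (\<lambda>y. x + y)"
          using lborel_affine[of 1 x] by (simp add: density_1)
        then have "(LINT z|lborel. C z * \<psi> (z - x)) = (LINT z|distr lborel borel (\<lambda>y. x + y). C z * \<psi> (z - x))" by simp
        then show ?thesis by (subst (asm) integral_distr) auto
      qed
      also have "\<dots> = (LINT y|lborel. u x * of_real (indicator W y))"
      proof (rule integral_cong_AE)
        show "AE y in lborel. C (x + y) * \<psi> (x + y - x) = u x * of_real (indicator W y)"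
          using elim nu
        proof eventually_elim
          case (elim y)
          show ?case
          proof (cases "y \<in> W")
            case True
            then have "y \<in> B" using WB by auto
            then have "C (x + y) = u x * u y" "norm (u y) = 1" using elim x by auto
            moreover have "u y * cnj (u y) = 1" using \<open>norm (u y) = 1\<close> by (simp add: complex_norm_square[symmetric])
            ultimately show ?thesis using True by (simp add: \<psi>_def mult.assoc)
          qed (simp add: \<psi>_def)
        qed
      qed measurable
      also have "\<dots> = u x * of_real m" using m by (simp add: m_def)
      finally show "u x = v x" using m by (simp add: v_def)
    qed
  qed
  have nv: "norm (v x) = 1" if "x \<in> B" for x
  proof -
    have "AE x in lborel. x \<in> B \<longrightarrow> norm (v x) = 1" using uv nu by eventually_elim auto
    from AE_open_continuous_eq[OF oB _ _ this that] show ?thesis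
      by (auto intro!: continuous_intros continuous_on_subset[OF cv])
  qed
  have AEu: "AE y in lborel. x - y \<in> B \<longrightarrow> u (x - y) = v (x - y)" for x
  proof -
    have [measurable]: "v \<in> borel_measurable borel" using borel_measurable_continuous_onI[OF cv] .
    have "Measurable.pred borel (\<lambda>y. y \<in> B \<longrightarrow> u y = v y)" by measurable
    from AE_lborel_reflect[OF uv this] show ?thesis .
  qed
  \<comment> \<open>For almost every \<open>x\<close> the product equals \<open>C x\<close> for all
    admissible \<open>y\<close>, and \<open>y = x / 2\<close> identifies this constant.\<close>
  have good: "AE x in lborel. \<forall>y. y \<in> B \<longrightarrow> x - y \<in> B \<longrightarrow> v y * v (x - y) = (v ((1/2) *\<^sub>R x))\<^sup>2"
    using char
  proof eventually_elim
    case (elim x)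
    have ae: "AE y in lborel. y \<in> B \<inter> (\<lambda>y. x - y) -` B \<longrightarrow> v y * v (x - y) = C x"
      using elim uv AEu[of x] by eventually_elim auto
    have o: "open (B \<inter> (\<lambda>y. x - y) -` B)"
      by (intro open_Int oB continuous_open_vimage continuous_intros)
    have c: "continuous_on (B \<inter> (\<lambda>y. x - y) -` B) (\<lambda>y. v y * v (x - y))"
      by (intro continuous_intros continuous_on_compose2[OF cv]) auto
    have *: "v y * v (x - y) = C x" if "y \<in> B" "x - y \<in> B" for y
      using AE_open_continuous_eq[OF o c continuous_on_const ae] that by auto
    show ?case
    proof (intro allI impI)
      fix y assume y: "y \<in> B" "x - y \<in> B"
      have h: "x - (1/2) *\<^sub>R x = (1/2) *\<^sub>R x" by (simp add: scaleR_left_diff_distrib[of 1 "1/2" x, simplified, symmetric])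
      have "norm ((1/2) *\<^sub>R x) \<le> max (norm y) (norm (x - y))"
        using norm_triangle_ineq[of y "x - y"] by (simp add: max_def)
      then have "(1/2) *\<^sub>R x \<in> B" using y unfolding B_def mem_Collect_eq
        by (auto intro: le_less_trans[of _ "ereal (max (norm y) (norm (x - y)))"] simp: max_def split: if_splits)
      from *[OF this] this h have "v ((1/2) *\<^sub>R x) * v ((1/2) *\<^sub>R x) = C x" by simp
      with *[OF y] show "v y * v (x - y) = (v ((1/2) *\<^sub>R x))\<^sup>2" by (simp add: power2_eq_square)
    qed
  qed
  have mid: "v x * v y = (v ((1/2) *\<^sub>R (x + y)))\<^sup>2" if xy: "x \<in> B" "y \<in> B" for x y
  proof -
    \<comment> \<open>Shifting \<open>x\<close> and \<open>y\<close> by \<open>s z\<close> moves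
      their sum to \<open>z\<close>. The identity holds for almost every \<open>z\<close> near
      \<open>x + y\<close>, hence by continuity at \<open>z = x + y\<close>, where the shift is
      zero.\<close>
    define s where "s z = (1/2) *\<^sub>R (z - (x + y))" for z
    define U where "U = (\<lambda>z. x + s z) -` B \<inter> (\<lambda>z. y + s z) -` B"
    have cs: "continuous_on UNIV s" unfolding s_def by (intro continuous_intros)
    have oU: "open U" unfolding U_def
      by (intro open_Int continuous_open_vimage oB) (auto intro!: continuous_intros cs simp: s_def)
    have in_U: "x + y \<in> U" using xy by (simp add: U_def s_def)
    have ae: "AE z in lborel. z \<in> U \<longrightarrow> v (x + s z) * v (y + s z) = (v ((1/2) *\<^sub>R z))\<^sup>2"
      using good
    proof eventually_elim
      case (elim z)
      have "z - (x + s z) = y + s z"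
        by (simp add: s_def algebra_simps) (simp add: scaleR_left_distrib[symmetric])
      with elim[rule_format, of "x + s z"] show ?case by (auto simp: U_def)
    qed
    have "v (x + s (x + y)) * v (y + s (x + y)) = (v ((1/2) *\<^sub>R (x + y)))\<^sup>2"
      by (rule AE_open_continuous_eq[OF oU _ _ ae in_U])
         (auto intro!: continuous_intros continuous_on_compose2[OF cv] continuous_on_subset[OF cs])
    then show ?thesis by (simp add: s_def)
  qed
  have "\<exists>(\<alpha>::real) w. \<forall>x\<in>B. v x = exp (\<i> * of_real (\<alpha> + x \<bullet> w))"
    unfolding B_def by (rule continuous_character_on_ball[OF \<rho>], fold B_def)
      (use continuous_on_subset[OF cv] nv mid in auto)
  then obtain \<alpha> :: real and w where "\<And>x. x \<in> B \<Longrightarrow> v x = exp (\<i> * of_real (\<alpha> + x \<bullet> w))" by blast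
  with uv have "AE x in lborel. x \<in> B \<longrightarrow> u x = exp (\<i> * of_real (\<alpha> + x \<bullet> w))"
    by (auto elim!: eventually_mono)
  then show ?thesis by blast
qed

text \<open>On the ball both moduli in \<open>tight_phase\<close> are nonzero and cancel, leaving
  the equation for \<open>u = sgn g\<close>. Outside the ball the claim is trivial.\<close>

theorem tight_character:
  fixes g :: "'a::euclidean_space \<Rightarrow> complex" and \<rho> :: ereal
  assumes [measurable]: "g \<in> borel_measurable borel" and nz: "\<not> (AE x in lborel. g x = 0)"
    and t: "tight n g" "n \<ge> 1" and \<rho>: "AE x in lborel. 0 < norm (g x) \<longleftrightarrow> ereal (norm x) < \<rho>"
  shows "\<exists>(\<alpha>::real) w. AE x in lborel. g x = exp (\<i> * of_real (\<alpha> + x \<bullet> w)) * of_real (norm (g x))"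
proof -
  let ?B = "{x. ereal (norm x) < \<rho>}"
  have \<rho>0: "0 < \<rho>"
  proof (rule ccontr)
    assume n: "\<not> 0 < \<rho>"
    have "\<not> ereal (norm x) < \<rho>" for x :: 'a using n
      by (metis ereal_less_eq(5) le_less_trans norm_ge_zero not_le order.strict_trans1)
    then have "AE x in lborel. g x = 0" using \<rho> by (auto elim!: eventually_mono)
    with nz show False ..
  qed
  define u where "u x = sgn (g x)" for x
  have [measurable]: "u \<in> borel_measurable borel" unfolding u_def sgn_div_norm by measurable
  have ch: "AE x in lborel. AE y in lborel. y \<in> ?B \<longrightarrow> x - y \<in> ?B \<longrightarrow> u y * u (x - y) = sgn (cconv g g x)"
  proof -
    have p2: "Measurable.pred borel (\<lambda>x. 0 < norm (g x) \<longleftrightarrow> ereal (norm x) < \<rho>)" by measurable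
    have r: "AE y in lborel. 0 < norm (g (x - y)) \<longleftrightarrow> ereal (norm (x - y)) < \<rho>" for x
      by (rule AE_lborel_reflect[OF \<rho> p2])
    from tight_phase[OF assms(1) tight_one[OF assms(1) nz t]] show ?thesis
    proof eventually_elim
      case (elim x)
      then show ?case using \<rho> r[of x]
      proof eventually_elim
        case (elim y)
        show ?case
        proof (intro impI)
          assume y: "y \<in> ?B" "x - y \<in> ?B"
          let ?n = "complex_of_real (norm (g y) * norm (g (x - y)))"
          have "?n \<noteq> 0" using elim y by auto
          moreover have "u y * u (x - y) * ?n = sgn (cconv g g x) * ?n"
            using elim(1) unfolding u_def by (simp add: sgn_eq)
          ultimately show "u y * u (x - y) = sgn (cconv g g x)" by simp
        qed
      qed
    qed
  qed
  have Cm: "(\<lambda>x. sgn (cconv g g x)) \<in> borel_measurable borel" unfolding sgn_div_norm by measurable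
  have nu: "AE x in lborel. x \<in> ?B \<longrightarrow> norm (u x) = 1"
    using \<rho> by eventually_elim (auto simp: u_def norm_sgn)
  have n1: "norm (u x) \<le> 1" "norm (sgn (cconv g g x)) \<le> 1" for x by (simp_all add: u_def norm_sgn)
  obtain \<alpha> :: real and w where "AE x in lborel. x \<in> ?B \<longrightarrow> u x = exp (\<i> * of_real (\<alpha> + x \<bullet> w))"
    using measurable_character_on_ball[OF \<rho>0 \<open>u \<in> borel_measurable borel\<close> Cm nu n1 ch] by blast
  then have "AE x in lborel. g x = exp (\<i> * of_real (\<alpha> + x \<bullet> w)) * of_real (norm (g x))"
    using \<rho>
  proof eventually_elim
    case (elim x)
    show ?case
    proof (cases "g x = 0")
      case False
      then have "u x = exp (\<i> * of_real (\<alpha> + x \<bullet> w))" using elim by auto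
      moreover have "g x = u x * of_real (norm (g x))" by (simp add: u_def sgn_eq)
      ultimately show ?thesis by simp
    qed simp
  qed
  then show ?thesis by blast
qed

subsection \<open>Square integrable functions\<close>

lemma integral_lborel_translate:
  fixes f :: "'a::euclidean_space \<Rightarrow> 'b::{banach, second_countable_topology}"
  assumes [measurable]: "f \<in> borel_measurable borel"
  shows "(LINT x|lborel. f (a + x)) = (LINT x|lborel. f x)"
proof -
  have "lborel = distr lborel borel (\<lambda>x. a + x)"
    using lborel_affine[of 1 a] by (simp add: density_1)
  then have "(LINT x|lborel. f x) = (LINT x|distr lborel borel (\<lambda>x. a + x). f x)" by simp
  also have "\<dots> = (LINT x|lborel. f (a + x))" by (subst integral_distr) auto
  finally show ?thesis by simp
qed

lemma integral_lborel_reflect: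
  fixes f :: "'a::euclidean_space \<Rightarrow> 'b::{banach, second_countable_topology}"
  assumes [measurable]: "f \<in> borel_measurable borel"
  shows "(LINT x|lborel. f (a - x)) = (LINT x|lborel. f x)"
proof -
  have "lborel = distr lborel borel (\<lambda>x. a - x)"
    using lborel_affine[of "-1" a] by (simp add: density_1)
  then have "(LINT x|lborel. f x) = (LINT x|distr lborel borel (\<lambda>x. a - x). f x)" by simp
  also have "\<dots> = (LINT x|lborel. f (a - x))" by (subst integral_distr) auto
  finally show ?thesis by simp
qed

lemma integral_lborel_scale:
  fixes f :: "'a::euclidean_space \<Rightarrow> 'b::{banach, second_countable_topology}"
  assumes [measurable]: "f \<in> borel_measurable borel" and c: "c > 0"
  shows "(LINT x|lborel. f x) = c ^ DIM('a) *\<^sub>R (LINT x|lborel. f (c *\<^sub>R x))"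
proof -
  have "(lborel :: 'a measure) = density (distr lborel borel (\<lambda>x. c *\<^sub>R x)) (\<lambda>_. ennreal (c ^ DIM('a)))"
    using lborel_affine[of c "0::'a"] c by simp
  then have "(LINT x|lborel. f x) = (LINT x|density (distr lborel borel (\<lambda>x. c *\<^sub>R x)) (\<lambda>_. ennreal (c ^ DIM('a))). f x)" by simp
  also have "\<dots> = (LINT x|distr lborel borel (\<lambda>x. c *\<^sub>R x). c ^ DIM('a) *\<^sub>R f x)"
    using c by (subst integral_density) auto
  also have "\<dots> = (LINT x|lborel. c ^ DIM('a) *\<^sub>R f (c *\<^sub>R x))" by (subst integral_distr) auto
  finally show ?thesis by simp
qed

lemma integrable_lborel_translate:
  fixes f :: "'a::euclidean_space \<Rightarrow> 'b::{banach, second_countable_topology}"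
  assumes "integrable lborel f"
  shows "integrable lborel (\<lambda>x. f (a + x))" "integrable lborel (\<lambda>x. f (a - x))"
proof -
  have [measurable]: "f \<in> borel_measurable borel" using assms by auto
  show "integrable lborel (\<lambda>x. f (a + x))" "integrable lborel (\<lambda>x. f (a - x))"
    using assms unfolding integrable_iff_bounded
    using nn_integral_lborel_translate[of "\<lambda>x. ennreal (norm (f x))" a] nn_integral_lborel_reflect[of "\<lambda>x. ennreal (norm (f x))" a] by auto
qed

lemma integral_lborel_commute:
  fixes F :: "'a::euclidean_space \<Rightarrow> 'b::euclidean_space \<Rightarrow> complex"
  assumes [measurable]: "(\<lambda>(x, y). F x y) \<in> borel_measurable (lborel \<Otimes>\<^sub>M lborel)"
    and fin: "(\<integral>\<^sup>+x. \<integral>\<^sup>+y. ennreal (norm (F x y)) \<partial>lborel \<partial>lborel) < \<infinity>"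
  shows "(LINT x|lborel. LINT y|lborel. F x y) = (LINT y|lborel. LINT x|lborel. F x y)"
proof -
  have "integrable (lborel \<Otimes>\<^sub>M lborel) (\<lambda>(x, y). F x y)"
  proof (rule integrableI_bounded)
    have "(\<integral>\<^sup>+p. ennreal (norm (case p of (x, y) \<Rightarrow> F x y)) \<partial>(lborel \<Otimes>\<^sub>M lborel)) = (\<integral>\<^sup>+x. \<integral>\<^sup>+y. ennreal (norm (F x y)) \<partial>lborel \<partial>lborel)"
      by (subst lborel.nn_integral_fst[symmetric]) (auto simp: case_prod_beta)
    then show "(\<integral>\<^sup>+p. ennreal (norm (case p of (x, y) \<Rightarrow> F x y)) \<partial>(lborel \<Otimes>\<^sub>M lborel)) < \<infinity>" using fin by simp
  qed measurable
  from lborel_pair.Fubini_integral[OF this] show ?thesis by simp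
qed

text \<open>The Borel counterpart of \<open>Lp_space 2\<close>. Fubini and the measurability prover
  work on \<open>lborel\<close>; \<open>rep\<close> below connects the two worlds.\<close>

definition L2 :: "('a::euclidean_space \<Rightarrow> complex) \<Rightarrow> bool" where
  "L2 f \<longleftrightarrow> f \<in> borel_measurable borel \<and> integrable lborel (\<lambda>x. (norm (f x))\<^sup>2)"

definition nq :: "('a::euclidean_space \<Rightarrow> complex) \<Rightarrow> real" where
  "nq f = (LINT x|lborel. (norm (f x))\<^sup>2)"

lemma L2_measurable [measurable_dest]: "L2 f \<Longrightarrow> f \<in> borel_measurable borel"
  by (simp add: L2_def)

lemma L2_integrable: "L2 f \<Longrightarrow> integrable lborel (\<lambda>x. (norm (f x))\<^sup>2)"
  by (simp add: L2_def)

lemma nq_nonneg: "0 \<le> nq f"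
  by (simp add: nq_def)

lemma L2_nn: "L2 f \<Longrightarrow> (\<integral>\<^sup>+x. ennreal ((norm (f x))\<^sup>2) \<partial>lborel) = ennreal (nq f)"
  unfolding nq_def by (intro nn_integral_eq_integral) (auto simp: L2_integrable)

lemma L2I:
  assumes [measurable]: "f \<in> borel_measurable borel" and le: "(\<integral>\<^sup>+x. ennreal ((norm (f x))\<^sup>2) \<partial>lborel) \<le> ennreal c" and c: "0 \<le> c"
  shows "L2 f" "nq f \<le> c"
proof -
  show L: "L2 f" unfolding L2_def
    by (intro conjI integrableI_bounded) (use le in \<open>auto simp: less_top[symmetric] top_unique\<close>)
  show "nq f \<le> c" using le L2_nn[OF L] c by simp
qed

lemma L2_bound:
  assumes g: "L2 g" and [measurable]: "f \<in> borel_measurable borel" and le: "\<And>x. norm (f x) \<le> norm (g x)"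
  shows "L2 f" "nq f \<le> nq g"
proof -
  have "(\<integral>\<^sup>+x. ennreal ((norm (f x))\<^sup>2) \<partial>lborel) \<le> (\<integral>\<^sup>+x. ennreal ((norm (g x))\<^sup>2) \<partial>lborel)"
    by (intro nn_integral_mono ennreal_leI power_mono le) auto
  then have "(\<integral>\<^sup>+x. ennreal ((norm (f x))\<^sup>2) \<partial>lborel) \<le> ennreal (nq g)"
    unfolding L2_nn[OF g] .
  from L2I[OF assms(2) this nq_nonneg] show "L2 f" "nq f \<le> nq g" .
qed

lemma norm_add_square_le: "(norm (a + b :: complex))\<^sup>2 \<le> 2 * (norm a)\<^sup>2 + 2 * (norm b)\<^sup>2"
proof -
  have "(norm (a + b))\<^sup>2 \<le> (norm a + norm b)\<^sup>2" by (intro power_mono norm_triangle_ineq) auto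
  also have "\<dots> \<le> 2 * (norm a)\<^sup>2 + 2 * (norm b)\<^sup>2"
    using sum_squares_bound[of "norm a" "norm b"] by (simp add: power2_sum)
  finally show ?thesis .
qed

lemma L2_add: assumes "L2 f" "L2 g" shows "L2 (\<lambda>x. f x + g x)" "nq (\<lambda>x. f x + g x) \<le> 2 * nq f + 2 * nq g"
proof -
  note [measurable] = assms[THEN L2_measurable]
  have "(\<integral>\<^sup>+x. ennreal ((norm (f x + g x))\<^sup>2) \<partial>lborel) \<le> (\<integral>\<^sup>+x. ennreal (2 * (norm (f x))\<^sup>2 + 2 * (norm (g x))\<^sup>2) \<partial>lborel)"
    by (intro nn_integral_mono ennreal_leI norm_add_square_le)
  also have "\<dots> = ennreal (LINT x|lborel. 2 * (norm (f x))\<^sup>2 + 2 * (norm (g x))\<^sup>2)"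
    by (intro nn_integral_eq_integral) (auto simp: assms L2_integrable)
  also have "\<dots> = ennreal (2 * nq f + 2 * nq g)"
    unfolding nq_def by (subst Bochner_Integration.integral_add) (auto simp: assms L2_integrable)
  finally have le: "(\<integral>\<^sup>+x. ennreal ((norm (f x + g x))\<^sup>2) \<partial>lborel) \<le> ennreal (2 * nq f + 2 * nq g)" .
  have 0: "0 \<le> 2 * nq f + 2 * nq g" using nq_nonneg[of f] nq_nonneg[of g] by simp
  have m: "(\<lambda>x. f x + g x) \<in> borel_measurable borel" by measurable
  from L2I[OF m le 0] show "L2 (\<lambda>x. f x + g x)" "nq (\<lambda>x. f x + g x) \<le> 2 * nq f + 2 * nq g" .
qed

lemma L2_minus: assumes "L2 f" shows "L2 (\<lambda>x. - f x)" "nq (\<lambda>x. - f x) = nq f"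
  using assms by (auto simp: L2_def nq_def)

lemma L2_diff: assumes "L2 f" "L2 g" shows "L2 (\<lambda>x. f x - g x)" "nq (\<lambda>x. f x - g x) \<le> 2 * nq f + 2 * nq g"
  using L2_add[OF assms(1) L2_minus(1)[OF assms(2)]] by (auto simp: L2_minus assms)

lemma nq_minus_commute: "nq (\<lambda>x. f x - g x) = nq (\<lambda>x. g x - f x)"
  by (simp add: nq_def norm_minus_commute)

text \<open>Young's inequality with a free parameter; optimizing in \<open>d\<close> would give
  Cauchy-Schwarz, in whose place it is used.\<close>

lemma L2_prod_bound: "norm (a * b :: complex) \<le> ((norm a)\<^sup>2 / d + d * (norm b)\<^sup>2) / 2" if "d > 0"
proof -
  have "0 \<le> (norm a / sqrt d - sqrt d * norm b)\<^sup>2" by simp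
  also have "\<dots> = (norm a)\<^sup>2 / d + d * (norm b)\<^sup>2 - 2 * (norm a * norm b)"
    using that by (simp add: power2_diff power_divide power_mult_distrib)
  finally show ?thesis by (simp add: norm_mult)
qed

lemma L2_prod: assumes "L2 f" "L2 g" shows "integrable lborel (\<lambda>x. f x * g x)"
proof -
  note [measurable] = assms[THEN L2_measurable]
  show ?thesis
  proof (rule Bochner_Integration.integrable_bound)
    show "integrable lborel (\<lambda>x. ((norm (f x))\<^sup>2 / 1 + 1 * (norm (g x))\<^sup>2) / 2)"
      using assms by (auto simp: L2_integrable)
    show "AE x in lborel. norm (f x * g x) \<le> norm (((norm (f x))\<^sup>2 / 1 + 1 * (norm (g x))\<^sup>2) / 2)"
      using L2_prod_bound[of 1] by (auto intro!: AE_I2 simp del: norm_mult simp: abs_of_nonneg)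
  qed measurable
qed

lemma L2_prod_integral_bound:
  assumes "L2 f" "L2 g" "d > 0"
  shows "norm (LINT x|lborel. f x * g x) \<le> (nq f / d + d * nq g) / 2"
    and "(LINT x|lborel. norm (f x * g x)) \<le> (nq f / d + d * nq g) / 2"
proof -
  have "(LINT x|lborel. norm (f x * g x)) \<le> (LINT x|lborel. ((norm (f x))\<^sup>2 / d + d * (norm (g x))\<^sup>2) / 2)"
    by (intro integral_mono integrable_norm L2_prod assms L2_prod_bound) (auto simp: assms L2_integrable)
  also have "\<dots> = (nq f / d + d * nq g) / 2"
    unfolding nq_def using assms by (simp add: L2_integrable)
  finally show *: "(LINT x|lborel. norm (f x * g x)) \<le> (nq f / d + d * nq g) / 2" .
  show "norm (LINT x|lborel. f x * g x) \<le> (nq f / d + d * nq g) / 2"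
    by (rule order_trans[OF integral_norm_bound *])
qed

text \<open>The way in which Young's inequality yields limits: \<open>d\<close> is fixed first to
  make \<open>d * c\<close> small, and only then \<open>n\<close> is sent to infinity, so
  \<open>C d\<close> may be arbitrarily large.\<close>

lemma tendsto_0_of_bound:
  fixes X Y :: "nat \<Rightarrow> real"
  assumes Y: "Y \<longlonglongrightarrow> 0" and c: "0 \<le> c" and b: "\<And>n d. d > 0 \<Longrightarrow> \<bar>X n\<bar> \<le> C d * Y n + d * c"
  shows "X \<longlonglongrightarrow> 0"
proof (rule LIMSEQ_I)
  fix e :: real assume e: "e > 0"
  define d where "d = e / (2 * (c + 1))"
  have d: "d > 0" "d * c < e / 2 + e / 4" using e c by (auto simp: d_def divide_simps)
  have "(\<lambda>n. C d * Y n) \<longlonglongrightarrow> C d * 0" by (intro tendsto_intros Y)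
  then obtain N where N: "\<And>n. n \<ge> N \<Longrightarrow> \<bar>C d * Y n\<bar> < e / 4"
    using LIMSEQ_D[of "\<lambda>n. C d * Y n" 0 "e / 4"] e by auto
  show "\<exists>no. \<forall>n\<ge>no. norm (X n - 0) < e"
  proof (intro exI[of _ N] allI impI)
    fix n assume "n \<ge> N"
    from N[OF this] b[OF d(1), of n] d(2) show "norm (X n - 0) < e" by auto
  qed
qed

lemma L2_prod_tendsto:
  assumes "\<And>n. L2 (F n)" "L2 f" "L2 k" "(\<lambda>n. nq (\<lambda>x. F n x - f x)) \<longlonglongrightarrow> 0"
  shows "(\<lambda>n. LINT x|lborel. F n x * k x) \<longlonglongrightarrow> (LINT x|lborel. f x * k x)"
proof -
  have "(\<lambda>n. norm ((LINT x|lborel. F n x * k x) - (LINT x|lborel. f x * k x))) \<longlonglongrightarrow> 0"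
  proof (rule tendsto_0_of_bound[OF assms(4), of "nq k / 2" _ "\<lambda>d. 1 / (2 * d)"])
    fix n and d :: real assume d: "d > 0"
    have "(LINT x|lborel. F n x * k x) - (LINT x|lborel. f x * k x) = (LINT x|lborel. F n x * k x - f x * k x)"
      by (intro Bochner_Integration.integral_diff[symmetric] L2_prod assms)
    also have "\<dots> = (LINT x|lborel. (F n x - f x) * k x)" by (simp add: left_diff_distrib)
    finally show "\<bar>norm ((LINT x|lborel. F n x * k x) - (LINT x|lborel. f x * k x))\<bar> \<le> 1 / (2 * d) * nq (\<lambda>x. F n x - f x) + d * (nq k / 2)"
      using L2_prod_integral_bound(1)[OF L2_diff(1)[OF assms(1)[of n] assms(2)] assms(3) d] by (simp add: add_divide_distrib)
  qed (simp add: nq_nonneg)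
  then show ?thesis by (simp add: tendsto_norm_zero_iff LIM_zero_iff)
qed

lemma nq_tendsto:
  assumes "\<And>n. L2 (F n)" "L2 f" "(\<lambda>n. nq (\<lambda>x. F n x - f x)) \<longlonglongrightarrow> 0"
  shows "(\<lambda>n. nq (F n)) \<longlonglongrightarrow> nq f"
proof -
  have "(\<lambda>n. nq (F n) - nq f) \<longlonglongrightarrow> 0"
  proof (rule tendsto_0_of_bound[OF assms(3), of "nq f" _ "\<lambda>d. 1 + 1 / d"])
    fix n and d :: real assume d: "d > 0"
    have p: "\<bar>(norm a)\<^sup>2 - (norm b)\<^sup>2\<bar> \<le> (1 + 1 / d) * (norm (a - b))\<^sup>2 + d * (norm b)\<^sup>2" for a b :: complex
    proof -
      define s where "s = norm (a - b)"
      have s: "\<bar>norm a - norm b\<bar> \<le> s" unfolding s_def by (rule norm_triangle_ineq3)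
      have "\<bar>(norm a)\<^sup>2 - (norm b)\<^sup>2\<bar> = \<bar>norm a - norm b\<bar> * (norm a + norm b)"
        by (simp add: power2_eq_square square_diff_square_factored abs_mult mult.commute)
      also have "\<dots> \<le> s * (norm a + norm b)" using s by (intro mult_right_mono) auto
      also have "\<dots> \<le> s * (s + 2 * norm b)" using s by (intro mult_left_mono) (auto simp: s_def)
      also have "\<dots> = s\<^sup>2 + 2 * (s * norm b)" by (simp add: power2_eq_square algebra_simps)
      also have "2 * (s * norm b) \<le> s\<^sup>2 / d + d * (norm b)\<^sup>2"
        using L2_prod_bound[OF d, of "of_real s" b] by (simp add: norm_mult s_def)
      finally show ?thesis by (simp add: s_def algebra_simps)
    qed
    have i: "integrable lborel (\<lambda>x. (norm (F n x - f x))\<^sup>2)" using L2_integrable[OF L2_diff(1)[OF assms(1)[of n] assms(2)]] .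
    have "\<bar>nq (F n) - nq f\<bar> = \<bar>LINT x|lborel. (norm (F n x))\<^sup>2 - (norm (f x))\<^sup>2\<bar>"
      unfolding nq_def by (subst Bochner_Integration.integral_diff) (auto simp: assms L2_integrable)
    also have "\<dots> \<le> (LINT x|lborel. \<bar>(norm (F n x))\<^sup>2 - (norm (f x))\<^sup>2\<bar>)" by (rule integral_abs_bound)
    also have "\<dots> \<le> (LINT x|lborel. (1 + 1 / d) * (norm (F n x - f x))\<^sup>2 + d * (norm (f x))\<^sup>2)"
      by (intro integral_mono p) (use i assms in \<open>auto simp: L2_integrable\<close>)
    also have "\<dots> = (1 + 1 / d) * nq (\<lambda>x. F n x - f x) + d * nq f"
      unfolding nq_def by (subst Bochner_Integration.integral_add) (use i assms in \<open>auto simp: L2_integrable\<close>)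
    finally show "\<bar>nq (F n) - nq f\<bar> \<le> (1 + 1 / d) * nq (\<lambda>x. F n x - f x) + d * nq f" .
  qed (simp add: nq_nonneg)
  then show ?thesis by (simp add: LIM_zero_iff)
qed

lemma nq_zero_iff: "L2 f \<Longrightarrow> nq f = 0 \<longleftrightarrow> (AE x in lborel. f x = 0)"
  unfolding nq_def by (subst integral_nonneg_eq_0_iff_AE) (auto simp: L2_integrable)

lemma L2_limit_unique:
  assumes "\<And>n. L2 (F n)" "L2 f" "L2 g" "(\<lambda>n. nq (\<lambda>x. F n x - f x)) \<longlonglongrightarrow> 0" "(\<lambda>n. nq (\<lambda>x. F n x - g x)) \<longlonglongrightarrow> 0"
  shows "AE x in lborel. f x = g x"
proof -
  have fg: "L2 (\<lambda>x. f x - g x)" by (rule L2_diff[OF assms(2,3)])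
  have "nq (\<lambda>x. f x - g x) \<le> 2 * nq (\<lambda>x. F n x - f x) + 2 * nq (\<lambda>x. F n x - g x)" for n
    using L2_diff(2)[OF L2_diff(1)[OF assms(1)[of n] assms(3)] L2_diff(1)[OF assms(1)[of n] assms(2)]] by (simp add: algebra_simps)
  moreover have "(\<lambda>n. 2 * nq (\<lambda>x. F n x - f x) + 2 * nq (\<lambda>x. F n x - g x)) \<longlonglongrightarrow> 2 * 0 + 2 * 0"
    by (intro tendsto_intros assms)
  ultimately have "nq (\<lambda>x. f x - g x) \<le> 0" by (intro LIMSEQ_le_const) auto
  then have "nq (\<lambda>x. f x - g x) = 0" using nq_nonneg[of "\<lambda>x. f x - g x"] by simp
  then show ?thesis unfolding nq_zero_iff[OF fg] by eventually_elim simp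
qed

lemma L2_AE_subseq:
  assumes "\<And>n. L2 (F n)" "L2 f" "(\<lambda>n. nq (\<lambda>x. F n x - f x)) \<longlonglongrightarrow> 0"
  shows "\<exists>r::nat\<Rightarrow>nat. strict_mono r \<and> (AE x in lborel. (\<lambda>n. F (r n) x) \<longlonglongrightarrow> f x)"
proof -
  have "\<exists>r::nat\<Rightarrow>nat. strict_mono r \<and> (AE x in lborel. (\<lambda>n. (norm (F (r n) x - f x))\<^sup>2) \<longlonglongrightarrow> 0)"
    by (rule tendsto_L1_AE_subseq) (use assms L2_integrable[OF L2_diff(1)] in \<open>auto simp: nq_def\<close>)
  then obtain r :: "nat \<Rightarrow> nat" where r: "strict_mono r" "AE x in lborel. (\<lambda>n. (norm (F (r n) x - f x))\<^sup>2) \<longlonglongrightarrow> 0" by blast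
  have "AE x in lborel. (\<lambda>n. F (r n) x) \<longlonglongrightarrow> f x"
    using r(2)
  proof eventually_elim
    case (elim x)
    then have "(\<lambda>n. sqrt ((norm (F (r n) x - f x))\<^sup>2)) \<longlonglongrightarrow> sqrt 0" by (rule tendsto_real_sqrt)
    then show ?case by (simp add: tendsto_norm_zero_iff LIM_zero_iff)
  qed
  with r show ?thesis by blast
qed

section \<open>Gaussians, completeness of L2, and continuity of translations in L2\<close>

definition gs :: "'a::euclidean_space \<Rightarrow> real" where
  "gs x = (\<Prod>b\<in>Basis. std_normal_density (x \<bullet> b))"

lemma norm_square_Basis: "(norm x)\<^sup>2 = (\<Sum>b\<in>Basis. (x \<bullet> b)\<^sup>2)" for x :: "'a::euclidean_space"
  unfolding power2_norm_eq_inner by (subst euclidean_inner) (simp add: power2_eq_square)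

lemma gs_eq: "gs x = gs (0::'a) * exp (- (norm x)\<^sup>2 / 2)" for x :: "'a::euclidean_space"
proof -
  have "gs x = (\<Prod>b\<in>(Basis :: 'a set). 1 / sqrt (2 * pi)) * (\<Prod>b\<in>Basis. exp (- (x \<bullet> b)\<^sup>2 / 2))"
    unfolding gs_def std_normal_density_def by (rule prod.distrib)
  also have "(\<Prod>b\<in>(Basis :: 'a set). 1 / sqrt (2 * pi)) = gs (0::'a)"
    by (simp add: gs_def std_normal_density_def)
  finally have "gs x = gs (0::'a) * (\<Prod>b\<in>Basis. exp (- (x \<bullet> b)\<^sup>2 / 2))" .
  also have "(\<Prod>b\<in>Basis. exp (- (x \<bullet> b)\<^sup>2 / 2)) = exp (\<Sum>b\<in>Basis. - (x \<bullet> b)\<^sup>2 / 2)"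
    by (rule exp_sum[symmetric]) simp
  also have "(\<Sum>b\<in>Basis. - (x \<bullet> b)\<^sup>2 / 2) = - (norm x)\<^sup>2 / 2"
    by (simp add: norm_square_Basis sum_negf sum_divide_distrib)
  finally show ?thesis .
qed

lemma gs_zero: "gs (0::'a::euclidean_space) ^ 2 * (2 * pi) ^ DIM('a) = 1"
proof -
  have "gs (0::'a) = (1 / sqrt (2 * pi)) ^ DIM('a)" by (simp add: gs_def std_normal_density_def)
  then have "gs (0::'a) ^ 2 = (1 / (2 * pi)) ^ DIM('a)"
    by (simp add: power_mult[symmetric] mult.commute[of _ 2] power_mult power_divide)
  then show ?thesis by (simp add: power_divide)
qed

lemma gs_pos: "gs x > 0"
  unfolding gs_def by (intro prod_pos) (simp add: normal_density_pos)

lemma borel_gs [measurable]: "gs \<in> borel_measurable borel"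
  unfolding gs_def by measurable

lemma gs_le: "gs x \<le> gs (0::'a)" for x :: "'a::euclidean_space"
  using gs_pos[of "0::'a"] by (subst gs_eq) (auto simp: mult_le_cancel_left1)

text \<open>The density is a product over coordinates, so the transform factors into values of the
  characteristic function of the standard normal distribution.\<close>

lemma
  shows integrable_gs: "integrable lborel (gs :: 'a::euclidean_space \<Rightarrow> real)"
    and gs_fourier: "(LINT x|lborel. exp (\<i> * of_real (x \<bullet> t)) * of_real (gs x)) = complex_of_real (gs (t::'a) / gs (0::'a))"
    and integral_gs: "(LINT x|lborel. gs (x::'a)) = 1"
proof -
  interpret product_sigma_finite "\<lambda>_::'a. lborel :: real measure"
    by (simp add: product_sigma_finite_def sigma_finite_lborel)
  let ?f = "\<lambda>b x. exp (\<i> * of_real ((t \<bullet> b) * x)) * complex_of_real (std_normal_density x)"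
  let ?P = "\<Pi>\<^sub>M b\<in>(Basis :: 'a set). lborel :: real measure"
  let ?S = "\<lambda>f. \<Sum>b\<in>(Basis :: 'a set). f b *\<^sub>R b"
  have [measurable]: "(\<lambda>f. f c) \<in> borel_measurable ?P" if "c \<in> Basis" for c :: 'a
    using that measurable_component_singleton[of c Basis "\<lambda>_. lborel :: real measure"] by simp
  have Sm [measurable]: "?S \<in> borel_measurable ?P" by measurable
  have Sb: "?S f \<bullet> b = f b" if "b \<in> Basis" for f b
    using that by (simp add: inner_sum_left inner_Basis sum.If_cases if_distrib cong: if_cong)
  have i1: "integrable lborel (std_normal_density :: real \<Rightarrow> real)"
    using integrable_std_normal_moment[of 0] by simp
  have gS: "gs (?S f) = (\<Prod>b\<in>Basis. std_normal_density (f b))" for f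
    unfolding gs_def by (intro prod.cong) (auto simp: Sb)
  have "integrable ?P (\<lambda>f. gs (?S f))" unfolding gS
    by (intro product_integrable_prod i1) simp
  then show ig: "integrable lborel (gs :: 'a \<Rightarrow> real)"
    by (subst lborel_eq) (subst integrable_distr_eq, auto)
  have ft: "(LINT x|lborel. exp (\<i> * of_real (x \<bullet> s)) * of_real (gs x)) = complex_of_real (gs s / gs (0::'a))" for s :: 'a
  proof -
    let ?f = "\<lambda>b x. exp (\<i> * of_real ((s \<bullet> b) * x)) * complex_of_real (std_normal_density x)"
    have i2: "integrable lborel (?f b)" for b
      by (rule Bochner_Integration.integrable_bound[OF i1]) (auto simp: norm_mult)
    have "(LINT x|lborel. exp (\<i> * of_real (x \<bullet> s)) * of_real (gs x)) = (LINT f|?P. exp (\<i> * of_real (?S f \<bullet> s)) * of_real (gs (?S f)))"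
      by (subst lborel_eq) (subst integral_distr, auto)
    also have "\<dots> = (LINT f|?P. (\<Prod>b\<in>Basis. ?f b (f b)))"
    proof (rule Bochner_Integration.integral_cong[OF refl])
      fix f
      have "?S f \<bullet> s = (\<Sum>b\<in>Basis. (s \<bullet> b) * f b)" by (simp add: inner_sum_left inner_commute[of s] mult.commute)
      then show "exp (\<i> * of_real (?S f \<bullet> s)) * of_real (gs (?S f)) = (\<Prod>b\<in>Basis. ?f b (f b))"
        unfolding gS by (simp add: prod.distrib sum_distrib_left exp_sum)
    qed
    also have "\<dots> = (\<Prod>b\<in>Basis. LINT x|lborel. ?f b x)"
      by (intro product_integral_prod i2) simp
    also have "\<dots> = (\<Prod>b\<in>Basis. complex_of_real (exp (- ((s \<bullet> b)\<^sup>2) / 2)))"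
    proof (rule prod.cong[OF refl])
      fix b :: 'a
      have "(LINT x|lborel. ?f b x) = char std_normal_distribution (s \<bullet> b)"
        unfolding char_def by (subst integral_density) (auto simp: scaleR_conv_of_real mult_ac normal_density_nonneg)
      then show "(LINT x|lborel. ?f b x) = complex_of_real (exp (- ((s \<bullet> b)\<^sup>2) / 2))"
        by (simp add: char_std_normal_distribution)
    qed
    also have "\<dots> = complex_of_real (exp (\<Sum>b\<in>Basis. - ((s \<bullet> b)\<^sup>2) / 2))"
      by (simp only: of_real_prod[symmetric] exp_sum[OF finite_Basis])
    also have "(\<Sum>b\<in>Basis. - ((s \<bullet> b)\<^sup>2) / 2) = - (norm s)\<^sup>2 / 2"
      by (simp add: norm_square_Basis sum_negf sum_divide_distrib)
    also have "exp (- (norm s)\<^sup>2 / 2) = gs s / gs (0::'a)"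
      using gs_pos[of "0::'a"] by (subst gs_eq) simp
    finally show ?thesis .
  qed
  show "(LINT x|lborel. exp (\<i> * of_real (x \<bullet> t)) * of_real (gs x)) = complex_of_real (gs t / gs (0::'a))" by (rule ft)
  have "complex_of_real (LINT x|lborel. gs (x::'a)) = 1" using ft[of 0] gs_pos[of "0::'a"] by simp
  then show "(LINT x|lborel. gs (x::'a)) = 1" by (simp only: of_real_eq_1_iff)
qed

lemma L2_gs: "L2 (\<lambda>x. of_real (gs x))"
  unfolding L2_def
proof (intro conjI)
  show "integrable lborel (\<lambda>x::'a. (norm (complex_of_real (gs x)))\<^sup>2)"
  proof (rule Bochner_Integration.integrable_bound[OF integrable_mult_right[OF integrable_gs, of "gs (0::'a)"]])
    show "AE x in lborel. norm ((norm (complex_of_real (gs (x::'a))))\<^sup>2) \<le> norm (gs (0::'a) * gs x)"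
    proof (rule AE_I2)
      fix x :: 'a
      show "norm ((norm (complex_of_real (gs x)))\<^sup>2) \<le> norm (gs (0::'a) * gs x)"
        using gs_pos[of x] gs_pos[of "0::'a"] gs_le[of x] by (simp add: power2_eq_square abs_mult mult_right_mono)
    qed
  qed measurable
qed measurable

text \<open>Multiplying by a Gaussian, which is in L2, makes an L2 Cauchy sequence Cauchy in L1 and
  so provides an almost everywhere convergent subsequence. Dividing by the positive Gaussian gives
  the limit, and Fatou's lemma gives convergence in L2.\<close>

lemma L2_complete:
  fixes F :: "nat \<Rightarrow> 'a::euclidean_space \<Rightarrow> complex"
  assumes F: "\<And>n. L2 (F n)" and C: "\<And>e. e > 0 \<Longrightarrow> \<exists>N. \<forall>i\<ge>N. \<forall>j\<ge>N. nq (\<lambda>x. F i x - F j x) < e"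
  shows "\<exists>f. L2 f \<and> (\<lambda>n. nq (\<lambda>x. F n x - f x)) \<longlonglongrightarrow> 0"
proof -
  note [measurable] = L2_measurable[OF F]
  let ?s = "\<lambda>n x. F n x * of_real (gs x)"
  define c where "c = nq (\<lambda>x::'a. of_real (gs x))"
  have c: "c \<ge> 0" by (simp add: c_def nq_nonneg)
  obtain r :: "nat \<Rightarrow> nat" where r: "strict_mono r" "AE x in lborel. Cauchy (\<lambda>i. ?s (r i) x)"
  proof (rule cauchy_L1_AE_cauchy_subseq[of lborel ?s])
    show "integrable lborel (?s n)" for n by (rule L2_prod[OF F L2_gs])
    fix e :: real assume e: "e > 0"
    define d where "d = e / (c + 1)"
    have d: "d > 0" "d * c < e" using e c by (auto simp: d_def field_simps)
    obtain N where N: "\<And>i j. i \<ge> N \<Longrightarrow> j \<ge> N \<Longrightarrow> nq (\<lambda>x. F i x - F j x) < d * e"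
      using C[of "d * e"] d e by auto
    show "\<exists>N. \<forall>i\<ge>N. \<forall>j\<ge>N. (LINT x|lborel. norm (?s i x - ?s j x)) < e"
    proof (intro exI[of _ N] allI impI)
      fix i j assume ij: "i \<ge> N" "j \<ge> N"
      have "(LINT x|lborel. norm (?s i x - ?s j x)) = (LINT x|lborel. norm ((F i x - F j x) * of_real (gs x)))"
        by (simp add: left_diff_distrib)
      also have "\<dots> \<le> (nq (\<lambda>x. F i x - F j x) / d + d * c) / 2"
        unfolding c_def by (rule L2_prod_integral_bound(2)[OF L2_diff(1)[OF F F] L2_gs d(1)])
      also have "nq (\<lambda>x. F i x - F j x) / d < e" using N[OF ij] d by (simp add: divide_less_eq mult.commute)
      finally show "(LINT x|lborel. norm (?s i x - ?s j x)) < e" using d(2) by simp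
    qed
  qed
  have conv: "AE x in lborel. convergent (\<lambda>i. F (r i) x)"
    using r(2)
  proof eventually_elim
    case (elim x)
    then have "convergent (\<lambda>i. ?s (r i) x)" by (rule Cauchy_convergent)
    then obtain l where "(\<lambda>i. ?s (r i) x) \<longlonglongrightarrow> l" by (auto simp: convergent_def)
    then have "(\<lambda>i. ?s (r i) x / of_real (gs x)) \<longlonglongrightarrow> l / of_real (gs x)"
      using gs_pos[of x] by (intro tendsto_divide tendsto_const) auto
    then show ?case using gs_pos[of x] by (auto simp: convergent_def)
  qed
  define f where "f x = lim (\<lambda>i. F (r i) x)" for x
  have [measurable]: "f \<in> borel_measurable borel" unfolding f_def by measurable
  have lim: "AE x in lborel. (\<lambda>i. F (r i) x) \<longlonglongrightarrow> f x"
    using conv by eventually_elim (simp add: f_def convergent_LIMSEQ_iff)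
  have fat: "(\<integral>\<^sup>+x. ennreal ((norm (F n x - f x))\<^sup>2) \<partial>lborel) \<le> ennreal e"
    if e: "e > 0" and N: "\<And>j. j \<ge> N \<Longrightarrow> nq (\<lambda>x. F n x - F j x) < e" for n N e
  proof -
    have "(\<integral>\<^sup>+x. ennreal ((norm (F n x - f x))\<^sup>2) \<partial>lborel) = (\<integral>\<^sup>+x. liminf (\<lambda>i. ennreal ((norm (F n x - F (r i) x))\<^sup>2)) \<partial>lborel)"
    proof (rule nn_integral_cong_AE)
      show "AE x in lborel. ennreal ((norm (F n x - f x))\<^sup>2) = liminf (\<lambda>i. ennreal ((norm (F n x - F (r i) x))\<^sup>2))"
        using lim
      proof eventually_elim
        case (elim x)
        then have "(\<lambda>i. ennreal ((norm (F n x - F (r i) x))\<^sup>2)) \<longlonglongrightarrow> ennreal ((norm (F n x - f x))\<^sup>2)"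
          by (intro tendsto_intros tendsto_ennrealI)
        from lim_imp_Liminf[OF trivial_limit_sequentially this] show ?case by (rule sym)
      qed
    qed
    also have "\<dots> \<le> liminf (\<lambda>i. \<integral>\<^sup>+x. ennreal ((norm (F n x - F (r i) x))\<^sup>2) \<partial>lborel)"
      by (rule nn_integral_liminf) measurable
    also have "\<dots> \<le> liminf (\<lambda>i. ennreal e)"
    proof (rule Liminf_mono)
      show "eventually (\<lambda>i. (\<integral>\<^sup>+x. ennreal ((norm (F n x - F (r i) x))\<^sup>2) \<partial>lborel) \<le> ennreal e) sequentially"
        using eventually_ge_at_top[of N]
      proof eventually_elim
        case (elim i)
        then have "r i \<ge> N" using seq_suble[OF r(1), of i] by linarith
        then show ?case using N[of "r i"] by (subst L2_nn[OF L2_diff(1)[OF F F]]) (auto intro: ennreal_leI less_imp_le)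
      qed
    qed
    also have "\<dots> = ennreal e" by (simp add: Liminf_const)
    finally show ?thesis .
  qed
  obtain N1 where N1: "\<And>i j. i \<ge> N1 \<Longrightarrow> j \<ge> N1 \<Longrightarrow> nq (\<lambda>x. F i x - F j x) < 1" using C[of 1] by auto
  have "L2 (\<lambda>x. F N1 x - f x)"
    by (rule L2I(1)[of _ 1]) (use fat[of 1 N1 N1] N1 in auto)
  from L2_diff(1)[OF F[of N1] this] have f: "L2 f" by simp
  moreover have "(\<lambda>n. nq (\<lambda>x. F n x - f x)) \<longlonglongrightarrow> 0"
  proof (rule LIMSEQ_I)
    fix e :: real assume e: "e > 0"
    obtain N where N: "\<And>i j. i \<ge> N \<Longrightarrow> j \<ge> N \<Longrightarrow> nq (\<lambda>x. F i x - F j x) < e / 2" using C[of "e / 2"] e by auto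
    show "\<exists>no. \<forall>n\<ge>no. norm (nq (\<lambda>x. F n x - f x) - 0) < e"
    proof (intro exI[of _ N] allI impI)
      fix n assume n: "n \<ge> N"
      have "nq (\<lambda>x. F n x - f x) \<le> e / 2"
        by (rule L2I(2)[OF _ fat[of "e / 2" N n]]) (use e N n in auto)
      then show "norm (nq (\<lambda>x. F n x - f x) - 0) < e" using e nq_nonneg[of "\<lambda>x. F n x - f x"] by simp
    qed
  qed
  ultimately show ?thesis by blast
qed

text \<open>The map taking \<open>a\<close> to \<open>a * \<bar>a\<bar>\<close> carries L2 to L1,
  and differences of its values control squared differences. It reduces L2 continuity of
  translations to the L1 statement.\<close>

lemma signed_square_diff: "(a - b)\<^sup>2 \<le> 2 * \<bar>a * \<bar>a\<bar> - b * \<bar>b\<bar>\<bar>" for a b :: real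
proof -
  have dbl: "x \<le> \<bar>y\<bar> \<Longrightarrow> x \<le> 2 * \<bar>y\<bar>" for x y :: real by arith
  have k: "(a - b)\<^sup>2 \<le> 2 * \<bar>a * \<bar>a\<bar> - b * \<bar>b\<bar>\<bar>" if ab: "b \<le> a" for a b :: real
  proof -
    consider "0 \<le> b" | "a \<le> 0" | "b < 0" "0 < a" by linarith
    then show ?thesis
    proof cases
      case 1
      have "(a - b) * (a - b) \<le> (a - b) * (a + b)" using 1 ab by (intro mult_left_mono) auto
      also have "\<dots> = a * a - b * b" by (simp add: algebra_simps)
      also have "\<dots> \<le> \<bar>a * \<bar>a\<bar> - b * \<bar>b\<bar>\<bar>" using 1 ab by simp
      finally show ?thesis unfolding power2_eq_square by (rule dbl)
    next
      case 2
      have "(a - b) * (a - b) \<le> (a - b) * (- a - b)" using 2 ab by (intro mult_left_mono) auto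
      also have "\<dots> = b * b - a * a" by (simp add: algebra_simps)
      also have "\<dots> \<le> \<bar>a * \<bar>a\<bar> - b * \<bar>b\<bar>\<bar>" using 2 ab by simp
      finally show ?thesis unfolding power2_eq_square by (rule dbl)
    next
      case 3
      have "(a - b)\<^sup>2 \<le> 2 * (a * a + b * b)" using sum_squares_bound[of a "- b"] by (simp add: power2_eq_square algebra_simps)
      also have "a * a + b * b \<le> \<bar>a * \<bar>a\<bar> - b * \<bar>b\<bar>\<bar>" using 3 by simp
      finally show ?thesis by simp
    qed
  qed
  show ?thesis using k[of b a] k[of a b] by (cases "b \<le> a") (auto simp: power2_commute abs_minus_commute)
qed

text \<open>The signed squares \<open>S Re\<close> and \<open>S Im\<close> of the real and imaginary
  parts are integrable, so their translations are continuous in L1, and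
  \<open>signed_square_diff\<close> bounds the squared modulus of the difference.\<close>

lemma L2_translation_continuous:
  assumes f: "L2 f" and v: "v \<longlonglongrightarrow> 0"
  shows "(\<lambda>n. nq (\<lambda>x. f (v n + x) - f x)) \<longlonglongrightarrow> 0"
proof -
  note [measurable] = L2_measurable[OF f]
  define S where "S h x = h (f x) * \<bar>h (f x)\<bar>" for h :: "complex \<Rightarrow> real" and x
  have S: "integrable lborel (S h)" if "h = Re \<or> h = Im" for h
  proof -
    have [measurable]: "h \<in> borel_measurable borel" using that by auto
    have h: "\<bar>h z\<bar> \<le> norm z" for z using that abs_Re_le_cmod abs_Im_le_cmod by auto
    show ?thesis
    proof (rule Bochner_Integration.integrable_bound[OF L2_integrable[OF f]])
      show "S h \<in> borel_measurable lborel" unfolding S_def by measurable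
      have "norm (S h x) \<le> norm ((norm (f x))\<^sup>2)" for x
        using mult_mono[OF h[of "f x"] h[of "f x"]] by (simp add: S_def abs_mult power2_eq_square)
      then show "AE x in lborel. norm (S h x) \<le> norm ((norm (f x))\<^sup>2)" by (rule AE_I2)
    qed
  qed
  have tc: "(\<lambda>n. \<integral>\<^sup>+x. ennreal (norm (S h (v n + x) - S h x)) \<partial>lborel) \<longlonglongrightarrow> 0" if "h = Re \<or> h = Im" for h
    using translation_continuous_integrable[OF S[OF that]] v by (simp add: translation_continuous_def)
  have Lv: "L2 (\<lambda>x. f (v n + x))" for n
    using integrable_lborel_translate(1)[OF L2_integrable[OF f], of "v n"] by (simp add: L2_def)
  have b: "ennreal (nq (\<lambda>x. f (v n + x) - f x)) \<le>
     2 * ((\<integral>\<^sup>+x. ennreal (norm (S Re (v n + x) - S Re x)) \<partial>lborel) + (\<integral>\<^sup>+x. ennreal (norm (S Im (v n + x) - S Im x)) \<partial>lborel))" for n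
  proof -
    have [measurable]: "S Re \<in> borel_measurable borel" "S Im \<in> borel_measurable borel" using S by auto
    have "ennreal (nq (\<lambda>x. f (v n + x) - f x)) = (\<integral>\<^sup>+x. ennreal ((norm (f (v n + x) - f x))\<^sup>2) \<partial>lborel)"
      by (rule L2_nn[symmetric]) (rule L2_diff(1)[OF Lv f])
    also have "\<dots> \<le> (\<integral>\<^sup>+x. 2 * (ennreal (norm (S Re (v n + x) - S Re x)) + ennreal (norm (S Im (v n + x) - S Im x))) \<partial>lborel)"
    proof (rule nn_integral_mono)
      fix x
      have "(norm (f (v n + x) - f x))\<^sup>2 \<le> 2 * (norm (S Re (v n + x) - S Re x) + norm (S Im (v n + x) - S Im x))"
        using signed_square_diff[of "Re (f (v n + x))" "Re (f x)"] signed_square_diff[of "Im (f (v n + x))" "Im (f x)"]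
        by (simp add: cmod_power2 S_def)
      then have "ennreal ((norm (f (v n + x) - f x))\<^sup>2) \<le> ennreal (2 * (norm (S Re (v n + x) - S Re x) + norm (S Im (v n + x) - S Im x)))"
        by (rule ennreal_leI)
      then show "ennreal ((norm (f (v n + x) - f x))\<^sup>2) \<le> 2 * (ennreal (norm (S Re (v n + x) - S Re x)) + ennreal (norm (S Im (v n + x) - S Im x)))"
        by (simp add: ennreal_mult ennreal_plus)
    qed
    also have "\<dots> = 2 * ((\<integral>\<^sup>+x. ennreal (norm (S Re (v n + x) - S Re x)) \<partial>lborel) + (\<integral>\<^sup>+x. ennreal (norm (S Im (v n + x) - S Im x)) \<partial>lborel))"
      by (subst nn_integral_cmult) (auto simp: nn_integral_add)
    finally show ?thesis .
  qed
  have "(\<lambda>n. 2 * ((\<integral>\<^sup>+x. ennreal (norm (S Re (v n + x) - S Re x)) \<partial>lborel) + (\<integral>\<^sup>+x. ennreal (norm (S Im (v n + x) - S Im x)) \<partial>lborel))) \<longlonglongrightarrow> 2 * (0 + 0)"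
    by (intro tendsto_add ennreal_tendsto_cmult tc) auto
  then have "(\<lambda>n. 2 * ((\<integral>\<^sup>+x. ennreal (norm (S Re (v n + x) - S Re x)) \<partial>lborel) + (\<integral>\<^sup>+x. ennreal (norm (S Im (v n + x) - S Im x)) \<partial>lborel))) \<longlonglongrightarrow> 0" by simp
  from tendsto_sandwich[OF _ always_eventually[OF allI[OF b]] tendsto_const[of 0] this]
  have "(\<lambda>n. ennreal (nq (\<lambda>x. f (v n + x) - f x))) \<longlonglongrightarrow> ennreal 0" by simp
  then show ?thesis by (rule tendsto_ennrealD) (auto simp: nq_nonneg)
qed

subsection \<open>Plancherel's theorem\<close>

definition ek :: "real \<Rightarrow> complex" where
  "ek t = exp (- 2 * complex_of_real pi * \<i> * complex_of_real t)"

lemma ek_add: "ek (s + t) = ek s * ek t"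
  by (simp add: ek_def exp_add[symmetric] algebra_simps)

lemma ek_0 [simp]: "ek 0 = 1"
  by (simp add: ek_def)

lemma norm_ek [simp]: "norm (ek t) = 1"
  by (simp add: ek_def norm_exp_eq_Re)

lemma cnj_ek: "cnj (ek t) = ek (- t)"
  by (simp add: ek_def exp_cnj)

lemma borel_ek [measurable]: "ek \<in> borel_measurable borel"
  unfolding ek_def by measurable

definition FI :: "('a::euclidean_space \<Rightarrow> complex) \<Rightarrow> 'a \<Rightarrow> complex" where
  "FI f \<xi> = (LINT x|lborel. ek (x \<bullet> \<xi>) * f x)"

lemma borel_FI [measurable]:
  assumes [measurable]: "f \<in> borel_measurable borel"
  shows "FI f \<in> borel_measurable borel"
  unfolding FI_def by measurable

lemma integrable_ek_mult:
  assumes "integrable lborel f" 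
  shows "integrable lborel (\<lambda>x. ek (x \<bullet> \<xi>) * f x)"
proof -
  have [measurable]: "f \<in> borel_measurable borel" using assms by auto
  show ?thesis by (rule Bochner_Integration.integrable_bound[OF assms]) (auto simp: norm_mult)
qed

lemma norm_FI_le: "norm (FI f \<xi>) \<le> (LINT x|lborel. norm (f x))"
  using integral_norm_bound[of lborel "\<lambda>x. ek (x \<bullet> \<xi>) * f x"] by (simp add: FI_def norm_mult)

lemma FI_diff: "integrable lborel f \<Longrightarrow> integrable lborel g \<Longrightarrow> FI (\<lambda>x. f x - g x) \<xi> = FI f \<xi> - FI g \<xi>"
  unfolding FI_def by (subst Bochner_Integration.integral_diff[symmetric]) (auto simp: integrable_ek_mult right_diff_distrib)

lemma integral_FI_mult:
  assumes f: "integrable lborel f" and g: "integrable lborel g"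
  shows "(LINT \<xi>|lborel. FI f \<xi> * g \<xi>) = (LINT x|lborel. f x * FI g x)"
proof -
  have [measurable]: "f \<in> borel_measurable borel" "g \<in> borel_measurable borel" using f g by auto
  have "(LINT \<xi>|lborel. FI f \<xi> * g \<xi>) = (LINT \<xi>|lborel. LINT x|lborel. ek (x \<bullet> \<xi>) * f x * g \<xi>)"
    unfolding FI_def by simp
  also have "\<dots> = (LINT x|lborel. LINT \<xi>|lborel. ek (x \<bullet> \<xi>) * f x * g \<xi>)"
  proof (rule integral_lborel_commute)
    have "(\<integral>\<^sup>+\<xi>. \<integral>\<^sup>+x. ennreal (norm (ek (x \<bullet> \<xi>) * f x * g \<xi>)) \<partial>lborel \<partial>lborel)
      = (\<integral>\<^sup>+\<xi>. (\<integral>\<^sup>+x. ennreal (norm (f x)) \<partial>lborel) * ennreal (norm (g \<xi>)) \<partial>lborel)"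
      by (rule nn_integral_cong) (simp add: norm_mult ennreal_mult nn_integral_multc)
    also have "\<dots> = (\<integral>\<^sup>+x. ennreal (norm (f x)) \<partial>lborel) * (\<integral>\<^sup>+\<xi>. ennreal (norm (g \<xi>)) \<partial>lborel)"
      by (rule nn_integral_cmult) measurable
    also have "\<dots> < \<infinity>" using f g by (auto simp: integrable_iff_bounded ennreal_mult_less_top)
    finally show "(\<integral>\<^sup>+\<xi>. \<integral>\<^sup>+x. ennreal (norm (ek (x \<bullet> \<xi>) * f x * g \<xi>)) \<partial>lborel \<partial>lborel) < \<infinity>" .
  qed measurable
  also have "\<dots> = (LINT x|lborel. f x * FI g x)"
    unfolding FI_def by (simp add: inner_commute mult_ac flip: integral_mult_right_zero)
  finally show ?thesis .
qed

lemma integrable_bounded_mult: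
  fixes f g :: "'a::euclidean_space \<Rightarrow> complex"
  assumes g: "integrable lborel g" and [measurable]: "f \<in> borel_measurable borel" and b: "\<And>x. norm (f x) \<le> c"
  shows "integrable lborel (\<lambda>x. f x * g x)"
proof (rule Bochner_Integration.integrable_bound[OF integrable_mult_right[OF integrable_norm[OF g], of c]])
  have [measurable]: "g \<in> borel_measurable borel" using g by auto
  show "(\<lambda>x. f x * g x) \<in> borel_measurable lborel" by measurable
  have "0 \<le> c" using order_trans[OF norm_ge_zero b] .
  then show "AE x in lborel. norm (f x * g x) \<le> norm (c * norm (g x))"
    using b by (intro AE_I2) (simp add: norm_mult abs_mult mult_right_mono)
qed

context
  fixes \<epsilon> :: real
  assumes eps: "\<epsilon> > 0"
begin

text \<open>A Gaussian damping factor with value 1 at the origin, increasing to 1 everywhere as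
  \<open>\<epsilon>\<close> decreases to 0.\<close>

definition dk :: "'a::euclidean_space \<Rightarrow> real" where
  "dk \<xi> = gs (\<epsilon> *\<^sub>R \<xi>) / gs (0::'a)"

text \<open>The Fourier transform of \<open>dk\<close>, see \<open>FI_dk\<close>: a Gaussian of
  total mass 1, by \<open>gs_zero\<close>, concentrating at the origin as \<open>\<epsilon>\<close>
  tends to 0.\<close>

definition dK :: "'a::euclidean_space \<Rightarrow> real" where
  "dK z = gs ((2 * pi / \<epsilon>) *\<^sub>R z) / (\<epsilon> ^ DIM('a) * (gs (0::'a))\<^sup>2)"

lemma borel_dk [measurable]: "dk \<in> borel_measurable borel" and borel_dK [measurable]: "dK \<in> borel_measurable borel"
  unfolding dk_def dK_def by measurable

lemma dk_eq: "dk \<xi> = exp (- (\<epsilon> * norm \<xi>)\<^sup>2 / 2)" for \<xi> :: "'a::euclidean_space"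
  unfolding dk_def using gs_pos[of "0::'a"] eps by (subst gs_eq) (simp add: abs_mult)

lemma integrable_gs_scale: "c > 0 \<Longrightarrow> integrable lborel (\<lambda>x::'a::euclidean_space. gs (c *\<^sub>R x))"
proof -
  assume c: "c > 0"
  have "(\<integral>\<^sup>+x. ennreal (norm (gs (x::'a))) \<partial>lborel) = ennreal (c ^ DIM('a)) * (\<integral>\<^sup>+x. ennreal (norm (gs (c *\<^sub>R x::'a))) \<partial>lborel)"
  proof -
    have "(lborel :: 'a measure) = density (distr lborel borel (\<lambda>x. c *\<^sub>R x)) (\<lambda>_. ennreal (c ^ DIM('a)))"
      using lborel_affine[of c "0::'a"] c by simp
    then have "(\<integral>\<^sup>+x. ennreal (norm (gs (x::'a))) \<partial>lborel) = (\<integral>\<^sup>+x. ennreal (norm (gs x)) \<partial>density (distr lborel borel (\<lambda>x::'a. c *\<^sub>R x)) (\<lambda>_. ennreal (c ^ DIM('a))))" by simp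
    also have "\<dots> = ennreal (c ^ DIM('a)) * (\<integral>\<^sup>+x. ennreal (norm (gs (c *\<^sub>R x::'a))) \<partial>lborel)"
      by (simp add: nn_integral_density nn_integral_distr nn_integral_cmult)
    finally show ?thesis .
  qed
  moreover have "(\<integral>\<^sup>+x. ennreal (norm (gs (x::'a))) \<partial>lborel) < \<infinity>" using integrable_gs[where 'a='a] by (simp add: integrable_iff_bounded)
  ultimately show ?thesis using c by (intro integrableI_bounded) (auto simp: ennreal_mult_less_top)
qed

lemma integrable_dk: "integrable lborel (dk :: 'a::euclidean_space \<Rightarrow> real)"
  unfolding dk_def[abs_def] by (intro integrable_divide_zero integrable_gs_scale eps)

lemma dK_bounds: "0 \<le> dK z" "dK z \<le> dK (0::'a)" for z :: "'a::euclidean_space"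
  unfolding dK_def using eps gs_pos[of "0::'a"] gs_pos[of "(2 * pi / \<epsilon>) *\<^sub>R z"] gs_le[of "(2 * pi / \<epsilon>) *\<^sub>R z"]
  by (auto intro!: divide_right_mono)

lemma integrable_dK: "integrable lborel (dK :: 'a::euclidean_space \<Rightarrow> real)"
  unfolding dK_def[abs_def] by (intro integrable_divide_zero integrable_gs_scale) (use eps in auto)

lemma FI_dk: "FI (\<lambda>\<xi>. of_real (dk \<xi>)) z = of_real (dK z)" for z :: "'a::euclidean_space"
proof -
  let ?t = "- (2 * pi / \<epsilon>) *\<^sub>R z"
  have "complex_of_real (gs ?t / gs (0::'a)) = (LINT x|lborel. exp (\<i> * of_real (x \<bullet> ?t)) * of_real (gs x))"
    by (rule gs_fourier[symmetric])
  also have "\<dots> = \<epsilon> ^ DIM('a) *\<^sub>R (LINT x|lborel. exp (\<i> * of_real ((\<epsilon> *\<^sub>R x) \<bullet> ?t)) * of_real (gs (\<epsilon> *\<^sub>R x)))"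
    by (rule integral_lborel_scale[OF _ eps]) measurable
  also have "(\<lambda>x. exp (\<i> * of_real ((\<epsilon> *\<^sub>R x) \<bullet> ?t)) * of_real (gs (\<epsilon> *\<^sub>R x))) = (\<lambda>x. of_real (gs (0::'a)) * (ek (x \<bullet> z) * of_real (dk x)))"
    using eps gs_pos[of "0::'a"] by (auto simp: ek_def dk_def mult_ac)
  also have "(LINT x|lborel. of_real (gs (0::'a)) * (ek (x \<bullet> z) * of_real (dk x))) = of_real (gs (0::'a)) * FI (\<lambda>\<xi>. of_real (dk \<xi>)) z"
    unfolding FI_def by simp
  finally have "complex_of_real (gs ?t / gs (0::'a)) = of_real (\<epsilon> ^ DIM('a) * gs (0::'a)) * FI (\<lambda>\<xi>. of_real (dk \<xi>)) z"
    by (simp add: scaleR_conv_of_real mult_ac)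
  moreover have "gs ?t = gs ((2 * pi / \<epsilon>) *\<^sub>R z)"
    unfolding gs_eq[of ?t] gs_eq[of "(2 * pi / \<epsilon>) *\<^sub>R z"] by simp
  ultimately show ?thesis using eps gs_pos[of "0::'a"]
    by (simp add: dK_def field_simps power2_eq_square)
qed

text \<open>The damped integral equals the autocorrelation of \<open>f\<close> integrated against
  \<open>dK\<close>. The real part of the autocorrelation at \<open>z\<close> is \<open>nq f\<close>
  minus half the squared L2 distance between \<open>f\<close> and its translate, so the error in
  Plancherel's identity is an average of such distances.\<close>

lemma plancherel_smoothed:
  fixes f :: "'a::euclidean_space \<Rightarrow> complex"
  assumes f1: "integrable lborel f" and f2: "L2 f"
  shows "(LINT \<xi>|lborel. (norm (FI f \<xi>))\<^sup>2 * dk \<xi>) = nq f - (LINT z|lborel. gs z * nq (\<lambda>x. f x - f (x - (\<epsilon> / (2 * pi)) *\<^sub>R z))) / 2"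
proof -
  have fm [measurable]: "f \<in> borel_measurable borel" using f1 by auto
  define c where "c = (LINT x|lborel. norm (f x))"
  have idk: "integrable lborel (\<lambda>\<xi>::'a. complex_of_real (dk \<xi>))" by (intro integrable_of_real integrable_dk)
  define G where "G \<xi> = cnj (FI f \<xi>) * of_real (dk \<xi>)" for \<xi>
  have G: "integrable lborel G" unfolding G_def
    by (rule integrable_bounded_mult[OF idk, of _ c]) (use norm_FI_le in \<open>auto simp: c_def\<close>)
  \<comment> \<open>The conjugated reflection has transform \<open>cnj (FI f)\<close>, so both
    factors of the squared modulus are transforms and the multiplication formula
    \<open>integral_FI_mult\<close> applies twice.\<close>
  define h where "h y = cnj (f (0 - y))" for y
  have h: "integrable lborel h" unfolding h_def
    using integrable_lborel_translate(2)[OF f1, of 0] by (simp add: integrable_cnj)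
  have hm [measurable]: "h \<in> borel_measurable borel" using h by auto
  have FIh: "FI h \<xi> = cnj (FI f \<xi>)" for \<xi>
  proof -
    have "FI h \<xi> = (LINT y|lborel. ek ((0 - y) \<bullet> \<xi>) * h (0 - y))"
      unfolding FI_def by (rule integral_lborel_reflect[symmetric]) measurable
    also have "\<dots> = (LINT y|lborel. cnj (ek (y \<bullet> \<xi>) * f y))"
      by (simp add: h_def cnj_ek)
    finally show ?thesis by (simp add: FI_def del: complex_cnj_mult)
  qed
  have FIG: "FI G x = (LINT z|lborel. cnj (f (x - z)) * of_real (dK z))" for x
  proof -
    have i: "integrable lborel (\<lambda>\<xi>::'a. ek (\<xi> \<bullet> x) * complex_of_real (dk \<xi>))" by (rule integrable_ek_mult[OF idk])
    have "FI G x = (LINT \<xi>|lborel. FI h \<xi> * (ek (\<xi> \<bullet> x) * of_real (dk \<xi>)))"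
      unfolding FI_def[of G] G_def FIh by (simp add: mult_ac)
    also have "\<dots> = (LINT y|lborel. h y * FI (\<lambda>\<xi>. ek (\<xi> \<bullet> x) * of_real (dk \<xi>)) y)"
      by (rule integral_FI_mult[OF h i])
    also have "(\<lambda>y. FI (\<lambda>\<xi>. ek (\<xi> \<bullet> x) * of_real (dk \<xi>)) y) = (\<lambda>y. FI (\<lambda>\<xi>. of_real (dk \<xi>)) (x + y))"
      unfolding FI_def by (simp add: inner_add_right ek_add mult_ac)
    also have "(LINT y|lborel. h y * FI (\<lambda>\<xi>. of_real (dk \<xi>)) (x + y)) = (LINT y|lborel. h y * of_real (dK (x + y)))"
      by (simp add: FI_dk)
    also have "\<dots> = (LINT z|lborel. h (- x + z) * of_real (dK (x + (- x + z))))"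
      by (rule integral_lborel_translate[symmetric]) measurable
    finally show ?thesis by (simp add: h_def)
  qed
  \<comment> \<open>The autocorrelation of \<open>f\<close>.\<close>
  define A where "A z = (LINT x|lborel. f x * cnj (f (x - z)))" for z
  have Am [measurable]: "A \<in> borel_measurable borel" unfolding A_def by measurable
  have Lz: "L2 (\<lambda>x. f (x - z))" and nz: "nq (\<lambda>x. f (x - z)) = nq f" for z
  proof -
    show "L2 (\<lambda>x. f (x - z))"
      using integrable_lborel_translate(1)[OF L2_integrable[OF f2], of "- z"] by (simp add: L2_def)
    show "nq (\<lambda>x. f (x - z)) = nq f"
      using integral_lborel_translate[of "\<lambda>x. (norm (f x))\<^sup>2" "- z"] by (simp add: nq_def)
  qed
  have Lc: "L2 (\<lambda>x. cnj (f (x - z)))" and nc: "nq (\<lambda>x. cnj (f (x - z))) = nq f" for z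
    using Lz[of z] nz[of z] by (auto simp: L2_def nq_def)
  have A_bound: "norm (A z) \<le> nq f" for z
    using L2_prod_integral_bound(1)[OF f2 Lc[of z], of 1] by (simp add: A_def nc)
  have ReA: "Re (A z) = nq f - nq (\<lambda>x. f x - f (x - z)) / 2" for z
  proof -
    have e: "(norm (a - b))\<^sup>2 = (norm a)\<^sup>2 + (norm b)\<^sup>2 - 2 * Re (a * cnj b)" for a b :: complex
      unfolding cmod_power2 by (simp add: power2_eq_square algebra_simps)
    have i: "integrable lborel (\<lambda>x. f x * cnj (f (x - z)))" by (rule L2_prod[OF f2 Lc])
    have "nq (\<lambda>x. f x - f (x - z)) = (LINT x|lborel. (norm (f x))\<^sup>2 + (norm (f (x - z)))\<^sup>2) - (LINT x|lborel. 2 * Re (f x * cnj (f (x - z))))"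
      unfolding nq_def[of "\<lambda>x. f x - f (x - z)"] e
      by (intro Bochner_Integration.integral_diff Bochner_Integration.integrable_add L2_integrable f2 Lz integrable_mult_right integrable_Re i)
    also have "(LINT x|lborel. (norm (f x))\<^sup>2 + (norm (f (x - z)))\<^sup>2) = nq f + nq (\<lambda>x. f (x - z))"
      unfolding nq_def by (intro Bochner_Integration.integral_add L2_integrable f2 Lz)
    also have "(LINT x|lborel. 2 * Re (f x * cnj (f (x - z)))) = 2 * Re (A z)"
      unfolding A_def using i by (simp del: times_complex.sel)
    finally show ?thesis unfolding nz by linarith
  qed
  have "complex_of_real (LINT \<xi>|lborel. (norm (FI f \<xi>))\<^sup>2 * dk \<xi>) = (LINT \<xi>|lborel. complex_of_real ((norm (FI f \<xi>))\<^sup>2 * dk \<xi>))"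
    by (rule integral_complex_of_real[symmetric])
  also have "\<dots> = (LINT \<xi>|lborel. FI f \<xi> * G \<xi>)"
    unfolding G_def by (intro Bochner_Integration.integral_cong refl) (simp only: of_real_mult complex_norm_square mult.assoc)
  also have "\<dots> = (LINT x|lborel. f x * FI G x)" by (rule integral_FI_mult[OF f1 G])
  also have "\<dots> = (LINT x|lborel. LINT z|lborel. f x * cnj (f (x - z)) * of_real (dK z))"
    unfolding FIG by (simp add: mult.assoc)
  also have "\<dots> = (LINT z|lborel. LINT x|lborel. f x * cnj (f (x - z)) * of_real (dK z))"
  proof (rule integral_lborel_commute)
    have "(\<integral>\<^sup>+x. \<integral>\<^sup>+z. ennreal (norm (f x * cnj (f (x - z)) * of_real (dK z))) \<partial>lborel \<partial>lborel)
       \<le> (\<integral>\<^sup>+x. \<integral>\<^sup>+z. ennreal (norm (f x)) * (ennreal (dK (0::'a)) * ennreal (norm (f (x - z)))) \<partial>lborel \<partial>lborel)"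
    proof (intro nn_integral_mono)
      fix x z
      have "norm (f x * cnj (f (x - z)) * of_real (dK z)) \<le> norm (f x) * (dK (0::'a) * norm (f (x - z)))"
      proof -
        have "norm (f x * cnj (f (x - z)) * of_real (dK z)) = norm (f x) * (dK z * norm (f (x - z)))"
          using dK_bounds(1)[of z] by (simp add: norm_mult)
        also have "\<dots> \<le> norm (f x) * (dK (0::'a) * norm (f (x - z)))"
          by (intro mult_left_mono mult_right_mono dK_bounds) auto
        finally show ?thesis .
      qed
      then have "ennreal (norm (f x * cnj (f (x - z)) * of_real (dK z))) \<le> ennreal (norm (f x) * (dK (0::'a) * norm (f (x - z))))"
        by (rule ennreal_leI)
      then show "ennreal (norm (f x * cnj (f (x - z)) * of_real (dK z))) \<le> ennreal (norm (f x)) * (ennreal (dK (0::'a)) * ennreal (norm (f (x - z))))"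
        by (simp add: ennreal_mult dK_bounds)
    qed
    also have "\<dots> = (\<integral>\<^sup>+x. ennreal (norm (f x)) * (ennreal (dK (0::'a)) * (\<integral>\<^sup>+z. ennreal (norm (f z)) \<partial>lborel)) \<partial>lborel)"
      using nn_integral_lborel_reflect[of "\<lambda>z. ennreal (norm (f z))"] by (simp add: nn_integral_cmult)
    also have "\<dots> = (\<integral>\<^sup>+x. ennreal (norm (f x)) \<partial>lborel) * (ennreal (dK (0::'a)) * (\<integral>\<^sup>+z. ennreal (norm (f z)) \<partial>lborel))"
      by (rule nn_integral_multc) measurable
    also have "\<dots> < \<infinity>" using f1 by (auto simp: integrable_iff_bounded ennreal_mult_less_top)
    finally show "(\<integral>\<^sup>+x. \<integral>\<^sup>+z. ennreal (norm (f x * cnj (f (x - z)) * of_real (dK z))) \<partial>lborel \<partial>lborel) < \<infinity>" .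
  qed measurable
  also have "\<dots> = (LINT z|lborel. A z * of_real (dK z))" by (simp add: A_def)
  finally have 1: "complex_of_real (LINT \<xi>|lborel. (norm (FI f \<xi>))\<^sup>2 * dk \<xi>) = (LINT z|lborel. A z * of_real (dK z))" .
  have iA: "integrable lborel (\<lambda>z. A z * complex_of_real (dK z))"
    by (rule integrable_bounded_mult[OF integrable_of_real[OF integrable_dK], of _ "nq f"]) (use A_bound in auto)
  from arg_cong[OF 1, of Re] have "(LINT \<xi>|lborel. (norm (FI f \<xi>))\<^sup>2 * dk \<xi>) = (LINT z|lborel. Re (A z * of_real (dK z)))"
    using iA by (simp del: times_complex.sel)
  also have "\<dots> = (LINT z|lborel. Re (A z) * dK z)" by simp
  \<comment> \<open>This rescaling turns \<open>dK\<close> into the fixed density \<open>gs\<close>,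
    leaving \<open>\<epsilon>\<close> only in the size of the shift.\<close>
  also have "\<dots> = (\<epsilon> / (2 * pi)) ^ DIM('a) *\<^sub>R (LINT z|lborel. Re (A ((\<epsilon> / (2 * pi)) *\<^sub>R z)) * dK ((\<epsilon> / (2 * pi)) *\<^sub>R z))"
    by (rule integral_lborel_scale) (use eps in auto)
  also have "\<dots> = (LINT z|lborel. (\<epsilon> / (2 * pi)) ^ DIM('a) * (Re (A ((\<epsilon> / (2 * pi)) *\<^sub>R z)) * dK ((\<epsilon> / (2 * pi)) *\<^sub>R z)))"
    by simp
  also have "\<dots> = (LINT z|lborel. gs z * Re (A ((\<epsilon> / (2 * pi)) *\<^sub>R z)))"
  proof (intro Bochner_Integration.integral_cong refl)
    fix z :: 'a
    have "dK ((\<epsilon> / (2 * pi)) *\<^sub>R z) = gs z / (\<epsilon> ^ DIM('a) * (gs (0::'a))\<^sup>2)" using eps by (simp add: dK_def)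
    moreover have "(\<epsilon> / (2 * pi)) ^ DIM('a) / (\<epsilon> ^ DIM('a) * (gs (0::'a))\<^sup>2) = 1 / ((gs (0::'a))\<^sup>2 * (2 * pi) ^ DIM('a))"
      using eps by (simp add: power_divide)
    ultimately show "(\<epsilon> / (2 * pi)) ^ DIM('a) * (Re (A ((\<epsilon> / (2 * pi)) *\<^sub>R z)) * dK ((\<epsilon> / (2 * pi)) *\<^sub>R z)) = gs z * Re (A ((\<epsilon> / (2 * pi)) *\<^sub>R z))"
      unfolding gs_zero by (simp add: mult_ac)
  qed
  also have "\<dots> = (LINT z|lborel. nq f * gs z - gs z * nq (\<lambda>x. f x - f (x - (\<epsilon> / (2 * pi)) *\<^sub>R z)) / 2)"
    unfolding ReA by (simp add: algebra_simps)
  also have "\<dots> = nq f - (LINT z|lborel. gs z * nq (\<lambda>x. f x - f (x - (\<epsilon> / (2 * pi)) *\<^sub>R z))) / 2"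
  proof -
    let ?D = "\<lambda>z. nq (\<lambda>x. f x - f (x - (\<epsilon> / (2 * pi)) *\<^sub>R z))"
    have Db: "?D z \<le> 4 * nq f" for z using L2_diff(2)[OF f2 Lz] by (simp add: nz)
    have [measurable]: "?D \<in> borel_measurable borel" unfolding nq_def by measurable
    have iD: "integrable lborel (\<lambda>z. gs z * ?D z)"
    proof (rule Bochner_Integration.integrable_bound[OF integrable_mult_left[OF integrable_gs, of "4 * nq f"]])
      show "AE z in lborel. norm (gs z * ?D z) \<le> norm (gs z * (4 * nq f))"
        using Db by (intro AE_I2) (auto simp: abs_mult nq_nonneg intro!: mult_left_mono)
    qed measurable
    have i1: "integrable lborel (\<lambda>z::'a. nq f * gs z)" by (intro integrable_mult_right integrable_gs)
    have i2: "integrable lborel (\<lambda>z. gs z * ?D z / 2)" using iD by simp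
    have "(LINT z|lborel. nq f * gs z - gs z * ?D z / 2) = (LINT z|lborel. nq f * gs (z::'a)) - (LINT z|lborel. gs z * ?D z / 2)"
      by (rule Bochner_Integration.integral_diff[OF i1 i2])
    then show ?thesis by (simp add: integral_gs)
  qed
  finally show ?thesis .
qed

end

text \<open>Remove the damping: the error tends to 0 by dominated convergence and L2 continuity of
  translations, while the damped integrals increase to the full one by monotone convergence. The
  latter needs no prior knowledge that the transform is square integrable, but proves it.\<close>

theorem plancherel_L1_L2:
  fixes f :: "'a::euclidean_space \<Rightarrow> complex"
  assumes f1: "integrable lborel f" and f2: "L2 f"
  shows "L2 (FI f)" "nq (FI f) = nq f"
proof -
  have fm [measurable]: "f \<in> borel_measurable borel" using f1 by auto
  define e where "e n = 1 / real (Suc n)" for n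
  have e: "e n > 0" for n by (simp add: e_def)
  have e0: "e \<longlonglongrightarrow> 0" unfolding e_def by (rule LIMSEQ_Suc[OF lim_1_over_n, unfolded]) 
  define D where "D v = nq (\<lambda>x. f x - f (x - v))" for v
  have [measurable]: "D \<in> borel_measurable borel" unfolding D_def nq_def by measurable
  have Lz: "L2 (\<lambda>x. f (x - z))" and nz: "nq (\<lambda>x. f (x - z)) = nq f" for z
  proof -
    show "L2 (\<lambda>x. f (x - z))"
      using integrable_lborel_translate(1)[OF L2_integrable[OF f2], of "- z"] by (simp add: L2_def)
    show "nq (\<lambda>x. f (x - z)) = nq f"
      using integral_lborel_translate[of "\<lambda>x. (norm (f x))\<^sup>2" "- z"] by (simp add: nq_def)
  qed
  have Db: "0 \<le> D v" "D v \<le> 4 * nq f" for v using L2_diff(2)[OF f2 Lz] by (simp_all add: D_def nz nq_nonneg)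
  have D0: "(\<lambda>n. D (v n)) \<longlonglongrightarrow> 0" if "v \<longlonglongrightarrow> 0" for v
  proof -
    have "(\<lambda>n. - v n) \<longlonglongrightarrow> 0" using tendsto_minus[OF that] by simp
    from L2_translation_continuous[OF f2 this] show ?thesis
      by (simp add: D_def nq_minus_commute[of f])
  qed
  have "(\<lambda>n. LINT z|lborel. gs z * D ((e n / (2 * pi)) *\<^sub>R z)) \<longlonglongrightarrow> integral\<^sup>L lborel (\<lambda>z::'a. 0 :: real)"
  proof (rule integral_dominated_convergence[where w = "\<lambda>z. gs z * (4 * nq f)"])
    show "integrable lborel (\<lambda>z::'a. gs z * (4 * nq f))" by (intro integrable_mult_left integrable_gs)
    show "AE z in lborel. norm (gs z * D ((e n / (2 * pi)) *\<^sub>R z)) \<le> gs z * (4 * nq f)" for n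
      using Db by (intro AE_I2) (auto simp: abs_mult abs_of_pos[OF gs_pos] intro!: mult_left_mono less_imp_le[OF gs_pos])
    show "AE z in lborel. (\<lambda>n. gs z * D ((e n / (2 * pi)) *\<^sub>R z)) \<longlonglongrightarrow> 0"
    proof (rule AE_I2)
      fix z :: 'a
      have "(\<lambda>n. (e n / (2 * pi)) *\<^sub>R z) \<longlonglongrightarrow> (0 / (2 * pi)) *\<^sub>R z" by (intro tendsto_intros e0) auto
      then have "(\<lambda>n. gs z * D ((e n / (2 * pi)) *\<^sub>R z)) \<longlonglongrightarrow> gs z * 0" by (intro tendsto_mult tendsto_const D0) simp
      then show "(\<lambda>n. gs z * D ((e n / (2 * pi)) *\<^sub>R z)) \<longlonglongrightarrow> 0" by simp
    qed
  qed measurable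
  then have "(\<lambda>n. nq f - (LINT z|lborel. gs z * D ((e n / (2 * pi)) *\<^sub>R z)) / 2) \<longlonglongrightarrow> nq f - 0 / 2"
    by (intro tendsto_intros) auto
  then have l1: "(\<lambda>n. LINT \<xi>|lborel. (norm (FI f \<xi>))\<^sup>2 * dk (e n) \<xi>) \<longlonglongrightarrow> nq f"
    unfolding plancherel_smoothed[OF e f1 f2] D_def by simp
  have kb: "0 \<le> dk (e n) \<xi>" for n \<xi> by (simp add: dk_eq[OF e])
  define c where "c = (LINT x|lborel. norm (f x))"
  have nnint: "(\<integral>\<^sup>+\<xi>. ennreal ((norm (FI f \<xi>))\<^sup>2 * dk (e n) \<xi>) \<partial>lborel) = ennreal (LINT \<xi>|lborel. (norm (FI f \<xi>))\<^sup>2 * dk (e n) \<xi>)" for n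
  proof (rule nn_integral_eq_integral)
    show "integrable lborel (\<lambda>\<xi>. (norm (FI f \<xi>))\<^sup>2 * dk (e n) \<xi>)"
    proof (rule Bochner_Integration.integrable_bound[OF integrable_mult_right[OF integrable_dk[OF e], of "c\<^sup>2"]])
      show "(\<lambda>\<xi>. (norm (FI f \<xi>))\<^sup>2 * dk (e n) \<xi>) \<in> borel_measurable lborel"
        using borel_dk[OF e] by measurable
      show "AE \<xi> in lborel. norm ((norm (FI f \<xi>))\<^sup>2 * dk (e n) \<xi>) \<le> norm (c\<^sup>2 * dk (e n) \<xi>)"
        using norm_FI_le[of f] kb by (intro AE_I2) (auto simp: abs_mult c_def intro!: mult_right_mono power_mono)
    qed
  qed (use kb in \<open>auto intro!: AE_I2 mult_nonneg_nonneg\<close>)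
  have l2: "(\<lambda>n. \<integral>\<^sup>+\<xi>. ennreal ((norm (FI f \<xi>))\<^sup>2 * dk (e n) \<xi>) \<partial>lborel) \<longlonglongrightarrow> (\<integral>\<^sup>+\<xi>. ennreal ((norm (FI f \<xi>))\<^sup>2) \<partial>lborel)"
  proof (rule nn_integral_LIMSEQ)
    show "incseq (\<lambda>n \<xi>. ennreal ((norm (FI f \<xi>))\<^sup>2 * dk (e n) \<xi>))"
    proof (rule incseq_SucI, rule le_funI, rule ennreal_leI, rule mult_left_mono)
      fix n and \<xi> :: 'a
      have "e (Suc n) \<le> e n" by (simp add: e_def frac_le)
      then have "(e (Suc n) * norm \<xi>)\<^sup>2 \<le> (e n * norm \<xi>)\<^sup>2" using e[of "Suc n"] by (intro power_mono mult_right_mono) auto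
      then show "dk (e n) \<xi> \<le> dk (e (Suc n)) \<xi>" by (simp add: dk_eq[OF e])
    qed simp
    show "(\<lambda>\<xi>. ennreal ((norm (FI f \<xi>))\<^sup>2 * dk (e n) \<xi>)) \<in> borel_measurable lborel" for n
      using borel_dk[OF e] by measurable
    fix \<xi> :: 'a
    have "(\<lambda>n. exp (- (e n * norm \<xi>)\<^sup>2 / 2)) \<longlonglongrightarrow> exp (- (0 * norm \<xi>)\<^sup>2 / 2)"
      by (intro tendsto_intros e0) auto
    then have "(\<lambda>n. (norm (FI f \<xi>))\<^sup>2 * dk (e n) \<xi>) \<longlonglongrightarrow> (norm (FI f \<xi>))\<^sup>2 * 1"
      by (intro tendsto_mult tendsto_const) (simp add: dk_eq[OF e])
    then show "(\<lambda>n. ennreal ((norm (FI f \<xi>))\<^sup>2 * dk (e n) \<xi>)) \<longlonglongrightarrow> ennreal ((norm (FI f \<xi>))\<^sup>2)"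
      by (intro tendsto_ennrealI) simp
  qed
  have eq: "(\<integral>\<^sup>+\<xi>. ennreal ((norm (FI f \<xi>))\<^sup>2) \<partial>lborel) = ennreal (nq f)"
    by (rule LIMSEQ_unique[OF l2]) (unfold nnint, intro tendsto_ennrealI l1)
  show L: "L2 (FI f)" by (rule L2I(1)[of _ "nq f"]) (use eq nq_nonneg in auto)
  show "nq (FI f) = nq f" using eq L2_nn[OF L] by (simp add: nq_nonneg)
qed


section \<open>The Fourier transform on L2 and its inverse\<close>

definition tr :: "nat \<Rightarrow> ('a::euclidean_space \<Rightarrow> complex) \<Rightarrow> 'a \<Rightarrow> complex" where
  "tr n f x = indicator (cball 0 (real n)) x * f x"

lemma borel_tr [measurable]:
  assumes [measurable]: "f \<in> borel_measurable borel"
  shows "tr n f \<in> borel_measurable borel"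
proof -
  have [measurable]: "cball (0::'a) (real n) \<in> sets borel" by simp
  show ?thesis unfolding tr_def[abs_def] by measurable
qed

lemma norm_tr_le: "norm (tr n f x) \<le> norm (f x)"
  by (auto simp: tr_def norm_mult split: split_indicator)

lemma L2_tr: "L2 f \<Longrightarrow> L2 (tr n f)"
  by (rule L2_bound(1)) (auto simp: norm_tr_le)

lemma integrable_tr: 
  assumes "L2 f" shows "integrable lborel (tr n f)"
proof -
  have "L2 (\<lambda>x. indicator (cball (0::'a) (real n)) x :: complex)"
  proof -
    have "integrable lborel (indicator (cball (0::'a) (real n)) :: 'a \<Rightarrow> real)"
      using emeasure_bounded_finite[OF bounded_cball, of "0::'a" "real n"] by (intro integrable_real_indicator) simp_all
    moreover have "(\<lambda>x. (norm (indicator (cball (0::'a) (real n)) x :: complex))\<^sup>2) = indicator (cball 0 (real n))"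
      by (auto split: split_indicator)
    moreover have "(indicator (cball (0::'a) (real n)) :: 'a \<Rightarrow> complex) \<in> borel_measurable borel"
      by (rule borel_measurable_indicator) simp
    ultimately show ?thesis by (simp add: L2_def)
  qed
  from L2_prod[OF this assms] show ?thesis by (simp add: tr_def[abs_def])
qed

lemma tr_tendsto: "(\<lambda>n. tr n f x) \<longlonglongrightarrow> f x"
proof -
  obtain N :: nat where N: "norm x \<le> real N" using real_arch_simple by blast
  have "eventually (\<lambda>n. tr n f x = f x) sequentially"
    using eventually_ge_at_top[of N] by eventually_elim (use N in \<open>auto simp: tr_def\<close>)
  then show ?thesis by (rule tendsto_eventually)
qed

lemma L2_dominated:
  assumes f: "L2 f" and [measurable]: "\<And>n. F n \<in> borel_measurable borel"
    and le: "\<And>n x. norm (F n x) \<le> norm (f x)" and lim: "AE x in lborel. (\<lambda>n. F n x) \<longlonglongrightarrow> f x"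
  shows "(\<lambda>n. nq (\<lambda>x. F n x - f x)) \<longlonglongrightarrow> 0"
proof -
  note [measurable] = L2_measurable[OF f]
  have "(\<lambda>n. nq (\<lambda>x. F n x - f x)) \<longlonglongrightarrow> integral\<^sup>L lborel (\<lambda>x::'a. 0 :: real)"
    unfolding nq_def
  proof (rule integral_dominated_convergence[where w = "\<lambda>x. 4 * (norm (f x))\<^sup>2"])
    show "integrable lborel (\<lambda>x. 4 * (norm (f x))\<^sup>2)" using f by (simp add: L2_integrable)
    show "AE x in lborel. norm ((norm (F n x - f x))\<^sup>2) \<le> 4 * (norm (f x))\<^sup>2" for n
    proof (rule AE_I2)
      fix x
      have "norm (F n x - f x) \<le> 2 * norm (f x)" using norm_triangle_ineq4[of "F n x" "f x"] le[of n x] by linarith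
      then have "(norm (F n x - f x))\<^sup>2 \<le> (2 * norm (f x))\<^sup>2" by (intro power_mono) auto
      then show "norm ((norm (F n x - f x))\<^sup>2) \<le> 4 * (norm (f x))\<^sup>2" by (simp add: power_mult_distrib)
    qed
    show "AE x in lborel. (\<lambda>n. (norm (F n x - f x))\<^sup>2) \<longlonglongrightarrow> 0"
      using lim
    proof eventually_elim
      case (elim x)
      then have "(\<lambda>n. (norm (F n x - f x))\<^sup>2) \<longlonglongrightarrow> (norm (f x - f x))\<^sup>2" by (intro tendsto_intros)
      then show ?case by simp
    qed
  qed measurable
  then show ?thesis by simp
qed

lemma nq_tr: "L2 f \<Longrightarrow> (\<lambda>n. nq (\<lambda>x. tr n f x - f x)) \<longlonglongrightarrow> 0"
  by (rule L2_dominated) (auto simp: norm_tr_le tr_tendsto)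

text \<open>The Borel form of \<open>is_fourier\<close>, matched with it in
  \<open>is_fourier_iff\<close>. A relation suits functions that are determined only up to null
  sets.\<close>

definition fou :: "('a::euclidean_space \<Rightarrow> complex) \<Rightarrow> ('a \<Rightarrow> complex) \<Rightarrow> bool" where
  "fou f g \<longleftrightarrow> L2 f \<and> L2 g \<and> (\<lambda>n. nq (\<lambda>\<xi>. FI (tr n f) \<xi> - g \<xi>)) \<longlonglongrightarrow> 0"

lemma fouD: "fou f g \<Longrightarrow> L2 f" "fou f g \<Longrightarrow> L2 g"
  by (auto simp: fou_def)

lemma L2_FI_tr: "L2 f \<Longrightarrow> L2 (FI (tr n f))"
  by (intro plancherel_L1_L2 integrable_tr L2_tr)

lemma nq_FI_diff:
  assumes "integrable lborel f" "L2 f" "integrable lborel g" "L2 g"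
  shows "nq (\<lambda>\<xi>. FI f \<xi> - FI g \<xi>) = nq (\<lambda>x. f x - g x)"
proof -
  have "(\<lambda>\<xi>. FI f \<xi> - FI g \<xi>) = FI (\<lambda>x. f x - g x)" using assms by (intro ext FI_diff[symmetric])
  then show ?thesis
    using plancherel_L1_L2(2)[of "\<lambda>x. f x - g x"] L2_diff(1)[OF assms(2,4)] assms by simp
qed

lemma fou_ex:
  assumes f: "L2 f" shows "\<exists>g. fou f g"
proof -
  have "\<exists>g. L2 g \<and> (\<lambda>n. nq (\<lambda>\<xi>. FI (tr n f) \<xi> - g \<xi>)) \<longlonglongrightarrow> 0"
  proof (rule L2_complete)
    show "L2 (FI (tr n f))" for n by (rule L2_FI_tr[OF f])
    fix e :: real assume e: "e > 0"
    obtain N where N: "\<And>n. n \<ge> N \<Longrightarrow> nq (\<lambda>x. tr n f x - f x) < e / 4"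
      using LIMSEQ_D[OF nq_tr[OF f], of "e / 4"] e by (auto simp: nq_nonneg)
    show "\<exists>N. \<forall>i\<ge>N. \<forall>j\<ge>N. nq (\<lambda>x. FI (tr i f) x - FI (tr j f) x) < e"
    proof (intro exI[of _ N] allI impI)
      fix i j assume ij: "i \<ge> N" "j \<ge> N"
      have "nq (\<lambda>x. FI (tr i f) x - FI (tr j f) x) = nq (\<lambda>x. tr i f x - tr j f x)"
        by (intro nq_FI_diff integrable_tr L2_tr f)
      also have "\<dots> \<le> 2 * nq (\<lambda>x. tr i f x - f x) + 2 * nq (\<lambda>x. tr j f x - f x)"
        using L2_diff(2)[OF L2_diff(1)[OF L2_tr[OF f, of i] f] L2_diff(1)[OF L2_tr[OF f, of j] f]] by simp
      also have "\<dots> < e" using N[OF ij(1)] N[OF ij(2)] by simp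
      finally show "nq (\<lambda>x. FI (tr i f) x - FI (tr j f) x) < e" .
    qed
  qed
  then show ?thesis using f by (auto simp: fou_def)
qed

lemma fou_norm: "fou f g \<Longrightarrow> nq g = nq f"
proof -
  assume a: "fou f g"
  then have f: "L2 f" and g: "L2 g" by (auto simp: fou_def)
  have "(\<lambda>n. nq (FI (tr n f))) \<longlonglongrightarrow> nq g"
    using a by (intro nq_tendsto L2_FI_tr f g) (auto simp: fou_def)
  moreover have "(\<lambda>n. nq (tr n f)) \<longlonglongrightarrow> nq f" by (intro nq_tendsto L2_tr f nq_tr)
  moreover have "nq (FI (tr n f)) = nq (tr n f)" for n by (intro plancherel_L1_L2 integrable_tr L2_tr f)
  ultimately show ?thesis by (auto intro: LIMSEQ_unique)
qed

lemma fou_unique: "fou f g \<Longrightarrow> fou f g' \<Longrightarrow> AE \<xi> in lborel. g \<xi> = g' \<xi>"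
  by (rule L2_limit_unique[of "\<lambda>n. FI (tr n f)"]) (auto simp: fou_def L2_FI_tr)

lemma fou_diff:
  assumes "fou f g" "fou f' g'" shows "fou (\<lambda>x. f x - f' x) (\<lambda>\<xi>. g \<xi> - g' \<xi>)"
proof -
  have f: "L2 f" "L2 f'" and g: "L2 g" "L2 g'" using assms by (auto simp: fou_def)
  have t: "tr n (\<lambda>x. f x - f' x) = (\<lambda>x. tr n f x - tr n f' x)" for n by (auto simp: tr_def right_diff_distrib)
  have F: "FI (tr n (\<lambda>x. f x - f' x)) \<xi> = FI (tr n f) \<xi> - FI (tr n f') \<xi>" for n \<xi>
    unfolding t by (intro FI_diff integrable_tr f)
  have "(\<lambda>n. nq (\<lambda>\<xi>. FI (tr n (\<lambda>x. f x - f' x)) \<xi> - (g \<xi> - g' \<xi>))) \<longlonglongrightarrow> 0"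
  proof (rule tendsto_sandwich[OF _ _ tendsto_const])
    show "eventually (\<lambda>n. nq (\<lambda>\<xi>. FI (tr n (\<lambda>x. f x - f' x)) \<xi> - (g \<xi> - g' \<xi>)) \<le>
       2 * nq (\<lambda>\<xi>. FI (tr n f) \<xi> - g \<xi>) + 2 * nq (\<lambda>\<xi>. FI (tr n f') \<xi> - g' \<xi>)) sequentially"
      using L2_diff(2)[OF L2_diff(1)[OF L2_FI_tr[OF f(1)] g(1)] L2_diff(1)[OF L2_FI_tr[OF f(2)] g(2)]]
      by (intro always_eventually allI) (simp add: F algebra_simps)
    have "(\<lambda>n. 2 * nq (\<lambda>\<xi>. FI (tr n f) \<xi> - g \<xi>) + 2 * nq (\<lambda>\<xi>. FI (tr n f') \<xi> - g' \<xi>)) \<longlonglongrightarrow> 2 * 0 + 2 * 0"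
      using assms by (intro tendsto_intros) (auto simp: fou_def)
    then show "(\<lambda>n. 2 * nq (\<lambda>\<xi>. FI (tr n f) \<xi> - g \<xi>) + 2 * nq (\<lambda>\<xi>. FI (tr n f') \<xi> - g' \<xi>)) \<longlonglongrightarrow> 0" by simp
  qed (simp add: nq_nonneg)
  then show ?thesis unfolding fou_def by (intro conjI L2_diff f g)
qed

lemma fou_inj: "fou f g \<Longrightarrow> fou f' g \<Longrightarrow> AE x in lborel. f x = f' x"
proof -
  assume a: "fou f g" "fou f' g"
  have d: "fou (\<lambda>x. f x - f' x) (\<lambda>\<xi>. g \<xi> - g \<xi>)" by (rule fou_diff[OF a])
  have "nq (\<lambda>x. f x - f' x) = 0" using fou_norm[OF d] by (simp add: nq_def)
  then have "AE x in lborel. f x - f' x = 0" using nq_zero_iff[OF fouD(1)[OF d]] by simp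
  then show ?thesis by eventually_elim simp
qed

lemma nq_cong_AE:
  assumes "AE x in lborel. f x = g x" "f \<in> borel_measurable borel" "g \<in> borel_measurable borel"
  shows "nq f = nq g"
  unfolding nq_def by (rule integral_cong_AE) (use assms in \<open>auto elim!: eventually_mono\<close>)

lemma L2_cong_AE:
  assumes "AE x in lborel. f x = g x" "L2 f" and [measurable]: "g \<in> borel_measurable borel"
  shows "L2 g"
proof -
  note [measurable] = L2_measurable[OF assms(2)]
  show ?thesis
    using assms(1,2) unfolding L2_def
    by (auto intro!: integrable_cong_AE_imp[of _ "\<lambda>x. (norm (f x))\<^sup>2"] elim!: eventually_mono)
qed

lemma FI_cong_AE:
  assumes "AE x in lborel. f x = g x" and [measurable]: "f \<in> borel_measurable borel" "g \<in> borel_measurable borel"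
  shows "FI f = FI g"
  unfolding FI_def by (intro ext integral_cong_AE) (use assms(1) in \<open>auto elim!: eventually_mono\<close>)

lemma fou_cong_AE:
  assumes "fou f g" "AE x in lborel. f x = f' x" "AE x in lborel. g x = g' x"
    and [measurable]: "f' \<in> borel_measurable borel" "g' \<in> borel_measurable borel"
  shows "fou f' g'"
proof -
  have f: "L2 f" and g: "L2 g" using assms(1) by (auto simp: fou_def)
  note [measurable] = L2_measurable[OF f] L2_measurable[OF g]
  have t: "FI (tr n f) = FI (tr n f')" for n
    by (rule FI_cong_AE) (use assms(2) in \<open>auto simp: tr_def elim!: eventually_mono\<close>)
  have "nq (\<lambda>\<xi>. FI (tr n f') \<xi> - g \<xi>) = nq (\<lambda>\<xi>. FI (tr n f') \<xi> - g' \<xi>)" for n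
    by (rule nq_cong_AE) (use assms(3) in \<open>auto elim!: eventually_mono\<close>)
  then show ?thesis using assms(1) L2_cong_AE[OF assms(2) f] L2_cong_AE[OF assms(3) g] unfolding fou_def t by simp
qed

lemma fou_L1:
  assumes "integrable lborel f" "L2 f" shows "fou f (FI f)"
proof -
  have "nq (\<lambda>\<xi>. FI (tr n f) \<xi> - FI f \<xi>) = nq (\<lambda>x. tr n f x - f x)" for n
    by (intro nq_FI_diff integrable_tr L2_tr assms)
  then show ?thesis unfolding fou_def using nq_tr[OF assms(2)] plancherel_L1_L2[OF assms] assms by simp
qed

text \<open>By the isometry, the transforms \<open>G n\<close> also converge to a transform of
  \<open>f\<close>; limits in L2 are unique.\<close>

lemma fou_limit:
  assumes "\<And>n. fou (F n) (G n)" "L2 f" "L2 g" "(\<lambda>n. nq (\<lambda>x. F n x - f x)) \<longlonglongrightarrow> 0" "(\<lambda>n. nq (\<lambda>x. G n x - g x)) \<longlonglongrightarrow> 0"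
  shows "fou f g"
proof -
  obtain k where k: "fou f k" using fou_ex[OF assms(2)] by blast
  have "nq (\<lambda>x. G n x - k x) = nq (\<lambda>x. F n x - f x)" for n
    using fou_norm[OF fou_diff[OF assms(1)[of n] k]] .
  then have "AE x in lborel. k x = g x"
    by (intro L2_limit_unique[of G] fouD(2)[OF assms(1)] fouD(2)[OF k] assms) (use assms in auto)
  then show ?thesis by (intro fou_cong_AE[OF k]) (use assms in \<open>auto simp: L2_def\<close>)
qed

lemma L2_cnj: "L2 (\<lambda>x. cnj (f x)) \<longleftrightarrow> L2 f"
proof -
  have "f \<in> borel_measurable borel" if "(\<lambda>x. cnj (f x)) \<in> borel_measurable borel"
    using measurable_compose[OF that borel_measurable_cnj] by simp
  moreover have "(\<lambda>x. cnj (f x)) \<in> borel_measurable borel" if "f \<in> borel_measurable borel"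
    using measurable_compose[OF that borel_measurable_cnj] by simp
  ultimately show ?thesis unfolding L2_def complex_mod_cnj by blast
qed

text \<open>The transform is an isometry whose adjoint is the inverse transform, an isometry as well; hence
  both compositions are the identity.\<close>

theorem fou_cnj:
  assumes k: "fou (\<lambda>x. cnj (g x)) k"
  shows "fou (\<lambda>x. cnj (k x)) g"
proof -
  have kL: "L2 k" and g: "L2 g" using fouD[OF k] by (auto simp: L2_cnj)
  define f where "f x = cnj (k x)" for x
  have f: "L2 f" using kL by (simp add: f_def[abs_def] L2_cnj)
  obtain F where F: "fou f F" using fou_ex[OF f] by blast
  have FL: "L2 F" by (rule fouD(2)[OF F])
  have gc: "L2 (\<lambda>x. cnj (g x))" using g by (simp add: L2_cnj)
  \<comment> \<open>The multiplication formula, extended from truncations of \<open>f\<close> to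
    \<open>f\<close> itself by L2 limits; the truncation of \<open>g\<close> is removed
    afterwards.\<close>
  have c1: "(LINT \<xi>|lborel. F \<xi> * tr m (\<lambda>x. cnj (g x)) \<xi>) = (LINT x|lborel. f x * FI (tr m (\<lambda>x. cnj (g x))) x)" for m
  proof -
    have "(LINT \<xi>|lborel. FI (tr n f) \<xi> * tr m (\<lambda>x. cnj (g x)) \<xi>) = (LINT x|lborel. tr n f x * FI (tr m (\<lambda>x. cnj (g x))) x)" for n
      by (intro integral_FI_mult integrable_tr f gc)
    moreover have "(\<lambda>n. LINT \<xi>|lborel. FI (tr n f) \<xi> * tr m (\<lambda>x. cnj (g x)) \<xi>) \<longlonglongrightarrow> (LINT \<xi>|lborel. F \<xi> * tr m (\<lambda>x. cnj (g x)) \<xi>)"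
      by (intro L2_prod_tendsto L2_FI_tr L2_tr f FL gc) (use F in \<open>auto simp: fou_def\<close>)
    moreover have "(\<lambda>n. LINT x|lborel. tr n f x * FI (tr m (\<lambda>x. cnj (g x))) x) \<longlonglongrightarrow> (LINT x|lborel. f x * FI (tr m (\<lambda>x. cnj (g x))) x)"
      by (intro L2_prod_tendsto L2_FI_tr L2_tr f gc nq_tr)
    ultimately show ?thesis by (auto intro: LIMSEQ_unique)
  qed
  have "(LINT \<xi>|lborel. F \<xi> * cnj (g \<xi>)) = (LINT x|lborel. f x * k x)"
  proof (rule LIMSEQ_unique)
    have "(\<lambda>m. LINT \<xi>|lborel. tr m (\<lambda>x. cnj (g x)) \<xi> * F \<xi>) \<longlonglongrightarrow> (LINT \<xi>|lborel. cnj (g \<xi>) * F \<xi>)"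
      by (intro L2_prod_tendsto L2_tr gc FL nq_tr)
    then show "(\<lambda>m. LINT \<xi>|lborel. F \<xi> * tr m (\<lambda>x. cnj (g x)) \<xi>) \<longlonglongrightarrow> (LINT \<xi>|lborel. F \<xi> * cnj (g \<xi>))"
      by (simp add: mult.commute)
    have "(\<lambda>m. LINT x|lborel. FI (tr m (\<lambda>x. cnj (g x))) x * f x) \<longlonglongrightarrow> (LINT x|lborel. k x * f x)"
      by (intro L2_prod_tendsto L2_FI_tr gc f kL) (use k in \<open>auto simp: fou_def\<close>)
    then show "(\<lambda>m. LINT \<xi>|lborel. F \<xi> * tr m (\<lambda>x. cnj (g x)) \<xi>) \<longlonglongrightarrow> (LINT x|lborel. f x * k x)"
      unfolding c1 by (simp add: mult.commute)
  qed
  also have "(LINT x|lborel. f x * k x) = (LINT x|lborel. complex_of_real ((norm (k x))\<^sup>2))"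
    by (simp only: f_def complex_norm_square mult.commute)
  also have "\<dots> = of_real (nq k)" unfolding nq_def by (rule integral_complex_of_real)
  finally have ip: "(LINT \<xi>|lborel. F \<xi> * cnj (g \<xi>)) = of_real (nq k)" .
  have nk: "nq k = nq g" using fou_norm[OF k] by (simp add: nq_def)
  have nF: "nq F = nq g" using fou_norm[OF F] nk by (simp add: nq_def f_def)
  have i: "integrable lborel (\<lambda>\<xi>. F \<xi> * cnj (g \<xi>))" by (rule L2_prod[OF FL gc])
  \<comment> \<open>\<open>F\<close> and \<open>g\<close> have equal norms, and their inner product
    \<open>ip\<close> is the square of that norm, so the distance vanishes.\<close>
  have "nq (\<lambda>\<xi>. F \<xi> - g \<xi>) = (LINT x|lborel. (norm (F x))\<^sup>2 + (norm (g x))\<^sup>2) - (LINT x|lborel. 2 * Re (F x * cnj (g x)))"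
  proof -
    have e: "(norm (a - b))\<^sup>2 = (norm a)\<^sup>2 + (norm b)\<^sup>2 - 2 * Re (a * cnj b)" for a b :: complex
      unfolding cmod_power2 by (simp add: power2_eq_square algebra_simps)
    show ?thesis unfolding nq_def e
      by (intro Bochner_Integration.integral_diff Bochner_Integration.integrable_add L2_integrable FL g integrable_mult_right integrable_Re i)
  qed
  also have "(LINT x|lborel. (norm (F x))\<^sup>2 + (norm (g x))\<^sup>2) = nq F + nq g"
    unfolding nq_def by (intro Bochner_Integration.integral_add L2_integrable FL g)
  also have "(LINT x|lborel. 2 * Re (F x * cnj (g x))) = 2 * nq k"
  proof -
    have "(LINT x|lborel. Re (F x * cnj (g x))) = Re (LINT x|lborel. F x * cnj (g x))" by (rule integral_Re[OF i])
    then show ?thesis by (simp add: ip del: times_complex.sel)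
  qed
  finally have "nq (\<lambda>\<xi>. F \<xi> - g \<xi>) = 0" using nk nF by simp
  then have "AE \<xi> in lborel. F \<xi> - g \<xi> = 0" using nq_zero_iff[OF L2_diff(1)[OF FL g]] by simp
  then have "AE \<xi> in lborel. F \<xi> = g \<xi>" by eventually_elim simp
  then have "fou f g" by (intro fou_cong_AE[OF F]) (use f g in \<open>auto simp: L2_def\<close>)
  then show ?thesis by (simp add: f_def[abs_def])
qed

lemma fou_ex_inv:
  assumes "L2 g" shows "\<exists>f. fou f g"
  using fou_ex[of "\<lambda>x. cnj (g x)"] assms fou_cnj by (auto simp: L2_cnj)

definition IFI :: "('a::euclidean_space \<Rightarrow> complex) \<Rightarrow> 'a \<Rightarrow> complex" where
  "IFI g x = (LINT \<xi>|lborel. cnj (ek (\<xi> \<bullet> x)) * g \<xi>)"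

lemma borel_IFI [measurable]:
  assumes [measurable]: "f \<in> borel_measurable borel"
  shows "IFI f \<in> borel_measurable borel"
  unfolding IFI_def by measurable

lemma IFI_eq: "IFI g x = cnj (FI (\<lambda>\<xi>. cnj (g \<xi>)) x)"
proof -
  have "cnj (FI (\<lambda>\<xi>. cnj (g \<xi>)) x) = (LINT \<xi>|lborel. cnj (ek (\<xi> \<bullet> x) * cnj (g \<xi>)))"
    unfolding FI_def by (simp del: complex_cnj_mult)
  then show ?thesis by (simp add: IFI_def)
qed

lemma fou_IFI:
  assumes "integrable lborel g" "L2 g" shows "fou (IFI g) g"
  using fou_cnj[OF fou_L1[of "\<lambda>x. cnj (g x)"]] assms by (simp add: IFI_eq[abs_def] L2_cnj)

lemma fou_translate:
  assumes "fou f g"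
  shows "fou (\<lambda>x. f (x - a)) (\<lambda>\<xi>. ek (a \<bullet> \<xi>) * g \<xi>)"
proof (rule fou_limit)
  have f: "L2 f" and g: "L2 g" using assms by (auto simp: fou_def)
  note [measurable] = L2_measurable[OF f] L2_measurable[OF g]
  have sh: "L2 (\<lambda>x. h (x - a))" "nq (\<lambda>x. h (x - a)) = nq h" if "L2 h" for h
    using integrable_lborel_translate(1)[OF L2_integrable[OF that], of "- a"]
      integral_lborel_translate[of "\<lambda>x. (norm (h x))\<^sup>2" "- a"] L2_measurable[OF that] by (auto simp: L2_def nq_def)
  fix n
  let ?h = "\<lambda>x. tr n f (x - a)"
  have i: "integrable lborel ?h" using integrable_lborel_translate(1)[OF integrable_tr[OF f, of n], of "- a"] by simp
  have "FI ?h \<xi> = ek (a \<bullet> \<xi>) * FI (tr n f) \<xi>" for \<xi>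
  proof -
    have "FI ?h \<xi> = (LINT x|lborel. ek ((a + x) \<bullet> \<xi>) * ?h (a + x))"
      unfolding FI_def by (rule integral_lborel_translate[symmetric]) measurable
    also have "\<dots> = (LINT x|lborel. ek (a \<bullet> \<xi>) * (ek (x \<bullet> \<xi>) * tr n f x))"
      by (simp add: inner_add_left ek_add mult.assoc)
    finally show ?thesis by (simp add: FI_def)
  qed
  then have "FI ?h = (\<lambda>\<xi>. ek (a \<bullet> \<xi>) * FI (tr n f) \<xi>)" by (rule ext)
  then show "fou ?h (\<lambda>\<xi>. ek (a \<bullet> \<xi>) * FI (tr n f) \<xi>)"
    using fou_L1[OF i sh(1)[OF L2_tr[OF f]]] by simp
next
  have f: "L2 f" and g: "L2 g" using assms by (auto simp: fou_def)
  note [measurable] = L2_measurable[OF f] L2_measurable[OF g]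
  have sh: "L2 (\<lambda>x. h (x - a))" "nq (\<lambda>x. h (x - a)) = nq h" if "L2 h" for h
    using integrable_lborel_translate(1)[OF L2_integrable[OF that], of "- a"]
      integral_lborel_translate[of "\<lambda>x. (norm (h x))\<^sup>2" "- a"] L2_measurable[OF that] by (auto simp: L2_def nq_def)
  show "L2 (\<lambda>x. f (x - a))" by (rule sh(1)[OF f])
  show "L2 (\<lambda>\<xi>. ek (a \<bullet> \<xi>) * g \<xi>)"
    by (rule L2_bound(1)[OF g]) (auto simp: norm_mult)
  show "(\<lambda>n. nq (\<lambda>x. tr n f (x - a) - f (x - a))) \<longlonglongrightarrow> 0"
    using sh(2)[OF L2_diff(1)[OF L2_tr[OF f] f]] nq_tr[OF f] by simp
  have "nq (\<lambda>\<xi>. ek (a \<bullet> \<xi>) * FI (tr n f) \<xi> - ek (a \<bullet> \<xi>) * g \<xi>) = nq (\<lambda>\<xi>. FI (tr n f) \<xi> - g \<xi>)" for n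
    by (simp add: nq_def norm_mult flip: right_diff_distrib)
  then show "(\<lambda>n. nq (\<lambda>\<xi>. ek (a \<bullet> \<xi>) * FI (tr n f) \<xi> - ek (a \<bullet> \<xi>) * g \<xi>)) \<longlonglongrightarrow> 0"
    using assms by (simp add: fou_def)
qed

lemma fou_cmult:
  assumes "fou f g" shows "fou (\<lambda>x. c * f x) (\<lambda>\<xi>. c * g \<xi>)"
proof (cases "c = 0")
  case True
  have z: "integrable lborel (\<lambda>x::'a. 0 :: complex)" "L2 (\<lambda>x::'a. 0)" by (simp_all add: L2_def)
  have "FI (\<lambda>x::'a. 0) = (\<lambda>\<xi>. 0)" by (simp add: FI_def fun_eq_iff)
  with fou_L1[OF z] True show ?thesis by simp
next
  case False
  have t: "FI (tr n (\<lambda>x. c * f x)) \<xi> - c * g \<xi> = c * (FI (tr n f) \<xi> - g \<xi>)" for n \<xi>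
  proof -
    have "FI (tr n (\<lambda>x. c * f x)) \<xi> = (LINT x|lborel. c * (ek (x \<bullet> \<xi>) * tr n f x))"
      unfolding FI_def tr_def by (simp add: mult_ac)
    then show ?thesis by (simp add: FI_def right_diff_distrib)
  qed
  have n: "nq (\<lambda>x. c * h x) = (norm c)\<^sup>2 * nq h" for h :: "'a \<Rightarrow> complex" by (simp add: nq_def norm_mult power_mult_distrib)
  have L: "L2 (\<lambda>x. c * h x)" if "L2 h" for h
    using that by (auto simp: L2_def norm_mult power_mult_distrib)
  have "(\<lambda>n. (norm c)\<^sup>2 * nq (\<lambda>\<xi>. FI (tr n f) \<xi> - g \<xi>)) \<longlonglongrightarrow> (norm c)\<^sup>2 * 0"
    using assms by (intro tendsto_intros) (auto simp: fou_def)
  then show ?thesis using assms by (auto simp: fou_def t n L)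
qed

subsection \<open>The Gagliardo--Nirenberg functional on the Fourier side\<close>

lemma powr_of_nat: "0 \<le> (x::real) \<Longrightarrow> 0 < n \<Longrightarrow> x powr real n = x ^ n"
  by (cases "x = 0") (auto simp: powr_realpow)

lemma powr_two: "0 \<le> (x::real) \<Longrightarrow> x powr 2 = x\<^sup>2"
  using powr_of_nat[of x 2] by simp

section \<open>Borel representatives and the notions of the statement\<close>

lemma borel_representative:
  fixes f :: "'a::euclidean_space \<Rightarrow> complex"
  assumes "f \<in> borel_measurable lebesgue"
  obtains f' where "f' \<in> borel_measurable borel" "AE x in lborel. f x = f' x"
proof -
  have "(\<lambda>x. Re (f x)) \<in> borel_measurable lebesgue" "(\<lambda>x. Im (f x)) \<in> borel_measurable lebesgue"
    using assms by (auto intro: measurable_compose[OF assms])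
  from this[THEN completion_ex_borel_measurable_real] obtain a b where
    ab: "a \<in> borel_measurable lborel" "AE x in lborel. Re (f x) = a x" "b \<in> borel_measurable lborel" "AE x in lborel. Im (f x) = b x"
    by blast
  have "(\<lambda>x. Complex (a x) (b x)) \<in> borel_measurable borel"
    using ab(1,3) by (simp add: Complex_eq)
  moreover have "AE x in lborel. f x = Complex (a x) (b x)"
    using ab(2,4) by eventually_elim (simp add: complex_eq_iff)
  ultimately show thesis by (rule that)
qed

lemma measurable_lebesgue_AE:
  fixes f g :: "'a::euclidean_space \<Rightarrow> complex"
  assumes g: "g \<in> borel_measurable borel" and ae: "AE x in lborel. f x = g x"
  shows "f \<in> borel_measurable lebesgue"
proof (rule measurableI)
  obtain N where N: "N \<in> null_sets lborel" "{x \<in> space lborel. f x \<noteq> g x} \<subseteq> N"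
    using ae by (auto elim!: AE_E simp: null_sets_def)
  fix A :: "complex set" assume A: "A \<in> sets borel"
  have eq: "f -` A \<inter> space lebesgue = (g -` A - N) \<union> (f -` A \<inter> N)" using N(2) by auto
  have "g -` A \<in> sets lebesgue" using measurable_sets[OF g A] by simp
  moreover have "N \<in> sets lebesgue" using N(1) by auto
  moreover have "f -` A \<inter> N \<in> sets lebesgue"
    by (rule null_setsD2, rule null_sets_completion_subset[OF _ null_sets_completionI[OF N(1)]]) simp
  ultimately show "f -` A \<inter> space lebesgue \<in> sets lebesgue"
    unfolding eq by (intro sets.Un sets.Diff)
qed auto

lemma borel_lebesgue: "f \<in> borel_measurable borel \<Longrightarrow> f \<in> borel_measurable lebesgue" for f :: "'a::euclidean_space \<Rightarrow> complex"
  by (rule measurable_lebesgue_AE) auto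

lemma integral_lebesgue_rep:
  fixes f :: "'a::euclidean_space \<Rightarrow> complex" and h :: "complex \<Rightarrow> real"
  assumes f: "f \<in> borel_measurable lebesgue" and f': "f' \<in> borel_measurable borel" and ae: "AE x in lborel. f x = f' x"
    and h: "h \<in> borel_measurable borel"
  shows "(LINT x|lebesgue. h (f x)) = (LINT x|lborel. h (f' x))"
    and "integrable lebesgue (\<lambda>x. h (f x)) \<longleftrightarrow> integrable lborel (\<lambda>x. h (f' x))"
proof -
  have m: "(\<lambda>x. h (f x)) \<in> borel_measurable lebesgue" "(\<lambda>x. h (f' x)) \<in> borel_measurable lebesgue"
    using measurable_compose[OF f h] measurable_compose[OF borel_lebesgue[OF f'] h] by auto
  have b: "(\<lambda>x. h (f' x)) \<in> borel_measurable lborel" using measurable_compose[OF f' h] by simp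
  have ae': "AE x in lebesgue. h (f x) = h (f' x)" using AE_completion[OF ae] by eventually_elim simp
  show "(LINT x|lebesgue. h (f x)) = (LINT x|lborel. h (f' x))"
    using integral_cong_AE[OF m ae'] integral_completion[OF b] by simp
  show "integrable lebesgue (\<lambda>x. h (f x)) \<longleftrightarrow> integrable lborel (\<lambda>x. h (f' x))"
    using integrable_cong_AE[OF m ae'] integrable_completion[OF b] by simp
qed

text \<open>The functions picked by \<open>SOME\<close> in \<open>fourier\<close> and
  \<open>inv_fourier\<close> are only Lebesgue measurable; arguments are carried out for a Borel
  representative and transferred back.\<close>

definition rep :: "('a::euclidean_space \<Rightarrow> complex) \<Rightarrow> ('a \<Rightarrow> complex) \<Rightarrow> bool" where
  "rep f f' \<longleftrightarrow> f \<in> borel_measurable lebesgue \<and> f' \<in> borel_measurable borel \<and> (AE x in lborel. f x = f' x)"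

lemma rep_refl: "f \<in> borel_measurable borel \<Longrightarrow> rep f f"
  by (simp add: rep_def borel_lebesgue)

lemma ex_rep: "f \<in> borel_measurable lebesgue \<Longrightarrow> \<exists>f'. rep f f'"
  using borel_representative[of f] by (auto simp: rep_def)

lemma Lp_space_measurable: "f \<in> Lp_space p \<Longrightarrow> f \<in> borel_measurable lebesgue"
  by (simp add: Lp_space_def)

lemma Lp_space_two: "rep f f' \<Longrightarrow> f \<in> Lp_space 2 \<longleftrightarrow> L2 f'"
  using integral_lebesgue_rep(2)[of f f' "\<lambda>z. norm z powr 2"]
  by (auto simp: rep_def Lp_space_def L2_def powr_two)

lemma Lp_norm_two: "rep f f' \<Longrightarrow> Lp_norm 2 f = nq f' powr (1 / 2)"
  using integral_lebesgue_rep(1)[of f f' "\<lambda>z. norm z powr 2"]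
  by (auto simp: rep_def Lp_norm_def nq_def powr_two)

lemma fourier_integral_rep:
  assumes "rep f f'"
  shows "fourier_integral (\<lambda>x. indicator (cball 0 (real n)) x * f x) \<xi> = FI (tr n f') \<xi>"
proof -
  have f: "f \<in> borel_measurable lebesgue" and f'[measurable]: "f' \<in> borel_measurable borel" and ae: "AE x in lborel. f x = f' x"
    using assms by (auto simp: rep_def)
  have m: "(\<lambda>x. ek (x \<bullet> \<xi>) * tr n f' x) \<in> borel_measurable borel" by measurable
  have ae2: "AE x in lborel. ek (x \<bullet> \<xi>) * (indicator (cball 0 (real n)) x * f x) = ek (x \<bullet> \<xi>) * tr n f' x"
    using ae by eventually_elim (simp add: tr_def)
  have "fourier_integral (\<lambda>x. indicator (cball 0 (real n)) x * f x) \<xi> = (LINT x|lebesgue. ek (x \<bullet> \<xi>) * (indicator (cball 0 (real n)) x * f x))"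
    by (simp add: fourier_integral_def ek_def)
  also have "\<dots> = (LINT x|lebesgue. ek (x \<bullet> \<xi>) * tr n f' x)"
    by (rule integral_cong_AE[OF measurable_lebesgue_AE[OF m ae2] borel_lebesgue[OF m] AE_completion[OF ae2]])
  also have "\<dots> = FI (tr n f') \<xi>" unfolding FI_def by (rule integral_completion) (use m in simp)
  finally show ?thesis .
qed

lemma is_fourier_iff:
  assumes f: "rep f f'" and g: "rep g g'"
  shows "is_fourier f g \<longleftrightarrow> fou f' g'"
proof -
  have aeg: "AE x in lborel. g x = g' x" using g by (simp add: rep_def)
  have "(\<integral>\<^sup>+ \<xi>. ennreal ((norm (fourier_integral (\<lambda>x. indicator (cball 0 (real n)) x * f x) \<xi> - g \<xi>))\<^sup>2) \<partial>lebesgue) = ennreal (nq (\<lambda>\<xi>. FI (tr n f') \<xi> - g' \<xi>))"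
    if L: "L2 f'" "L2 g'" for n
  proof -
    have "(\<integral>\<^sup>+ \<xi>. ennreal ((norm (fourier_integral (\<lambda>x. indicator (cball 0 (real n)) x * f x) \<xi> - g \<xi>))\<^sup>2) \<partial>lebesgue) =
       (\<integral>\<^sup>+ \<xi>. ennreal ((norm (FI (tr n f') \<xi> - g \<xi>))\<^sup>2) \<partial>lborel)"
      unfolding fourier_integral_rep[OF f] nn_integral_completion ..
    also have "\<dots> = (\<integral>\<^sup>+ \<xi>. ennreal ((norm (FI (tr n f') \<xi> - g' \<xi>))\<^sup>2) \<partial>lborel)"
      by (rule nn_integral_cong_AE) (use aeg in eventually_elim, simp)
    also have "\<dots> = ennreal (nq (\<lambda>\<xi>. FI (tr n f') \<xi> - g' \<xi>))" by (rule L2_nn[OF L2_diff(1)[OF L2_FI_tr[OF L(1)] L(2)]])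
    finally show ?thesis .
  qed
  moreover have "(\<lambda>n. ennreal (nq (\<lambda>\<xi>. FI (tr n f') \<xi> - g' \<xi>))) \<longlonglongrightarrow> 0 \<longleftrightarrow> (\<lambda>n. nq (\<lambda>\<xi>. FI (tr n f') \<xi> - g' \<xi>)) \<longlonglongrightarrow> 0"
  proof
    assume "(\<lambda>n. ennreal (nq (\<lambda>\<xi>. FI (tr n f') \<xi> - g' \<xi>))) \<longlonglongrightarrow> 0"
    then have "(\<lambda>n. ennreal (nq (\<lambda>\<xi>. FI (tr n f') \<xi> - g' \<xi>))) \<longlonglongrightarrow> ennreal 0" by simp
    then show "(\<lambda>n. nq (\<lambda>\<xi>. FI (tr n f') \<xi> - g' \<xi>)) \<longlonglongrightarrow> 0"
      by (rule tendsto_ennrealD) (auto simp: nq_nonneg)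
  next
    assume "(\<lambda>n. nq (\<lambda>\<xi>. FI (tr n f') \<xi> - g' \<xi>)) \<longlonglongrightarrow> 0"
    from tendsto_ennrealI[OF this] show "(\<lambda>n. ennreal (nq (\<lambda>\<xi>. FI (tr n f') \<xi> - g' \<xi>))) \<longlonglongrightarrow> 0" by simp
  qed
  ultimately show ?thesis
    unfolding is_fourier_def fou_def Lp_space_two[OF f] Lp_space_two[OF g] by auto
qed

text \<open>Existence in the Borel setting makes the choice operator pick a genuine
  transform.\<close>

lemma is_fourier_fourier:
  assumes "f \<in> Lp_space 2" shows "is_fourier f (fourier f)"
proof -
  obtain f' where f': "rep f f'" using ex_rep[OF Lp_space_measurable[OF assms]] by blast
  then obtain g where g: "fou f' g" using fou_ex Lp_space_two assms by blast
  then have "rep g g" by (intro rep_refl) (use fouD(2)[OF g] in \<open>simp add: L2_def\<close>)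
  then have "is_fourier f g" using is_fourier_iff[OF f'] g by blast
  then show ?thesis unfolding fourier_def by (rule someI[of "is_fourier f"])
qed

lemma is_fourier_inv_fourier:
  assumes "g \<in> Lp_space 2" shows "is_fourier (inv_fourier g) g"
proof -
  obtain g' where g': "rep g g'" using ex_rep[OF Lp_space_measurable[OF assms]] by blast
  then obtain f where f: "fou f g'" using fou_ex_inv Lp_space_two assms by blast
  then have "rep f f" by (intro rep_refl) (use fouD(1)[OF f] in \<open>simp add: L2_def\<close>)
  then have "is_fourier f g" using is_fourier_iff[OF _ g'] f by blast
  then show ?thesis unfolding inv_fourier_def by (rule someI[of "\<lambda>f. is_fourier f g"])
qed

lemma rep_fourier:
  assumes "rep f f'" "fou f' g"
  shows "rep (fourier f) g"
proof -
  have g: "g \<in> borel_measurable borel" using fouD(2)[OF assms(2)] by (simp add: L2_def)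
  have fL: "f \<in> Lp_space 2" using Lp_space_two[OF assms(1)] fouD(1)[OF assms(2)] by simp
  have F: "is_fourier f (fourier f)" by (rule is_fourier_fourier[OF fL])
  then obtain k where k: "rep (fourier f) k" using ex_rep Lp_space_measurable unfolding is_fourier_def by blast
  have "fou f' k" using F is_fourier_iff[OF assms(1) k] by simp
  from fou_unique[OF this assms(2)] have "AE x in lborel. k x = g x" .
  moreover have "AE x in lborel. fourier f x = k x" "fourier f \<in> borel_measurable lebesgue" using k by (auto simp: rep_def)
  ultimately have "AE x in lborel. fourier f x = g x" by (elim AE_mp) simp
  with g \<open>fourier f \<in> borel_measurable lebesgue\<close> show ?thesis by (simp add: rep_def)
qed

lemma rep_mult:
  assumes "rep f f'" and [measurable]: "c \<in> borel_measurable borel"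
  shows "rep (\<lambda>x. c x * f x) (\<lambda>x. c x * f' x)"
proof -
  have [measurable]: "f' \<in> borel_measurable borel" and ae: "AE x in lborel. f x = f' x" using assms by (auto simp: rep_def)
  have m: "(\<lambda>x. c x * f' x) \<in> borel_measurable borel" by measurable
  have ae': "AE x in lborel. c x * f x = c x * f' x" using ae by eventually_elim simp
  show ?thesis using m ae' measurable_lebesgue_AE[OF m ae'] by (simp add: rep_def)
qed

definition wt :: "real \<Rightarrow> 'a::euclidean_space \<Rightarrow> real" where
  "wt s \<xi> = (2 * pi * norm \<xi>) powr s"

lemma borel_wt [measurable]: "wt s \<in> borel_measurable borel"
  unfolding wt_def by measurable

lemma Lp_norm_frac_laplacian:
  assumes "rep f f'" "fou f' g" "L2 (\<lambda>\<xi>. of_real (wt s \<xi>) * g \<xi>)"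
  shows "Lp_norm 2 (frac_laplacian (s / 2) f) = nq (\<lambda>\<xi>. of_real (wt s \<xi>) * g \<xi>) powr (1 / 2)"
proof -
  let ?m = "\<lambda>\<xi>. complex_of_real (wt s \<xi>) * fourier f \<xi>"
  have eq: "frac_laplacian (s / 2) f = inv_fourier ?m"
    by (simp add: frac_laplacian_def wt_def)
  have r: "rep ?m (\<lambda>\<xi>. of_real (wt s \<xi>) * g \<xi>)"
    by (rule rep_mult[OF rep_fourier[OF assms(1,2)]]) measurable
  then have "?m \<in> Lp_space 2" using Lp_space_two assms(3) by blast
  from is_fourier_inv_fourier[OF this] have I: "is_fourier (inv_fourier ?m) ?m" .
  then obtain k where k: "rep (inv_fourier ?m) k" using ex_rep Lp_space_measurable unfolding is_fourier_def by blast
  have "fou k (\<lambda>\<xi>. of_real (wt s \<xi>) * g \<xi>)" using I is_fourier_iff[OF k r] by simp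
  from fou_norm[OF this] show ?thesis unfolding eq Lp_norm_two[OF k] by simp
qed

text \<open>\<open>A\<close> and \<open>B\<close> stand for squared norms, hence the halved
  exponents.\<close>

definition prodf :: "real \<Rightarrow> real \<Rightarrow> real \<Rightarrow> real" where
  "prodf \<theta> A B = A powr (\<theta> / 2) * B powr ((1 - \<theta>) / 2)"

lemma gn_product_eq:
  fixes f :: "'a::euclidean_space \<Rightarrow> complex"
  assumes "rep f f'" "fou f' g" "L2 (\<lambda>\<xi>. of_real (wt s \<xi>) * g \<xi>)"
  shows "gn_product s p f = prodf (gn_theta DIM('a) s p) (nq (\<lambda>\<xi>. of_real (wt s \<xi>) * g \<xi>)) (nq g)"
  unfolding gn_product_def Lp_norm_frac_laplacian[OF assms] Lp_norm_two[OF assms(1)] fou_norm[OF assms(2), symmetric] prodf_def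
  by (simp add: powr_powr)

lemma sobolev_iff:
  assumes "rep f f'" "fou f' g"
  shows "f \<in> sobolev_space s \<longleftrightarrow> L2 (\<lambda>\<xi>. of_real ((1 + (norm \<xi>)\<^sup>2) powr (s / 2)) * g \<xi>)"
proof -
  have "rep (\<lambda>\<xi>. complex_of_real ((1 + (norm \<xi>)\<^sup>2) powr (s / 2)) * fourier f \<xi>) (\<lambda>\<xi>. of_real ((1 + (norm \<xi>)\<^sup>2) powr (s / 2)) * g \<xi>)"
    by (rule rep_mult[OF rep_fourier[OF assms]]) measurable
  then show ?thesis using Lp_space_two[OF assms(1)] fouD(1)[OF assms(2)] by (simp add: sobolev_space_def Lp_space_two)
qed

lemma L2_cmult: "L2 f \<Longrightarrow> L2 (\<lambda>x. c * f x)"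
  by (auto simp: L2_def norm_mult power_mult_distrib)

lemma wt_le:
  assumes "s > 0" shows "wt s \<xi> \<le> (2 * pi) powr s * (1 + (norm \<xi>)\<^sup>2) powr (s / 2)"
proof -
  have "norm \<xi> powr s = ((norm \<xi>)\<^sup>2) powr (s / 2)"
    unfolding powr_two[OF norm_ge_zero, symmetric] powr_powr by simp
  also have "\<dots> \<le> (1 + (norm \<xi>)\<^sup>2) powr (s / 2)" using assms by (intro powr_mono2) auto
  finally have "(2 * pi) powr s * norm \<xi> powr s \<le> (2 * pi) powr s * (1 + (norm \<xi>)\<^sup>2) powr (s / 2)" by (rule mult_left_mono) simp
  then show ?thesis by (simp add: wt_def powr_mult)
qed

lemma sobolev_wt:
  assumes "s > 0" "g \<in> borel_measurable borel" "L2 (\<lambda>\<xi>. of_real ((1 + (norm \<xi>)\<^sup>2) powr (s / 2)) * g \<xi>)"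
  shows "L2 (\<lambda>\<xi>. of_real (wt s \<xi>) * g \<xi>)"
proof (rule L2_bound(1)[OF L2_cmult[OF assms(3), of "of_real ((2 * pi) powr s)"]])
  note [measurable] = assms(2)
  show "(\<lambda>\<xi>. of_real (wt s \<xi>) * g \<xi>) \<in> borel_measurable borel" by measurable
  show "norm (of_real (wt s \<xi>) * g \<xi>) \<le> norm (of_real ((2 * pi) powr s) * (of_real ((1 + (norm \<xi>)\<^sup>2) powr (s / 2)) * g \<xi>))" for \<xi>
    using wt_le[OF assms(1), of \<xi>] by (simp add: norm_mult mult.assoc[symmetric] mult_right_mono wt_def)
qed

text \<open>Integrable and bounded: closed under convolution and contained in L2, so the convolution
  theorem and Plancherel's identity hold without convergence questions. Bounded truncations with
  bounded support are of this kind.\<close>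

definition nice :: "('a::euclidean_space \<Rightarrow> complex) \<Rightarrow> bool" where
  "nice g \<longleftrightarrow> integrable lborel g \<and> (\<exists>M. \<forall>x. norm (g x) \<le> M)"

lemma nice_L2: "nice g \<Longrightarrow> L2 g"
proof -
  assume g: "nice g"
  then obtain M where M: "\<And>x. norm (g x) \<le> M" and i: "integrable lborel g" by (auto simp: nice_def)
  have [measurable]: "g \<in> borel_measurable borel" using i by auto
  have "integrable lborel (\<lambda>x. (norm (g x))\<^sup>2)"
  proof (rule Bochner_Integration.integrable_bound[OF integrable_mult_right[OF integrable_norm[OF i], of M]])
    have "0 \<le> M" using order_trans[OF norm_ge_zero M] .
    then show "AE x in lborel. norm ((norm (g x))\<^sup>2) \<le> norm (M * norm (g x))"
      using M by (intro AE_I2) (simp add: power2_eq_square abs_mult mult_right_mono)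
  qed measurable
  then show ?thesis by (simp add: L2_def)
qed

lemma integral_nconv:
  fixes f g :: "'a::euclidean_space \<Rightarrow> ennreal"
  assumes [measurable]: "f \<in> borel_measurable borel" "g \<in> borel_measurable borel"
  shows "(\<integral>\<^sup>+x. nconv f g x \<partial>lborel) = (\<integral>\<^sup>+x. f x \<partial>lborel) * (\<integral>\<^sup>+x. g x \<partial>lborel)"
proof -
  have "(\<integral>\<^sup>+x. nconv f g x \<partial>lborel) = (\<integral>\<^sup>+y. \<integral>\<^sup>+x. f y * g (x - y) \<partial>lborel \<partial>lborel)"
    unfolding nconv_def by (rule nn_integral_commute[OF sigma_finite_lborel sigma_finite_lborel]) measurable
  also have "\<dots> = (\<integral>\<^sup>+y. f y * (\<integral>\<^sup>+x. g x \<partial>lborel) \<partial>lborel)"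
  proof (rule nn_integral_cong)
    fix y
    have "(\<integral>\<^sup>+x. g (- y + x) \<partial>lborel) = (\<integral>\<^sup>+x. g x \<partial>lborel)" by (rule nn_integral_lborel_translate) measurable
    then show "(\<integral>\<^sup>+x. f y * g (x - y) \<partial>lborel) = f y * (\<integral>\<^sup>+x. g x \<partial>lborel)" by (subst nn_integral_cmult) auto
  qed
  finally show ?thesis by (simp add: nn_integral_multc)
qed

lemma norm_cconv_le: "ennreal (norm (cconv f g x)) \<le> nconv (\<lambda>x. ennreal (norm (f x))) (\<lambda>x. ennreal (norm (g x))) x"
  unfolding cconv_def nconv_def
  by (rule order_trans[OF norm_integral_le_nn_integral]) (simp add: norm_mult ennreal_mult)

lemma nice_cconv:
  assumes "nice f" "nice g" shows "nice (cconv f g)"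
proof -
  obtain M where M: "\<And>x. norm (f x) \<le> M" and f: "integrable lborel f" using assms(1) by (auto simp: nice_def)
  have g: "integrable lborel g" using assms(2) by (simp add: nice_def)
  have [measurable]: "f \<in> borel_measurable borel" "g \<in> borel_measurable borel" using f g by auto
  have M0: "0 \<le> M" using order_trans[OF norm_ge_zero M] .
  have "integrable lborel (cconv f g)"
  proof (rule integrableI_bounded)
    have "(\<integral>\<^sup>+x. ennreal (norm (cconv f g x)) \<partial>lborel) \<le> (\<integral>\<^sup>+x. ennreal (norm (f x)) \<partial>lborel) * (\<integral>\<^sup>+x. ennreal (norm (g x)) \<partial>lborel)"
      by (subst integral_nconv[symmetric]) (auto intro!: nn_integral_mono norm_cconv_le)
    also have "\<dots> < \<infinity>" using f g by (auto simp: integrable_iff_bounded ennreal_mult_less_top)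
    finally show "(\<integral>\<^sup>+x. ennreal (norm (cconv f g x)) \<partial>lborel) < \<infinity>" .
  qed measurable
  moreover have "norm (cconv f g x) \<le> M * (LINT y|lborel. norm (g y))" for x
  proof -
    have i: "integrable lborel (\<lambda>y. M * norm (g (x - y)))"
      using integrable_norm[OF integrable_lborel_translate(2)[OF g, of x]] by simp
    have "norm (cconv f g x) \<le> (LINT y|lborel. norm (f y * g (x - y)))" unfolding cconv_def by (rule integral_norm_bound)
    also have "\<dots> \<le> (LINT y|lborel. M * norm (g (x - y)))"
      by (rule integral_mono'[OF i]) (use M M0 in \<open>auto simp: norm_mult intro!: mult_right_mono\<close>)
    also have "\<dots> = M * (LINT y|lborel. norm (g y))"
      using integral_lborel_reflect[of "\<lambda>y. norm (g y)" x] by simp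
    finally show ?thesis .
  qed
  ultimately show ?thesis unfolding nice_def by blast
qed

lemma nice_ccpow: "nice g \<Longrightarrow> nice (ccpow m g)"
  by (induction m) (auto intro: nice_cconv)

lemma IFI_cconv:
  assumes "nice f" "nice g"
  shows "IFI (cconv f g) x = IFI f x * IFI g x"
proof -
  have f: "integrable lborel f" and g: "integrable lborel g" using assms by (auto simp: nice_def)
  have [measurable]: "f \<in> borel_measurable borel" "g \<in> borel_measurable borel" using f g by auto
  have "IFI (cconv f g) x = (LINT \<xi>|lborel. LINT y|lborel. cnj (ek (\<xi> \<bullet> x)) * (f y * g (\<xi> - y)))"
    unfolding IFI_def cconv_def by simp
  also have "\<dots> = (LINT y|lborel. LINT \<xi>|lborel. cnj (ek (\<xi> \<bullet> x)) * (f y * g (\<xi> - y)))"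
  proof (rule integral_lborel_commute)
    have "(\<integral>\<^sup>+\<xi>. \<integral>\<^sup>+y. ennreal (norm (cnj (ek (\<xi> \<bullet> x)) * (f y * g (\<xi> - y)))) \<partial>lborel \<partial>lborel)
       = (\<integral>\<^sup>+\<xi>. nconv (\<lambda>y. ennreal (norm (f y))) (\<lambda>y. ennreal (norm (g y))) \<xi> \<partial>lborel)"
      unfolding nconv_def by (simp add: norm_mult ennreal_mult)
    also have "\<dots> < \<infinity>" using f g by (subst integral_nconv) (auto simp: integrable_iff_bounded ennreal_mult_less_top)
    finally show "(\<integral>\<^sup>+\<xi>. \<integral>\<^sup>+y. ennreal (norm (cnj (ek (\<xi> \<bullet> x)) * (f y * g (\<xi> - y)))) \<partial>lborel \<partial>lborel) < \<infinity>" .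
  qed measurable
  also have "\<dots> = (LINT y|lborel. cnj (ek (y \<bullet> x)) * f y * IFI g x)"
  proof (rule Bochner_Integration.integral_cong[OF refl])
    fix y
    have "(LINT \<xi>|lborel. cnj (ek (\<xi> \<bullet> x)) * (f y * g (\<xi> - y))) = (LINT \<xi>|lborel. cnj (ek ((y + \<xi>) \<bullet> x)) * (f y * g ((y + \<xi>) - y)))"
      by (rule integral_lborel_translate[symmetric]) measurable
    also have "\<dots> = (LINT \<xi>|lborel. cnj (ek (y \<bullet> x)) * f y * (cnj (ek (\<xi> \<bullet> x)) * g \<xi>))"
      by (simp add: inner_add_left ek_add mult_ac)
    finally show "(LINT \<xi>|lborel. cnj (ek (\<xi> \<bullet> x)) * (f y * g (\<xi> - y))) = cnj (ek (y \<bullet> x)) * f y * IFI g x"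
      by (simp add: IFI_def)
  qed
  also have "\<dots> = IFI f x * IFI g x" by (simp add: IFI_def)
  finally show ?thesis .
qed

lemma IFI_ccpow: "nice g \<Longrightarrow> IFI (ccpow m g) x = IFI g x ^ Suc m"
  by (induction m) (auto simp: IFI_cconv nice_ccpow)

lemma fou_IFI_nice: "nice g \<Longrightarrow> fou (IFI g) g"
  by (rule fou_IFI) (auto simp: nice_def nice_L2)

text \<open>Here evenness of the exponent enters: the power \<open>Suc m\<close> of
  \<open>IFI g\<close> is the inverse transform of \<open>ccpow m g\<close>, and Plancherel computes
  its L2 norm.\<close>

lemma nq_ccpow:
  assumes "nice g"
  shows "(LINT x|lborel. norm (IFI g x) ^ (2 * Suc m)) = nq (ccpow m g)"
    and "integrable lborel (\<lambda>x. norm (IFI g x) ^ (2 * Suc m))"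
proof -
  have F: "fou (IFI (ccpow m g)) (ccpow m g)" by (intro fou_IFI_nice nice_ccpow assms)
  have e: "(norm (IFI (ccpow m g) x))\<^sup>2 = norm (IFI g x) ^ (2 * Suc m)" for x
    unfolding IFI_ccpow[OF assms] norm_power by (simp only: power_mult[symmetric] mult.commute)
  show "(LINT x|lborel. norm (IFI g x) ^ (2 * Suc m)) = nq (ccpow m g)"
    using fou_norm[OF F] unfolding nq_def e by simp
  show "integrable lborel (\<lambda>x. norm (IFI g x) ^ (2 * Suc m))"
    using L2_integrable[OF fouD(1)[OF F]] unfolding e .
qed

lemma cpow_mono: "(\<And>x. f x \<le> g x) \<Longrightarrow> cpow m f x \<le> cpow m g x"
proof (induction m arbitrary: x)
  case (Suc m)
  then show ?case by (auto simp: nconv_def intro!: nn_integral_mono mult_mono)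
qed simp

lemma cpow_SUP:
  fixes f :: "nat \<Rightarrow> 'a::euclidean_space \<Rightarrow> ennreal"
  assumes [measurable]: "\<And>n. f n \<in> borel_measurable borel" and inc: "incseq f" and F: "\<And>x. (SUP n. f n x) = F x"
  shows "(SUP n. cpow m (f n) x) = cpow m F x"
proof (induction m arbitrary: x)
  case 0
  then show ?case by (simp add: F)
next
  case (Suc m)
  have ic: "incseq (\<lambda>n. cpow m (f n) x)" for x
    using inc by (auto simp: incseq_def le_fun_def intro!: cpow_mono)
  have i1: "incseq (\<lambda>n. f n x)" for x using inc by (auto simp: incseq_def le_fun_def)
  have ip: "incseq (\<lambda>n y. f n y * cpow m (f n) (x - y))"
    using ic i1 unfolding incseq_def le_fun_def by (blast intro: mult_mono zero_le)
  have "cpow (Suc m) F x = (\<integral>\<^sup>+y. (SUP n. f n y * cpow m (f n) (x - y)) \<partial>lborel)"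
    unfolding cpow.simps nconv_def by (intro nn_integral_cong) (subst SUP_mult_incseq[OF i1 ic], simp add: F Suc.IH)
  also have "\<dots> = (SUP n. cpow (Suc m) (f n) x)"
    unfolding cpow.simps nconv_def by (rule nn_integral_monotone_convergence_SUP[OF ip]) measurable
  finally show ?case ..
qed

lemma cpow_finite:
  assumes [measurable]: "f \<in> borel_measurable borel" and b: "\<And>x. f x \<le> ennreal M" and i: "(\<integral>\<^sup>+x. f x \<partial>lborel) < \<infinity>"
  shows "cpow m f x < \<infinity>"
proof (cases m)
  case 0
  then show ?thesis using b[of x] by (auto intro: le_less_trans)
next
  case (Suc k)
  have "(\<integral>\<^sup>+x. cpow k f x \<partial>lborel) < \<infinity>"
    using i by (induction k) (auto simp: integral_nconv ennreal_mult_less_top)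
  moreover have "cpow (Suc k) f x \<le> (\<integral>\<^sup>+y. ennreal M * cpow k f (x - y) \<partial>lborel)"
    unfolding cpow.simps nconv_def using b by (intro nn_integral_mono mult_right_mono) auto
  moreover have "\<dots> = ennreal M * (\<integral>\<^sup>+y. cpow k f y \<partial>lborel)"
    using nn_integral_lborel_reflect[of "cpow k f" x] by (subst nn_integral_cmult) auto
  ultimately show ?thesis using Suc by (auto simp: ennreal_mult_less_top elim!: le_less_trans)
qed

lemma ccpow_of_nonneg:
  fixes u :: "'a::euclidean_space \<Rightarrow> real"
  assumes [measurable]: "u \<in> borel_measurable borel" and u: "\<And>x. 0 \<le> u x" and b: "\<And>x. u x \<le> M" and i: "integrable lborel u"
  shows "ccpow m (\<lambda>x. of_real (u x)) x = of_real (enn2real (cpow m (\<lambda>x. ennreal (u x)) x))"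
proof (induction m arbitrary: x)
  case 0
  then show ?case using u by simp
next
  case (Suc m)
  let ?c = "cpow m (\<lambda>x. ennreal (u x))"
  have fin: "?c z < \<infinity>" for z
    by (rule cpow_finite[where M=M]) (use b i u in \<open>auto intro: ennreal_leI simp: nn_integral_eq_integral\<close>)
  have "ccpow (Suc m) (\<lambda>x. of_real (u x)) x = (LINT y|lborel. complex_of_real (u y * enn2real (?c (x - y))))"
    by (simp add: cconv_def Suc.IH)
  also have "\<dots> = of_real (LINT y|lborel. u y * enn2real (?c (x - y)))" by (rule integral_complex_of_real)
  also have "(LINT y|lborel. u y * enn2real (?c (x - y))) = enn2real (\<integral>\<^sup>+y. ennreal (u y * enn2real (?c (x - y))) \<partial>lborel)"
    by (rule integral_eq_nn_integral) (use u in \<open>auto intro!: AE_I2\<close>)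
  also have "(\<integral>\<^sup>+y. ennreal (u y * enn2real (?c (x - y))) \<partial>lborel) = cpow (Suc m) (\<lambda>x. ennreal (u x)) x"
    unfolding cpow.simps nconv_def using fin u
    by (intro nn_integral_cong) (simp add: ennreal_mult less_top)
  finally show ?case .
qed

subsection \<open>The optimal constant\<close>

text \<open>An infinite constant times the positive product would be infinite, whereas the norm of
  \<open>Q\<close> is a real number. So admissible constants exist, and their infimum is admissible
  because the inequality is closed in the constant.\<close>

lemma gn_best_constant:
  fixes Q :: "'a::euclidean_space \<Rightarrow> complex"
  assumes opt: "gn_optimizer s p Q" and pos: "gn_product s p Q > 0"
  obtains c where "0 \<le> c" "Lp_norm p Q = c * gn_product s p Q"
    "\<And>f :: 'a \<Rightarrow> complex. f \<in> sobolev_space s \<Longrightarrow> f \<in> Lp_space p \<and> Lp_norm p f \<le> c * gn_product s p f"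
proof -
  define S where "S = {C. 0 < C \<and> gn_inequality TYPE('a) s p C}"
  define K where "K = gn_constant TYPE('a) s p"
  have K: "K = (INF C\<in>S. ennreal C)" by (simp add: K_def S_def gn_constant_def)
  have eq: "ennreal (Lp_norm p Q) = K * ennreal (gn_product s p Q)" using opt by (simp add: gn_optimizer_def K_def)
  have "K \<noteq> \<top>"
  proof
    assume "K = \<top>"
    then have "ennreal (Lp_norm p Q) = \<top>" using eq pos by (simp add: ennreal_top_mult)
    then show False by simp
  qed
  then obtain c where c: "K = ennreal c" "0 \<le> c" by (cases K) auto
  have n0: "0 \<le> Lp_norm p f" for f :: "'a \<Rightarrow> complex" by (simp add: Lp_norm_def)
  have p0: "0 \<le> gn_product s p f" for f :: "'a \<Rightarrow> complex" by (simp add: gn_product_def)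
  have "ennreal (Lp_norm p Q) = ennreal (c * gn_product s p Q)" using eq c pos by (simp add: ennreal_mult)
  then have Q: "Lp_norm p Q = c * gn_product s p Q" using n0 c p0 by (subst (asm) ennreal_inj) auto
  have "S \<noteq> {}"
  proof
    assume "S = {}"
    then have "K = \<top>" using K by simp
    with \<open>K \<noteq> \<top>\<close> show False ..
  qed
  then obtain C0 where C0: "C0 \<in> S" by blast
  have "f \<in> Lp_space p \<and> Lp_norm p f \<le> c * gn_product s p f" if f: "f \<in> sobolev_space s" for f :: "'a \<Rightarrow> complex"
  proof
    show "f \<in> Lp_space p" using C0 f by (auto simp: S_def gn_inequality_def)
    have le: "Lp_norm p f \<le> C * gn_product s p f" if "C \<in> S" for C using that f by (auto simp: S_def gn_inequality_def)
    show "Lp_norm p f \<le> c * gn_product s p f"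
    \<comment> \<open>For a vanishing product one cannot divide, but any admissible constant then
      bounds the norm by 0.\<close>
    proof (cases "gn_product s p f = 0")
      case True
      then show ?thesis using le[OF C0] by simp
    next
      case False
      then have pf: "gn_product s p f > 0" using p0[of f] by simp
      have "ennreal (Lp_norm p f / gn_product s p f) \<le> K"
        unfolding K using le pf by (intro INF_greatest ennreal_leI) (simp add: divide_le_eq)
      then have "Lp_norm p f / gn_product s p f \<le> c" using c by simp
      then show ?thesis using pf by (simp add: divide_le_eq)
    qed
  qed
  with c(2) Q show thesis by (rule that)
qed

lemma Lp_norm_power:
  assumes "rep f f'" "0 < p"
  shows "Lp_norm (real p) f ^ p = (LINT x|lborel. norm (f' x) ^ p)"
    and "f \<in> Lp_space (real p) \<Longrightarrow> integrable lborel (\<lambda>x. norm (f' x) ^ p)"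
proof -
  have r: "f \<in> borel_measurable lebesgue" "f' \<in> borel_measurable borel" "AE x in lborel. f x = f' x" using assms(1) by (auto simp: rep_def)
  have m: "(\<lambda>z::complex. norm z ^ p) \<in> borel_measurable borel" by measurable
  have e: "norm z powr real p = norm z ^ p" for z :: complex using assms(2) by (simp add: powr_of_nat)
  have i: "0 \<le> (LINT x|lborel. norm (f' x) ^ p)" by simp
  show "Lp_norm (real p) f ^ p = (LINT x|lborel. norm (f' x) ^ p)"
    unfolding Lp_norm_def e integral_lebesgue_rep(1)[OF r m]
    using assms(2) i by (simp flip: powr_of_nat[OF powr_ge_zero assms(2)] add: powr_powr)
  show "f \<in> Lp_space (real p) \<Longrightarrow> integrable lborel (\<lambda>x. norm (f' x) ^ p)"
    using integral_lebesgue_rep(2)[OF r m] by (simp add: Lp_space_def e)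
qed

lemma prodf_mono:
  assumes "0 \<le> \<theta>" "\<theta> \<le> 1" "0 \<le> A" "A \<le> A'" "0 \<le> B" "B \<le> B'"
  shows "prodf \<theta> A B \<le> prodf \<theta> A' B'"
  unfolding prodf_def using assms by (intro mult_mono powr_mono2) auto

text \<open>The Gagliardo-Nirenberg inequality read on the Fourier side, for functions such as
  Steiner symmetrizations of which only integrals are known. It is applied to the inverse transforms
  of truncations increasing to \<open>f\<close>; truncation lowers both norms, so upper bounds
  \<open>A\<close> and \<open>B\<close> suffice, and monotone convergence concludes.\<close>

lemma cpow_square_bound:
  fixes f :: "'a::euclidean_space \<Rightarrow> ennreal"
  assumes s: "s > 0" and \<theta>: "0 \<le> gn_theta DIM('a) s (real p)" "gn_theta DIM('a) s (real p) \<le> 1"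
    and p: "p = 2 * Suc m" and c: "0 \<le> c"
    and gn: "\<And>f :: 'a \<Rightarrow> complex. f \<in> sobolev_space s \<Longrightarrow> f \<in> Lp_space (real p) \<and> Lp_norm (real p) f \<le> c * gn_product s (real p) f"
    and [measurable]: "f \<in> borel_measurable borel"
    and A: "(\<integral>\<^sup>+x. ennreal ((wt s x)\<^sup>2) * (f x)\<^sup>2 \<partial>lborel) \<le> ennreal A" "0 \<le> A"
    and B: "(\<integral>\<^sup>+x. (f x)\<^sup>2 \<partial>lborel) \<le> ennreal B" "0 \<le> B"
  shows "(\<integral>\<^sup>+x. (cpow m f x)\<^sup>2 \<partial>lborel) \<le> ennreal ((c * prodf (gn_theta DIM('a) s (real p)) A B) ^ p)"
proof -
  let ?\<theta> = "gn_theta DIM('a) s (real p)"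
  \<comment> \<open>The minimum with \<open>n\<close> is taken in \<open>ennreal\<close> before
    converting, since \<open>enn2real\<close> would send infinite values of \<open>f\<close> to
    0.\<close>
  define u where "u n x = (if norm x \<le> real n then enn2real (min (f x) (of_nat n)) else 0)" for n and x :: 'a
  have [measurable]: "u n \<in> borel_measurable borel" for n unfolding u_def by measurable
  have eu: "ennreal (u n x) = (if norm x \<le> real n then min (f x) (of_nat n) else 0)" for n x
  proof -
    have "min (f x) (of_nat n) < \<top>" by (simp add: min_less_iff_disj of_nat_less_top)
    then show ?thesis by (simp add: u_def)
  qed
  have u0: "0 \<le> u n x" for n x by (simp add: u_def)
  have un: "u n x \<le> real n" for n x
  proof -
    have "ennreal (u n x) \<le> ennreal (real n)" by (simp add: eu ennreal_of_nat_eq_real_of_nat)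
    then show ?thesis by simp
  qed
  have uf: "ennreal (u n x) \<le> f x" for n x by (simp add: eu)
  have ui: "integrable lborel (u n)" for n
  proof (rule Bochner_Integration.integrable_bound)
    show "integrable lborel (\<lambda>x::'a. real n * indicator (cball 0 (real n)) x)"
      using emeasure_bounded_finite[OF bounded_cball, of "0::'a" "real n"] by (intro integrable_mult_right integrable_real_indicator) simp_all
    show "AE x in lborel. norm (u n x) \<le> norm (real n * indicator (cball 0 (real n)) x)"
    proof (rule AE_I2)
      fix x
      show "norm (u n x) \<le> norm (real n * indicator (cball 0 (real n)) x)"
        using u0[of n x] un[of n x] by (auto simp: u_def split: split_indicator)
    qed
  qed measurable
  define g where "g n x = complex_of_real (u n x)" for n x
  have [measurable]: "g n \<in> borel_measurable borel" for n unfolding g_def by measurable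
  have ng: "norm (g n x) = u n x" for n x using u0 by (simp add: g_def)
  have nice: "nice (g n)" for n
    unfolding nice_def using ui[of n] un[of n] ng[of n] by (auto simp: g_def[abs_def] intro!: exI[of _ "real n"])
  have sq: "ennreal ((u n x)\<^sup>2) \<le> (f x)\<^sup>2" for n x
    using power_mono[OF uf[of n x], of 2] by (simp add: ennreal_power u0)
  have cb: "(\<integral>\<^sup>+x. (cpow m (\<lambda>x. ennreal (u n x)) x)\<^sup>2 \<partial>lborel) \<le> ennreal ((c * prodf ?\<theta> A B) ^ p)" for n
  proof -
    have F: "fou (IFI (g n)) (g n)" by (rule fou_IFI_nice[OF nice])
    have r: "rep (IFI (g n)) (IFI (g n))" by (rule rep_refl) measurable
    let ?W = "\<lambda>\<xi>. complex_of_real ((1 + (norm \<xi>)\<^sup>2) powr (s / 2)) * g n \<xi>"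
    have LW: "L2 ?W"
    proof (rule L2_bound(1)[OF L2_cmult[OF nice_L2[OF nice[of n]], of "of_real ((1 + (real n)\<^sup>2) powr (s / 2))"]])
      show "?W \<in> borel_measurable borel" by measurable
      show "norm (?W \<xi>) \<le> norm (of_real ((1 + (real n)\<^sup>2) powr (s / 2)) * g n \<xi>)" for \<xi>
      proof (cases "norm \<xi> \<le> real n")
        case True
        then have "(1 + (norm \<xi>)\<^sup>2) powr (s / 2) \<le> (1 + (real n)\<^sup>2) powr (s / 2)"
          using s by (intro powr_mono2 add_left_mono power_mono) auto
        then show ?thesis by (simp add: norm_mult mult_right_mono)
      qed (simp add: g_def u_def)
    qed
    have sob: "IFI (g n) \<in> sobolev_space s" using sobolev_iff[OF r F] LW by blast
    have Lw: "L2 (\<lambda>\<xi>. of_real (wt s \<xi>) * g n \<xi>)" by (rule sobolev_wt[OF s _ LW]) measurable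
    have nA: "nq (\<lambda>\<xi>. of_real (wt s \<xi>) * g n \<xi>) \<le> A"
    proof (rule L2I(2)[OF _ _ A(2)])
      show "(\<lambda>\<xi>. of_real (wt s \<xi>) * g n \<xi>) \<in> borel_measurable borel" by measurable
      have "(\<integral>\<^sup>+x. ennreal ((norm (of_real (wt s x) * g n x))\<^sup>2) \<partial>lborel) \<le> (\<integral>\<^sup>+x. ennreal ((wt s x)\<^sup>2) * (f x)\<^sup>2 \<partial>lborel)"
      proof (rule nn_integral_mono)
        fix x
        have "ennreal ((norm (of_real (wt s x) * g n x))\<^sup>2) = ennreal ((wt s x)\<^sup>2) * ennreal ((u n x)\<^sup>2)"
          by (simp add: norm_mult ng power_mult_distrib ennreal_mult)
        also have "\<dots> \<le> ennreal ((wt s x)\<^sup>2) * (f x)\<^sup>2" by (intro mult_left_mono sq) simp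
        finally show "ennreal ((norm (of_real (wt s x) * g n x))\<^sup>2) \<le> ennreal ((wt s x)\<^sup>2) * (f x)\<^sup>2" .
      qed
      with A(1) show "(\<integral>\<^sup>+x. ennreal ((norm (of_real (wt s x) * g n x))\<^sup>2) \<partial>lborel) \<le> ennreal A" by (rule order_trans[rotated])
    qed
    have nB: "nq (g n) \<le> B"
    proof (rule L2I(2)[OF _ _ B(2)])
      show "g n \<in> borel_measurable borel" by measurable
      have "(\<integral>\<^sup>+x. ennreal ((norm (g n x))\<^sup>2) \<partial>lborel) \<le> (\<integral>\<^sup>+x. (f x)\<^sup>2 \<partial>lborel)"
        by (rule nn_integral_mono) (simp add: ng sq)
      with B(1) show "(\<integral>\<^sup>+x. ennreal ((norm (g n x))\<^sup>2) \<partial>lborel) \<le> ennreal B" by (rule order_trans[rotated])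
    qed
    have "Lp_norm (real p) (IFI (g n)) \<le> c * prodf ?\<theta> (nq (\<lambda>\<xi>. of_real (wt s \<xi>) * g n \<xi>)) (nq (g n))"
      using gn[OF sob] gn_product_eq[OF r F Lw] by simp
    also have "\<dots> \<le> c * prodf ?\<theta> A B" by (intro mult_left_mono c prodf_mono \<theta> nA nB nq_nonneg)
    finally have "Lp_norm (real p) (IFI (g n)) ^ p \<le> (c * prodf ?\<theta> A B) ^ p"
      by (rule power_mono) (simp add: Lp_norm_def)
    moreover have "Lp_norm (real p) (IFI (g n)) ^ p = nq (ccpow m (g n))"
    proof -
      have "0 < p" using p by simp
      from Lp_norm_power(1)[OF r this] show ?thesis using nq_ccpow(1)[OF nice, of n m] unfolding p by simp
    qed
    ultimately have le: "nq (ccpow m (g n)) \<le> (c * prodf ?\<theta> A B) ^ p" by simp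
    have fin: "cpow m (\<lambda>x. ennreal (u n x)) x < \<infinity>" for x
      by (rule cpow_finite[where M = "real n"]) (use un ui u0 in \<open>auto intro: ennreal_leI simp: nn_integral_eq_integral\<close>)
    have "(\<integral>\<^sup>+x. (cpow m (\<lambda>x. ennreal (u n x)) x)\<^sup>2 \<partial>lborel) = (\<integral>\<^sup>+x. ennreal ((norm (ccpow m (g n) x))\<^sup>2) \<partial>lborel)"
    proof (rule nn_integral_cong)
      fix x
      have "ccpow m (g n) x = of_real (enn2real (cpow m (\<lambda>x. ennreal (u n x)) x))"
        unfolding g_def[abs_def] by (rule ccpow_of_nonneg[OF _ u0 un ui]) measurable
      then show "(cpow m (\<lambda>x. ennreal (u n x)) x)\<^sup>2 = ennreal ((norm (ccpow m (g n) x))\<^sup>2)"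
        using fin[of x] by (simp add: ennreal_power[symmetric] less_top)
    qed
    also have "\<dots> = ennreal (nq (ccpow m (g n)))" by (rule L2_nn) (intro nice_L2 nice_ccpow nice)
    also have "\<dots> \<le> ennreal ((c * prodf ?\<theta> A B) ^ p)" by (rule ennreal_leI[OF le])
    finally show ?thesis .
  qed
  have incu: "incseq (\<lambda>n x. ennreal (u n x))"
  proof (rule incseq_SucI, rule le_funI)
    fix n x
    show "ennreal (u n x) \<le> ennreal (u (Suc n) x)"
      unfolding eu by (auto intro!: min.mono of_nat_mono simp: min.coboundedI2)
  qed
  have supu: "(SUP n. ennreal (u n x)) = f x" for x
  proof (rule antisym)
    show "(SUP n. ennreal (u n x)) \<le> f x" by (intro SUP_least uf)
    show "f x \<le> (SUP n. ennreal (u n x))"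
    proof (rule le_SUP_iff[THEN iffD2, rule_format])
      fix y assume y: "y < f x"
      then obtain r where r: "y = ennreal r" "0 \<le> r" by (cases y) auto
      obtain n :: nat where n: "max (norm x) (r + 1) \<le> real n" using real_arch_simple by blast
      have "y < of_nat n" using r n by (simp add: ennreal_of_nat_eq_real_of_nat ennreal_less_iff)
      then have "y < ennreal (u n x)" using y n by (simp add: eu)
      then show "\<exists>n\<in>UNIV. y < ennreal (u n x)" by blast
    qed
  qed
  have cS: "(SUP n. cpow m (\<lambda>x. ennreal (u n x)) x) = cpow m f x" for x
    by (rule cpow_SUP[OF _ incu supu]) measurable
  have ic: "incseq (\<lambda>n. cpow m (\<lambda>x. ennreal (u n x)) x)" for x
    using incu by (auto simp: incseq_def le_fun_def intro!: cpow_mono)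
  have "(\<integral>\<^sup>+x. (cpow m f x)\<^sup>2 \<partial>lborel) = (\<integral>\<^sup>+x. (SUP n. (cpow m (\<lambda>x. ennreal (u n x)) x)\<^sup>2) \<partial>lborel)"
    unfolding power2_eq_square SUP_mult_incseq[OF ic ic] cS ..
  also have "\<dots> = (SUP n. \<integral>\<^sup>+x. (cpow m (\<lambda>x. ennreal (u n x)) x)\<^sup>2 \<partial>lborel)"
  proof (rule nn_integral_monotone_convergence_SUP)
    show "incseq (\<lambda>n x. (cpow m (\<lambda>x. ennreal (u n x)) x)\<^sup>2)"
      using ic unfolding incseq_def le_fun_def by (blast intro: power_mono zero_le)
  qed measurable
  also have "\<dots> \<le> ennreal ((c * prodf ?\<theta> A B) ^ p)" by (intro SUP_least cb)
  finally show ?thesis .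
qed

text \<open>Dominated convergence, with the convolution power of the modulus as majorant. Finiteness
  at \<open>x\<close> passes to the inner power at \<open>x - y\<close> for almost every
  \<open>y\<close> with \<open>g y\<close> nonzero; where \<open>g y\<close> is 0 the integrand
  vanishes anyway.\<close>

lemma ccpow_tendsto:
  fixes g :: "'a::euclidean_space \<Rightarrow> complex"
  assumes [measurable]: "g \<in> borel_measurable borel" "\<And>n. G n \<in> borel_measurable borel"
    and le: "\<And>n x. norm (G n x) \<le> norm (g x)" and lim: "\<And>x. (\<lambda>n. G n x) \<longlonglongrightarrow> g x"
  shows "cpow m (\<lambda>x. ennreal (norm (g x))) x < \<infinity> \<Longrightarrow> (\<lambda>n. ccpow m (G n) x) \<longlonglongrightarrow> ccpow m g x"
proof (induction m arbitrary: x)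
  case 0
  then show ?case using lim by simp
next
  case (Suc m)
  let ?F = "\<lambda>x. ennreal (norm (g x))"
  let ?w = "\<lambda>y. ?F y * cpow m ?F (x - y)"
  have fin: "(\<integral>\<^sup>+y. ?w y \<partial>lborel) < \<infinity>" using Suc.prems by (simp add: nconv_def)
  have aefin: "AE y in lborel. ?w y \<noteq> \<infinity>" using fin by (intro nn_integral_PInf_AE) auto
  show ?case
    unfolding ccpow.simps cconv_def
  proof (rule integral_dominated_convergence[where w = "\<lambda>y. enn2real (?w y)"])
    show "integrable lborel (\<lambda>y. enn2real (?w y))"
    proof (rule integrableI_bounded)
      have "(\<integral>\<^sup>+y. ennreal (norm (enn2real (?w y))) \<partial>lborel) = (\<integral>\<^sup>+y. ?w y \<partial>lborel)"
        by (rule nn_integral_cong_AE) (use aefin in \<open>eventually_elim, simp add: less_top\<close>)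
      then show "(\<integral>\<^sup>+y. ennreal (norm (enn2real (?w y))) \<partial>lborel) < \<infinity>" using fin by simp
    qed measurable
    show "AE y in lborel. (\<lambda>n. G n y * ccpow m (G n) (x - y)) \<longlonglongrightarrow> g y * ccpow m g (x - y)"
      using aefin
    proof eventually_elim
      case (elim y)
      show ?case
      proof (cases "g y = 0")
        case True
        then have "G n y = 0" for n using le[of n y] by simp
        then show ?thesis using True by simp
      next
        case False
        then have "cpow m ?F (x - y) < \<infinity>" using elim by (auto simp: ennreal_mult_eq_top_iff less_top)
        then show ?thesis by (intro tendsto_mult lim Suc.IH)
      qed
    qed
    show "AE y in lborel. norm (G n y * ccpow m (G n) (x - y)) \<le> enn2real (?w y)" for n
      using aefin
    proof eventually_elim
      case (elim y)
      have "ennreal (norm (G n y * ccpow m (G n) (x - y))) \<le> ?w y"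
      proof -
        have "ennreal (norm (ccpow m (G n) (x - y))) \<le> cpow m (\<lambda>x. ennreal (norm (G n x))) (x - y)" by (rule norm_ccpow_le)
        also have "\<dots> \<le> cpow m ?F (x - y)" by (intro cpow_mono ennreal_leI le)
        finally show ?thesis by (simp add: norm_mult ennreal_mult mult_mono ennreal_leI le)
      qed
      then have "enn2real (ennreal (norm (G n y * ccpow m (G n) (x - y)))) \<le> enn2real (?w y)"
        using elim by (intro enn2real_mono) (auto simp: less_top)
      then show ?case by simp
    qed
  qed measurable
qed

text \<open>For truncations of \<open>g\<close> this is an identity, \<open>nq_ccpow\<close>. In the
  limit the convolution side converges by domination, whereas the inverse transforms converge to
  \<open>Q\<close> only in L2, hence almost everywhere along a subsequence, and Fatou's lemma gives
  one inequality.\<close>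

lemma Lp_power_le_ccpow:
  fixes Q g :: "'a::euclidean_space \<Rightarrow> complex"
  assumes F: "fou Q g" and fin: "(\<integral>\<^sup>+x. (cpow m (\<lambda>x. ennreal (norm (g x))) x)\<^sup>2 \<partial>lborel) < \<infinity>"
  shows "(\<integral>\<^sup>+x. ennreal (norm (Q x) ^ (2 * Suc m)) \<partial>lborel) \<le> (\<integral>\<^sup>+x. (ennreal (norm (ccpow m g x)))\<^sup>2 \<partial>lborel)"
proof -
  have QL: "L2 Q" and gL: "L2 g" using F by (auto simp: fou_def)
  note [measurable] = L2_measurable[OF QL] L2_measurable[OF gL]
  let ?F = "\<lambda>x. ennreal (norm (g x))"
  define G where "G n x = (if norm (g x) \<le> real n \<and> norm x \<le> real n then g x else 0)" for n x
  have [measurable]: "G n \<in> borel_measurable borel" for n unfolding G_def by measurable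
  have Gle: "norm (G n x) \<le> norm (g x)" for n x by (simp add: G_def)
  have Glim: "(\<lambda>n. G n x) \<longlonglongrightarrow> g x" for x
  proof -
    obtain N :: nat where N: "max (norm (g x)) (norm x) \<le> real N" using real_arch_simple by blast
    have "eventually (\<lambda>n. G n x = g x) sequentially"
      using eventually_ge_at_top[of N] by eventually_elim (use N in \<open>auto simp: G_def\<close>)
    then show ?thesis by (rule tendsto_eventually)
  qed
  have nice: "nice (G n)" for n
  proof -
    have "norm (G n x) \<le> norm (tr n g x)" for x by (simp add: G_def tr_def)
    then have "integrable lborel (G n)"
      by (intro Bochner_Integration.integrable_bound[OF integrable_tr[OF gL, of n]]) auto
    moreover have "norm (G n x) \<le> real n" for x by (simp add: G_def)
    ultimately show ?thesis unfolding nice_def by blast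
  qed
  have FG: "fou (IFI (G n)) (G n)" for n by (rule fou_IFI_nice[OF nice])
  have "(\<lambda>n. nq (\<lambda>x. G n x - g x)) \<longlonglongrightarrow> 0"
    by (rule L2_dominated[OF gL _ Gle]) (auto simp: Glim)
  moreover have "nq (\<lambda>x. G n x - g x) = nq (\<lambda>x. IFI (G n) x - Q x)" for n
    by (rule fou_norm[OF fou_diff[OF FG F]])
  ultimately have "(\<lambda>n. nq (\<lambda>x. IFI (G n) x - Q x)) \<longlonglongrightarrow> 0" by simp
  from L2_AE_subseq[OF fouD(1)[OF FG] QL this] obtain r :: "nat \<Rightarrow> nat" where
    r: "strict_mono r" "AE x in lborel. (\<lambda>n. IFI (G (r n)) x) \<longlonglongrightarrow> Q x" by blast
  have aefin: "AE x in lborel. cpow m ?F x < \<infinity>"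
  proof -
    have "AE x in lborel. (cpow m ?F x)\<^sup>2 \<noteq> \<infinity>" using fin by (intro nn_integral_PInf_AE) auto
    then show ?thesis by eventually_elim (auto simp: power2_eq_square ennreal_mult_eq_top_iff less_top)
  qed
  have conv: "(\<lambda>n. \<integral>\<^sup>+x. (ennreal (norm (ccpow m (G (r n)) x)))\<^sup>2 \<partial>lborel) \<longlonglongrightarrow> (\<integral>\<^sup>+x. (ennreal (norm (ccpow m g x)))\<^sup>2 \<partial>lborel)"
  proof (rule nn_integral_dominated_convergence[OF _ _ _ _ fin])
    show "AE x in lborel. (ennreal (norm (ccpow m (G (r n)) x)))\<^sup>2 \<le> (cpow m ?F x)\<^sup>2" for n
    proof (rule AE_I2)
      fix x
      have "ennreal (norm (ccpow m (G (r n)) x)) \<le> cpow m (\<lambda>x. ennreal (norm (G (r n) x))) x" by (rule norm_ccpow_le)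
      also have "\<dots> \<le> cpow m ?F x" by (intro cpow_mono ennreal_leI Gle)
      finally show "(ennreal (norm (ccpow m (G (r n)) x)))\<^sup>2 \<le> (cpow m ?F x)\<^sup>2" by (intro power_mono) auto
    qed
    show "AE x in lborel. (\<lambda>n. (ennreal (norm (ccpow m (G (r n)) x)))\<^sup>2) \<longlonglongrightarrow> (ennreal (norm (ccpow m g x)))\<^sup>2"
      using aefin
    proof eventually_elim
      case (elim x)
      have "(\<lambda>n. ccpow m (G n) x) \<longlonglongrightarrow> ccpow m g x" by (rule ccpow_tendsto[OF _ _ Gle Glim elim]) measurable
      from LIMSEQ_subseq_LIMSEQ[OF this r(1)] have "(\<lambda>n. ccpow m (G (r n)) x) \<longlonglongrightarrow> ccpow m g x" by (simp add: o_def)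
      then have "(\<lambda>n. ennreal ((norm (ccpow m (G (r n)) x))\<^sup>2)) \<longlonglongrightarrow> ennreal ((norm (ccpow m g x))\<^sup>2)"
        by (intro tendsto_ennrealI tendsto_intros)
      then show ?case by (simp add: ennreal_power)
    qed
  qed measurable
  have pw: "(\<integral>\<^sup>+x. ennreal (norm (IFI (G n) x) ^ (2 * Suc m)) \<partial>lborel) = (\<integral>\<^sup>+x. (ennreal (norm (ccpow m (G n) x)))\<^sup>2 \<partial>lborel)" for n
  proof -
    have "(\<integral>\<^sup>+x. ennreal (norm (IFI (G n) x) ^ (2 * Suc m)) \<partial>lborel) = ennreal (nq (ccpow m (G n)))"
      unfolding nq_ccpow(1)[OF nice, of n m, symmetric] by (rule nn_integral_eq_integral[OF nq_ccpow(2)[OF nice]]) simp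
    also have "\<dots> = (\<integral>\<^sup>+x. ennreal ((norm (ccpow m (G n) x))\<^sup>2) \<partial>lborel)" by (rule L2_nn[symmetric]) (intro nice_L2 nice_ccpow nice)
    finally show ?thesis by (simp add: ennreal_power)
  qed
  have "(\<integral>\<^sup>+x. ennreal (norm (Q x) ^ (2 * Suc m)) \<partial>lborel) = (\<integral>\<^sup>+x. liminf (\<lambda>n. ennreal (norm (IFI (G (r n)) x) ^ (2 * Suc m))) \<partial>lborel)"
  proof (rule nn_integral_cong_AE)
    show "AE x in lborel. ennreal (norm (Q x) ^ (2 * Suc m)) = liminf (\<lambda>n. ennreal (norm (IFI (G (r n)) x) ^ (2 * Suc m)))"
      using r(2)
    proof eventually_elim
      case (elim x)
      then have "(\<lambda>n. ennreal (norm (IFI (G (r n)) x) ^ (2 * Suc m))) \<longlonglongrightarrow> ennreal (norm (Q x) ^ (2 * Suc m))"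
        by (intro tendsto_ennrealI tendsto_power tendsto_norm)
      from lim_imp_Liminf[OF trivial_limit_sequentially this] show ?case by (rule sym)
    qed
  qed
  also have "\<dots> \<le> liminf (\<lambda>n. \<integral>\<^sup>+x. ennreal (norm (IFI (G (r n)) x) ^ (2 * Suc m)) \<partial>lborel)"
    by (rule nn_integral_liminf) measurable
  also have "\<dots> = (\<integral>\<^sup>+x. (ennreal (norm (ccpow m g x)))\<^sup>2 \<partial>lborel)"
    unfolding pw by (rule lim_imp_Liminf[OF trivial_limit_sequentially conv])
  finally show ?thesis .
qed

text \<open>By Pythagoras the norm of \<open>z + t *\<^sub>R e\<close> depends strictly
  monotonically on the modulus of \<open>t\<close>, and \<open>wt s\<close> is strictly increasing
  in the norm.\<close>

lemma heavy_slice_wt: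
  fixes e :: "'a::euclidean_space"
  assumes s: "s > 0" and e: "norm e = 1" and z: "z \<bullet> e = 0"
  shows "heavy (slice e (\<lambda>x. ennreal ((wt s x)\<^sup>2)) z)"
proof -
  have n: "norm (z + t *\<^sub>R e) = sqrt ((norm z)\<^sup>2 + t\<^sup>2)" for t
  proof -
    have "(z + t *\<^sub>R e) \<bullet> (z + t *\<^sub>R e) = z \<bullet> z + t * t"
      using z e by (simp add: inner_add_left inner_add_right inner_commute norm_eq_1)
    then show ?thesis by (simp add: norm_eq_sqrt_inner power2_eq_square[of t])
  qed
  have le: "norm (z + x *\<^sub>R e) \<le> norm (z + y *\<^sub>R e)" if "\<bar>x\<bar> \<le> \<bar>y\<bar>" for x y
    using that by (simp add: n abs_le_square_iff)
  have less: "norm (z + x *\<^sub>R e) < norm (z + y *\<^sub>R e)" if "\<bar>x\<bar> < \<bar>y\<bar>" for x y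
  proof -
    have "x\<^sup>2 < y\<^sup>2" using power_strict_mono[OF that, of 2] by simp
    then show ?thesis by (simp add: n)
  qed
  have wle: "wt s a \<le> wt s b" if "norm a \<le> norm b" for a b :: 'a
    unfolding wt_def using that s by (intro powr_mono2) auto
  have wless: "wt s a < wt s b" if "norm a < norm b" for a b :: 'a
    unfolding wt_def using that s by (intro powr_less_mono2) auto
  have w0: "0 \<le> wt s a" for a :: 'a by (simp add: wt_def)
  show ?thesis unfolding heavy_def slice_def
  proof (intro conjI allI impI)
    fix x y :: real
    show "ennreal ((wt s (z + x *\<^sub>R e))\<^sup>2) < \<infinity>" by simp
    show "ennreal ((wt s (z + x *\<^sub>R e))\<^sup>2) \<le> ennreal ((wt s (z + y *\<^sub>R e))\<^sup>2)" if "\<bar>x\<bar> \<le> \<bar>y\<bar>"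
      by (intro ennreal_leI power_mono wle le that w0)
    show "ennreal ((wt s (z + x *\<^sub>R e))\<^sup>2) < ennreal ((wt s (z + y *\<^sub>R e))\<^sup>2)" if "\<bar>x\<bar> < \<bar>y\<bar>"
      using power_strict_mono[OF wless[OF less[OF that]] w0, of 2] by (simp add: ennreal_less_iff)
  qed
qed

subsection \<open>Optimizers\<close>

lemma AE_lborel_subset:
  assumes "AE x in lborel. P x"
  obtains N where "N \<in> null_sets lborel" "\<And>x. x \<notin> N \<Longrightarrow> P x"
proof -
  from assms obtain N where "{x \<in> space lborel. \<not> P x} \<subseteq> N" "emeasure lborel N = 0" "N \<in> sets lborel" by (rule AE_E)
  then show thesis by (intro that[of N]) auto
qed

lemma AE_lborel_shift:
  fixes v :: "'a::euclidean_space"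
  assumes "AE x in lborel. P x" shows "AE x in lborel. P (v + x)"
proof -
  obtain N where N: "N \<in> null_sets lborel" "\<And>x. x \<notin> N \<Longrightarrow> P x" using assms by (rule AE_lborel_subset) blast
  have [measurable]: "N \<in> sets borel" using N(1) by auto
  have "AE x in lborel. v + x \<notin> N"
    by (rule AE_lborel_translate[where P = "\<lambda>x. x \<notin> N"]) (auto intro: AE_not_in N)
  then show ?thesis by eventually_elim (rule N(2))
qed

lemma AE_lborel_orthogonal:
  fixes T :: "'a::euclidean_space \<Rightarrow> 'a"
  assumes T: "orthogonal_transformation T" and "AE x in lborel. P x" shows "AE x in lborel. P (T x)"
proof -
  note [measurable] = borel_measurable_orthogonal[OF T]
  obtain N where N: "N \<in> null_sets lborel" "\<And>x. x \<notin> N \<Longrightarrow> P x" using assms(2) by (rule AE_lborel_subset) blast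
  have [measurable]: "N \<in> sets borel" using N(1) by auto
  have "{x. T x \<in> N} \<in> sets lborel" by measurable
  then have "{x. T x \<in> N} \<in> null_sets lborel"
    using emeasure_orthogonal_vimage[OF T, of N] N(1) by (auto simp: null_sets_def)
  then have "AE x in lborel. x \<notin> {x. T x \<in> N}" by (rule AE_not_in)
  then show ?thesis by eventually_elim (auto intro: N)
qed

section \<open>Inverse transforms of radial real functions\<close>

lemma integral_orthogonal:
  fixes T :: "'a::euclidean_space \<Rightarrow> 'a" and f :: "'a \<Rightarrow> complex"
  assumes T: "orthogonal_transformation T" and [measurable]: "f \<in> borel_measurable borel"
  shows "(LINT x|lborel. f (T x)) = (LINT x|lborel. f x)"
proof -
  note [measurable] = borel_measurable_orthogonal[OF T]
  have "distr lborel borel T = lborel"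
    by (rule measure_eqI) (auto simp: emeasure_distr emeasure_orthogonal_vimage[OF T] vimage_def)
  then have "(LINT x|lborel. f x) = (LINT x|distr lborel borel T. f x)" by simp
  also have "\<dots> = (LINT x|lborel. f (T x))" by (rule integral_distr) auto
  finally show ?thesis by simp
qed

text \<open>Two functions are involved because the transform needs a Borel function
  \<open>h\<close>, while symmetry at every point is available only for \<open>k\<close>, in the
  application the rearrangement.\<close>

lemma IFI_radial:
  fixes h :: "real ^ 'd \<Rightarrow> complex"
  assumes [measurable]: "h \<in> borel_measurable borel" and ae: "AE \<xi> in lborel. h \<xi> = k \<xi>"
    and rad: "\<And>\<xi> \<eta>. norm \<xi> = norm \<eta> \<Longrightarrow> k \<xi> = k \<eta>" and xy: "norm x = norm y"
  shows "IFI h x = IFI h y"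
proof -
  obtain T where T: "orthogonal_transformation T" "T x = y" using orthogonal_transformation_exists[OF xy] by blast
  note [measurable] = borel_measurable_orthogonal[OF T(1)]
  have "IFI h y = (LINT \<xi>|lborel. cnj (ek (T \<xi> \<bullet> y)) * h (T \<xi>))"
    unfolding IFI_def by (rule integral_orthogonal[OF T(1), symmetric]) measurable
  also have "\<dots> = (LINT \<xi>|lborel. cnj (ek (\<xi> \<bullet> x)) * h \<xi>)"
  proof (rule integral_cong_AE)
    have "AE \<xi> in lborel. h (T \<xi>) = k (T \<xi>)" by (rule AE_lborel_orthogonal[OF T(1) ae])
    then show "AE \<xi> in lborel. cnj (ek (T \<xi> \<bullet> y)) * h (T \<xi>) = cnj (ek (\<xi> \<bullet> x)) * h \<xi>"
      using ae
    proof eventually_elim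
      case (elim \<xi>)
      have "T \<xi> \<bullet> y = \<xi> \<bullet> x" using T by (auto simp: orthogonal_transformation_def)
      moreover have "k (T \<xi>) = k \<xi>" using orthogonal_transformation_norm[OF T(1)] by (intro rad) simp
      ultimately show ?case using elim by simp
    qed
  qed measurable
  finally show ?thesis by (simp add: IFI_def)
qed

text \<open>Conjugation reflects the argument, and a radial function does not notice the
  reflection.\<close>

lemma IFI_radial_real:
  fixes h :: "real ^ 'd \<Rightarrow> real"
  assumes [measurable]: "h \<in> borel_measurable borel" and "AE \<xi> in lborel. h \<xi> = k \<xi>"
    and "\<And>\<xi> \<eta>. norm \<xi> = norm \<eta> \<Longrightarrow> k \<xi> = k \<eta>"
  shows "IFI (\<lambda>\<xi>. of_real (h \<xi>)) x \<in> \<real>"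
proof -
  have "cnj (IFI (\<lambda>\<xi>. of_real (h \<xi>)) x) = (LINT \<xi>|lborel. cnj (cnj (ek (\<xi> \<bullet> x)) * of_real (h \<xi>)))"
    unfolding IFI_def by (simp del: complex_cnj_mult)
  also have "\<dots> = IFI (\<lambda>\<xi>. of_real (h \<xi>)) (- x)" by (simp add: IFI_def cnj_ek)
  also have "\<dots> = IFI (\<lambda>\<xi>. of_real (h \<xi>)) x"
  proof (rule IFI_radial[where k = "\<lambda>\<xi>. of_real (k \<xi>)"])
    show "AE \<xi> in lborel. complex_of_real (h \<xi>) = of_real (k \<xi>)" using assms(2) by eventually_elim simp
    show "complex_of_real (k \<xi>) = of_real (k \<eta>)" if "norm \<xi> = norm \<eta>" for \<xi> \<eta> using assms(3)[OF that] by simp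
  qed simp_all
  finally show ?thesis by (simp add: Reals_cnj_iff)
qed

text \<open>\<open>H\<close> is only an L2 limit. The inverse integrals of truncations are radial
  and real at every point and converge to \<open>H\<close> almost everywhere along a subsequence.
  Evaluating them on the ray through \<open>b\<close> supplies the radial profile.\<close>

lemma fou_radial_real:
  fixes h :: "real ^ 'd \<Rightarrow> real"
  assumes F: "fou H (\<lambda>\<xi>. of_real (h \<xi>))" and [measurable]: "h \<in> borel_measurable borel" and ae: "AE \<xi> in lborel. h \<xi> = k \<xi>"
    and rad: "\<And>\<xi> \<eta>. norm \<xi> = norm \<eta> \<Longrightarrow> k \<xi> = k \<eta>"
  shows "\<exists>\<phi>. AE x in lborel. H x = \<phi> (norm x) \<and> H x \<in> \<real>"
proof -
  define u where "u n \<xi> = (if \<bar>h \<xi>\<bar> \<le> real n \<and> norm \<xi> \<le> real n then h \<xi> else 0)" for n \<xi>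
  define ku where "ku n \<xi> = (if \<bar>k \<xi>\<bar> \<le> real n \<and> norm \<xi> \<le> real n then k \<xi> else 0)" for n \<xi>
  define G where "G n \<xi> = complex_of_real (u n \<xi>)" for n \<xi>
  have [measurable]: "u n \<in> borel_measurable borel" "G n \<in> borel_measurable borel" for n unfolding u_def G_def by measurable
  have uk: "AE \<xi> in lborel. u n \<xi> = ku n \<xi>" for n using ae by eventually_elim (simp add: u_def ku_def)
  have krad: "ku n \<xi> = ku n \<eta>" if "norm \<xi> = norm \<eta>" for n \<xi> \<eta> using that rad[OF that] by (simp add: ku_def)
  have gL: "L2 (\<lambda>\<xi>. complex_of_real (h \<xi>))" using fouD(2)[OF F] .
  have Gle: "norm (G n \<xi>) \<le> norm (complex_of_real (h \<xi>))" for n \<xi> by (simp add: G_def u_def)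
  have Glim: "(\<lambda>n. G n \<xi>) \<longlonglongrightarrow> complex_of_real (h \<xi>)" for \<xi>
  proof -
    obtain N :: nat where N: "max \<bar>h \<xi>\<bar> (norm \<xi>) \<le> real N" using real_arch_simple by blast
    have "eventually (\<lambda>n. G n \<xi> = complex_of_real (h \<xi>)) sequentially"
      using eventually_ge_at_top[of N] by eventually_elim (use N in \<open>auto simp: G_def u_def\<close>)
    then show ?thesis by (rule tendsto_eventually)
  qed
  have nice: "nice (G n)" for n
  proof -
    have "norm (G n x) \<le> norm (tr n (\<lambda>\<xi>. complex_of_real (h \<xi>)) x)" for x by (simp add: G_def u_def tr_def)
    then have "integrable lborel (G n)"
      by (intro Bochner_Integration.integrable_bound[OF integrable_tr[OF gL, of n]]) auto
    moreover have "norm (G n x) \<le> real n" for x by (simp add: G_def u_def)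
    ultimately show ?thesis unfolding nice_def by blast
  qed
  have FG: "fou (IFI (G n)) (G n)" for n by (rule fou_IFI_nice[OF nice])
  have "(\<lambda>n. nq (\<lambda>x. G n x - complex_of_real (h x))) \<longlonglongrightarrow> 0"
    by (rule L2_dominated[OF gL _ Gle]) (auto simp: Glim)
  moreover have "nq (\<lambda>x. G n x - complex_of_real (h x)) = nq (\<lambda>x. IFI (G n) x - H x)" for n
    by (rule fou_norm[OF fou_diff[OF FG F]])
  ultimately have "(\<lambda>n. nq (\<lambda>x. IFI (G n) x - H x)) \<longlonglongrightarrow> 0" by simp
  from L2_AE_subseq[OF fouD(1)[OF FG] fouD(1)[OF F] this] obtain r :: "nat \<Rightarrow> nat" where
    r: "AE x in lborel. (\<lambda>n. IFI (G (r n)) x) \<longlonglongrightarrow> H x" by blast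
  have IR: "IFI (G n) x \<in> \<real>" for n x
    unfolding G_def by (rule IFI_radial_real[OF _ uk krad]) auto
  have Irad: "IFI (G n) x = IFI (G n) y" if "norm x = norm y" for n x y
  proof (rule IFI_radial[OF _ _ _ that])
    show "AE \<xi> in lborel. G n \<xi> = of_real (ku n \<xi>)" using uk[of n] by eventually_elim (simp add: G_def)
    show "complex_of_real (ku n \<xi>) = of_real (ku n \<eta>)" if "norm \<xi> = norm \<eta>" for \<xi> \<eta> using krad[OF that] by simp
  qed measurable
  obtain b :: "real ^ 'd" where b: "b \<in> Basis" using nonempty_Basis by blast
  have "AE x in lborel. H x = lim (\<lambda>n. IFI (G (r n)) (norm x *\<^sub>R b)) \<and> H x \<in> \<real>"
    using r
  proof eventually_elim
    case (elim x)
    have "norm (norm x *\<^sub>R b) = norm x" using b by simp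
    from Irad[OF this] have "(\<lambda>n. IFI (G (r n)) (norm x *\<^sub>R b)) = (\<lambda>n. IFI (G (r n)) x)" by (simp add: fun_eq_iff)
    then have "H x = lim (\<lambda>n. IFI (G (r n)) (norm x *\<^sub>R b))" using limI[OF elim] by simp
    moreover have "H x \<in> \<real>"
      by (rule closed_sequentially[OF closed_complex_Reals _ elim]) (rule IR)
    ultimately show ?case ..
  qed
  then show ?thesis by (intro exI[of _ "\<lambda>t. lim (\<lambda>n. IFI (G (r n)) (t *\<^sub>R b))"])
qed

section \<open>The chain of equalities for an optimizer\<close>

lemma gn_theta_bounds:
  assumes "s > 0" "2 < p" "ereal p < p_star d s" "d > 0"
  shows "0 < gn_theta d s p" "gn_theta d s p < 1"
proof -
  show "0 < gn_theta d s p" using assms by (simp add: gn_theta_def)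
  have "p * (real d - 2 * s) < 2 * real d"
  proof (cases "s < real d / 2")
    case True
    then have "p < 2 * real d / (real d - 2 * s)" using assms(3) by (simp add: p_star_def)
    then show ?thesis using True by (simp add: less_divide_eq)
  next
    case False
    then have "p * (real d - 2 * s) \<le> 0" using assms(2) by (simp add: mult_nonneg_nonpos)
    then show ?thesis using assms(4) by linarith
  qed
  then show "gn_theta d s p < 1" using assms by (simp add: gn_theta_def divide_less_eq algebra_simps)
qed

lemma prodf_strict_mono:
  assumes "0 < \<theta>" "\<theta> \<le> 1" "0 \<le> A" "A < A'" "0 \<le> B" "B \<le> B'" "0 < B'"
  shows "prodf \<theta> A B < prodf \<theta> A' B'"
proof -
  have "A powr (\<theta> / 2) * B powr ((1 - \<theta>) / 2) \<le> A powr (\<theta> / 2) * B' powr ((1 - \<theta>) / 2)"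
    using assms by (intro mult_left_mono powr_mono2) auto
  also have "\<dots> < A' powr (\<theta> / 2) * B' powr ((1 - \<theta>) / 2)"
    using assms by (intro mult_strict_right_mono powr_less_mono2) auto
  finally show ?thesis by (simp add: prodf_def)
qed

lemma ex_slicing:
  fixes e :: "real ^ 'd"
  assumes e: "norm e = 1"
  shows "\<exists>(M :: (real ^ 'd \<Rightarrow> real) measure) \<pi>. slicing e M \<pi>"
  using lborel_slicing[OF e]
proof (elim exE conjE)
  fix M :: "(real ^ 'd \<Rightarrow> real) measure" and \<pi>
  assume M: "sigma_finite_measure M" "\<pi> \<in> borel_measurable M" "\<forall>y\<in>space M. \<pi> y \<bullet> e = 0"
    and fub: "\<forall>F\<in>borel_measurable borel. (\<integral>\<^sup>+x. F x \<partial>lborel) = (\<integral>\<^sup>+y. \<integral>\<^sup>+t. F (\<pi> y + t *\<^sub>R e) \<partial>lborel \<partial>M)"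
  have "slicing e M \<pi>"
  proof (rule slicing.intro)
    show "\<pi> y \<bullet> e = 0" if "y \<in> space M" for y using M(3) that by (rule bspec)
    show "(\<integral>\<^sup>+x. F x \<partial>lborel) = (\<integral>\<^sup>+y. \<integral>\<^sup>+t. slice e F (\<pi> y) t \<partial>lborel \<partial>M)" if "F \<in> borel_measurable borel" for F
      unfolding slice_def using fub that by (rule bspec)
  qed fact+
  then show ?thesis by (intro exI)
qed

text \<open>The optimal value, to the power \<open>p\<close>, is at most the squared norm of
  \<open>ccpow m g\<close>, which is at most that of \<open>cpow m\<close> of the modulus, which by
  \<open>cpow_square_bound\<close> is at most the optimal value again. Equality in the middle is
  tightness. Inserting the Steiner symmetrization shows that the weighted norm cannot have dropped,
  which is its equality case.\<close>

lemma extremal_fourier_modulus: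
  fixes Q g :: "real ^ 'd \<Rightarrow> complex" and s :: real and p :: nat
  defines "\<theta> \<equiv> gn_theta DIM(real ^ 'd) s (real p)"
  assumes s: "s > 0" and \<theta>: "0 < \<theta>" "\<theta> \<le> 1" and p: "p = 2 * Suc m" and c: "0 \<le> c"
    and gn: "\<And>f :: real ^ 'd \<Rightarrow> complex. f \<in> sobolev_space s \<Longrightarrow> f \<in> Lp_space (real p) \<and> Lp_norm (real p) f \<le> c * gn_product s (real p) f"
    and F: "fou Q g" and W: "L2 (\<lambda>\<xi>. of_real (wt s \<xi>) * g \<xi>)" and nz: "\<not> (AE x in lborel. Q x = 0)"
    and eq: "(\<integral>\<^sup>+x. ennreal (norm (Q x) ^ p) \<partial>lborel) = ennreal ((c * prodf \<theta> (nq (\<lambda>\<xi>. of_real (wt s \<xi>) * g \<xi>)) (nq g)) ^ p)"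
  shows "norm e = 1 \<Longrightarrow> AE x in lborel. ennreal (norm (g x)) = steiner e (\<lambda>x. ennreal (norm (g x))) x"
    and "tight m g"
proof -
  define A where "A = nq (\<lambda>\<xi>. of_real (wt s \<xi>) * g \<xi>)"
  define B where "B = nq g"
  let ?F = "\<lambda>x. ennreal (norm (g x))"
  let ?P = "prodf \<theta> A B"
  have QL: "L2 Q" and gL: "L2 g" using F by (auto simp: fou_def)
  note [measurable] = L2_measurable[OF QL] L2_measurable[OF gL]
  have A0: "0 \<le> A" and B0: "0 \<le> B" by (auto simp: A_def B_def nq_nonneg)
  have "B \<noteq> 0" using fou_norm[OF F] nq_zero_iff[OF QL] nz by (simp add: B_def)
  then have Bp: "0 < B" using B0 by simp
  have AF: "(\<integral>\<^sup>+x. ennreal ((wt s x)\<^sup>2) * (?F x)\<^sup>2 \<partial>lborel) = ennreal A"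
    unfolding A_def L2_nn[OF W, symmetric]
    by (intro nn_integral_cong) (simp add: norm_mult power_mult_distrib ennreal_mult ennreal_power)
  have BF: "(\<integral>\<^sup>+x. (?F x)\<^sup>2 \<partial>lborel) = ennreal B"
    unfolding B_def L2_nn[OF gL, symmetric] by (intro nn_integral_cong) (simp add: ennreal_power)
  have bound: "(\<integral>\<^sup>+x. (cpow m f x)\<^sup>2 \<partial>lborel) \<le> ennreal ((c * prodf \<theta> A' B') ^ p)"
    if "f \<in> borel_measurable borel" "(\<integral>\<^sup>+x. ennreal ((wt s x)\<^sup>2) * (f x)\<^sup>2 \<partial>lborel) \<le> ennreal A'" "0 \<le> A'"
      "(\<integral>\<^sup>+x. (f x)\<^sup>2 \<partial>lborel) \<le> ennreal B'" "0 \<le> B'" for f :: "real ^ 'd \<Rightarrow> ennreal" and A' B'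
    using cpow_square_bound[OF s _ _ p c gn that] \<theta> unfolding \<theta>_def by simp
  have up: "(\<integral>\<^sup>+x. (cpow m ?F x)\<^sup>2 \<partial>lborel) \<le> ennreal ((c * ?P) ^ p)"
    by (rule bound) (auto simp: AF BF A0 B0)
  then have fin: "(\<integral>\<^sup>+x. (cpow m ?F x)\<^sup>2 \<partial>lborel) < \<infinity>" by (rule order.strict_trans1) simp
  have low: "ennreal ((c * ?P) ^ p) \<le> (\<integral>\<^sup>+x. (ennreal (norm (ccpow m g x)))\<^sup>2 \<partial>lborel)"
    using Lp_power_le_ccpow[OF F fin] eq unfolding p A_def B_def by simp
  have mid: "(\<integral>\<^sup>+x. (ennreal (norm (ccpow m g x)))\<^sup>2 \<partial>lborel) \<le> (\<integral>\<^sup>+x. (cpow m ?F x)\<^sup>2 \<partial>lborel)"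
    by (intro nn_integral_mono power_mono norm_ccpow_le) auto
  show "tight m g" by (rule tight_of_square[OF _ _ fin]) (use low mid up in auto)
  \<comment> \<open>The constant is cancelled below, so it must be positive; otherwise
    \<open>Q\<close> would vanish almost everywhere.\<close>
  have cp: "0 < c"
  proof (rule ccontr)
    assume "\<not> 0 < c"
    then have "c = 0" using c by simp
    then have "(\<integral>\<^sup>+x. ennreal (norm (Q x) ^ p) \<partial>lborel) = 0" using eq p by simp
    then have "AE x in lborel. ennreal (norm (Q x) ^ p) = 0" by (subst (asm) nn_integral_0_iff_AE) auto
    then have "AE x in lborel. Q x = 0"
    proof eventually_elim
      case (elim x)
      show ?case
      proof (rule ccontr)
        assume "Q x \<noteq> 0"
        then have "0 < norm (Q x) ^ p" by simp
        with elim show False by (simp only: ennreal_eq_0_iff)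
      qed
    qed
    with nz show False ..
  qed
  assume e: "norm e = 1"
  obtain M :: "(real ^ 'd \<Rightarrow> real) measure" and \<pi> where "slicing e M \<pi>" using ex_slicing[OF e] by blast
  then interpret slicing e M \<pi> .
  have hw: "heavy (slice e (\<lambda>x. ennreal ((wt s x)\<^sup>2)) z)" if "z \<bullet> e = 0" for z
    by (rule heavy_slice_wt[OF s e that])
  let ?f = "steiner e ?F"
  have le: "(\<integral>\<^sup>+x. ennreal ((wt s x)\<^sup>2) * (?f x)\<^sup>2 \<partial>lborel) \<le> ennreal A"
    unfolding AF[symmetric] by (rule steiner_weighted_le[OF _ _ hw]) measurable
  define A' where "A' = enn2real (\<integral>\<^sup>+x. ennreal ((wt s x)\<^sup>2) * (?f x)\<^sup>2 \<partial>lborel)"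
  have A': "(\<integral>\<^sup>+x. ennreal ((wt s x)\<^sup>2) * (?f x)\<^sup>2 \<partial>lborel) = ennreal A'"
    unfolding A'_def using le by (intro ennreal_enn2real[symmetric]) (auto simp: less_top[symmetric] top_unique)
  have A'0: "0 \<le> A'" by (simp add: A'_def)
  have A'A: "A' \<le> A" using le A0 unfolding A' by simp
  have "(\<integral>\<^sup>+x. (?f x)\<^sup>2 \<partial>lborel) \<le> ennreal B"
    unfolding BF[symmetric] by (rule steiner_square_le) measurable
  then have cb: "(\<integral>\<^sup>+x. (cpow m ?f x)\<^sup>2 \<partial>lborel) \<le> ennreal ((c * prodf \<theta> A' B) ^ p)"
    by (intro bound) (auto simp: A' A'0 B0)
  have "(\<integral>\<^sup>+x. (cpow m ?F x)\<^sup>2 \<partial>lborel) \<le> (\<integral>\<^sup>+x. (cpow m ?f x)\<^sup>2 \<partial>lborel)"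
    by (rule cpow_square_steiner) measurable
  then have "ennreal ((c * ?P) ^ p) \<le> ennreal ((c * prodf \<theta> A' B) ^ p)"
    by (intro order_trans[OF low order_trans[OF mid order_trans[OF _ cb]]])
  moreover have P0: "0 \<le> prodf \<theta> A' B" by (simp add: prodf_def)
  ultimately have lep: "(c * ?P) ^ p \<le> (c * prodf \<theta> A' B) ^ p" using c by simp
  have "c * ?P \<le> c * prodf \<theta> A' B"
  proof (rule ccontr)
    assume "\<not> c * ?P \<le> c * prodf \<theta> A' B"
    then have "c * prodf \<theta> A' B < c * ?P" by simp
    then have "(c * prodf \<theta> A' B) ^ p < (c * ?P) ^ p"
      by (rule power_strict_mono) (use c P0 p in simp_all)
    with lep show False by simp
  qed
  then have "?P \<le> prodf \<theta> A' B" using cp by simp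
  \<comment> \<open>A smaller \<open>A'\<close> would lower the product strictly, because
    \<open>\<theta>\<close> and \<open>B\<close> are positive.\<close>
  then have "\<not> A' < A" using prodf_strict_mono[OF \<theta> A'0 _ B0 order_refl Bp] by force
  then have "A' = A" using A'A by simp
  then show "AE x in lborel. ?F x = ?f x"
    by (intro steiner_weighted_eq[OF _ _ hw]) (auto simp: A' AF)
qed

lemma fourier_rearr_rep:
  fixes Q :: "real ^ 'd \<Rightarrow> complex"
  assumes h: "L2 (\<lambda>\<xi>. of_real (h \<xi>))" and ae: "AE \<xi> in lborel. sym_decr_rearr (fourier Q) \<xi> = h \<xi>"
  obtains H where "rep (fourier_rearr Q) H" "fou H (\<lambda>\<xi>. of_real (h \<xi>))"
proof -
  let ?k = "\<lambda>\<xi>. complex_of_real (sym_decr_rearr (fourier Q) \<xi>)"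
  have m: "(\<lambda>\<xi>. complex_of_real (h \<xi>)) \<in> borel_measurable borel" using h by (rule L2_measurable)
  have ae': "AE \<xi> in lborel. ?k \<xi> = of_real (h \<xi>)" using ae by eventually_elim simp
  have r: "rep ?k (\<lambda>\<xi>. of_real (h \<xi>))" using m ae' measurable_lebesgue_AE[OF m ae'] by (simp add: rep_def)
  then have "?k \<in> Lp_space 2" using Lp_space_two h by blast
  from is_fourier_inv_fourier[OF this] have I: "is_fourier (fourier_rearr Q) ?k" by (simp add: fourier_rearr_def)
  then obtain H where H: "rep (fourier_rearr Q) H" using ex_rep Lp_space_measurable unfolding is_fourier_def by blast
  with I is_fourier_iff[OF H r] that show thesis by blast
qed

theorem theorem2:
  fixes Q :: "real ^ 'd \<Rightarrow> complex" and s :: real and p :: nat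
  assumes "s > 0"
    and "even p" and "2 < p" and "ereal (real p) < p_star CARD('d) s"
    and "gn_optimizer s (real p) Q"
  shows "\<exists>(\<alpha>::real) (x0 :: real ^ 'd).
           (AE x in lebesgue.
              Q x = exp (\<i> * complex_of_real \<alpha>) * fourier_rearr Q (x - x0)) \<and>
           radial_about x0 Q \<and>
           (AE x in lebesgue. exp (- \<i> * complex_of_real \<alpha>) * Q x \<in> \<real>)"
proof -
  let ?\<theta> = "gn_theta DIM(real ^ 'd) s (real p)"
  have \<theta>: "0 < ?\<theta>" "?\<theta> \<le> 1"
    using gn_theta_bounds[of s "real p" "DIM(real ^ 'd)"] assms by auto
  obtain n where n: "p = 2 * n" using assms(2) by (auto elim: evenE)
  \<comment> \<open>\<open>cpow m\<close> has \<open>m + 1\<close> factors, matching half of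
    \<open>p\<close>. From \<open>p > 2\<close> it follows that \<open>m\<close> is at least 1, so
    at least two factors are present and the phase equation is available.\<close>
  define m where "m = n - 1"
  have p: "p = 2 * Suc m" and m: "1 \<le> m" using n assms(3) by (auto simp: m_def)
  have Qs: "Q \<in> sobolev_space s" and Qnz: "\<not> (AE x in lebesgue. Q x = 0)"
    using assms(5) by (auto simp: gn_optimizer_def)
  then have Q2: "Q \<in> Lp_space 2" by (simp add: sobolev_space_def)
  then obtain Q' where Q': "rep Q Q'" using ex_rep Lp_space_measurable by blast
  then have QL: "L2 Q'" using Lp_space_two Q2 by blast
  then obtain g where F: "fou Q' g" using fou_ex by blast
  have gL: "L2 g" by (rule fouD(2)[OF F])
  note [measurable] = L2_measurable[OF QL] L2_measurable[OF gL]
  have W: "L2 (\<lambda>\<xi>. of_real (wt s \<xi>) * g \<xi>)"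
    using sobolev_iff[OF Q' F] Qs by (intro sobolev_wt[OF assms(1)]) auto
  have QQ': "AE x in lborel. Q x = Q' x" using Q' by (simp add: rep_def)
  have nz: "\<not> (AE x in lborel. Q' x = 0)"
  proof
    assume "AE x in lborel. Q' x = 0"
    with QQ' have "AE x in lborel. Q x = 0" by eventually_elim simp
    from AE_completion[OF this] Qnz show False by simp
  qed
  have gnz: "\<not> (AE x in lborel. g x = 0)"
    using nz fou_norm[OF F] nq_zero_iff[OF QL] nq_zero_iff[OF gL] by simp
  define A where "A = nq (\<lambda>\<xi>. of_real (wt s \<xi>) * g \<xi>)"
  have "nq g \<noteq> 0" using gnz nq_zero_iff[OF gL] by simp
  then have B: "0 < nq g" using nq_nonneg[of g] by linarith
  \<comment> \<open>The weight vanishes only at the origin. Positivity of \<open>A\<close> and of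
    \<open>nq g\<close> makes the product for \<open>Q\<close> positive, as
    \<open>gn_best_constant\<close> requires.\<close>
  have "A \<noteq> 0"
  proof
    assume "A = 0"
    then have "AE \<xi> in lborel. of_real (wt s \<xi>) * g \<xi> = 0" using nq_zero_iff[OF W] by (simp add: A_def)
    moreover have "AE \<xi> in lborel. \<xi> \<noteq> (0 :: real ^ 'd)" by (rule AE_lborel_singleton)
    ultimately have "AE \<xi> in lborel. g \<xi> = 0" by eventually_elim (simp add: wt_def)
    with gnz show False ..
  qed
  then have A: "0 < A" using nq_nonneg[of "\<lambda>\<xi>. of_real (wt s \<xi>) * g \<xi>"] unfolding A_def by linarith
  have gnp: "gn_product s (real p) Q = prodf ?\<theta> A (nq g)" unfolding A_def by (rule gn_product_eq[OF Q' F W])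
  have "0 < gn_product s (real p) Q" unfolding gnp prodf_def using A B by simp
  from gn_best_constant[OF assms(5) this] obtain c where c: "0 \<le> c" "Lp_norm (real p) Q = c * gn_product s (real p) Q"
    "\<And>f :: real ^ 'd \<Rightarrow> complex. f \<in> sobolev_space s \<Longrightarrow> f \<in> Lp_space (real p) \<and> Lp_norm (real p) f \<le> c * gn_product s (real p) f"
    by blast
  have p0: "0 < p" using p by simp
  have "(\<integral>\<^sup>+x. ennreal (norm (Q' x) ^ p) \<partial>lborel) = ennreal (LINT x|lborel. norm (Q' x) ^ p)"
    by (rule nn_integral_eq_integral[OF Lp_norm_power(2)[OF Q' p0]]) (use c(3)[OF Qs] in auto)
  also have "\<dots> = ennreal ((c * prodf ?\<theta> A (nq g)) ^ p)"
    unfolding Lp_norm_power(1)[OF Q' p0, symmetric] c(2) gnp ..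
  finally have eq: "(\<integral>\<^sup>+x. ennreal (norm (Q' x) ^ p) \<partial>lborel) = ennreal ((c * prodf ?\<theta> A (nq g)) ^ p)" .
  note ext = extremal_fourier_modulus[OF assms(1) \<theta> p c(1) c(3) F W nz eq[unfolded A_def]]
  have dec: "AE z in lborel. AE x in lborel. norm x < norm z \<longrightarrow> ennreal (norm (g z)) \<le> ennreal (norm (g x))"
    by (rule steiner_invariant_decreasing[OF _ ext(1)]) auto
  \<comment> \<open>The level 0: the set where \<open>g\<close> is nonzero is a ball, possibly the
    whole space.\<close>
  obtain \<rho> :: ereal where \<rho>: "AE x in lborel. 0 < ennreal (norm (g x)) \<longleftrightarrow> ereal (norm x) < \<rho>"
    using decreasing_level_ball[OF _ dec, of 0] by auto
  then have "AE x in lborel. 0 < norm (g x) \<longleftrightarrow> ereal (norm x) < \<rho>" by simp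
  from tight_character[OF _ gnz ext(2) m this] obtain \<alpha> :: real and w where
    ph: "AE x in lborel. g x = exp (\<i> * of_real (\<alpha> + x \<bullet> w)) * of_real (norm (g x))" by auto
  have rg: "rep (fourier Q) g" by (rule rep_fourier[OF Q' F])
  then have gg: "AE x in lborel. fourier Q x = g x" "fourier Q \<in> borel_measurable lebesgue" by (auto simp: rep_def)
  have fing: "(\<integral>\<^sup>+x. (ennreal (norm (g x)))\<^sup>2 \<partial>lborel) < \<infinity>"
    using L2_nn[OF gL] by (simp add: ennreal_power)
  have sdr: "AE x in lborel. sym_decr_rearr (fourier Q) x = norm (g x)"
  proof (rule sym_decr_rearr_eq[OF _ _ fing gg(2) _ dec])
    have "AE x in lborel. norm (fourier Q x) = norm (g x)" using gg(1) by eventually_elim simp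
    then show "AE x in lebesgue. norm (fourier Q x) = norm (g x)" by (rule AE_completion)
  qed auto
  have hL: "L2 (\<lambda>\<xi>. complex_of_real (norm (g \<xi>)))" using gL by (auto simp: L2_def)
  obtain H where H: "rep (fourier_rearr Q) H" "fou H (\<lambda>\<xi>. of_real (norm (g \<xi>)))"
    using fourier_rearr_rep[OF hL sdr] .
  have sdr': "AE x in lborel. norm (g x) = sym_decr_rearr (fourier Q) x" using sdr by eventually_elim simp
  obtain \<phi> where \<phi>: "AE x in lborel. H x = \<phi> (norm x) \<and> H x \<in> \<real>"
    using fou_radial_real[OF H(2) _ sdr' sym_decr_rearr_radial] by auto
  \<comment> \<open>Chosen so that \<open>ek (a \<bullet> \<xi>)\<close> is the linear part
    \<open>exp (\<i> * of_real (\<xi> \<bullet> w))\<close> of the phase, by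
    \<open>fou_translate\<close> the effect of a translation by \<open>a\<close>.\<close>
  define a where "a = - (1 / (2 * pi)) *\<^sub>R w"
  let ?E = "exp (\<i> * complex_of_real \<alpha>)"
  have "fou (\<lambda>x. ?E * H (x - a)) (\<lambda>\<xi>. ?E * (ek (a \<bullet> \<xi>) * of_real (norm (g \<xi>))))"
    by (intro fou_cmult fou_translate H(2))
  moreover have "AE x in lborel. ?E * H (x - a) = ?E * H (x - a)" by simp
  moreover have "AE \<xi> in lborel. ?E * (ek (a \<bullet> \<xi>) * of_real (norm (g \<xi>))) = g \<xi>"
    using ph
  proof eventually_elim
    case (elim \<xi>)
    have "- 2 * complex_of_real pi * \<i> * complex_of_real (a \<bullet> \<xi>) = \<i> * complex_of_real (\<xi> \<bullet> w)"
      by (simp add: a_def inner_commute)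
    then have "?E * ek (a \<bullet> \<xi>) = exp (\<i> * of_real (\<alpha> + \<xi> \<bullet> w))"
      unfolding ek_def by (simp add: exp_add distrib_left)
    then show ?case by (subst elim) (simp add: mult.assoc[symmetric])
  qed
  ultimately have "fou (\<lambda>x. ?E * H (x - a)) g"
  proof (rule fou_cong_AE)
    have [measurable]: "H \<in> borel_measurable borel" using H(1) by (simp add: rep_def)
    show "(\<lambda>x. ?E * H (x - a)) \<in> borel_measurable borel" "g \<in> borel_measurable borel" by measurable
  qed
  from fou_inj[OF F this] have "AE x in lborel. Q' x = ?E * H (x - a)" .
  with QQ' have QH: "AE x in lborel. Q x = ?E * H (x - a)" by eventually_elim simp
  have "AE x in lborel. fourier_rearr Q x = H x" using H(1) by (simp add: rep_def)
  from AE_lborel_shift[OF this, of "- a"] have RH: "AE x in lborel. fourier_rearr Q (x - a) = H (x - a)" by simp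
  from AE_lborel_shift[OF \<phi>, of "- a"] have \<phi>a: "AE x in lborel. H (x - a) = \<phi> (norm (x - a)) \<and> H (x - a) \<in> \<real>" by simp
  have "AE x in lborel. Q x = ?E * fourier_rearr Q (x - a)" using QH RH by eventually_elim simp
  moreover have "AE x in lborel. Q x = ?E * \<phi> (norm (x - a))" using QH \<phi>a by eventually_elim simp
  moreover have "AE x in lborel. exp (- \<i> * complex_of_real \<alpha>) * Q x \<in> \<real>"
    using QH \<phi>a
  proof eventually_elim
    case (elim x)
    have "exp (- \<i> * complex_of_real \<alpha>) * (?E * H (x - a)) = H (x - a)"
      by (simp add: mult.assoc[symmetric] exp_add[symmetric])
    then show ?case unfolding elim(1) using conjunct2[OF elim(2)] by (simp only:)
  qed
  ultimately show ?thesis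
    unfolding radial_about_def by (intro exI[of _ \<alpha>] exI[of _ a] conjI exI[of _ "\<lambda>t. ?E * \<phi> t"] AE_completion)
qed

end
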